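(* Let $\Omega\subset\mathbb{R}^N$ be a regular, bounded domain and let $f\in L^2(\Omega)$. Assume: (1) $F:\mathbb{R}\times\mathbb{R}\to\mathbb{R}$, $(y,u)\mapsto F(y,u)$, is continuous, convex in $u$ for each fixed $y$, and there is a constant $C>0$ with $C(|u|^2-1)\le F(y,u)$ for all $(y,u)$; (2) $W:\mathbb{R}^N\to\mathbb{R}$ is strictly convex and there are constants $0<c<C$ with $c(|\mathbf{y}|^2-1)\le W(\mathbf{y})\le C(|\mathbf{y}|^2+1)$ for all $\mathbf{y}\in\mathbb{R}^N$; (3) $w:\mathbb{R}\to\mathbb{R}$ is continuous. For a control $u\in L^2(\Omega)$, let the associated state $y_u\in H^1_0(\Omega)$ be determined by $$I(y_u,u)=\min_{y\in H^1_0(\Omega)}I(y,u),\qquad I(y,u)=\int_\Omega\big[W(\nabla y(\boldsymbol{x}))+w(y(\boldsymbol{x}))u(\boldsymbol{x})+f(\boldsymbol{x})y(\boldsymbol{x})\big]\,d\boldsymbol{x}.$$ Then the problem $$\text{Minimize in }u\in L^2(\Omega):\quad E(u)=\int_\Omega F(y_u(\boldsymbol{x}),u(\boldsymbol{x}))\,d\boldsymbol{x}$$ admits optimal solutions, i.e. there is an admissible control $u_0$, with associated state $y_{u_0}$, at which the infimum of $E$ is attained.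
   Context: The domain $\Omega$ is assumed to be as regular as needed (e.g. bounded with smooth boundary). $u$ is the control and $y_u$ its associated state.
   Formalization: It is assumed that every control u in L² has at least one state with finite minimal energy, which (1)–(3) do not ensure (e.g. w(y)=y³); states need not be unique, and the optimum is over all pairs of a control and an associated state. *)

theory Defs
  imports "HOL-Analysis.Analysis"
begin

section \<open>Regular bounded domains\<close>

text \<open>
  Near each boundary point the set is the strict subgraph, in some direction \<open>e\<close>, of a Lipschitz
  function of the coordinates orthogonal to \<open>e\<close>.  Every bounded domain with smooth boundary has
  this property.
\<close>

definition lipschitz_boundary :: "'a::euclidean_space set \<Rightarrow> bool" where
  "lipschitz_boundary \<Omega> \<longleftrightarrow>
     (\<forall>p\<in>frontier \<Omega>. \<exists>r>0. \<exists>e \<gamma> L. norm e = 1 \<and> L-lipschitz_on UNIV (\<gamma> :: 'a \<Rightarrow> real) \<and>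
        (\<forall>x\<in>ball p r. x \<in> \<Omega> \<longleftrightarrow> x \<bullet> e < \<gamma> (x - (x \<bullet> e) *\<^sub>R e)))"

definition regular_bounded_domain :: "'a::euclidean_space set \<Rightarrow> bool" where
  "regular_bounded_domain \<Omega> \<longleftrightarrow>
     open \<Omega> \<and> connected \<Omega> \<and> \<Omega> \<noteq> {} \<and> bounded \<Omega> \<and> lipschitz_boundary \<Omega>"


section \<open>Function spaces\<close>

text \<open>
  Elements of the spaces below are functions on the whole space, of which only the values on
  \<open>\<Omega>\<close> matter; functions that agree almost everywhere on \<open>\<Omega>\<close> are not identified.
\<close>

definition L2 :: "'a::euclidean_space set \<Rightarrow> ('a \<Rightarrow> 'b::euclidean_space) set" where
  "L2 \<Omega> = {g. g \<in> borel_measurable (lebesgue_on \<Omega>) \<and>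
              integrable (lebesgue_on \<Omega>) (\<lambda>x. (norm (g x))\<^sup>2)}"

text \<open>\<open>f\<close> is of class \<open>C\<^sup>k\<close> on the whole space.\<close>

primrec C_class :: "nat \<Rightarrow> ('a::euclidean_space \<Rightarrow> real) \<Rightarrow> bool" where
  "C_class 0 = (\<lambda>f. continuous_on UNIV f)"
| "C_class (Suc k) = (\<lambda>f. (\<forall>x. f differentiable (at x)) \<and>
                          (\<forall>v. C_class k (\<lambda>x. frechet_derivative f (at x) v)))"

definition test_functions :: "'a::euclidean_space set \<Rightarrow> ('a \<Rightarrow> real) set" where
  "test_functions \<Omega> = {\<phi>. (\<forall>k. C_class k \<phi>) \<and>
                          compact (closure {x. \<phi> x \<noteq> 0}) \<and> closure {x. \<phi> x \<noteq> 0} \<subseteq> \<Omega>}"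

definition grad :: "(real^'n \<Rightarrow> real) \<Rightarrow> real^'n \<Rightarrow> real^'n" where
  "grad \<phi> x = (\<chi> i. frechet_derivative \<phi> (at x) (axis i 1))"

definition is_weak_gradient ::
  "(real^'n) set \<Rightarrow> (real^'n \<Rightarrow> real) \<Rightarrow> (real^'n \<Rightarrow> real^'n) \<Rightarrow> bool" where
  "is_weak_gradient \<Omega> y G \<longleftrightarrow>
     (\<forall>\<psi>\<in>test_functions \<Omega>.
        (LINT x|lebesgue_on \<Omega>. y x *\<^sub>R grad \<psi> x) = - (LINT x|lebesgue_on \<Omega>. \<psi> x *\<^sub>R G x))"

definition H1 :: "(real^'n) set \<Rightarrow> (real^'n \<Rightarrow> real) set" where
  "H1 \<Omega> = {y \<in> L2 \<Omega>. \<exists>G\<in>L2 \<Omega>. is_weak_gradient \<Omega> y G}"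

text \<open>The weak gradient is unique up to a null set; \<open>weak_grad\<close> chooses a representative.\<close>

definition weak_grad :: "(real^'n) set \<Rightarrow> (real^'n \<Rightarrow> real) \<Rightarrow> real^'n \<Rightarrow> real^'n" where
  "weak_grad \<Omega> y = (SOME G. G \<in> L2 \<Omega> \<and> is_weak_gradient \<Omega> y G)"

text \<open>The closure of the test functions in the norm of \<open>H\<^sup>1\<close>.\<close>

definition H10 :: "(real^'n) set \<Rightarrow> (real^'n \<Rightarrow> real) set" where
  "H10 \<Omega> = {y \<in> H1 \<Omega>. \<exists>\<phi> :: nat \<Rightarrow> real^'n \<Rightarrow> real.
      (\<forall>k. \<phi> k \<in> test_functions \<Omega>) \<and>
      (\<lambda>k. (LINT x|lebesgue_on \<Omega>. (y x - \<phi> k x)\<^sup>2) +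
           (LINT x|lebesgue_on \<Omega>. (norm (weak_grad \<Omega> y x - grad (\<phi> k) x))\<^sup>2)) \<longlonglongrightarrow> 0}"


section \<open>The control problem\<close>

definition strictly_convex :: "('a::real_vector \<Rightarrow> real) \<Rightarrow> bool" where
  "strictly_convex W \<longleftrightarrow>
     (\<forall>a b t. a \<noteq> b \<longrightarrow> 0 < t \<longrightarrow> t < 1 \<longrightarrow>
        W ((1 - t) *\<^sub>R a + t *\<^sub>R b) < (1 - t) * W a + t * W b)"

text \<open>
  The hypotheses bound neither \<open>F\<close> from above nor the growth of \<open>w\<close>, so the functionals need not be
  finite.  They are integrals with extended real values, with the convention \<open>\<infinity> - \<infinity> = \<infinity>\<close> that is
  usual in minimization (and is that of subtraction on \<^typ>\<open>ereal\<close>).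
\<close>

definition ext_integral :: "'a measure \<Rightarrow> ('a \<Rightarrow> real) \<Rightarrow> ereal" where
  "ext_integral M g =
     enn2ereal (\<integral>\<^sup>+x. ennreal (g x) \<partial>M) - enn2ereal (\<integral>\<^sup>+x. ennreal (- g x) \<partial>M)"

lemma ext_integral_eq_integral:
  assumes "integrable M g"
  shows "ext_integral M g = ereal (LINT x|M. g x)"
proof -
  have fin: "(\<integral>\<^sup>+x. ennreal (g x) \<partial>M) \<noteq> \<infinity>" "(\<integral>\<^sup>+x. ennreal (- g x) \<partial>M) \<noteq> \<infinity>"
    using assms by (auto simp: real_integrable_def)
  have *: "enn2ereal a = ereal (enn2real a)" if "a \<noteq> \<infinity>" for a
    using that by (cases a) auto
  show ?thesis
    using fin by (simp add: ext_integral_def real_lebesgue_integral_def[OF assms] *)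
qed

definition state_energy ::
  "(real^'n) set \<Rightarrow> (real^'n \<Rightarrow> real) \<Rightarrow> (real \<Rightarrow> real) \<Rightarrow> (real^'n \<Rightarrow> real) \<Rightarrow>
   (real^'n \<Rightarrow> real) \<Rightarrow> (real^'n \<Rightarrow> real) \<Rightarrow> ereal" where
  "state_energy \<Omega> W w f y u =
     ext_integral (lebesgue_on \<Omega>) (\<lambda>x. W (weak_grad \<Omega> y x) + w (y x) * u x + f x * y x)"

text \<open>
  The states associated with \<open>u\<close>, i.e. the \<open>y\<close> at which the minimum of the energy over \<open>H10 \<Omega>\<close> is
  attained as a real number.  As \<open>w\<close> is an arbitrary continuous function, the energy need not be
  convex in \<open>y\<close>, and a minimizer need not be unique even almost everywhere.
\<close>

definition states ::
  "(real^'n) set \<Rightarrow> (real^'n \<Rightarrow> real) \<Rightarrow> (real \<Rightarrow> real) \<Rightarrow> (real^'n \<Rightarrow> real) \<Rightarrow>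
   (real^'n \<Rightarrow> real) \<Rightarrow> (real^'n \<Rightarrow> real) set" where
  "states \<Omega> W w f u =
     {y \<in> H10 \<Omega>. \<bar>state_energy \<Omega> W w f y u\<bar> \<noteq> \<infinity> \<and>
                 (\<forall>z\<in>H10 \<Omega>. state_energy \<Omega> W w f y u \<le> state_energy \<Omega> W w f z u)}"

definition cost ::
  "(real^'n) set \<Rightarrow> (real \<Rightarrow> real \<Rightarrow> real) \<Rightarrow> (real^'n \<Rightarrow> real) \<Rightarrow> (real^'n \<Rightarrow> real) \<Rightarrow> ereal" where
  "cost \<Omega> F y u = ext_integral (lebesgue_on \<Omega>) (\<lambda>x. F (y x) (u x))"

end

theory Submission
  imports Defs "HOL-Library.Diagonal_Subsequence"
begin

text \<open>
  The direct method: take a minimizing sequence of controls \<open>u j\<close> with states \<open>y j\<close>, pass to a limit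
  \<open>u0\<close>, \<open>y0\<close>, show that \<open>y0\<close> is a state of \<open>u0\<close>, and that the cost does not jump up in the limit.

  \<^emph>\<open>What coercivity rests on.\<close>  The growth of \<open>w\<close> is unrestricted, so a bound for the states in terms
  of their controls cannot come from the growth conditions alone.  It comes from the assumption that
  \<^emph>\<open>every\<close> square integrable control has a state.  The energy is then bounded below for every control.
  First, \<open>w (y x)\<close> is square integrable for all \<open>y\<close>, since otherwise some control makes the energy
  \<open>- \<infinity>\<close> (\<open>w_L2\<close>).  Second, for every \<open>d > 0\<close> the norm of \<open>w (y x)\<close> is at most \<open>d\<close> times the
  squared norm of the gradient plus a constant (\<open>coercive\<close>).  In dimension at most four, testing
  with multiples of a plateau function shows that \<open>w\<close> grows less than any multiple of the square, and
  the norm of \<open>y\<^sup>2\<close> is bounded by the gradient (\<open>L4_embedding\<close>).  In higher dimension a failure is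
  amplified: small copies of the bad functions in disjoint balls have little energy, and one control
  acting on all of them makes the energy unbounded below.  As \<open>d\<close> is arbitrary, \<open>W\<close> dominates the
  term with the control, and states of bounded controls are bounded (\<open>states_bounded\<close>).

  \<^emph>\<open>Limits.\<close>  The growth of \<open>F\<close> bounds the controls.  The states converge almost everywhere along a
  subsequence (\<open>Rellich\<close>).  Instead of weak limits of controls and gradients, convex combinations
  with common weights are used, which converge strongly (\<open>convex_combs_converge\<close>).  Lower
  semicontinuity of convex integrands then is Jensen's inequality together with Fatou's lemma.

  \<^emph>\<open>The limit is a state.\<close>  The product of \<open>w (y j x)\<close> and \<open>u j x\<close> need not converge to that of
  the limits: \<open>w (y j x)\<close> is merely bounded in \<open>L\<^sup>2\<close> and may concentrate.  Hence \<open>y j\<close> is not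
  compared with a fixed \<open>z\<close> but with a function equal to \<open>z\<close> where \<open>y j\<close> is close to \<open>z\<close> and equal to
  \<open>y j\<close> where it is far (\<open>truncated_comparison\<close>).  For bounded \<open>z\<close> the remaining difference of
  the nonlinear terms is bounded, converges strongly, and can be paired with the controls.  The
  transition has slope \<open>s > 1\<close>, which by convexity of \<open>W\<close> costs a multiple of \<open>s - 1\<close>, uniformly in
  the width of the transition.  Afterwards the truncation levels tend to infinity, \<open>s\<close> tends to one
  (\<open>limit_comparison\<close>), and bounded competitors approximate all others (\<open>limit_minimal\<close>).  The
  limits in the levels are dominated because, along suitable levels, all truncations are controlled
  by a single Lipschitz function \<open>zigzag\<close>, and \<open>w\<close> composed with Lipschitz images of elements of
  \<open>H10\<close> is square integrable.

  \<^emph>\<open>The cost.\<close>  At a point where \<open>y j\<close> converges, supporting lines of \<open>F\<close> in the control are stable under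
  small changes of \<open>y\<close> because \<open>F\<close> grows quadratically (\<open>perturbed_supporting_line\<close>).

  Functions with zero boundary values are handled as pairs \<open>H0\<close> of a function and a gradient in the
  closure of the test functions, and the needed facts on them are derived from translations and
  averages of test functions.
\<close>

section \<open>Square integrable functions\<close>

definition L2_on :: "'a measure \<Rightarrow> ('a \<Rightarrow> 'b::euclidean_space) set" where
  "L2_on M = {g. g \<in> borel_measurable M \<and> integrable M (\<lambda>x. (norm (g x))\<^sup>2)}"

definition nsq :: "'a measure \<Rightarrow> ('a \<Rightarrow> 'b::euclidean_space) \<Rightarrow> real" where
  "nsq M g = (LINT x|M. (norm (g x))\<^sup>2)"

lemma L2_eq_L2_on: "L2 \<Omega> = L2_on (lebesgue_on \<Omega>)"
  by (simp add: L2_def L2_on_def)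

lemma L2_onD:
  assumes "g \<in> L2_on M"
  shows "g \<in> borel_measurable M" "integrable M (\<lambda>x. (norm (g x))\<^sup>2)"
  using assms by (auto simp: L2_on_def)

lemma nsq_nonneg [simp]: "0 \<le> nsq M g"
  by (simp add: nsq_def)

lemma L2_on_bound:
  assumes "g \<in> borel_measurable M" "integrable M b" "AE x in M. (norm (g x))\<^sup>2 \<le> b x"
  shows "g \<in> L2_on M"
proof -
  have "integrable M (\<lambda>x. (norm (g x))\<^sup>2)"
  proof (rule Bochner_Integration.integrable_bound[OF assms(2)])
    show "AE x in M. norm ((norm (g x))\<^sup>2) \<le> norm (b x)"
      using assms(3) by eventually_elim auto
  qed (use assms(1) in measurable)
  then show ?thesis using assms(1) by (simp add: L2_on_def)
qed

lemma norm_add_sq_le: "(norm (a + b))\<^sup>2 \<le> 2 * (norm a)\<^sup>2 + 2 * (norm b)\<^sup>2"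
  for a b :: "'b::real_normed_vector"
proof -
  have "(norm (a + b))\<^sup>2 \<le> (norm a + norm b)\<^sup>2"
    by (simp add: norm_triangle_ineq power_mono)
  also have "\<dots> \<le> 2 * (norm a)\<^sup>2 + 2 * (norm b)\<^sup>2"
    using zero_le_power2[of "norm a - norm b"] by (simp add: power2_eq_square algebra_simps)
  finally show ?thesis .
qed

lemma L2_on_zero [simp]: "(\<lambda>x. 0) \<in> L2_on M"
  by (simp add: L2_on_def)

lemma L2_on_add:
  assumes "a \<in> L2_on M" "b \<in> L2_on M"
  shows "(\<lambda>x. a x + b x) \<in> L2_on M"
proof (rule L2_on_bound)
  show "integrable M (\<lambda>x. 2 * (norm (a x))\<^sup>2 + 2 * (norm (b x))\<^sup>2)"
    using assms by (auto simp: L2_on_def)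
qed (use assms norm_add_sq_le in \<open>auto simp: L2_on_def\<close>)

lemma L2_on_scaleR:
  assumes "a \<in> L2_on M"
  shows "(\<lambda>x. c *\<^sub>R a x) \<in> L2_on M"
  using assms by (auto simp: L2_on_def power_mult_distrib)

lemma L2_on_cmult:
  fixes a :: "'a \<Rightarrow> real"
  assumes "a \<in> L2_on M"
  shows "(\<lambda>x. c * a x) \<in> L2_on M"
  using L2_on_scaleR[OF assms, of c] by simp

lemma L2_on_diff:
  assumes "a \<in> L2_on M" "b \<in> L2_on M"
  shows "(\<lambda>x. a x - b x) \<in> L2_on M"
  using L2_on_add[OF assms(1) L2_on_scaleR[OF assms(2), of "-1"]] by simp

lemma L2_on_sum:
  assumes "\<And>i. i \<in> I \<Longrightarrow> a i \<in> L2_on M"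
  shows "(\<lambda>x. \<Sum>i\<in>I. a i x) \<in> L2_on M"
  using assms by (induction I rule: infinite_finite_induct) (auto intro!: L2_on_add)

lemma L2_on_Pair:
  assumes "a \<in> L2_on M" "b \<in> L2_on M"
  shows "(\<lambda>x. (a x, b x)) \<in> L2_on M"
  using assms by (auto simp: L2_on_def norm_Pair)

lemma nsq_Pair:
  assumes "a \<in> L2_on M" "b \<in> L2_on M"
  shows "nsq M (\<lambda>x. (a x, b x)) = nsq M a + nsq M b"
  using assms by (auto simp: L2_on_def nsq_def norm_Pair)

lemma L2_on_fst:
  assumes "g \<in> L2_on M" shows "(\<lambda>x. fst (g x)) \<in> L2_on M"
proof (rule L2_on_bound)
  show "(\<lambda>x. fst (g x)) \<in> borel_measurable M"
    using assms by (auto simp: L2_on_def intro: borel_measurable_continuous_on[where f=fst, rotated]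
        simp: continuous_on_fst)
  show "AE x in M. (norm (fst (g x)))\<^sup>2 \<le> (norm (g x))\<^sup>2"
    using norm_fst_le[of "fst (g x)" "snd (g x)" for x] by (auto intro!: power_mono)
qed (use assms in \<open>auto simp: L2_on_def\<close>)

lemma L2_on_snd:
  assumes "g \<in> L2_on M" shows "(\<lambda>x. snd (g x)) \<in> L2_on M"
proof (rule L2_on_bound)
  show "(\<lambda>x. snd (g x)) \<in> borel_measurable M"
    using assms by (auto simp: L2_on_def intro: borel_measurable_continuous_on[where f=snd, rotated]
        simp: continuous_on_snd)
  show "AE x in M. (norm (snd (g x)))\<^sup>2 \<le> (norm (g x))\<^sup>2"
    using norm_snd_le[of "snd (g x)" "fst (g x)" for x] by (auto intro!: power_mono)
qed (use assms in \<open>auto simp: L2_on_def\<close>)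

lemma L2_on_bounded_scaleR:
  assumes "g \<in> L2_on M" "h \<in> borel_measurable M" "\<And>x. \<bar>h x\<bar> \<le> (B::real)"
  shows "(\<lambda>x. h x *\<^sub>R g x) \<in> L2_on M"
proof (rule L2_on_bound)
  show "integrable M (\<lambda>x. B\<^sup>2 * (norm (g x))\<^sup>2)"
    using assms by (auto simp: L2_on_def)
  show "AE x in M. (norm (h x *\<^sub>R g x))\<^sup>2 \<le> B\<^sup>2 * (norm (g x))\<^sup>2"
  proof (rule AE_I2)
    fix x
    have "(h x)\<^sup>2 \<le> B\<^sup>2" using assms(3)[of x] by (metis abs_ge_zero power2_abs power_mono)
    then show "(norm (h x *\<^sub>R g x))\<^sup>2 \<le> B\<^sup>2 * (norm (g x))\<^sup>2"
      by (simp add: power_mult_distrib mult_right_mono)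
  qed
qed (use assms in \<open>auto simp: L2_on_def\<close>)

lemma L2_on_const: "finite_measure M \<Longrightarrow> (\<lambda>x. c) \<in> L2_on M"
  by (simp add: L2_on_def finite_measure.integrable_const)

lemma L2_on_bounded:
  assumes "finite_measure M" "g \<in> borel_measurable M" "\<And>x. norm (g x) \<le> B"
  shows "g \<in> L2_on M"
proof (rule L2_on_bound[OF assms(2)])
  show "integrable M (\<lambda>x. B\<^sup>2)" using assms(1) by (simp add: finite_measure.integrable_const)
qed (use assms(3) in \<open>auto intro!: AE_I2 power_mono\<close>)

lemma L2_on_inner_integrable:
  assumes "a \<in> L2_on M" "b \<in> L2_on M"
  shows "integrable M (\<lambda>x. norm (a x) * norm (b x))" "integrable M (\<lambda>x. a x \<bullet> b x)"
proof -
  have i: "integrable M (\<lambda>x. (norm (a x))\<^sup>2 + (norm (b x))\<^sup>2)"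
    using assms by (auto simp: L2_on_def)
  have *: "norm s * norm t \<le> (norm s)\<^sup>2 + (norm t)\<^sup>2" for s t :: 'b
  proof -
    have "0 \<le> norm s * norm t" by simp
    moreover have "0 \<le> (norm s - norm t)\<^sup>2" by simp
    ultimately show ?thesis unfolding power2_diff by linarith
  qed
  show "integrable M (\<lambda>x. norm (a x) * norm (b x))"
    by (rule Bochner_Integration.integrable_bound[OF i]) (use assms * in \<open>auto simp: L2_on_def\<close>)
  show "integrable M (\<lambda>x. a x \<bullet> b x)"
    by (rule Bochner_Integration.integrable_bound[OF i])
      (use assms in \<open>auto simp: L2_on_def intro!: order_trans[OF Cauchy_Schwarz_ineq2 *]\<close>)
qed

lemma L2_on_mult_integrable:
  fixes a b :: "'a \<Rightarrow> real"
  assumes "a \<in> L2_on M" "b \<in> L2_on M"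
  shows "integrable M (\<lambda>x. a x * b x)"
  using L2_on_inner_integrable(2)[OF assms] by simp

lemma L2_on_norm: "g \<in> L2_on M \<Longrightarrow> (\<lambda>x. norm (g x)) \<in> L2_on M"
  by (auto simp: L2_on_def)

lemma L2_on_integrable:
  assumes "finite_measure M" "g \<in> L2_on M"
  shows "integrable M g"
proof -
  have "integrable M (\<lambda>x. norm (norm (g x)) * norm (1::real))"
    using L2_on_inner_integrable(1)[OF L2_on_norm[OF assms(2)] L2_on_const[OF assms(1), of "1::real"]] .
  then have "integrable M (\<lambda>x. norm (g x))" by simp
  then show ?thesis using L2_onD(1)[OF assms(2)] integrable_norm_iff by blast
qed

lemma nsq_norm [simp]: "nsq M (\<lambda>x. norm (g x)) = nsq M g"
  by (simp add: nsq_def)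

lemma nsq_scaleR: "nsq M (\<lambda>x. c *\<^sub>R g x) = c\<^sup>2 * nsq M g"
  by (simp add: nsq_def power_mult_distrib)

lemma nsq_minus_commute: "nsq M (\<lambda>x. a x - b x) = nsq M (\<lambda>x. b x - a x)"
  by (simp add: nsq_def norm_minus_commute)

lemma nsq_mono:
  assumes "b \<in> L2_on M" "a \<in> borel_measurable M" "AE x in M. norm (a x) \<le> norm (b x)"
  shows "nsq M a \<le> nsq M b"
  unfolding nsq_def
proof (rule integral_mono_AE)
  show "integrable M (\<lambda>x. (norm (b x))\<^sup>2)" using assms by (auto simp: L2_on_def)
  show "AE x in M. (norm (a x))\<^sup>2 \<le> (norm (b x))\<^sup>2"
    using assms(3) by eventually_elim (simp add: power_mono)
  then have "a \<in> L2_on M" using assms by (intro L2_on_bound) (auto simp: L2_on_def)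
  then show "integrable M (\<lambda>x. (norm (a x))\<^sup>2)" by (auto simp: L2_on_def)
qed

lemma nsq_cong_AE:
  assumes "a \<in> borel_measurable M" "b \<in> borel_measurable M" "AE x in M. a x = b x"
  shows "nsq M a = nsq M b"
  unfolding nsq_def by (rule integral_cong_AE) (use assms in auto)

lemma nsq_add_le:
  assumes "a \<in> L2_on M" "b \<in> L2_on M"
  shows "nsq M (\<lambda>x. a x + b x) \<le> 2 * nsq M a + 2 * nsq M b"
proof -
  have "nsq M (\<lambda>x. a x + b x) \<le> (LINT x|M. 2 * (norm (a x))\<^sup>2 + 2 * (norm (b x))\<^sup>2)"
    unfolding nsq_def
    by (rule integral_mono)
      (use assms L2_on_add[OF assms] norm_add_sq_le in \<open>auto simp: L2_on_def\<close>)
  also have "\<dots> = 2 * nsq M a + 2 * nsq M b"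
    using assms by (simp add: L2_on_def nsq_def)
  finally show ?thesis .
qed

lemma nsq_diff_triangle:
  assumes "a \<in> L2_on M" "b \<in> L2_on M" "c \<in> L2_on M"
  shows "nsq M (\<lambda>x. a x - c x) \<le> 2 * nsq M (\<lambda>x. a x - b x) + 2 * nsq M (\<lambda>x. b x - c x)"
  using nsq_add_le[OF L2_on_diff[OF assms(1,2)] L2_on_diff[OF assms(2,3)]] by simp

lemma nsq_parallelogram:
  assumes "a \<in> L2_on M" "b \<in> L2_on M"
  shows "nsq M (\<lambda>x. a x - b x) + nsq M (\<lambda>x. a x + b x) = 2 * nsq M a + 2 * nsq M b"
proof -
  have "nsq M (\<lambda>x. a x - b x) + nsq M (\<lambda>x. a x + b x)
      = (LINT x|M. (norm (a x - b x))\<^sup>2 + (norm (a x + b x))\<^sup>2)"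
    using L2_on_add[OF assms] L2_on_diff[OF assms] by (simp add: L2_on_def nsq_def)
  also have "\<dots> = (LINT x|M. 2 * (norm (a x))\<^sup>2 + 2 * (norm (b x))\<^sup>2)"
    by (intro Bochner_Integration.integral_cong)
      (auto simp: power2_norm_eq_inner inner_add inner_diff inner_commute)
  also have "\<dots> = 2 * nsq M a + 2 * nsq M b"
    using assms by (simp add: L2_on_def nsq_def)
  finally show ?thesis .
qed

lemma nn_integral_eq_nsq:
  assumes "g \<in> L2_on M"
  shows "(\<integral>\<^sup>+x. (ennreal (norm (g x)))\<^sup>2 \<partial>M) = ennreal (nsq M g)"
  using assms unfolding nsq_def
  by (subst nn_integral_eq_integral[symmetric]) (auto simp: L2_on_def ennreal_power)

lemma nsq_Cauchy_Schwarz_norm: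
  fixes a b :: "'a \<Rightarrow> 'b::euclidean_space"
  assumes "a \<in> L2_on M" "b \<in> L2_on M"
  shows "(LINT x|M. norm (a x) * norm (b x)) \<le> sqrt (nsq M a) * sqrt (nsq M b)"
proof -
  have m: "a \<in> borel_measurable M" "b \<in> borel_measurable M" using assms by (auto simp: L2_on_def)
  have "(\<integral>\<^sup>+x. ennreal (norm (a x)) * ennreal (norm (b x)) \<partial>M)\<^sup>2
      \<le> (\<integral>\<^sup>+x. (ennreal (norm (a x)))\<^sup>2 \<partial>M) * (\<integral>\<^sup>+x. (ennreal (norm (b x)))\<^sup>2 \<partial>M)"
    by (rule Cauchy_Schwarz_nn_integral) (use m in auto)
  also have "\<dots> = ennreal (nsq M a * nsq M b)"
    by (simp add: nn_integral_eq_nsq assms ennreal_mult)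
  also have "(\<integral>\<^sup>+x. ennreal (norm (a x)) * ennreal (norm (b x)) \<partial>M)
      = ennreal (LINT x|M. norm (a x) * norm (b x))"
    using L2_on_inner_integrable(1)[OF assms]
    by (subst nn_integral_eq_integral[symmetric]) (auto simp: ennreal_mult)
  finally have "(LINT x|M. norm (a x) * norm (b x))\<^sup>2 \<le> nsq M a * nsq M b"
    by (simp add: ennreal_power)
  then have "(LINT x|M. norm (a x) * norm (b x)) \<le> sqrt (nsq M a * nsq M b)"
    by (rule real_le_rsqrt)
  then show ?thesis by (simp add: real_sqrt_mult)
qed

lemma nsq_Cauchy_Schwarz:
  fixes a b :: "'a \<Rightarrow> real"
  assumes "a \<in> L2_on M" "b \<in> L2_on M"
  shows "\<bar>LINT x|M. a x * b x\<bar> \<le> sqrt (nsq M a) * sqrt (nsq M b)"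
proof -
  have "\<bar>LINT x|M. a x * b x\<bar> \<le> (LINT x|M. norm (a x * b x))"
    using integral_norm_bound[of M "\<lambda>x. a x * b x"] by simp
  then show ?thesis using nsq_Cauchy_Schwarz_norm[OF assms] by (simp add: abs_mult)
qed

lemma sqrt_nsq_triangle:
  assumes "a \<in> L2_on M" "b \<in> L2_on M"
  shows "sqrt (nsq M (\<lambda>x. a x + b x)) \<le> sqrt (nsq M a) + sqrt (nsq M b)"
proof -
  have "nsq M (\<lambda>x. a x + b x)
      \<le> (LINT x|M. (norm (a x))\<^sup>2 + 2 * (norm (a x) * norm (b x)) + (norm (b x))\<^sup>2)"
    unfolding nsq_def
  proof (rule integral_mono)
    fix x
    have "(norm (a x + b x))\<^sup>2 \<le> (norm (a x) + norm (b x))\<^sup>2"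
      by (simp add: norm_triangle_ineq power_mono)
    then show "(norm (a x + b x))\<^sup>2 \<le> (norm (a x))\<^sup>2 + 2 * (norm (a x) * norm (b x)) + (norm (b x))\<^sup>2"
      by (simp add: power2_eq_square algebra_simps)
  qed (use assms L2_on_add[OF assms] L2_on_inner_integrable(1)[OF assms] in \<open>auto simp: L2_on_def\<close>)
  also have "\<dots> = nsq M a + 2 * (LINT x|M. norm (a x) * norm (b x)) + nsq M b"
    using assms L2_on_inner_integrable(1)[OF assms] by (simp add: L2_on_def nsq_def)
  also have "\<dots> \<le> (sqrt (nsq M a) + sqrt (nsq M b))\<^sup>2"
    using nsq_Cauchy_Schwarz_norm[OF assms] by (simp add: power2_sum)
  finally show ?thesis by (simp add: real_le_lsqrt)
qed

lemma L2_conv_AE_subseq: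
  assumes "\<And>k. g k \<in> L2_on M" "g0 \<in> L2_on M" "(\<lambda>k. nsq M (\<lambda>x. g k x - g0 x)) \<longlonglongrightarrow> 0"
  obtains r :: "nat \<Rightarrow> nat" where "strict_mono r" "AE x in M. (\<lambda>k. g (r k) x) \<longlonglongrightarrow> g0 x"
proof -
  have "\<exists>r::nat\<Rightarrow>nat. strict_mono r \<and> (AE x in M. (\<lambda>n. (norm (g (r n) x - g0 x))\<^sup>2) \<longlonglongrightarrow> 0)"
  proof (rule tendsto_L1_AE_subseq)
    show "\<And>n. integrable M (\<lambda>x. (norm (g n x - g0 x))\<^sup>2)"
      using L2_on_diff[OF assms(1) assms(2)] by (auto simp: L2_on_def)
    show "(\<lambda>n. LINT x|M. norm ((norm (g n x - g0 x))\<^sup>2)) \<longlonglongrightarrow> 0"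
      using assms(3) by (simp add: nsq_def)
  qed
  then obtain r where r: "strict_mono r" "AE x in M. (\<lambda>n. (norm (g (r n) x - g0 x))\<^sup>2) \<longlonglongrightarrow> 0"
    by blast
  have "AE x in M. (\<lambda>k. g (r k) x) \<longlonglongrightarrow> g0 x"
    using r(2)
  proof eventually_elim
    case (elim x)
    then have "(\<lambda>n. sqrt ((norm (g (r n) x - g0 x))\<^sup>2)) \<longlonglongrightarrow> sqrt 0" by (rule tendsto_real_sqrt)
    then show ?case by (simp add: LIM_zero_iff tendsto_norm_zero_iff)
  qed
  with r(1) show ?thesis by (rule that)
qed

lemma L2_dominated_convergence:
  fixes g :: "nat \<Rightarrow> 'a \<Rightarrow> 'b::euclidean_space"
  assumes "\<And>k. g k \<in> borel_measurable M" "g0 \<in> borel_measurable M"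
    and "AE x in M. (\<lambda>k. g k x) \<longlonglongrightarrow> g0 x"
    and "integrable M b" "\<And>k. AE x in M. (norm (g k x))\<^sup>2 \<le> b x"
  shows "g0 \<in> L2_on M" "(\<lambda>k. nsq M (\<lambda>x. g k x - g0 x)) \<longlonglongrightarrow> 0"
proof -
  have "AE x in M. \<forall>k. (norm (g k x))\<^sup>2 \<le> b x" using assms(5) by (simp add: AE_all_countable)
  with assms(3) have bd: "AE x in M. (norm (g0 x))\<^sup>2 \<le> b x"
  proof eventually_elim
    case (elim x)
    have "(\<lambda>k. (norm (g k x))\<^sup>2) \<longlonglongrightarrow> (norm (g0 x))\<^sup>2" using elim(1) by (intro tendsto_intros)
    then show ?case using elim(2) by (intro LIMSEQ_le_const2) auto
  qed
  show "g0 \<in> L2_on M" by (rule L2_on_bound[OF assms(2,4) bd])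
  have "(\<lambda>k. LINT x|M. (norm (g k x - g0 x))\<^sup>2) \<longlonglongrightarrow> (LINT x|M. 0)"
  proof (rule integral_dominated_convergence[where w = "\<lambda>x. 4 * b x"])
    show "AE x in M. (\<lambda>k. (norm (g k x - g0 x))\<^sup>2) \<longlonglongrightarrow> 0"
      using assms(3)
    proof eventually_elim
      case (elim x)
      then have "(\<lambda>k. norm (g k x - g0 x)) \<longlonglongrightarrow> 0" by (simp add: LIM_zero_iff tendsto_norm_zero)
      from tendsto_power[OF this, of 2] show ?case by simp
    qed
    fix k
    show "AE x in M. norm ((norm (g k x - g0 x))\<^sup>2) \<le> 4 * b x"
      using assms(5)[of k] bd
    proof eventually_elim
      case (elim x)
      then show ?case using norm_add_sq_le[of "g k x" "- g0 x"] by simp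
    qed
  qed (use assms in auto)
  then show "(\<lambda>k. nsq M (\<lambda>x. g k x - g0 x)) \<longlonglongrightarrow> 0" by (simp add: nsq_def)
qed

lemma tendsto_nsq:
  assumes "\<And>k. g k \<in> L2_on M" "g0 \<in> L2_on M" "(\<lambda>k. nsq M (\<lambda>x. g k x - g0 x)) \<longlonglongrightarrow> 0"
  shows "(\<lambda>k. nsq M (g k)) \<longlonglongrightarrow> nsq M g0"
proof -
  have bd: "\<bar>sqrt (nsq M (g k)) - sqrt (nsq M g0)\<bar> \<le> sqrt (nsq M (\<lambda>x. g k x - g0 x))" for k
  proof -
    have "sqrt (nsq M (g k)) \<le> sqrt (nsq M (\<lambda>x. g k x - g0 x)) + sqrt (nsq M g0)"
      using sqrt_nsq_triangle[OF L2_on_diff[OF assms(1)[of k] assms(2)] assms(2)] by simp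
    moreover have "sqrt (nsq M g0) \<le> sqrt (nsq M (\<lambda>x. g k x - g0 x)) + sqrt (nsq M (g k))"
      using sqrt_nsq_triangle[OF L2_on_diff[OF assms(2) assms(1)[of k]] assms(1)[of k]]
      by (simp add: nsq_minus_commute[of M g0])
    ultimately show ?thesis by linarith
  qed
  have z: "(\<lambda>k. sqrt (nsq M (\<lambda>x. g k x - g0 x))) \<longlonglongrightarrow> 0"
    using tendsto_real_sqrt[OF assms(3)] by simp
  have "(\<lambda>k. sqrt (nsq M (g k)) - sqrt (nsq M g0)) \<longlonglongrightarrow> 0"
    by (rule tendsto_rabs_zero_cancel, rule tendsto_sandwich[OF _ _ tendsto_const z])
      (use bd in auto)
  then have "(\<lambda>k. sqrt (nsq M (g k))) \<longlonglongrightarrow> sqrt (nsq M g0)" by (simp add: LIM_zero_iff)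
  from tendsto_power[OF this, of 2] show ?thesis by simp
qed

lemma tendsto_L2_mult_integral:
  fixes a b :: "nat \<Rightarrow> 'a \<Rightarrow> real"
  assumes "\<And>k. a k \<in> L2_on M" "a0 \<in> L2_on M" "(\<lambda>k. nsq M (\<lambda>x. a k x - a0 x)) \<longlonglongrightarrow> 0"
    and "b0 \<in> L2_on M"
  shows "(\<lambda>k. LINT x|M. a k x * b0 x) \<longlonglongrightarrow> (LINT x|M. a0 x * b0 x)"
proof (rule LIM_zero_cancel, rule tendsto_rabs_zero_cancel)
  have z: "(\<lambda>k. sqrt (nsq M (\<lambda>x. a k x - a0 x)) * sqrt (nsq M b0)) \<longlonglongrightarrow> 0"
    using tendsto_mult_left_zero[OF tendsto_real_sqrt[OF assms(3), simplified]] by simp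
  have "\<bar>(LINT x|M. a k x * b0 x) - (LINT x|M. a0 x * b0 x)\<bar>
      \<le> sqrt (nsq M (\<lambda>x. a k x - a0 x)) * sqrt (nsq M b0)" for k
  proof -
    have "(LINT x|M. a k x * b0 x) - (LINT x|M. a0 x * b0 x) = (LINT x|M. (a k x - a0 x) * b0 x)"
      using L2_on_mult_integrable[OF assms(1)[of k] assms(4)] L2_on_mult_integrable[OF assms(2,4)]
      by (simp add: left_diff_distrib)
    then show ?thesis using nsq_Cauchy_Schwarz[OF L2_on_diff[OF assms(1)[of k] assms(2)] assms(4)] by simp
  qed
  then show "(\<lambda>k. \<bar>(LINT x|M. a k x * b0 x) - (LINT x|M. a0 x * b0 x)\<bar>) \<longlonglongrightarrow> 0"
    by (intro tendsto_sandwich[OF _ _ tendsto_const z]) auto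
qed

text \<open>
  A fast subsequence of an \<open>L\<^sup>2\<close> Cauchy sequence converges almost everywhere; Fatou's lemma, applied
  to the differences, makes the pointwise limit the limit in \<open>L\<^sup>2\<close>.
\<close>

lemma L2_complete:
  fixes g :: "nat \<Rightarrow> 'a \<Rightarrow> 'b::euclidean_space"
  assumes fin: "finite_measure M" and g: "\<And>k. g k \<in> L2_on M"
    and C: "\<And>e. e > 0 \<Longrightarrow> \<exists>N. \<forall>i\<ge>N. \<forall>j\<ge>N. nsq M (\<lambda>x. g i x - g j x) < e"
  obtains g0 r where "g0 \<in> L2_on M" "(\<lambda>k. nsq M (\<lambda>x. g k x - g0 x)) \<longlonglongrightarrow> 0"
    "strict_mono (r::nat\<Rightarrow>nat)" "AE x in M. (\<lambda>k. g (r k) x) \<longlonglongrightarrow> g0 x"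
proof -
  define m where "m = measure M (space M) + 1"
  have m: "m > 0" "m \<ge> nsq M (\<lambda>x. 1::real)"
    by (auto simp: m_def nsq_def add_nonneg_pos)
  have L1: "(LINT x|M. norm (h x)) \<le> sqrt (nsq M h) * sqrt m" if "h \<in> L2_on M" for h :: "'a \<Rightarrow> 'b"
  proof -
    have "(LINT x|M. norm (norm (h x)) * norm (1::real)) \<le> sqrt (nsq M h) * sqrt (nsq M (\<lambda>x. 1::real))"
      using nsq_Cauchy_Schwarz_norm[OF L2_on_norm[OF that] L2_on_const[OF fin, of "1::real"]] by simp
    also have "\<dots> \<le> sqrt (nsq M h) * sqrt m" using m by (simp add: mult_left_mono)
    finally show ?thesis by simp
  qed
  obtain r where r: "strict_mono r" "AE x in M. Cauchy (\<lambda>i. g (r i) x)"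
  proof (rule cauchy_L1_AE_cauchy_subseq)
    show "\<And>n. integrable M (g n)" using L2_on_integrable[OF fin g] .
    fix e :: real assume "e > 0"
    then have "e\<^sup>2 / m > 0" using m by simp
    from C[OF this] obtain N where N: "\<And>i j. i \<ge> N \<Longrightarrow> j \<ge> N \<Longrightarrow> nsq M (\<lambda>x. g i x - g j x) < e\<^sup>2 / m"
      by blast
    have "(LINT x|M. norm (g i x - g j x)) < e" if "i \<ge> N" "j \<ge> N" for i j
    proof -
      have "(LINT x|M. norm (g i x - g j x)) \<le> sqrt (nsq M (\<lambda>x. g i x - g j x)) * sqrt m"
        by (rule L1[OF L2_on_diff[OF g g]])
      also have "\<dots> < sqrt (e\<^sup>2 / m) * sqrt m"
        using N[OF that] m by (intro mult_strict_right_mono) auto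
      also have "\<dots> = e" using m \<open>e > 0\<close> by (simp add: real_sqrt_mult[symmetric])
      finally show ?thesis .
    qed
    then show "\<exists>N. \<forall>i\<ge>N. \<forall>j\<ge>N. (LINT x|M. norm (g i x - g j x)) < e" by blast
  qed
  define g0 where "g0 x = (if Cauchy (\<lambda>i. g (r i) x) then lim (\<lambda>i. g (r i) x) else 0)" for x
  have gm[measurable]: "\<And>k. g k \<in> borel_measurable M" using g by (auto simp: L2_on_def)
  have g0m[measurable]: "g0 \<in> borel_measurable M"
    unfolding g0_def by measurable
  have conv: "AE x in M. (\<lambda>i. g (r i) x) \<longlonglongrightarrow> g0 x"
    using r(2) by eventually_elim (simp add: g0_def Cauchy_convergent_iff convergent_LIMSEQ_iff)
  have key: "\<exists>N. \<forall>k\<ge>N. integrable M (\<lambda>x. (norm (g k x - g0 x))\<^sup>2) \<and> nsq M (\<lambda>x. g k x - g0 x) \<le> e"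
    if e: "e > 0" for e
  proof -
    obtain N where N: "\<And>i j. i \<ge> N \<Longrightarrow> j \<ge> N \<Longrightarrow> nsq M (\<lambda>x. g i x - g j x) < e" using C[OF e] by blast
    have "integrable M (\<lambda>x. (norm (g k x - g0 x))\<^sup>2) \<and> nsq M (\<lambda>x. g k x - g0 x) \<le> e" if k: "k \<ge> N" for k
    proof -
      have "(\<integral>\<^sup>+x. ennreal ((norm (g k x - g0 x))\<^sup>2) \<partial>M)
          = (\<integral>\<^sup>+x. liminf (\<lambda>i. ennreal ((norm (g k x - g (r i) x))\<^sup>2)) \<partial>M)"
      proof (rule nn_integral_cong_AE, use conv in eventually_elim)
        case (elim x)
        have "(\<lambda>i. ennreal ((norm (g k x - g (r i) x))\<^sup>2)) \<longlonglongrightarrow> ennreal ((norm (g k x - g0 x))\<^sup>2)"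
          by (intro tendsto_intros tendsto_ennrealI elim)
        then show ?case using lim_imp_Liminf[OF sequentially_bot] by force
      qed
      also have "\<dots> \<le> liminf (\<lambda>i. \<integral>\<^sup>+x. ennreal ((norm (g k x - g (r i) x))\<^sup>2) \<partial>M)"
        by (rule nn_integral_liminf) measurable
      also have "\<dots> \<le> liminf (\<lambda>i. ennreal e)"
      proof (rule Liminf_mono, rule eventually_sequentiallyI[of N])
        fix i assume "N \<le> i"
        then have "r i \<ge> N" using seq_suble[OF r(1), of i] by linarith
        have "(\<integral>\<^sup>+x. ennreal ((norm (g k x - g (r i) x))\<^sup>2) \<partial>M) = ennreal (nsq M (\<lambda>x. g k x - g (r i) x))"
          unfolding nsq_def by (rule nn_integral_eq_integral)
            (use L2_on_diff[OF g g, of k "r i"] in \<open>auto simp: L2_on_def\<close>)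
        also have "\<dots> \<le> ennreal e" using N[OF k \<open>r i \<ge> N\<close>] by (simp add: ennreal_leI less_imp_le)
        finally show "(\<integral>\<^sup>+x. ennreal ((norm (g k x - g (r i) x))\<^sup>2) \<partial>M) \<le> ennreal e" .
      qed
      also have "\<dots> = ennreal e" by (simp add: Liminf_const)
      finally have le: "(\<integral>\<^sup>+x. ennreal ((norm (g k x - g0 x))\<^sup>2) \<partial>M) \<le> ennreal e" .
      have i: "integrable M (\<lambda>x. (norm (g k x - g0 x))\<^sup>2)"
        by (rule integrableI_bounded) (use le in \<open>auto intro: le_less_trans\<close>)
      have "ennreal (nsq M (\<lambda>x. g k x - g0 x)) \<le> ennreal e"
        unfolding nsq_def using le i by (subst nn_integral_eq_integral[symmetric]) auto
      then show ?thesis using i e by simp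
    qed
    then show ?thesis by blast
  qed
  obtain N1 where "integrable M (\<lambda>x. (norm (g N1 x - g0 x))\<^sup>2)" using key[of 1] by auto
  then have "(\<lambda>x. g N1 x - g0 x) \<in> L2_on M" by (auto simp: L2_on_def)
  from L2_on_diff[OF g[of N1] this] have "g0 \<in> L2_on M" by simp
  moreover have "(\<lambda>k. nsq M (\<lambda>x. g k x - g0 x)) \<longlonglongrightarrow> 0"
  proof (rule LIMSEQ_I)
    fix e :: real assume "e > 0"
    then obtain N where "\<And>k. k \<ge> N \<Longrightarrow> nsq M (\<lambda>x. g k x - g0 x) \<le> e / 2"
      using key[of "e / 2"] by auto
    then show "\<exists>N. \<forall>k\<ge>N. norm (nsq M (\<lambda>x. g k x - g0 x) - 0) < e"
      using \<open>e > 0\<close> by (intro exI[of _ N]) fastforce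
  qed
  ultimately show ?thesis using r(1) conv by (rule that)
qed

section \<open>Strongly convergent convex combinations\<close>

text \<open>
  The rows of \<open>c\<close> are finite convex combinations of the tails of a sequence: row \<open>k\<close> uses indices
  from \<open>k\<close> to \<open>m k\<close> only.
\<close>

definition tail_weights :: "(nat \<Rightarrow> nat \<Rightarrow> real) \<Rightarrow> (nat \<Rightarrow> nat) \<Rightarrow> bool" where
  "tail_weights c m \<longleftrightarrow> (\<forall>k j. 0 \<le> c k j) \<and> (\<forall>k. (\<Sum>j=k..m k. c k j) = 1)"

lemma tail_weights_tendsto:
  fixes a :: "nat \<Rightarrow> 'b::real_normed_vector"
  assumes tw: "tail_weights c m" and a: "a \<longlonglongrightarrow> l"
  shows "(\<lambda>k. \<Sum>j=k..m k. c k j *\<^sub>R a j) \<longlonglongrightarrow> l"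
proof (rule LIMSEQ_I)
  fix e :: real assume "e > 0"
  then obtain N where N: "\<And>j. j \<ge> N \<Longrightarrow> norm (a j - l) < e / 2"
    using LIMSEQ_D[OF a, of "e / 2"] by auto
  have "norm ((\<Sum>j=k..m k. c k j *\<^sub>R a j) - l) < e" if "k \<ge> N" for k
  proof -
    have s: "(\<Sum>j=k..m k. c k j) = 1" using tw by (simp add: tail_weights_def)
    have "(\<Sum>j=k..m k. c k j *\<^sub>R a j) - l = (\<Sum>j=k..m k. c k j *\<^sub>R (a j - l))"
      by (simp add: scaleR_diff_right sum_subtractf flip: scaleR_sum_left) (simp add: s)
    also have "norm \<dots> \<le> (\<Sum>j=k..m k. c k j * (e / 2))"
    proof (rule sum_norm_le)
      fix j assume "j \<in> {k..m k}"
      then have "norm (a j - l) \<le> e / 2" "0 \<le> c k j"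
        using N[of j] that tw by (auto simp: tail_weights_def)
      then show "norm (c k j *\<^sub>R (a j - l)) \<le> c k j * (e / 2)"
        by (simp add: mult_left_mono del: times_divide_eq_right)
    qed
    also have "\<dots> = e / 2" by (simp add: sum_distrib_right[symmetric] s flip: sum_divide_distrib)
    finally show ?thesis using \<open>e > 0\<close> by linarith
  qed
  then show "\<exists>N. \<forall>k\<ge>N. norm ((\<Sum>j=k..m k. c k j *\<^sub>R a j) - l) < e" by blast
qed

lemma tail_weights_subseq:
  assumes "tail_weights c m" "strict_mono r"
  obtains c' m' where "tail_weights c' m'"
    "\<And>k (v::nat \<Rightarrow> 'b::real_vector). (\<Sum>j=k..m' k. c' k j *\<^sub>R v j) = (\<Sum>j=r k..m (r k). c (r k) j *\<^sub>R v j)"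
proof -
  define c' where "c' k j = (if j \<ge> r k then c (r k) j else 0)" for k j
  define m' where "m' k = m (r k)" for k
  have *: "(\<Sum>j=k..m' k. c' k j *\<^sub>R v j) = (\<Sum>j=r k..m (r k). c (r k) j *\<^sub>R v j)"
    for k and v :: "nat \<Rightarrow> 'c::real_vector"
  proof -
    have "k \<le> r k" using seq_suble[OF assms(2)] .
    then show ?thesis
      by (intro sum.mono_neutral_cong_right) (auto simp: c'_def m'_def)
  qed
  have "tail_weights c' m'"
    using assms(1) *[of _ "\<lambda>_. 1::real"] by (auto simp: tail_weights_def c'_def)
  then show ?thesis using * by (rule that)
qed

text \<open>
  Among the convex combinations of the tail from \<open>k\<close> on, take one of almost least norm.  The least
  norms increase with \<open>k\<close> to a finite limit, and by the parallelogram law two almost minimal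
  combinations are close, since their midpoint is again a competitor.  This replaces weak
  compactness of bounded sets followed by Mazur's lemma.
\<close>

lemma convex_combs_converge:
  fixes v :: "nat \<Rightarrow> 'a \<Rightarrow> 'b::euclidean_space"
  assumes fin: "finite_measure M" and v: "\<And>j. v j \<in> L2_on M" and B: "\<And>j. nsq M (v j) \<le> B"
  obtains c m v0 where "tail_weights c m" "v0 \<in> L2_on M"
    "(\<lambda>k. nsq M (\<lambda>x. (\<Sum>j=k..m k. c k j *\<^sub>R v j x) - v0 x)) \<longlonglongrightarrow> 0"
    "AE x in M. (\<lambda>k. \<Sum>j=k..m k. c k j *\<^sub>R v j x) \<longlonglongrightarrow> v0 x"
proof -
  define A where "A k = {g. \<exists>c n. (\<forall>j. 0 \<le> c j) \<and> (\<Sum>j=k..n. c j) = (1::real) \<and>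
      g = (\<lambda>x. \<Sum>j=k..n. c j *\<^sub>R v j x)}" for k :: nat
  have vA: "v k \<in> A k" for k
    unfolding A_def by (rule CollectI, rule exI[of _ "\<lambda>j. if j = k then 1 else 0"], rule exI[of _ k]) auto
  have AL: "g \<in> L2_on M" if "g \<in> A k" for g k
    using that by (auto simp: A_def intro!: L2_on_sum L2_on_scaleR v)
  have mid: "(\<lambda>x. (1/2) *\<^sub>R (g x + h x)) \<in> A k" if gh: "g \<in> A k" "h \<in> A l" "k \<le> l" for g h k l
  proof -
    obtain c n where g: "\<And>j. 0 \<le> c j" "(\<Sum>j=k..n. c j) = (1::real)" "g = (\<lambda>x. \<Sum>j=k..n. c j *\<^sub>R v j x)"
      using gh(1) by (auto simp: A_def)
    obtain d p where h: "\<And>j. 0 \<le> d j" "(\<Sum>j=l..p. d j) = (1::real)" "h = (\<lambda>x. \<Sum>j=l..p. d j *\<^sub>R v j x)"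
      using gh(2) by (auto simp: A_def)
    define e where "e j = (1/2) * ((if j \<le> n then c j else 0) + (if l \<le> j \<and> j \<le> p then d j else 0))" for j
    have s1: "(\<Sum>j=k..max n p. (if j \<le> n then c j else 0) *\<^sub>R w j) = (\<Sum>j=k..n. c j *\<^sub>R w j)"
      for w :: "nat \<Rightarrow> 'c::real_vector"
      by (intro sum.mono_neutral_cong_right) auto
    have s2: "(\<Sum>j=k..max n p. (if l \<le> j \<and> j \<le> p then d j else 0) *\<^sub>R w j) = (\<Sum>j=l..p. d j *\<^sub>R w j)"
      for w :: "nat \<Rightarrow> 'c::real_vector"
      using gh(3) by (intro sum.mono_neutral_cong_right) auto
    have e: "(\<Sum>j=k..max n p. e j *\<^sub>R w j) = (1/2) *\<^sub>R ((\<Sum>j=k..n. c j *\<^sub>R w j) + (\<Sum>j=l..p. d j *\<^sub>R w j))"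
      for w :: "nat \<Rightarrow> 'c::real_vector"
      unfolding e_def scaleR_add_left distrib_left scaleR_scaleR[symmetric] sum.distrib
        scaleR_sum_right[symmetric] scaleR_add_right s1 s2 ..

    show ?thesis
      unfolding A_def
    proof (intro CollectI exI conjI allI)
      show "0 \<le> e j" for j using g(1) h(1) by (simp add: e_def)
      show "(\<Sum>j=k..max n p. e j) = 1" using e[of "\<lambda>_. 1::real"] g(2) h(2) by simp
      show "(\<lambda>x. (1/2) *\<^sub>R (g x + h x)) = (\<lambda>x. \<Sum>j=k..max n p. e j *\<^sub>R v j x)"
        by (simp add: e g(3) h(3))
    qed
  qed
  define d where "d k = (INF g\<in>A k. nsq M g)" for k
  have bdd: "bdd_below (nsq M ` A k)" for k by (rule bdd_belowI[of _ 0]) auto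
  have dle: "d k \<le> nsq M g" if "g \<in> A k" for g k
    unfolding d_def using that bdd by (intro cINF_lower) auto
  have dB: "d k \<le> B" for k using dle[OF vA[of k]] B[of k] by linarith
  have Amono: "g \<in> A k" if gl: "g \<in> A l" "k \<le> l" for g k l
  proof -
    obtain c n where g: "\<And>j. 0 \<le> c j" "(\<Sum>j=l..n. c j) = (1::real)" "g = (\<lambda>x. \<Sum>j=l..n. c j *\<^sub>R v j x)"
      using gl(1) by (auto simp: A_def)
    have *: "(\<Sum>j=k..n. (if l \<le> j then c j else 0) *\<^sub>R w j) = (\<Sum>j=l..n. c j *\<^sub>R w j)"
      for w :: "nat \<Rightarrow> 'c::real_vector"
      using gl(2) by (intro sum.mono_neutral_cong_right) auto
    show ?thesis unfolding A_def
    proof (intro CollectI exI conjI allI)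
      show "0 \<le> (if l \<le> j then c j else 0)" for j using g(1) by simp
      show "(\<Sum>j=k..n. (if l \<le> j then c j else 0)) = 1" using *[of "\<lambda>_. 1::real"] g(2) by simp
      show "g = (\<lambda>x. \<Sum>j=k..n. (if l \<le> j then c j else 0) *\<^sub>R v j x)"
        unfolding g(3) by (rule ext) (rule *[symmetric])
    qed
  qed
  have dmono: "d k \<le> d l" if "k \<le> l" for k l
    unfolding d_def by (rule cINF_mono) (use vA[of l] bdd Amono that in auto)
  have "incseq d" using dmono by (auto simp: incseq_def)
  then obtain D where D: "d \<longlonglongrightarrow> D" using dB incseq_convergent by metis
  have "\<exists>g. g \<in> A k \<and> nsq M g < d k + 1 / real (Suc k)" for k
  proof -
    have "\<exists>y\<in>nsq M ` A k. y < d k + 1 / real (Suc k)"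
      unfolding d_def by (rule cInf_lessD) (use vA in auto)
    then show ?thesis by blast
  qed
  then obtain g where gA: "\<And>k. g k \<in> A k" and gd: "\<And>k. nsq M (g k) < d k + 1 / real (Suc k)" by metis
  have close: "nsq M (\<lambda>x. g k x - g l x) \<le> 2 * (d l - d k) + 4 / real (Suc k)" if "k \<le> l" for k l
  proof -
    have "4 * d k \<le> 4 * nsq M (\<lambda>x. (1/2) *\<^sub>R (g k x + g l x))"
      using dle[OF mid[OF gA gA that]] by simp
    also have "\<dots> = nsq M (\<lambda>x. g k x + g l x)" by (simp only: nsq_scaleR) (simp add: power2_eq_square)
    finally have "nsq M (\<lambda>x. g k x - g l x) \<le> 2 * nsq M (g k) + 2 * nsq M (g l) - 4 * d k"
      using nsq_parallelogram[OF AL[OF gA] AL[OF gA], of k l] by linarith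
    moreover have "1 / real (Suc l) \<le> 1 / real (Suc k)" using that by (simp add: frac_le)
    moreover have "4 / real (Suc k) = 2 * (1 / real (Suc k)) + 2 * (1 / real (Suc k))" by simp
    moreover have "x \<le> 2 * (v - u) + z"
      if "x \<le> 2 * s + 2 * t - 4 * u" "q \<le> p" "s < u + p" "t < v + q" "z = 2 * p + 2 * p"
      for x s t p q u v z :: real
      using that by argo
    ultimately show ?thesis using gd[of k] gd[of l] by blast
  qed
  have C: "\<exists>N. \<forall>i\<ge>N. \<forall>j\<ge>N. nsq M (\<lambda>x. g i x - g j x) < e" if e: "e > 0" for e
  proof -
    have "(\<lambda>k. 2 * (D - d k) + 4 / real (Suc k)) \<longlonglongrightarrow> 2 * (D - D) + 0"
      by (intro tendsto_intros D LIMSEQ_Suc[OF lim_const_over_n])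
    then have "\<forall>\<^sub>F k in sequentially. 2 * (D - d k) + 4 / real (Suc k) < e"
      using e by (intro order_tendstoD) auto
    then obtain N where N: "\<And>k. k \<ge> N \<Longrightarrow> 2 * (D - d k) + 4 / real (Suc k) < e"
      by (auto simp: eventually_sequentially)
    have dD: "d k \<le> D" for k using \<open>incseq d\<close> D by (rule incseq_le)
    have "nsq M (\<lambda>x. g i x - g j x) < e" if "i \<ge> N" "j \<ge> N" "i \<le> j" for i j
      using close[OF that(3)] N[OF that(1)] dD[of j] by argo
    then have "nsq M (\<lambda>x. g i x - g j x) < e" if "i \<ge> N" "j \<ge> N" for i j
      using that nsq_minus_commute[of M "g i" "g j"] by (metis linear)
    then show ?thesis by blast
  qed
  obtain v0 r where v0: "v0 \<in> L2_on M" "(\<lambda>k. nsq M (\<lambda>x. g k x - v0 x)) \<longlonglongrightarrow> 0"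
    "strict_mono (r::nat\<Rightarrow>nat)" "AE x in M. (\<lambda>k. g (r k) x) \<longlonglongrightarrow> v0 x"
    using L2_complete[OF fin AL[OF gA] C] by blast
  have "\<exists>c n. (\<forall>j. 0 \<le> c j) \<and> (\<Sum>j=k..n. c j) = (1::real) \<and> g k = (\<lambda>x. \<Sum>j=k..n. c j *\<^sub>R v j x)"
    for k using gA[of k] by (simp add: A_def)
  from choice[OF allI[OF this]] obtain c where "\<forall>k. \<exists>n. (\<forall>j. 0 \<le> c k j) \<and> (\<Sum>j=k..n. c k j) = (1::real)
      \<and> g k = (\<lambda>x. \<Sum>j=k..n. c k j *\<^sub>R v j x)" ..
  from choice[OF this] obtain m where "\<forall>k. (\<forall>j. 0 \<le> c k j) \<and> (\<Sum>j=k..m k. c k j) = (1::real)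
      \<and> g k = (\<lambda>x. \<Sum>j=k..m k. c k j *\<^sub>R v j x)" ..
  then have cm: "\<And>k j. 0 \<le> c k j" "\<And>k. (\<Sum>j=k..m k. c k j) = (1::real)"
    "\<And>k. g k = (\<lambda>x. \<Sum>j=k..m k. c k j *\<^sub>R v j x)" by blast+
  have tw: "tail_weights c m" using cm by (simp add: tail_weights_def)
  obtain c' m' where c': "tail_weights c' m'"
    "\<And>k (w::nat \<Rightarrow> 'b). (\<Sum>j=k..m' k. c' k j *\<^sub>R w j) = (\<Sum>j=r k..m (r k). c (r k) j *\<^sub>R w j)"
    using tail_weights_subseq[OF tw v0(3)] by blast
  have eq: "(\<lambda>x. \<Sum>j=k..m' k. c' k j *\<^sub>R v j x) = g (r k)" for k by (simp add: c'(2) cm(3))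
  have eq': "(\<Sum>j=k..m' k. c' k j *\<^sub>R v j x) = g (r k) x" for k x using fun_cong[OF eq[of k], of x] .
  show ?thesis
  proof (rule that[OF c'(1) v0(1)])
    show "(\<lambda>k. nsq M (\<lambda>x. (\<Sum>j=k..m' k. c' k j *\<^sub>R v j x) - v0 x)) \<longlonglongrightarrow> 0"
      unfolding eq' using LIMSEQ_subseq_LIMSEQ[OF v0(2,3)] by (simp add: o_def)
    show "AE x in M. (\<lambda>k. \<Sum>j=k..m' k. c' k j *\<^sub>R v j x) \<longlonglongrightarrow> v0 x"
      unfolding eq' using v0(4) .
  qed
qed

section \<open>Smooth functions and test functions\<close>

definition smooth :: "('a::euclidean_space \<Rightarrow> real) \<Rightarrow> bool" where
  "smooth f \<longleftrightarrow> (\<forall>k. C_class k f)"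

lemma frechet_derivative_eqI:
  "(f has_derivative f') (at x) \<Longrightarrow> frechet_derivative f (at x) = f'"
  by (metis frechet_derivative_at)

lemma C_class_const: "C_class k (\<lambda>x::'a::euclidean_space. c)"
proof (induction k arbitrary: c)
  case (Suc k)
  have "frechet_derivative (\<lambda>x::'a. c) (at x) v = 0" for x v by (simp add: frechet_derivative_eqI)
  then show ?case using Suc by simp
qed simp

lemma C_class_add:
  "C_class k f \<Longrightarrow> C_class k g \<Longrightarrow> C_class k (\<lambda>x. f x + g x)"
proof (induction k arbitrary: f g)
  case (Suc k)
  have d: "f differentiable at x" "g differentiable at x" for x using Suc.prems by auto
  have "frechet_derivative (\<lambda>x. f x + g x) (at x) v
      = frechet_derivative f (at x) v + frechet_derivative g (at x) v" for x v
    by (subst frechet_derivative_eqI[OF has_derivative_add[OF d[unfolded frechet_derivative_works]]]) simp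
  then show ?case using Suc d by simp
qed (auto intro: continuous_on_add)

lemma C_class_cmult:
  "C_class k f \<Longrightarrow> C_class k (\<lambda>x. c * f x)"
proof (induction k arbitrary: f)
  case (Suc k)
  have d: "f differentiable at x" for x using Suc.prems by auto
  have "frechet_derivative (\<lambda>x. c * f x) (at x) v = c * frechet_derivative f (at x) v" for x v
    by (subst frechet_derivative_eqI[OF has_derivative_mult_right[OF d[unfolded frechet_derivative_works]]]) simp
  then show ?case using Suc d by simp
qed (auto intro: continuous_intros)

lemma smooth_differentiable:
  assumes "smooth f"
  shows "f differentiable at x"
  using assms[unfolded smooth_def, rule_format, of "Suc 0"] by simp

lemma smooth_has_derivative:
  "smooth f \<Longrightarrow> (f has_derivative frechet_derivative f (at x)) (at x)"
  using smooth_differentiable frechet_derivative_works by blast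

lemma smooth_frechet: "smooth f \<Longrightarrow> smooth (\<lambda>x. frechet_derivative f (at x) v)"
  unfolding smooth_def by (metis C_class.simps(2))

lemma smooth_continuous: "smooth f \<Longrightarrow> continuous_on S f"
  using continuous_on_subset unfolding smooth_def by (metis C_class.simps(1) subset_UNIV)

lemma smooth_const: "smooth (\<lambda>x. c)"
  and smooth_add: "smooth f \<Longrightarrow> smooth g \<Longrightarrow> smooth (\<lambda>x. f x + g x)"
  and smooth_cmult: "smooth f \<Longrightarrow> smooth (\<lambda>x. c * f x)"
  by (auto simp: smooth_def C_class_const C_class_add C_class_cmult)

lemma smooth_mult:
  assumes "smooth f" "smooth g"
  shows "smooth (\<lambda>x. f x * g x)"
proof -
  have "C_class k (\<lambda>x. f x * g x)" for k
    using assms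
  proof (induction k arbitrary: f g)
    case 0
    then show ?case using smooth_continuous by (auto intro!: continuous_on_mult)
  next
    case (Suc k)
    have d: "((\<lambda>x. f x * g x) has_derivative
        (\<lambda>v. f x * frechet_derivative g (at x) v + frechet_derivative f (at x) v * g x)) (at x)" for x
      using Suc.prems by (intro has_derivative_mult smooth_has_derivative)
    have "C_class k (\<lambda>x. f x * frechet_derivative g (at x) v + frechet_derivative f (at x) v * g x)" for v
      by (intro C_class_add Suc.IH smooth_frechet Suc.prems)
    then show ?case using d by (auto simp: frechet_derivative_eqI[OF d] intro: differentiableI)
  qed
  then show ?thesis by (simp add: smooth_def)
qed

lemma smooth_prod: "(\<And>i. i \<in> I \<Longrightarrow> smooth (f i)) \<Longrightarrow> smooth (\<lambda>x. \<Prod>i\<in>I. f i x)"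
  by (induction I rule: infinite_finite_induct) (auto intro: smooth_const smooth_mult)

lemma smooth_sum: "(\<And>i. i \<in> I \<Longrightarrow> smooth (f i)) \<Longrightarrow> smooth (\<lambda>x. \<Sum>i\<in>I. f i x)"
  by (induction I rule: infinite_finite_induct) (auto intro: smooth_const smooth_add)

lemma smooth_power: "smooth f \<Longrightarrow> smooth (\<lambda>x. f x ^ n)"
  by (induction n) (auto intro: smooth_const smooth_mult)

lemma has_derivative_affine_comp:
  assumes "(f has_derivative f') (at (c *\<^sub>R x + a))"
  shows "((\<lambda>x. f (c *\<^sub>R x + a)) has_derivative (\<lambda>v. f' (c *\<^sub>R v))) (at x)"
proof -
  have "((\<lambda>x. c *\<^sub>R x + a) has_derivative (\<lambda>v. c *\<^sub>R v)) (at x)"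
    by (auto intro!: derivative_eq_intros)
  from has_derivative_compose[OF this assms] show ?thesis .
qed

lemma smooth_affine:
  assumes "smooth f"
  shows "smooth (\<lambda>x. f (c *\<^sub>R x + a))"
proof -
  have "C_class k (\<lambda>x. f (c *\<^sub>R x + a))" for k
    using assms
  proof (induction k arbitrary: f)
    case 0
    then show ?case
      using continuous_on_compose2[OF smooth_continuous[of f UNIV], of UNIV "\<lambda>x. c *\<^sub>R x + a"]
      by (simp add: continuous_on_add continuous_on_scaleR)
  next
    case (Suc k)
    note d = has_derivative_affine_comp[OF smooth_has_derivative[OF Suc.prems]]
    have "C_class k (\<lambda>x. frechet_derivative f (at (c *\<^sub>R x + a)) (c *\<^sub>R v))" for v
      by (rule Suc.IH[OF smooth_frechet[OF Suc.prems]])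
    moreover have "(\<lambda>x. f (c *\<^sub>R x + a)) differentiable at x" for x
      using d unfolding differentiable_def by blast
    ultimately show ?case by (simp add: frechet_derivative_eqI[OF d])
  qed
  then show ?thesis by (simp add: smooth_def)
qed

text \<open>
  The functions \<open>t \<mapsto> exp (- 1 / t) / t ^ m\<close>, extended by \<open>0\<close> to \<open>t \<le> 0\<close>.  The family is closed
  under differentiation up to linear combinations, which makes each member smooth.
\<close>

definition flat :: "nat \<Rightarrow> real \<Rightarrow> real" where
  "flat m t = (if 0 < t then exp (- 1 / t) / t ^ m else 0)"

lemma flat_nonneg [simp]: "0 \<le> flat m t"
  by (simp add: flat_def)

lemma flat_le: "flat m t \<le> fact (m + 2) * t\<^sup>2"
proof (cases "0 < t")
  case True
  have "(\<Sum>i\<in>{m + 2}. (1 / t) ^ i /\<^sub>R fact i) \<le> exp (1 / t)"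
    unfolding exp_def
    by (rule sum_le_suminf) (use True summable_exp_generic[of "1 / t"] in auto)
  then have "(1 / t) ^ (m + 2) / fact (m + 2) \<le> exp (1 / t)"
    by (simp add: divide_inverse mult.commute del: fact_Suc)
  then have "1 \<le> exp (1 / t) * (C * t ^ (m + 2))" if "C = fact (m + 2)" "C > 0" for C
    unfolding that(1)[symmetric] using True that(2)
    by (simp add: power_one_over pos_divide_le_eq mult.commute mult.left_commute del: power_Suc)
  from this[OF refl] have "1 \<le> exp (1 / t) * (fact (m + 2) * t ^ (m + 2))" by simp
  then have "exp (- (1 / t)) * 1 \<le> exp (- (1 / t)) * (exp (1 / t) * (fact (m + 2) * t ^ (m + 2)))"
    by (intro mult_left_mono) auto
  then have "exp (- 1 / t) \<le> fact (m + 2) * t ^ (m + 2)"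
    by (simp add: mult.assoc[symmetric] exp_minus del: fact_Suc power_Suc)
  then have "exp (- 1 / t) / t ^ m \<le> fact (m + 2) * t ^ (m + 2) / t ^ m"
    using True by (intro divide_right_mono) auto
  also have "\<dots> = fact (m + 2) * t\<^sup>2" using True by (simp add: power_add power2_eq_square)
  finally show ?thesis using True by (simp add: flat_def)
qed (auto simp: flat_def)

lemma flat_has_derivative:
  "(flat m has_real_derivative flat (m + 2) t - real m * flat (m + 1) t) (at t)"
proof -
  consider "t > 0" | "t < 0" | "t = 0" by linarith
  then show ?thesis
  proof cases
    case 1
    have "((\<lambda>t. exp (- 1 / t) / t ^ m) has_real_derivative flat (m + 2) t - real m * flat (m + 1) t) (at t)"
      using 1 by (auto intro!: derivative_eq_intros simp: flat_def divide_simps power_add power2_eq_square)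
        (cases m; simp add: algebra_simps)+
    then show ?thesis
      by (rule has_field_derivative_transform_within_open[where S = "{0<..}"]) (use 1 in \<open>auto simp: flat_def\<close>)
  next
    case 2
    have "((\<lambda>t. 0) has_real_derivative flat (m + 2) t - real m * flat (m + 1) t) (at t)"
      using 2 by (simp add: flat_def)
    then show ?thesis
      by (rule has_field_derivative_transform_within_open[where S = "{..<0}"]) (use 2 in \<open>auto simp: flat_def\<close>)
  next
    case 3
    have z: "((\<lambda>h::real. fact (m + 2) * \<bar>h\<bar>) \<longlongrightarrow> 0) (at 0)"
      by (intro tendsto_eq_intros) auto
    have "((\<lambda>h. flat m h / h) \<longlongrightarrow> 0) (at 0)"
    proof (rule Lim_null_comparison[OF _ z], rule always_eventually, intro allI)
      fix h :: real
      have "\<bar>flat m h\<bar> \<le> fact (m + 2) * \<bar>h\<bar> * \<bar>h\<bar>"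
        using flat_le[of m h] by (simp add: power2_eq_square)
      then show "norm (flat m h / h) \<le> fact (m + 2) * \<bar>h\<bar>"
        by (cases "h = 0") (auto simp: divide_le_eq)
    qed
    then show ?thesis using 3 by (simp add: has_field_derivative_iff flat_def)
  qed
qed

lemma smooth_flat_linear:
  fixes l :: "'a::euclidean_space \<Rightarrow> real"
  assumes l: "bounded_linear l"
  shows "smooth (\<lambda>x. flat m (l x + b))"
proof -
  have d: "((\<lambda>x. flat m (l x + b)) has_derivative
      (\<lambda>v. l v * (flat (m + 2) (l x + b) + (- real m) * flat (m + 1) (l x + b)))) (at x)" for m x
  proof -
    have "((\<lambda>x. l x + b) has_derivative l) (at x)"
      using bounded_linear_imp_has_derivative[OF l] by (auto intro!: derivative_eq_intros)
    from has_derivative_compose[OF this flat_has_derivative[unfolded has_field_derivative_def]]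
    show ?thesis by (simp add: mult.commute)
  qed
  have "C_class k (\<lambda>x. flat m (l x + b))" for k
  proof (induction k arbitrary: m)
    case 0
    show ?case
      using has_derivative_continuous[OF d[of m]] by (simp add: continuous_at_imp_continuous_on)
  next
    case (Suc k)
    have "C_class k (\<lambda>x. l v * (flat (m + 2) (l x + b) + (- real m) * flat (m + 1) (l x + b)))" for v
      by (intro C_class_cmult C_class_add Suc.IH)
    then show ?case using d[of m] by (auto simp: frechet_derivative_eqI[OF d] intro: differentiableI)
  qed
  then show ?thesis by (simp add: smooth_def)
qed

lemma frechet_eq_grad:
  fixes \<phi> :: "real^'n \<Rightarrow> real"
  assumes "\<phi> differentiable (at x)"
  shows "frechet_derivative \<phi> (at x) v = grad \<phi> x \<bullet> v"
proof -
  have l: "linear (frechet_derivative \<phi> (at x))" by (rule linear_frechet_derivative[OF assms])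
  have "frechet_derivative \<phi> (at x) v = frechet_derivative \<phi> (at x) (\<Sum>i\<in>UNIV. v $ i *\<^sub>R axis i 1)"
    using basis_expansion[of v] by (simp add: scalar_mult_eq_scaleR)
  also have "\<dots> = (\<Sum>i\<in>UNIV. v $ i * frechet_derivative \<phi> (at x) (axis i 1))"
    by (simp add: linear_sum[OF l] linear_cmul[OF l])
  also have "\<dots> = grad \<phi> x \<bullet> v" by (simp add: grad_def inner_vec_def mult.commute)
  finally show ?thesis .
qed

lemma grad_eqI:
  fixes \<phi> :: "real^'n \<Rightarrow> real"
  assumes "(\<phi> has_derivative (\<lambda>v. G \<bullet> v)) (at x)"
  shows "grad \<phi> x = G"
  by (simp add: grad_def frechet_derivative_eqI[OF assms] inner_axis vec_eq_iff)

lemma smooth_has_grad: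
  fixes \<phi> :: "real^'n \<Rightarrow> real"
  assumes "smooth \<phi>"
  shows "(\<phi> has_derivative (\<lambda>v. grad \<phi> x \<bullet> v)) (at x)"
  using smooth_has_derivative[OF assms, of x] frechet_eq_grad[OF smooth_differentiable[OF assms], of x]
  by (metis (no_types, lifting) ext)

lemma continuous_grad:
  fixes \<phi> :: "real^'n \<Rightarrow> real"
  assumes "smooth \<phi>"
  shows "continuous_on S (grad \<phi>)"
proof -
  have "continuous_on S (\<lambda>x. frechet_derivative \<phi> (at x) (axis i 1))" for i :: 'n
    by (rule smooth_continuous[OF smooth_frechet[OF assms]])
  then show ?thesis unfolding grad_def[abs_def] by (intro continuous_on_vec_lambda)
qed

lemma grad_add:
  fixes \<phi> \<psi> :: "real^'n \<Rightarrow> real"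
  assumes "smooth \<phi>" "smooth \<psi>"
  shows "grad (\<lambda>x. \<phi> x + \<psi> x) x = grad \<phi> x + grad \<psi> x"
  using has_derivative_add[OF smooth_has_grad[OF assms(1)] smooth_has_grad[OF assms(2)]]
  by (intro grad_eqI) (simp add: inner_add_left)

lemma grad_cmult:
  fixes \<phi> :: "real^'n \<Rightarrow> real"
  assumes "smooth \<phi>"
  shows "grad (\<lambda>x. c * \<phi> x) x = c *\<^sub>R grad \<phi> x"
  using has_derivative_mult_right[OF smooth_has_grad[OF assms], of c]
  by (intro grad_eqI) simp

lemma grad_mult:
  fixes \<phi> \<psi> :: "real^'n \<Rightarrow> real"
  assumes "smooth \<phi>" "smooth \<psi>"
  shows "grad (\<lambda>x. \<phi> x * \<psi> x) x = \<phi> x *\<^sub>R grad \<psi> x + \<psi> x *\<^sub>R grad \<phi> x"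
  using has_derivative_mult[OF smooth_has_grad[OF assms(1)] smooth_has_grad[OF assms(2)]]
  by (intro grad_eqI) (simp add: inner_add_left mult.commute)

lemma grad_affine:
  fixes \<phi> :: "real^'n \<Rightarrow> real"
  assumes "smooth \<phi>"
  shows "grad (\<lambda>x. \<phi> (c *\<^sub>R x + a)) x = c *\<^sub>R grad \<phi> (c *\<^sub>R x + a)"
  using has_derivative_affine_comp[OF smooth_has_grad[OF assms]]
  by (intro grad_eqI) simp

lemma grad_comp:
  fixes \<phi> :: "real^'n \<Rightarrow> real"
  assumes "smooth \<phi>" "(g has_real_derivative d) (at (\<phi> x))"
  shows "grad (\<lambda>x. g (\<phi> x)) x = d *\<^sub>R grad \<phi> x"
  using has_derivative_compose[OF smooth_has_grad[OF assms(1)] assms(2)[unfolded has_field_derivative_def]]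
  by (intro grad_eqI) simp

lemma test_smooth: "\<phi> \<in> test_functions \<Omega> \<Longrightarrow> smooth \<phi>"
  by (simp add: test_functions_def smooth_def)

lemma test_compact_support:
  fixes \<phi> :: "real^'n \<Rightarrow> real"
  assumes "\<phi> \<in> test_functions \<Omega>"
  shows "\<exists>K. compact K \<and> K \<subseteq> \<Omega> \<and> (\<forall>x. x \<notin> K \<longrightarrow> \<phi> x = 0 \<and> grad \<phi> x = 0)"
proof (intro exI conjI allI impI)
  let ?K = "closure {x. \<phi> x \<noteq> 0}"
  show "compact ?K" "?K \<subseteq> \<Omega>" using assms by (auto simp: test_functions_def)
  have z: "\<phi> x = 0" if "x \<notin> ?K" for x using that closure_subset[of "{x. \<phi> x \<noteq> 0}"] by auto
  fix x assume x: "x \<notin> ?K"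
  show "\<phi> x = 0" by (rule z[OF x])
  have "(\<phi> has_derivative (\<lambda>v. 0)) (at x)"
  proof (rule has_derivative_transform_within_open)
    show "((\<lambda>x. 0::real) has_derivative (\<lambda>v. 0)) (at x)" by simp
    show "open (- ?K)" by auto
    show "x \<in> - ?K" using x by simp
    show "0 = \<phi> y" if "y \<in> - ?K" for y using z[of y] that by auto
  qed
  then show "grad \<phi> x = 0" by (intro grad_eqI) simp
qed

lemma test_functionsI:
  assumes "smooth \<phi>" "compact K" "K \<subseteq> \<Omega>" "\<And>x. x \<notin> K \<Longrightarrow> \<phi> x = 0"
  shows "\<phi> \<in> test_functions \<Omega>"
proof -
  have "closure {x. \<phi> x \<noteq> 0} \<subseteq> K"
    using assms(2,4) by (intro closure_minimal) (auto simp: compact_imp_closed)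
  moreover from this have "compact (closure {x. \<phi> x \<noteq> 0})"
    using assms(2) by (meson bounded_subset closed_closure compact_eq_bounded_closed)
  ultimately show ?thesis using assms(1,3) by (auto simp: test_functions_def smooth_def)
qed

lemma test_zero: "(\<lambda>x. 0) \<in> test_functions \<Omega>"
  by (rule test_functionsI[of _ "{}"]) (auto intro: smooth_const)

lemma test_add:
  fixes \<phi> \<psi> :: "real^'n \<Rightarrow> real"
  assumes "\<phi> \<in> test_functions \<Omega>" "\<psi> \<in> test_functions \<Omega>"
  shows "(\<lambda>x. \<phi> x + \<psi> x) \<in> test_functions \<Omega>"
proof -
  obtain K where K: "compact K" "K \<subseteq> \<Omega>" "\<forall>x. x \<notin> K \<longrightarrow> \<phi> x = 0 \<and> grad \<phi> x = 0"
    using test_compact_support[OF assms(1)] by blast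
  obtain L where L: "compact L" "L \<subseteq> \<Omega>" "\<forall>x. x \<notin> L \<longrightarrow> \<psi> x = 0 \<and> grad \<psi> x = 0"
    using test_compact_support[OF assms(2)] by blast
  show ?thesis
    by (rule test_functionsI[OF smooth_add[OF test_smooth[OF assms(1)] test_smooth[OF assms(2)]] compact_Un[OF K(1) L(1)]])
      (use K L in auto)
qed

lemma test_mult:
  fixes \<phi> \<psi> :: "real^'n \<Rightarrow> real"
  assumes "\<phi> \<in> test_functions \<Omega>" "smooth \<psi>"
  shows "(\<lambda>x. \<phi> x * \<psi> x) \<in> test_functions \<Omega>"
proof -
  obtain K where K: "compact K" "K \<subseteq> \<Omega>" "\<forall>x. x \<notin> K \<longrightarrow> \<phi> x = 0 \<and> grad \<phi> x = 0"
    using test_compact_support[OF assms(1)] by blast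
  show ?thesis
    by (rule test_functionsI[OF smooth_mult[OF test_smooth[OF assms(1)] assms(2)] K(1,2)]) (use K(3) in auto)
qed

lemma test_cmult:
  fixes \<phi> :: "real^'n \<Rightarrow> real"
  assumes "\<phi> \<in> test_functions \<Omega>"
  shows "(\<lambda>x. c * \<phi> x) \<in> test_functions \<Omega>"
proof -
  have eq: "(\<lambda>x. c * \<phi> x) = (\<lambda>x. \<phi> x * c)" by (rule ext) (rule mult.commute)
  show ?thesis unfolding eq by (rule test_mult[OF assms smooth_const])
qed

lemma test_bounded:
  fixes \<phi> :: "real^'n \<Rightarrow> real"
  assumes "\<phi> \<in> test_functions \<Omega>"
  obtains B where "B > 0" "\<And>x. \<bar>\<phi> x\<bar> \<le> B" "\<And>x. norm (grad \<phi> x) \<le> B"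
proof -
  obtain K where K: "compact K" "K \<subseteq> \<Omega>" "\<forall>x. x \<notin> K \<longrightarrow> \<phi> x = 0 \<and> grad \<phi> x = 0"
    using test_compact_support[OF assms] by blast
  have "bounded (\<phi> ` K)" "bounded (grad \<phi> ` K)"
    using compact_continuous_image[OF smooth_continuous[OF test_smooth[OF assms]] K(1)]
      compact_continuous_image[OF continuous_grad[OF test_smooth[OF assms]] K(1)]
    by (auto simp: compact_imp_bounded)
  then obtain a b where ab: "a > 0" "\<forall>z\<in>\<phi> ` K. norm z \<le> a" "b > 0" "\<forall>z\<in>grad \<phi> ` K. norm z \<le> b"
    unfolding bounded_pos by blast
  show ?thesis
  proof (rule that[of "max a b"])
    show "\<bar>\<phi> x\<bar> \<le> max a b" for x using K(3) ab by (cases "x \<in> K") auto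
    show "norm (grad \<phi> x) \<le> max a b" for x using K(3) ab by (cases "x \<in> K") auto
  qed (use ab in auto)
qed

text \<open>
  For large \<open>n\<close> this function is close to the indicator of the open box with corners \<open>a\<close> and \<open>b\<close>,
  outside of which it vanishes.
\<close>

definition box_bump :: "real^'n \<Rightarrow> real^'n \<Rightarrow> nat \<Rightarrow> real^'n \<Rightarrow> real" where
  "box_bump a b n x =
     (\<Prod>i\<in>UNIV. flat 0 (real n * x $ i + - real n * a $ i) * flat 0 (- real n * x $ i + real n * b $ i))"

lemma smooth_box_bump: "smooth (box_bump a b n)"
proof -
  have bl: "bounded_linear (\<lambda>x::real^'n. c * x $ i)" for c i
    by (rule bounded_linear_compose[OF bounded_linear_mult_right bounded_linear_vec_nth])
  show ?thesis unfolding box_bump_def[abs_def]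
    by (intro smooth_prod smooth_mult smooth_flat_linear bl)
qed

lemma box_bump_nonneg: "0 \<le> box_bump a b n x"
  by (auto simp: box_bump_def intro!: prod_nonneg)

lemma flat_0_le_1: "flat 0 t \<le> 1"
  by (simp add: flat_def)

lemma box_bump_le_1: "box_bump a b n x \<le> 1"
  unfolding box_bump_def by (intro prod_le_1) (auto intro!: mult_le_one flat_0_le_1)

lemma box_bump_pos: "n > 0 \<Longrightarrow> x \<in> box a b \<Longrightarrow> 0 < box_bump a b n x"
  unfolding box_bump_def by (intro prod_pos) (auto simp: flat_def mem_box_cart mult_less_cancel_left)

lemma box_bump_eq_0:
  assumes "x \<notin> box a b"
  shows "box_bump a b n x = 0"
proof -
  obtain i where "\<not> (a $ i < x $ i \<and> x $ i < b $ i)" using assms by (auto simp: mem_box_cart)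
  then have "flat 0 (real n * x $ i + - real n * a $ i) * flat 0 (- real n * x $ i + real n * b $ i) = 0"
    by (auto simp: flat_def zero_less_mult_iff mult_less_cancel_left)
  then show ?thesis unfolding box_bump_def by (intro prod_zero) auto
qed

lemma box_bump_test: "cbox a b \<subseteq> \<Omega> \<Longrightarrow> box_bump a b n \<in> test_functions \<Omega>"
  by (rule test_functionsI[of _ "cbox a b"])
    (auto simp: smooth_box_bump intro!: box_bump_eq_0 dest: subsetD[OF box_subset_cbox])

lemma flat_0_tendsto:
  assumes "t > 0"
  shows "(\<lambda>n. flat 0 (real n * t)) \<longlonglongrightarrow> 1"
proof -
  have "(\<lambda>n. exp (- (1 / t) * (1 / real n))) \<longlonglongrightarrow> exp (- (1 / t) * 0)"
    by (intro tendsto_intros lim_1_over_n)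
  moreover have "\<forall>\<^sub>F n in sequentially. exp (- (1 / t) * (1 / real n)) = flat 0 (real n * t)"
    using eventually_gt_at_top[of 0] by eventually_elim (use assms in \<open>auto simp: flat_def\<close>)
  ultimately show ?thesis by (simp add: tendsto_cong)
qed

lemma box_bump_tendsto: "(\<lambda>n. box_bump a b n x) \<longlonglongrightarrow> indicator (box a b) x"
proof (cases "x \<in> box a b")
  case True
  have "(\<lambda>n. box_bump a b n x) \<longlonglongrightarrow> (\<Prod>i\<in>(UNIV::'a set). 1 * 1)"
    unfolding box_bump_def
  proof (intro tendsto_prod tendsto_mult)
    fix i
    show "(\<lambda>n. flat 0 (real n * x $ i + - real n * a $ i)) \<longlonglongrightarrow> 1"
      using flat_0_tendsto[of "x $ i - a $ i"] True by (simp add: mem_box_cart algebra_simps)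
    show "(\<lambda>n. flat 0 (- real n * x $ i + real n * b $ i)) \<longlonglongrightarrow> 1"
      using flat_0_tendsto[of "b $ i - x $ i"] True by (simp add: mem_box_cart algebra_simps)
  qed
  then show ?thesis using True by simp
qed (simp add: box_bump_eq_0)

section \<open>The closure of the test functions\<close>

text \<open>
  Pairs of a function and its gradient in the closure of the test functions.  The gradient is an
  argument rather than the result of a choice, so that limits and chain rules can be stated as closure
  properties.
\<close>

definition H0 :: "(real^'n) set \<Rightarrow> (real^'n \<Rightarrow> real) \<Rightarrow> (real^'n \<Rightarrow> real^'n) \<Rightarrow> bool" where
  "H0 \<Omega> y G \<longleftrightarrow> y \<in> L2 \<Omega> \<and> G \<in> L2 \<Omega> \<and>
     (\<exists>\<phi>. (\<forall>k. \<phi> k \<in> test_functions \<Omega>) \<and>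
        (\<lambda>k. nsq (lebesgue_on \<Omega>) (\<lambda>x. \<phi> k x - y x)) \<longlonglongrightarrow> 0 \<and>
        (\<lambda>k. nsq (lebesgue_on \<Omega>) (\<lambda>x. grad (\<phi> k) x - G x)) \<longlonglongrightarrow> 0)"

locale bounded_open =
  fixes \<Omega> :: "(real^'n) set"
  assumes open_dom: "open \<Omega>" and bounded_dom: "bounded \<Omega>" and nonempty_dom: "\<Omega> \<noteq> {}"
begin

abbreviation \<mu> :: "(real^'n) measure" where "\<mu> \<equiv> lebesgue_on \<Omega>"

lemma dom_lmeasurable: "\<Omega> \<in> lmeasurable"
  using open_dom bounded_dom by (simp add: lmeasurable_open)

lemma dom_sets [measurable, simp]: "\<Omega> \<in> sets lebesgue"
  using dom_lmeasurable by blast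

lemma dom_borel [simp]: "\<Omega> \<in> sets lborel"
  using open_dom by auto

lemma fin: "finite_measure \<mu>"
  using dom_lmeasurable by (rule finite_measure_lebesgue_on)

lemma integral_mu_eq_lborel:
  fixes g :: "real^'n \<Rightarrow> 'b::{banach, second_countable_topology}"
  assumes "g \<in> borel_measurable borel" "\<And>x. x \<notin> \<Omega> \<Longrightarrow> g x = 0"
  shows "(LINT x|\<mu>. g x) = (LINT x|lborel. g x)"
proof -
  have "(LINT x|\<mu>. g x) = (LINT x|lebesgue. indicator \<Omega> x *\<^sub>R g x)"
    by (rule integral_restrict_space) simp
  also have "(\<lambda>x. indicator \<Omega> x *\<^sub>R g x) = g" using assms(2) by (auto simp: indicator_def)
  also have "(LINT x|lebesgue. g x) = (LINT x|lborel. g x)"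
    by (rule integral_completion) (use assms(1) in simp)
  finally show ?thesis .
qed

lemma borel_measurable_mu: "g \<in> borel_measurable borel \<Longrightarrow> g \<in> borel_measurable \<mu>"
  by (intro measurable_restrict_space1 measurable_completion) simp

lemma test_borel:
  assumes "\<phi> \<in> test_functions \<Omega>"
  shows "\<phi> \<in> borel_measurable borel" "grad \<phi> \<in> borel_measurable borel"
  using smooth_continuous[OF test_smooth[OF assms]] continuous_grad[OF test_smooth[OF assms]]
  by (auto intro: borel_measurable_continuous_onI)

lemma test_L2:
  assumes "\<phi> \<in> test_functions \<Omega>"
  shows "\<phi> \<in> L2_on \<mu>" "grad \<phi> \<in> L2_on \<mu>"
proof -
  obtain B where B: "B > 0" "\<And>x. \<bar>\<phi> x\<bar> \<le> B" "\<And>x. norm (grad \<phi> x) \<le> B"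
    by (rule test_bounded[OF assms]) blast
  show "\<phi> \<in> L2_on \<mu>"
    by (rule L2_on_bounded[OF fin borel_measurable_mu[OF test_borel(1)[OF assms]]]) (use B in auto)
  show "grad \<phi> \<in> L2_on \<mu>"
    by (rule L2_on_bounded[OF fin borel_measurable_mu[OF test_borel(2)[OF assms]]]) (use B in auto)
qed

lemma test_outside:
  assumes "\<phi> \<in> test_functions \<Omega>" "x \<notin> \<Omega>"
  shows "\<phi> x = 0" "grad \<phi> x = 0"
  using test_compact_support[OF assms(1)] assms(2) by blast+

lemma H0_iff: "H0 \<Omega> y G \<longleftrightarrow> y \<in> L2_on \<mu> \<and> G \<in> L2_on \<mu> \<and>
     (\<exists>\<phi>. (\<forall>k. \<phi> k \<in> test_functions \<Omega>) \<and> (\<lambda>k. nsq \<mu> (\<lambda>x. \<phi> k x - y x)) \<longlonglongrightarrow> 0 \<and>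
        (\<lambda>k. nsq \<mu> (\<lambda>x. grad (\<phi> k) x - G x)) \<longlonglongrightarrow> 0)"
  by (simp add: H0_def L2_eq_L2_on)

lemma H0_L2: "H0 \<Omega> y G \<Longrightarrow> y \<in> L2_on \<mu>" "H0 \<Omega> y G \<Longrightarrow> G \<in> L2_on \<mu>"
  by (auto simp: H0_iff)

lemma H0_approx:
  assumes "H0 \<Omega> y G"
  obtains \<phi> where "\<And>k. \<phi> k \<in> test_functions \<Omega>" "(\<lambda>k. nsq \<mu> (\<lambda>x. \<phi> k x - y x)) \<longlonglongrightarrow> 0"
    "(\<lambda>k. nsq \<mu> (\<lambda>x. grad (\<phi> k) x - G x)) \<longlonglongrightarrow> 0"
  using assms unfolding H0_iff by blast

lemma H0_test: "\<phi> \<in> test_functions \<Omega> \<Longrightarrow> H0 \<Omega> \<phi> (grad \<phi>)"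
  unfolding H0_iff by (intro conjI test_L2 exI[of _ "\<lambda>_. \<phi>"] allI) (simp_all add: nsq_def)

lemma H0_approx_within:
  assumes "H0 \<Omega> y G" "e > 0"
  shows "\<exists>\<phi>. \<phi> \<in> test_functions \<Omega> \<and> nsq \<mu> (\<lambda>x. \<phi> x - y x) < e \<and> nsq \<mu> (\<lambda>x. grad \<phi> x - G x) < e"
proof -
  obtain \<phi> where \<phi>: "\<And>k. \<phi> k \<in> test_functions \<Omega>" "(\<lambda>k. nsq \<mu> (\<lambda>x. \<phi> k x - y x)) \<longlonglongrightarrow> 0"
    "(\<lambda>k. nsq \<mu> (\<lambda>x. grad (\<phi> k) x - G x)) \<longlonglongrightarrow> 0" by (rule H0_approx[OF assms(1)]) blast
  have "\<forall>\<^sub>F k in sequentially. nsq \<mu> (\<lambda>x. \<phi> k x - y x) < e \<and> nsq \<mu> (\<lambda>x. grad (\<phi> k) x - G x) < e"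
    using order_tendstoD(2)[OF \<phi>(2) assms(2)] order_tendstoD(2)[OF \<phi>(3) assms(2)]
    by eventually_elim simp
  then obtain k where "nsq \<mu> (\<lambda>x. \<phi> k x - y x) < e" "nsq \<mu> (\<lambda>x. grad (\<phi> k) x - G x) < e"
    by (auto simp: eventually_sequentially)
  then show ?thesis using \<phi>(1) by blast
qed

lemma H0_closed:
  assumes H: "\<And>j. H0 \<Omega> (y j) (G j)" and L: "y0 \<in> L2_on \<mu>" "G0 \<in> L2_on \<mu>"
    and c: "(\<lambda>j. nsq \<mu> (\<lambda>x. y j x - y0 x)) \<longlonglongrightarrow> 0" "(\<lambda>j. nsq \<mu> (\<lambda>x. G j x - G0 x)) \<longlonglongrightarrow> 0"
  shows "H0 \<Omega> y0 G0"
proof -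
  have "\<exists>\<phi>. \<phi> \<in> test_functions \<Omega> \<and> nsq \<mu> (\<lambda>x. \<phi> x - y j x) < 1 / Suc j \<and> nsq \<mu> (\<lambda>x. grad \<phi> x - G j x) < 1 / Suc j"
    for j by (rule H0_approx_within[OF H[of j]]) simp
  then have "\<forall>j. \<exists>\<phi>. \<phi> \<in> test_functions \<Omega> \<and> nsq \<mu> (\<lambda>x. \<phi> x - y j x) < 1 / Suc j \<and> nsq \<mu> (\<lambda>x. grad \<phi> x - G j x) < 1 / Suc j"
    by blast
  from choice[OF this] obtain \<phi> where \<phi>: "\<And>j. \<phi> j \<in> test_functions \<Omega>" "\<And>j. nsq \<mu> (\<lambda>x. \<phi> j x - y j x) < 1 / Suc j"
    "\<And>j. nsq \<mu> (\<lambda>x. grad (\<phi> j) x - G j x) < 1 / Suc j" by blast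
  have "(\<lambda>j. nsq \<mu> (\<lambda>x. \<phi> j x - y0 x)) \<longlonglongrightarrow> 0"
  proof (rule tendsto_sandwich[OF _ _ tendsto_const])
    show "\<forall>\<^sub>F j in sequentially. nsq \<mu> (\<lambda>x. \<phi> j x - y0 x) \<le> 2 * (1 / Suc j) + 2 * nsq \<mu> (\<lambda>x. y j x - y0 x)"
    proof (intro always_eventually allI)
      fix j
      show "nsq \<mu> (\<lambda>x. \<phi> j x - y0 x) \<le> 2 * (1 / Suc j) + 2 * nsq \<mu> (\<lambda>x. y j x - y0 x)"
        using nsq_diff_triangle[OF test_L2(1)[OF \<phi>(1)[of j]] H0_L2(1)[OF H[of j]] L(1)] \<phi>(2)[of j] by argo
    qed
    show "(\<lambda>j. 2 * (1 / real (Suc j)) + 2 * nsq \<mu> (\<lambda>x. y j x - y0 x)) \<longlonglongrightarrow> 0"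
      using tendsto_add[OF tendsto_mult_right_zero[OF LIMSEQ_Suc[OF lim_1_over_n], of 2] tendsto_mult_right_zero[OF c(1), of 2]]
      by simp
  qed simp
  moreover have "(\<lambda>j. nsq \<mu> (\<lambda>x. grad (\<phi> j) x - G0 x)) \<longlonglongrightarrow> 0"
  proof (rule tendsto_sandwich[OF _ _ tendsto_const])
    show "\<forall>\<^sub>F j in sequentially. nsq \<mu> (\<lambda>x. grad (\<phi> j) x - G0 x) \<le> 2 * (1 / Suc j) + 2 * nsq \<mu> (\<lambda>x. G j x - G0 x)"
    proof (intro always_eventually allI)
      fix j
      show "nsq \<mu> (\<lambda>x. grad (\<phi> j) x - G0 x) \<le> 2 * (1 / Suc j) + 2 * nsq \<mu> (\<lambda>x. G j x - G0 x)"
        using nsq_diff_triangle[OF test_L2(2)[OF \<phi>(1)[of j]] H0_L2(2)[OF H[of j]] L(2)] \<phi>(3)[of j] by argo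
    qed
    show "(\<lambda>j. 2 * (1 / real (Suc j)) + 2 * nsq \<mu> (\<lambda>x. G j x - G0 x)) \<longlonglongrightarrow> 0"
      using tendsto_add[OF tendsto_mult_right_zero[OF LIMSEQ_Suc[OF lim_1_over_n], of 2] tendsto_mult_right_zero[OF c(2), of 2]]
      by simp
  qed simp
  ultimately show ?thesis unfolding H0_iff using \<phi>(1) L by blast
qed

lemma H0_add:
  assumes "H0 \<Omega> y G" "H0 \<Omega> z K"
  shows "H0 \<Omega> (\<lambda>x. y x + z x) (\<lambda>x. G x + K x)"
proof -
  note L = H0_L2[OF assms(1)] H0_L2[OF assms(2)]
  obtain \<phi> where \<phi>: "\<And>k. \<phi> k \<in> test_functions \<Omega>" "(\<lambda>k. nsq \<mu> (\<lambda>x. \<phi> k x - y x)) \<longlonglongrightarrow> 0"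
    "(\<lambda>k. nsq \<mu> (\<lambda>x. grad (\<phi> k) x - G x)) \<longlonglongrightarrow> 0" by (rule H0_approx[OF assms(1)]) blast
  obtain \<psi> where \<psi>: "\<And>k. \<psi> k \<in> test_functions \<Omega>" "(\<lambda>k. nsq \<mu> (\<lambda>x. \<psi> k x - z x)) \<longlonglongrightarrow> 0"
    "(\<lambda>k. nsq \<mu> (\<lambda>x. grad (\<psi> k) x - K x)) \<longlonglongrightarrow> 0" by (rule H0_approx[OF assms(2)]) blast
  have sum: "(\<lambda>k. nsq \<mu> (\<lambda>x. (a k x + b k x) - (c x + d x))) \<longlonglongrightarrow> 0"
    if "\<And>k. a k \<in> L2_on \<mu>" "\<And>k. b k \<in> L2_on \<mu>" "c \<in> L2_on \<mu>" "d \<in> L2_on \<mu>"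
      and t: "(\<lambda>k. nsq \<mu> (\<lambda>x. a k x - c x)) \<longlonglongrightarrow> 0" "(\<lambda>k. nsq \<mu> (\<lambda>x. b k x - d x)) \<longlonglongrightarrow> 0"
    for a b and c d :: "real^'n \<Rightarrow> 'b::euclidean_space"
  proof (rule tendsto_sandwich[OF _ _ tendsto_const])
    show "\<forall>\<^sub>F k in sequentially. nsq \<mu> (\<lambda>x. (a k x + b k x) - (c x + d x))
        \<le> 2 * nsq \<mu> (\<lambda>x. a k x - c x) + 2 * nsq \<mu> (\<lambda>x. b k x - d x)"
      using nsq_add_le[OF L2_on_diff[OF that(1,3)] L2_on_diff[OF that(2,4)]]
      by (intro always_eventually allI) (simp add: algebra_simps)
    show "(\<lambda>k. 2 * nsq \<mu> (\<lambda>x. a k x - c x) + 2 * nsq \<mu> (\<lambda>x. b k x - d x)) \<longlonglongrightarrow> 0"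
      using tendsto_add[OF tendsto_mult_right_zero[OF t(1), of 2] tendsto_mult_right_zero[OF t(2), of 2]] by simp
  qed simp
  show ?thesis
    unfolding H0_iff
  proof (intro conjI exI allI)
    show "(\<lambda>x. \<phi> k x + \<psi> k x) \<in> test_functions \<Omega>" for k by (rule test_add[OF \<phi>(1) \<psi>(1)])
    show "(\<lambda>k. nsq \<mu> (\<lambda>x. \<phi> k x + \<psi> k x - (y x + z x))) \<longlonglongrightarrow> 0"
      by (rule sum) (use L \<phi> \<psi> test_L2 in auto)
    show "(\<lambda>k. nsq \<mu> (\<lambda>x. grad (\<lambda>x. \<phi> k x + \<psi> k x) x - (G x + K x))) \<longlonglongrightarrow> 0"
      unfolding grad_add[OF test_smooth[OF \<phi>(1)] test_smooth[OF \<psi>(1)]]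
      by (rule sum) (use L \<phi> \<psi> test_L2 in auto)
  qed (rule L2_on_add[OF L(1,3)] L2_on_add[OF L(2,4)])+
qed

lemma H0_scaleR:
  assumes "H0 \<Omega> y G"
  shows "H0 \<Omega> (\<lambda>x. c * y x) (\<lambda>x. c *\<^sub>R G x)"
proof -
  note L = H0_L2[OF assms(1)]
  obtain \<phi> where \<phi>: "\<And>k. \<phi> k \<in> test_functions \<Omega>" "(\<lambda>k. nsq \<mu> (\<lambda>x. \<phi> k x - y x)) \<longlonglongrightarrow> 0"
    "(\<lambda>k. nsq \<mu> (\<lambda>x. grad (\<phi> k) x - G x)) \<longlonglongrightarrow> 0" by (rule H0_approx[OF assms(1)]) blast
  show ?thesis
    unfolding H0_iff
  proof (intro conjI exI allI)
    show "(\<lambda>x. c * \<phi> k x) \<in> test_functions \<Omega>" for k by (rule test_cmult[OF \<phi>(1)])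
    have "(\<lambda>k. nsq \<mu> (\<lambda>x. c *\<^sub>R (\<phi> k x - y x))) \<longlonglongrightarrow> 0"
      unfolding nsq_scaleR using tendsto_mult_right_zero[OF \<phi>(2)] .
    then show "(\<lambda>k. nsq \<mu> (\<lambda>x. c * \<phi> k x - c * y x)) \<longlonglongrightarrow> 0" by (simp add: right_diff_distrib)
    have "(\<lambda>k. nsq \<mu> (\<lambda>x. c *\<^sub>R (grad (\<phi> k) x - G x))) \<longlonglongrightarrow> 0"
      unfolding nsq_scaleR using tendsto_mult_right_zero[OF \<phi>(3)] .
    then show "(\<lambda>k. nsq \<mu> (\<lambda>x. grad (\<lambda>x. c * \<phi> k x) x - c *\<^sub>R G x)) \<longlonglongrightarrow> 0"
      unfolding grad_cmult[OF test_smooth[OF \<phi>(1)]] by (simp add: scaleR_diff_right)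
  qed (rule L2_on_cmult[OF L(1)] L2_on_scaleR[OF L(2)])+
qed

lemma H0_zero: "H0 \<Omega> (\<lambda>x. 0) (\<lambda>x. 0)"
  using H0_scaleR[OF H0_test[OF test_zero], of 0] by simp

lemma H0_diff: "H0 \<Omega> y G \<Longrightarrow> H0 \<Omega> z K \<Longrightarrow> H0 \<Omega> (\<lambda>x. y x - z x) (\<lambda>x. G x - K x)"
  by (drule H0_scaleR[of z K "-1"], drule (1) H0_add) simp

lemma H0_sum:
  assumes "\<And>j. j \<in> I \<Longrightarrow> H0 \<Omega> (y j) (G j)"
  shows "H0 \<Omega> (\<lambda>x. \<Sum>j\<in>I. c j * y j x) (\<lambda>x. \<Sum>j\<in>I. c j *\<^sub>R G j x)"
  using assms
proof (induction I rule: infinite_finite_induct)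
  case (insert j I)
  have "H0 \<Omega> (\<lambda>x. c j * y j x + (\<Sum>j\<in>I. c j * y j x)) (\<lambda>x. c j *\<^sub>R G j x + (\<Sum>j\<in>I. c j *\<^sub>R G j x))"
    by (rule H0_add[OF H0_scaleR[OF insert.prems] insert.IH[OF insert.prems]]) simp_all
  then show ?case using insert.hyps by simp
qed (simp_all add: H0_zero)

lemma H0_cong_AE:
  assumes "H0 \<Omega> y G" "y' \<in> L2_on \<mu>" "G' \<in> L2_on \<mu>" "AE x in \<mu>. y x = y' x" "AE x in \<mu>. G x = G' x"
  shows "H0 \<Omega> y' G'"
proof (rule H0_closed[of "\<lambda>_. y" "\<lambda>_. G"])
  note L = H0_L2[OF assms(1)]
  have "nsq \<mu> (\<lambda>x. y x - y' x) = nsq \<mu> (\<lambda>x. 0::real)"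
    by (rule nsq_cong_AE) (use assms L in \<open>auto simp: L2_on_def\<close>)
  then show "(\<lambda>j. nsq \<mu> (\<lambda>x. y x - y' x)) \<longlonglongrightarrow> 0" by (simp add: nsq_def)
  have "nsq \<mu> (\<lambda>x. G x - G' x) = nsq \<mu> (\<lambda>x. 0::real^'n)"
    by (rule nsq_cong_AE) (use assms L in \<open>auto simp: L2_on_def\<close>)
  then show "(\<lambda>j. nsq \<mu> (\<lambda>x. G x - G' x)) \<longlonglongrightarrow> 0" by (simp add: nsq_def)
qed (use assms in auto)

text \<open>
  Strongly convergent convex combinations of the gradients supply the gradient of the limit.
\<close>

lemma H0_weak_closure:
  assumes H: "\<And>j. H0 \<Omega> (y j) (G j)" and B: "\<And>j. nsq \<mu> (y j) \<le> B" "\<And>j. nsq \<mu> (G j) \<le> B"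
    and y0: "AE x in \<mu>. (\<lambda>j. y j x) \<longlonglongrightarrow> y0 x" "y0 \<in> borel_measurable \<mu>"
  obtains G0 where "H0 \<Omega> y0 G0"
proof -
  note L = H0_L2[OF H]
  have "nsq \<mu> (\<lambda>x. (y j x, G j x)) \<le> 2 * B" for j
    using B[of j] nsq_Pair[OF L[of j]] by simp
  from convex_combs_converge[of \<mu> "\<lambda>j x. (y j x, G j x)", OF fin L2_on_Pair[OF L] this]
  obtain c m v where v: "tail_weights c m" "v \<in> L2_on \<mu>"
    "(\<lambda>k. nsq \<mu> (\<lambda>x. (\<Sum>j=k..m k. c k j *\<^sub>R (y j x, G j x)) - v x)) \<longlonglongrightarrow> 0"
    "AE x in \<mu>. (\<lambda>k. \<Sum>j=k..m k. c k j *\<^sub>R (y j x, G j x)) \<longlonglongrightarrow> v x" by blast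
  have s: "(\<Sum>j=k..m k. c k j *\<^sub>R (y j x, G j x)) = (\<Sum>j=k..m k. c k j * y j x, \<Sum>j=k..m k. c k j *\<^sub>R G j x)"
    for k x by (simp add: sum_prod)
  let ?y = "\<lambda>k x. \<Sum>j=k..m k. c k j * y j x" and ?G = "\<lambda>k x. \<Sum>j=k..m k. c k j *\<^sub>R G j x"
  have Hk: "H0 \<Omega> (?y k) (?G k)" for k by (rule H0_sum) (rule H)
  note Lv = L2_on_fst[OF v(2)] L2_on_snd[OF v(2)]
  have n: "nsq \<mu> (\<lambda>x. (\<Sum>j=k..m k. c k j *\<^sub>R (y j x, G j x)) - v x)
      = nsq \<mu> (\<lambda>x. ?y k x - fst (v x)) + nsq \<mu> (\<lambda>x. ?G k x - snd (v x))" for k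
  proof -
    have "(\<Sum>j=k..m k. c k j *\<^sub>R (y j x, G j x)) - v x = (?y k x - fst (v x), ?G k x - snd (v x))" for x
      unfolding s by (simp add: prod_eq_iff)
    then show ?thesis
      using nsq_Pair[OF L2_on_diff[OF H0_L2(1)[OF Hk] Lv(1)] L2_on_diff[OF H0_L2(2)[OF Hk] Lv(2)], of k k] by simp
  qed
  have t: "(\<lambda>k. nsq \<mu> (\<lambda>x. ?y k x - fst (v x)) + nsq \<mu> (\<lambda>x. ?G k x - snd (v x))) \<longlonglongrightarrow> 0"
    using v(3) unfolding n .
  have "H0 \<Omega> (\<lambda>x. fst (v x)) (\<lambda>x. snd (v x))"
  proof (rule H0_closed[OF Hk Lv])
    show "(\<lambda>k. nsq \<mu> (\<lambda>x. ?y k x - fst (v x))) \<longlonglongrightarrow> 0"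
      by (rule tendsto_sandwich[OF _ _ tendsto_const t]) auto
    show "(\<lambda>k. nsq \<mu> (\<lambda>x. ?G k x - snd (v x))) \<longlonglongrightarrow> 0"
      by (rule tendsto_sandwich[OF _ _ tendsto_const t]) auto
  qed
  note Hv = this
  have ae: "AE x in \<mu>. fst (v x) = y0 x"
    using v(4) y0(1)
  proof eventually_elim
    case (elim x)
    have "(\<lambda>k. ?y k x) \<longlonglongrightarrow> fst (v x)" using tendsto_fst[OF elim(1)] unfolding s by simp
    moreover have "(\<lambda>k. ?y k x) \<longlonglongrightarrow> y0 x" using tail_weights_tendsto[OF v(1) elim(2)] by simp
    ultimately show ?case by (rule LIMSEQ_unique)
  qed
  have "y0 \<in> L2_on \<mu>"
  proof (rule L2_on_bound[OF y0(2)])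
    show "integrable \<mu> (\<lambda>x. (norm (fst (v x)))\<^sup>2)" using Lv(1) by (rule L2_onD)
    show "AE x in \<mu>. (norm (y0 x))\<^sup>2 \<le> (norm (fst (v x)))\<^sup>2" using ae by eventually_elim simp
  qed
  from H0_cong_AE[OF Hv this Lv(2) ae AE_I2[OF refl]] show ?thesis by (rule that)
qed

section \<open>Weak gradients\<close>

lemma test_lipschitz:
  assumes "\<phi> \<in> test_functions \<Omega>" "\<And>x. norm (grad \<phi> x) \<le> B"
  shows "\<bar>\<phi> x - \<phi> y\<bar> \<le> B * norm (x - y)"
proof -
  have "norm (\<phi> x - \<phi> y) \<le> B * norm (x - y)"
  proof (rule differentiable_bound[where S = UNIV])
    fix z
    show "(\<phi> has_derivative (\<lambda>v. grad \<phi> z \<bullet> v)) (at z within UNIV)"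
      using smooth_has_grad[OF test_smooth[OF assms(1)]] by simp
    show "onorm (\<lambda>v. grad \<phi> z \<bullet> v) \<le> B"
    proof (rule onorm_le)
      fix v
      have "norm (grad \<phi> z \<bullet> v) \<le> norm (grad \<phi> z) * norm v" using Cauchy_Schwarz_ineq2 by simp
      also have "\<dots> \<le> B * norm v" using assms(2) by (simp add: mult_right_mono)
      finally show "norm (grad \<phi> z \<bullet> v) \<le> B * norm v" .
    qed
  qed auto
  then show ?thesis by simp
qed

text \<open>
  Translations preserve the integral, so the difference quotients in a fixed direction have
  integral zero.  They are bounded with support in a fixed ball and converge to the directional
  derivative.
\<close>

lemma integral_grad_test:
  assumes "\<phi> \<in> test_functions \<Omega>"
  shows "(LINT x|lborel. grad \<phi> x \<bullet> v) = 0"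
proof -
  obtain B where B: "B > 0" "\<And>x. \<bar>\<phi> x\<bar> \<le> B" "\<And>x. norm (grad \<phi> x) \<le> B"
    by (rule test_bounded[OF assms]) blast
  obtain R where R: "\<Omega> \<subseteq> ball 0 R" "R > 0" using bounded_subset_ballD[OF bounded_dom, of 0] by blast
  have [measurable]: "\<phi> \<in> borel_measurable borel" using test_borel[OF assms] by simp
  have int: "integrable lborel \<phi>"
  proof (rule Bochner_Integration.integrable_bound[where f = "\<lambda>x. indicator (ball 0 R) x * B"])
    show "integrable lborel (\<lambda>x. indicator (ball (0::real^'n) R) x * B)"
      by (intro integrable_mult_left integrable_real_indicator) (auto simp: emeasure_lborel_ball_finite[unfolded infinity_ennreal_def])
    show "AE x in lborel. norm (\<phi> x) \<le> norm (indicator (ball 0 R) x * B)"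
    proof (rule AE_I2)
      fix x
      show "norm (\<phi> x) \<le> norm (indicator (ball 0 R) x * B)"
        using B test_outside(1)[OF assms, of x] R(1) by (cases "x \<in> \<Omega>") (auto simp: indicator_def)
    qed
  qed simp
  define q where "q n x = real (Suc n) * (\<phi> (x + (1 / real (Suc n)) *\<^sub>R v) - \<phi> x)" for n x
  have "(\<lambda>n. LINT x|lborel. q n x) \<longlonglongrightarrow> (LINT x|lborel. grad \<phi> x \<bullet> v)"
  proof (rule integral_dominated_convergence)
    show "integrable lborel (\<lambda>x. indicator (ball (0::real^'n) (R + norm v)) x * (B * norm v))"
      by (intro integrable_mult_left integrable_real_indicator) (auto simp: emeasure_lborel_ball_finite[unfolded infinity_ennreal_def])
    show "(\<lambda>x. grad \<phi> x \<bullet> v) \<in> borel_measurable lborel"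
      using test_borel(2)[OF assms] by simp
    show "q n \<in> borel_measurable lborel" for n unfolding q_def[abs_def] by measurable
    show "AE x in lborel. (\<lambda>n. q n x) \<longlonglongrightarrow> grad \<phi> x \<bullet> v"
    proof (rule AE_I2)
      fix x
      have "((\<lambda>t. x + t *\<^sub>R v) has_derivative (\<lambda>t. t *\<^sub>R v)) (at 0)"
        by (auto intro!: derivative_eq_intros)
      from has_derivative_compose[OF this, of \<phi> "\<lambda>v. grad \<phi> x \<bullet> v"] smooth_has_grad[OF test_smooth[OF assms], of x]
      have "((\<lambda>t. \<phi> (x + t *\<^sub>R v)) has_real_derivative grad \<phi> x \<bullet> v) (at 0)"
        by (simp add: has_field_derivative_def mult.commute[of _ "grad \<phi> x \<bullet> v"] inner_scaleR_right)
      then have "((\<lambda>t. (\<phi> (x + t *\<^sub>R v) - \<phi> x) / t) \<longlongrightarrow> grad \<phi> x \<bullet> v) (at 0)"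
        by (simp add: has_field_derivative_iff)
      moreover have "filterlim (\<lambda>n. 1 / real (Suc n)) (at 0) sequentially"
        unfolding filterlim_at using LIMSEQ_Suc[OF lim_1_over_n[where 'a=real]] by auto
      ultimately have "(\<lambda>n. (\<phi> (x + (1 / real (Suc n)) *\<^sub>R v) - \<phi> x) / (1 / real (Suc n))) \<longlonglongrightarrow> grad \<phi> x \<bullet> v"
        by (rule filterlim_compose)
      then show "(\<lambda>n. q n x) \<longlonglongrightarrow> grad \<phi> x \<bullet> v" by (simp add: q_def mult.commute)
    qed
    fix n
    show "AE x in lborel. norm (q n x) \<le> indicator (ball 0 (R + norm v)) x * (B * norm v)"
    proof (rule AE_I2)
      fix x
      let ?h = "(1 / real (Suc n)) *\<^sub>R v"
      have h: "norm ?h \<le> norm v" by (simp add: divide_le_eq mult_le_cancel_left1)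
      show "norm (q n x) \<le> indicator (ball 0 (R + norm v)) x * (B * norm v)"
      proof (cases "x \<in> ball 0 (R + norm v)")
        case True
        have "\<bar>\<phi> (x + ?h) - \<phi> x\<bar> \<le> B * norm ?h"
          using test_lipschitz[OF assms B(3), of "x + ?h" x] by simp
        then have "real (Suc n) * \<bar>\<phi> (x + ?h) - \<phi> x\<bar> \<le> real (Suc n) * (B * norm ?h)"
          by (intro mult_left_mono) auto
        also have "\<dots> = B * norm v" by simp
        finally show ?thesis using True by (simp add: q_def abs_mult)
      next
        case False
        then have "norm x \<ge> R + norm v" by simp
        moreover have "norm x \<le> norm (x + ?h) + norm ?h" using norm_triangle_ineq4[of "x + ?h" ?h] by simp
        ultimately have "norm (x + ?h) \<ge> R" "norm x \<ge> R" using h norm_ge_zero[of v] by linarith+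
        then have "x + ?h \<notin> \<Omega>" "x \<notin> \<Omega>" using R(1) by (auto simp: subset_iff dist_norm)
        then have "q n x = 0" by (simp add: q_def test_outside[OF assms])
        then show ?thesis using False by simp
      qed
    qed
  qed
  moreover have "(LINT x|lborel. q n x) = 0" for n
  proof -
    let ?h = "(1 / real (Suc n)) *\<^sub>R v"
    have "integrable (distr lborel borel ((+) ?h)) \<phi>" using int by (simp only: lborel_distr_plus)
    then have i: "integrable lborel (\<lambda>x. \<phi> (x + ?h))" by (simp add: integrable_distr_eq add.commute)
    have "(LINT x|distr lborel borel ((+) ?h). \<phi> x) = (LINT x|lborel. \<phi> (?h + x))"
      by (rule integral_distr) auto
    then have "(LINT x|lborel. \<phi> (x + ?h)) = (LINT x|lborel. \<phi> x)"
      by (simp only: lborel_distr_plus add.commute)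
    then show ?thesis using int i by (simp add: q_def)
  qed
  ultimately show ?thesis by (simp add: LIMSEQ_const_iff)
qed

text \<open>
  The product \<open>\<phi> x * \<psi> x\<close> is a test function, so its gradient has integral zero.
\<close>

lemma integration_by_parts:
  assumes "\<phi> \<in> test_functions \<Omega>" "\<psi> \<in> test_functions \<Omega>"
  shows "(LINT x|\<mu>. \<phi> x *\<^sub>R grad \<psi> x) = - (LINT x|\<mu>. \<psi> x *\<^sub>R grad \<phi> x)"
proof -
  obtain B where B: "B > 0" "\<And>x. \<bar>\<phi> x\<bar> \<le> B" "\<And>x. norm (grad \<phi> x) \<le> B"
    by (rule test_bounded[OF assms(1)]) blast
  obtain C where C: "C > 0" "\<And>x. \<bar>\<psi> x\<bar> \<le> C" "\<And>x. norm (grad \<psi> x) \<le> C"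
    by (rule test_bounded[OF assms(2)]) blast
  note m = borel_measurable_mu[OF test_borel(1)[OF assms(1)]] borel_measurable_mu[OF test_borel(1)[OF assms(2)]]
  have i1: "integrable \<mu> (\<lambda>x. \<phi> x *\<^sub>R grad \<psi> x)"
    by (rule L2_on_integrable[OF fin L2_on_bounded_scaleR[OF test_L2(2)[OF assms(2)] m(1) B(2)]])
  have i2: "integrable \<mu> (\<lambda>x. \<psi> x *\<^sub>R grad \<phi> x)"
    by (rule L2_on_integrable[OF fin L2_on_bounded_scaleR[OF test_L2(2)[OF assms(1)] m(2) C(2)]])
  have t: "(\<lambda>x. \<phi> x * \<psi> x) \<in> test_functions \<Omega>" by (rule test_mult[OF assms(1) test_smooth[OF assms(2)]])
  note g = grad_mult[OF test_smooth[OF assms(1)] test_smooth[OF assms(2)]]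
  have i3: "integrable \<mu> (grad (\<lambda>x. \<phi> x * \<psi> x))" by (rule L2_on_integrable[OF fin test_L2(2)[OF t]])
  have "(LINT x|\<mu>. grad (\<lambda>x. \<phi> x * \<psi> x) x) \<bullet> v = 0" for v
  proof -
    have "(LINT x|\<mu>. grad (\<lambda>x. \<phi> x * \<psi> x) x) \<bullet> v = (LINT x|\<mu>. grad (\<lambda>x. \<phi> x * \<psi> x) x \<bullet> v)"
      using i3 by simp
    also have "\<dots> = (LINT x|lborel. grad (\<lambda>x. \<phi> x * \<psi> x) x \<bullet> v)"
      by (rule integral_mu_eq_lborel) (use test_borel(2)[OF t] test_outside(2)[OF t] in auto)
    finally show ?thesis using integral_grad_test[OF t] by simp
  qed
  then have "(LINT x|\<mu>. grad (\<lambda>x. \<phi> x * \<psi> x) x) = 0" by (metis inner_eq_zero_iff)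
  then have "(LINT x|\<mu>. \<phi> x *\<^sub>R grad \<psi> x) + (LINT x|\<mu>. \<psi> x *\<^sub>R grad \<phi> x) = 0"
    unfolding g using i1 i2 by simp
  then show ?thesis by (simp add: eq_neg_iff_add_eq_0)
qed

end

text \<open>
  Boxes generate the Borel sets and are stable under intersection, so the sets over which \<open>h\<close>
  integrates to zero, a Dynkin system, comprise all Borel sets.
\<close>

lemma AE_zero_if_box_integrals_zero:
  fixes h :: "'a::euclidean_space \<Rightarrow> real"
  assumes h: "integrable lborel h" and z: "\<And>a b. (LINT x:box a b|lborel. h x) = 0" "(LINT x|lborel. h x) = 0"
  shows "AE x in lborel. h x = 0"
proof -
  have si: "set_integrable lborel A h" if "A \<in> sets borel" for A
    unfolding set_integrable_def by (rule integrable_mult_indicator[OF _ h]) (use that in simp)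
  have IS: "Int_stable (range (\<lambda>(a, b). box a b :: 'a set))"
    by (auto simp: Int_stable_def box_Int_box)
  have PU: "range (\<lambda>(a, b). box a b :: 'a set) \<subseteq> Pow UNIV" by simp
  have "(LINT x:A|lborel. h x) = 0" if "A \<in> sets borel" for A
  proof -
    have "A \<in> sigma_sets UNIV (range (\<lambda>(a, b). box a b))"
      using that unfolding borel_eq_box by (simp add: sets_measure_of)
    from IS PU this show ?thesis
    proof (induction rule: sigma_sets_induct_disjoint)
      case (basic A) then show ?case using z by auto
    next
      case empty then show ?case by (simp add: set_lebesgue_integral_def)
    next
      case (compl A)
      then have A: "A \<in> sets borel" unfolding borel_eq_box by (simp add: sets_measure_of)
      have "(LINT x:UNIV|lborel. h x) = (LINT x:(UNIV - A) \<union> A|lborel. h x)" by simp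
      also have "\<dots> = (LINT x:UNIV - A|lborel. h x) + (LINT x:A|lborel. h x)"
        by (rule set_integral_Un) (use si A in auto)
      finally show ?case using compl z(2) by (simp add: set_lebesgue_integral_def)
    next
      case (union A)
      then have A: "A i \<in> sets borel" for i unfolding borel_eq_box by (auto simp: sets_measure_of)
      have "(LINT x:(\<Union>i. A i)|lborel. h x) = (\<Sum>i. LINT x:A i|lborel. h x)"
        by (rule lebesgue_integral_countable_add)
          (use A si union(1) in \<open>auto simp: disjoint_family_on_def\<close>)
      then show ?case using union by simp
    qed
  qed
  then show ?thesis
    by (intro density_unique_real h) (auto simp: set_lebesgue_integral_def)
qed

context bounded_open
begin

lemma L2_on_inner_const:
  assumes "g \<in> L2_on M"
  shows "(\<lambda>x. g x \<bullet> v) \<in> L2_on M"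
proof (rule L2_on_bound)
  show "integrable M (\<lambda>x. (norm v)\<^sup>2 * (norm (g x))\<^sup>2)" using assms by (auto simp: L2_on_def)
  show "AE x in M. (norm (g x \<bullet> v))\<^sup>2 \<le> (norm v)\<^sup>2 * (norm (g x))\<^sup>2"
  proof (rule AE_I2)
    fix x
    have "(norm (g x \<bullet> v))\<^sup>2 \<le> (norm (g x) * norm v)\<^sup>2"
      using Cauchy_Schwarz_ineq2[of "g x" v] by (intro power_mono) auto
    then show "(norm (g x \<bullet> v))\<^sup>2 \<le> (norm v)\<^sup>2 * (norm (g x))\<^sup>2" by (simp add: power_mult_distrib mult.commute)
  qed
qed (use assms in \<open>auto simp: L2_on_def\<close>)

lemma nsq_inner_const_le:
  assumes "g \<in> L2_on M"
  shows "nsq M (\<lambda>x. g x \<bullet> v) \<le> (norm v)\<^sup>2 * nsq M g"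
proof -
  have "nsq M (\<lambda>x. g x \<bullet> v) \<le> nsq M (\<lambda>x. norm v *\<^sub>R g x)"
    by (rule nsq_mono[OF L2_on_scaleR[OF assms] L2_onD(1)[OF L2_on_inner_const[OF assms]]])
      (use Cauchy_Schwarz_ineq2 in \<open>auto simp: mult.commute[of "norm v"]\<close>)
  then show ?thesis by (simp add: nsq_scaleR)
qed

text \<open>
  Bumps that approximate the indicator of a box show that \<open>D\<close> integrates to zero over every box
  inside the domain.  Inside a box of a countable cover, \<open>D\<close> therefore vanishes almost everywhere.
\<close>

lemma test_orthogonal_zero:
  fixes D :: "real^'n \<Rightarrow> real"
  assumes D: "D \<in> L2_on \<mu>" and o: "\<And>\<psi>. \<psi> \<in> test_functions \<Omega> \<Longrightarrow> (LINT x|\<mu>. \<psi> x * D x) = 0"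
  shows "AE x in \<mu>. D x = 0"
proof -
  have iD: "integrable \<mu> D" by (rule L2_on_integrable[OF fin D])
  then have i: "integrable lebesgue (\<lambda>x. indicator \<Omega> x * D x)"
    by (subst (asm) integrable_restrict_space) auto
  obtain g where gb: "g \<in> borel_measurable lborel" and ge: "AE x in lborel. indicator \<Omega> x * D x = g x"
    using completion_ex_borel_measurable_real[OF borel_measurable_integrable[OF i]] by blast
  note [measurable] = gb
  have ge': "AE x in lebesgue. indicator \<Omega> x * D x = g x" using ge by (rule AE_completion)
  have "integrable lebesgue g"
    using i ge' gb by (subst integrable_cong_AE[where g = "\<lambda>x. indicator \<Omega> x * D x"])
      (auto intro: measurable_completion simp: eq_commute)
  then have gi: "integrable lborel g" using integrable_completion[OF gb] by simp
  have box0: "(LINT x:box a b|lborel. g x) = 0" if "cbox a b \<subseteq> \<Omega>" for a b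
  proof -
    have "(\<lambda>n. LINT x|\<mu>. box_bump a b n x * D x) \<longlonglongrightarrow> (LINT x|\<mu>. indicator (box a b) x * D x)"
    proof (rule integral_dominated_convergence[where w = "\<lambda>x. norm (D x)"])
      show "integrable \<mu> (\<lambda>x. norm (D x))" using iD by simp
      have b: "box_bump a b n \<in> borel_measurable \<mu>" for n
        by (rule borel_measurable_mu[OF test_borel(1)[OF box_bump_test[OF that]]])
      show "(\<lambda>x. box_bump a b n x * D x) \<in> borel_measurable \<mu>" for n using b[of n] iD by auto
      have "indicat_real (box a b) \<in> borel_measurable \<mu>" by (rule borel_measurable_mu) simp
      then show "(\<lambda>x. indicator (box a b) x * D x) \<in> borel_measurable \<mu>" using iD by auto
      show "AE x in \<mu>. (\<lambda>n. box_bump a b n x * D x) \<longlonglongrightarrow> indicator (box a b) x * D x"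
        by (intro AE_I2 tendsto_intros box_bump_tendsto)
      show "AE x in \<mu>. norm (box_bump a b n x * D x) \<le> norm (D x)" for n
        using box_bump_nonneg[of a b n] box_bump_le_1[of a b n]
        by (intro AE_I2) (simp add: abs_mult mult_left_le_one_le)
    qed
    moreover have "(LINT x|\<mu>. box_bump a b n x * D x) = 0" for n
      by (rule o[OF box_bump_test[OF that]])
    ultimately have z: "(LINT x|\<mu>. indicator (box a b) x * D x) = 0" by (simp add: LIMSEQ_const_iff)
    have sub: "box a b \<subseteq> \<Omega>" using that box_subset_cbox by blast
    have "(LINT x|\<mu>. indicator (box a b) x * D x) = (LINT x|lebesgue. indicator \<Omega> x *\<^sub>R (indicator (box a b) x * D x))"
      by (rule integral_restrict_space) simp
    also have "\<dots> = (LINT x|lebesgue. indicator (box a b) x *\<^sub>R g x)"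
    proof (rule integral_cong_AE)
      show "AE x in lebesgue. indicator \<Omega> x *\<^sub>R (indicator (box a b) x * D x) = indicator (box a b) x *\<^sub>R g x"
        using ge' by eventually_elim (use sub in \<open>auto simp: indicator_def split: if_splits\<close>)
      have m1: "indicat_real (box a b) \<in> borel_measurable lebesgue" by (rule measurable_completion) simp
      have "(\<lambda>x. indicator (box a b) x * (indicator \<Omega> x * D x)) \<in> borel_measurable lebesgue"
        using m1 i by auto
      then show "(\<lambda>x. indicator \<Omega> x *\<^sub>R (indicator (box a b) x * D x)) \<in> borel_measurable lebesgue"
        by (simp add: mult.left_commute)
      show "(\<lambda>x. indicat_real (box a b) x *\<^sub>R g x) \<in> borel_measurable lebesgue"
        by (rule measurable_completion) measurable
    qed
    also have "\<dots> = (LINT x|lborel. indicator (box a b) x *\<^sub>R g x)"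
      by (rule integral_completion) measurable
    finally show ?thesis using z by (simp add: set_lebesgue_integral_def)
  qed
  have cb: "AE x in lborel. x \<in> cbox a b \<longrightarrow> g x = 0" if sub: "cbox a b \<subseteq> \<Omega>" for a b
  proof -
    let ?h = "\<lambda>x. indicator (box a b) x * g x"
    have hi: "integrable lborel ?h"
      using integrable_mult_indicator[OF _ gi, of "box a b"] by simp
    have "AE x in lborel. ?h x = 0"
    proof (rule AE_zero_if_box_integrals_zero[OF hi])
      fix c d
      obtain p q where pq: "box c d \<inter> box a b = box p q" using box_Int_box[of c d a b] by blast
      have "(LINT x:box p q|lborel. g x) = 0"
      proof (cases "box p q = {}")
        case False
        then have "cbox p q = closure (box p q)" by simp
        also have "\<dots> \<subseteq> closure (box a b)" using pq by (metis closure_mono inf_le2)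
        also have "\<dots> \<subseteq> cbox a b" by (intro closure_minimal box_subset_cbox closed_cbox)
        finally show ?thesis using sub by (intro box0) auto
      qed (simp add: set_lebesgue_integral_def)
      then show "(LINT x:box c d|lborel. ?h x) = 0"
        unfolding set_lebesgue_integral_def pq[symmetric] by (simp add: indicator_inter_arith mult.assoc)
    next
      show "(LINT x|lborel. ?h x) = 0" using box0[OF sub] by (simp add: set_lebesgue_integral_def)
    qed
    moreover have "AE x in lborel. x \<notin> cbox a b - box a b"
    proof -
      have "negligible (cbox a b - box a b)" by (rule negligible_frontier_interval)
      then have "emeasure lborel (cbox a b - box a b) = 0"
        by (simp add: negligible_iff_null_sets null_sets_def)
      then show ?thesis by (intro AE_not_in) (auto simp: null_sets_def)
    qed
    ultimately show ?thesis by eventually_elim (auto simp: indicator_def split: if_splits)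
  qed
  obtain \<D> where \<D>: "countable \<D>" "\<D> \<subseteq> Pow \<Omega>" "\<And>X. X \<in> \<D> \<Longrightarrow> \<exists>a b. X = cbox a b" "\<Union>\<D> = \<Omega>"
    using open_countable_Union_open_cbox[OF open_dom] by blast
  have "AE x in lborel. \<forall>X\<in>\<D>. x \<in> X \<longrightarrow> g x = 0"
  proof (subst AE_ball_countable[OF \<D>(1)], intro ballI)
    fix X assume X: "X \<in> \<D>"
    then obtain a b where "X = cbox a b" using \<D>(3) by blast
    then show "AE x in lborel. x \<in> X \<longrightarrow> g x = 0" using cb[of a b] X \<D>(2) by auto
  qed
  with ge have "AE x in lborel. x \<in> \<Omega> \<longrightarrow> D x = 0"
  proof eventually_elim
    case (elim x)
    show ?case
    proof
      assume x: "x \<in> \<Omega>"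
      then obtain X where "X \<in> \<D>" "x \<in> X" using \<D>(4) by blast
      then have "g x = 0" using elim(2) by blast
      then show "D x = 0" using elim(1) x by simp
    qed
  qed
  then have "AE x in lebesgue. x \<in> \<Omega> \<longrightarrow> D x = 0" by (rule AE_completion)
  then show ?thesis by (subst AE_restrict_space_iff) auto
qed

lemma weak_gradient_inner:
  assumes "y \<in> L2_on \<mu>" "G \<in> L2_on \<mu>" "\<psi> \<in> test_functions \<Omega>"
  shows "(LINT x|\<mu>. y x *\<^sub>R grad \<psi> x) \<bullet> v = (LINT x|\<mu>. y x * (grad \<psi> x \<bullet> v))"
    "(LINT x|\<mu>. \<psi> x *\<^sub>R G x) \<bullet> v = (LINT x|\<mu>. (G x \<bullet> v) * \<psi> x)"
proof -
  obtain B where B: "B > 0" "\<And>x. \<bar>\<psi> x\<bar> \<le> B" "\<And>x. norm (grad \<psi> x) \<le> B"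
    by (rule test_bounded[OF assms(3)]) blast
  note t = borel_measurable_mu[OF test_borel(1)[OF assms(3)]] borel_measurable_mu[OF test_borel(2)[OF assms(3)]]
  have "integrable \<mu> (\<lambda>x. y x *\<^sub>R grad \<psi> x)"
  proof (rule Bochner_Integration.integrable_bound)
    show "integrable \<mu> (\<lambda>x. norm (y x) * norm (norm (grad \<psi> x)))"
      by (rule L2_on_inner_integrable(1)[OF assms(1) L2_on_norm[OF test_L2(2)[OF assms(3)]]])
  qed (use assms t in \<open>auto simp: L2_on_def\<close>)
  then show "(LINT x|\<mu>. y x *\<^sub>R grad \<psi> x) \<bullet> v = (LINT x|\<mu>. y x * (grad \<psi> x \<bullet> v))"
    by (subst integral_inner_left[symmetric]) auto
  have "integrable \<mu> (\<lambda>x. \<psi> x *\<^sub>R G x)"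
    by (rule L2_on_integrable[OF fin L2_on_bounded_scaleR[OF assms(2) t(1) B(2)]])
  then show "(LINT x|\<mu>. \<psi> x *\<^sub>R G x) \<bullet> v = (LINT x|\<mu>. (G x \<bullet> v) * \<psi> x)"
    by (subst integral_inner_left[symmetric]) (auto simp: mult.commute)
qed

lemma H0_is_weak_gradient:
  assumes "H0 \<Omega> y G"
  shows "is_weak_gradient \<Omega> y G"
  unfolding is_weak_gradient_def
proof
  fix \<psi> assume \<psi>: "\<psi> \<in> test_functions \<Omega>"
  note L = H0_L2[OF assms]
  obtain \<phi> where \<phi>: "\<And>k. \<phi> k \<in> test_functions \<Omega>" "(\<lambda>k. nsq \<mu> (\<lambda>x. \<phi> k x - y x)) \<longlonglongrightarrow> 0"
    "(\<lambda>k. nsq \<mu> (\<lambda>x. grad (\<phi> k) x - G x)) \<longlonglongrightarrow> 0" by (rule H0_approx[OF assms]) blast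
  show "(LINT x|\<mu>. y x *\<^sub>R grad \<psi> x) = - (LINT x|\<mu>. \<psi> x *\<^sub>R G x)"
  proof (rule vector_eq_rdot[THEN iffD1], rule allI)
    fix v
    have l1: "(\<lambda>k. LINT x|\<mu>. \<phi> k x * (grad \<psi> x \<bullet> v)) \<longlonglongrightarrow> (LINT x|\<mu>. y x * (grad \<psi> x \<bullet> v))"
      by (rule tendsto_L2_mult_integral[OF test_L2(1)[OF \<phi>(1)] L(1) \<phi>(2) L2_on_inner_const[OF test_L2(2)[OF \<psi>]]])
    have l2: "(\<lambda>k. LINT x|\<mu>. (grad (\<phi> k) x \<bullet> v) * \<psi> x) \<longlonglongrightarrow> (LINT x|\<mu>. (G x \<bullet> v) * \<psi> x)"
    proof (rule tendsto_L2_mult_integral[OF L2_on_inner_const[OF test_L2(2)[OF \<phi>(1)]] L2_on_inner_const[OF L(2)] _ test_L2(1)[OF \<psi>]])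
      show "(\<lambda>k. nsq \<mu> (\<lambda>x. grad (\<phi> k) x \<bullet> v - G x \<bullet> v)) \<longlonglongrightarrow> 0"
      proof (rule tendsto_sandwich[OF _ _ tendsto_const tendsto_mult_right_zero[OF \<phi>(3), of "(norm v)\<^sup>2"]])
        show "\<forall>\<^sub>F k in sequentially. nsq \<mu> (\<lambda>x. grad (\<phi> k) x \<bullet> v - G x \<bullet> v) \<le> (norm v)\<^sup>2 * nsq \<mu> (\<lambda>x. grad (\<phi> k) x - G x)"
          using nsq_inner_const_le[OF L2_on_diff[OF test_L2(2)[OF \<phi>(1)] L(2)]]
          by (simp add: inner_diff_left)
      qed simp
    qed
    have e: "(LINT x|\<mu>. \<phi> k x * (grad \<psi> x \<bullet> v)) = - (LINT x|\<mu>. (grad (\<phi> k) x \<bullet> v) * \<psi> x)" for k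
      using arg_cong[OF integration_by_parts[OF \<phi>(1)[of k] \<psi>], of "\<lambda>z. z \<bullet> v"]
      by (simp add: weak_gradient_inner[OF test_L2[OF \<phi>(1)] \<psi>])
    have "(LINT x|\<mu>. y x * (grad \<psi> x \<bullet> v)) = - (LINT x|\<mu>. (G x \<bullet> v) * \<psi> x)"
      by (rule LIMSEQ_unique[OF l1[unfolded e] tendsto_minus[OF l2]])
    then show "(LINT x|\<mu>. y x *\<^sub>R grad \<psi> x) \<bullet> v = - (LINT x|\<mu>. \<psi> x *\<^sub>R G x) \<bullet> v"
      by (simp add: weak_gradient_inner[OF L \<psi>])
  qed
qed

lemma weak_gradient_unique:
  assumes "y \<in> L2_on \<mu>" "G \<in> L2_on \<mu>" "K \<in> L2_on \<mu>" "is_weak_gradient \<Omega> y G" "is_weak_gradient \<Omega> y K"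
  shows "AE x in \<mu>. G x = K x"
proof -
  have "AE x in \<mu>. \<forall>v\<in>Basis. (G x - K x) \<bullet> v = 0"
  proof (subst AE_ball_countable, simp add: countable_finite, rule ballI)
    fix v :: "real^'n"
    show "AE x in \<mu>. (G x - K x) \<bullet> v = 0"
    proof (rule test_orthogonal_zero[OF L2_on_inner_const[OF L2_on_diff[OF assms(2,3)]]])
      fix \<psi> assume \<psi>: "\<psi> \<in> test_functions \<Omega>"
      have "(LINT x|\<mu>. \<psi> x *\<^sub>R G x) = (LINT x|\<mu>. \<psi> x *\<^sub>R K x)"
        using assms(4,5) \<psi> by (simp add: is_weak_gradient_def)
      then have e: "(LINT x|\<mu>. (G x \<bullet> v) * \<psi> x) = (LINT x|\<mu>. (K x \<bullet> v) * \<psi> x)"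
        by (metis weak_gradient_inner(2)[OF assms(1,2) \<psi>] weak_gradient_inner(2)[OF assms(1,3) \<psi>])
      have "(LINT x|\<mu>. \<psi> x * ((G x - K x) \<bullet> v)) = (LINT x|\<mu>. (G x \<bullet> v) * \<psi> x - (K x \<bullet> v) * \<psi> x)"
        by (intro Bochner_Integration.integral_cong) (auto simp: inner_diff_left algebra_simps)
      also have "\<dots> = 0"
        using e L2_on_mult_integrable[OF L2_on_inner_const[OF assms(2)] test_L2(1)[OF \<psi>]]
          L2_on_mult_integrable[OF L2_on_inner_const[OF assms(3)] test_L2(1)[OF \<psi>]] by simp
      finally show "(LINT x|\<mu>. \<psi> x * ((G x - K x) \<bullet> v)) = 0" .
    qed
  qed
  then show ?thesis
  proof eventually_elim
    case (elim x)
    then have "G x - K x = 0" using euclidean_all_zero_iff by blast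
    then show ?case by simp
  qed
qed

lemma H0_if_H10:
  assumes "y \<in> H10 \<Omega>"
  shows "H0 \<Omega> y (weak_grad \<Omega> y)"
proof -
  have y: "y \<in> H1 \<Omega>" using assms by (simp add: H10_def)
  then have "\<exists>G. G \<in> L2 \<Omega> \<and> is_weak_gradient \<Omega> y G" by (auto simp: H1_def)
  then have w: "weak_grad \<Omega> y \<in> L2_on \<mu>" unfolding weak_grad_def L2_eq_L2_on[symmetric] by (rule someI2_ex) simp
  obtain \<phi> where \<phi>: "\<And>k. \<phi> k \<in> test_functions \<Omega>"
    "(\<lambda>k. (LINT x|\<mu>. (y x - \<phi> k x)\<^sup>2) + (LINT x|\<mu>. (norm (weak_grad \<Omega> y x - grad (\<phi> k) x))\<^sup>2)) \<longlonglongrightarrow> 0"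
    using assms by (auto simp: H10_def)
  have t: "(\<lambda>k. nsq \<mu> (\<lambda>x. \<phi> k x - y x) + nsq \<mu> (\<lambda>x. grad (\<phi> k) x - weak_grad \<Omega> y x)) \<longlonglongrightarrow> 0"
    using \<phi>(2) by (simp add: nsq_def norm_minus_commute power2_commute)
  show ?thesis
    unfolding H0_iff
  proof (intro conjI exI allI)
    show "y \<in> L2_on \<mu>" using y by (simp add: H1_def L2_eq_L2_on)
    show "(\<lambda>k. nsq \<mu> (\<lambda>x. \<phi> k x - y x)) \<longlonglongrightarrow> 0"
      by (rule tendsto_sandwich[OF _ _ tendsto_const t]) auto
    show "(\<lambda>k. nsq \<mu> (\<lambda>x. grad (\<phi> k) x - weak_grad \<Omega> y x)) \<longlonglongrightarrow> 0"
      by (rule tendsto_sandwich[OF _ _ tendsto_const t]) auto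
  qed (use w \<phi>(1) in auto)
qed

text \<open>
  A gradient obtained as a limit of gradients of test functions is a weak gradient, hence agrees with
  the chosen one by uniqueness.
\<close>

lemma H10_if_H0:
  assumes "H0 \<Omega> y G"
  shows "y \<in> H10 \<Omega>" "AE x in \<mu>. weak_grad \<Omega> y x = G x"
proof -
  note L = H0_L2[OF assms]
  have "\<exists>K. K \<in> L2 \<Omega> \<and> is_weak_gradient \<Omega> y K"
    using L(2) H0_is_weak_gradient[OF assms] by (auto simp: L2_eq_L2_on)
  then have w: "weak_grad \<Omega> y \<in> L2 \<Omega> \<and> is_weak_gradient \<Omega> y (weak_grad \<Omega> y)"
    unfolding weak_grad_def by (rule someI_ex)
  show ae: "AE x in \<mu>. weak_grad \<Omega> y x = G x"
    by (rule weak_gradient_unique[OF L(1) _ L(2)])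
      (use w H0_is_weak_gradient[OF assms] in \<open>auto simp: L2_eq_L2_on\<close>)
  obtain \<phi> where \<phi>: "\<And>k. \<phi> k \<in> test_functions \<Omega>" "(\<lambda>k. nsq \<mu> (\<lambda>x. \<phi> k x - y x)) \<longlonglongrightarrow> 0"
    "(\<lambda>k. nsq \<mu> (\<lambda>x. grad (\<phi> k) x - G x)) \<longlonglongrightarrow> 0" by (rule H0_approx[OF assms]) blast
  have e: "nsq \<mu> (\<lambda>x. grad (\<phi> k) x - G x) = (LINT x|\<mu>. (norm (weak_grad \<Omega> y x - grad (\<phi> k) x))\<^sup>2)" for k
    unfolding nsq_def
  proof (rule integral_cong_AE)
    show "AE x in \<mu>. (norm (grad (\<phi> k) x - G x))\<^sup>2 = (norm (weak_grad \<Omega> y x - grad (\<phi> k) x))\<^sup>2"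
      using ae by eventually_elim (simp add: norm_minus_commute)
  qed (use L2_onD(2)[OF L2_on_diff[OF test_L2(2)[OF \<phi>(1)[of k]] L(2)]]
      L2_onD(2)[OF L2_on_diff[OF _ test_L2(2)[OF \<phi>(1)[of k]]], of "weak_grad \<Omega> y"] w
      in \<open>auto simp: L2_eq_L2_on\<close>)
  have "y \<in> H1 \<Omega>" using L w by (auto simp: H1_def L2_eq_L2_on)
  moreover have "(\<lambda>k. (LINT x|\<mu>. (y x - \<phi> k x)\<^sup>2) + (LINT x|\<mu>. (norm (weak_grad \<Omega> y x - grad (\<phi> k) x))\<^sup>2)) \<longlonglongrightarrow> 0"
    using tendsto_add[OF \<phi>(2,3)] unfolding e by (simp add: nsq_def power2_commute)
  ultimately show "y \<in> H10 \<Omega>" using \<phi>(1) by (auto simp: H10_def)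
qed

end

section \<open>Chain rules\<close>

context bounded_open
begin

text \<open>
  Polynomials without constant term map test functions to test functions.  They approximate
  \<open>g\<close> together with its derivative uniformly on the range of the test function.
\<close>

lemma H0_chain_test:
  assumes \<phi>: "\<phi> \<in> test_functions \<Omega>"
    and g: "\<And>t. (g has_real_derivative g' t) (at t)" "continuous_on UNIV g'" "g 0 = 0"
  shows "H0 \<Omega> (\<lambda>x. g (\<phi> x)) (\<lambda>x. g' (\<phi> x) *\<^sub>R grad \<phi> x)"
proof -
  obtain B where B: "B > 0" "\<And>x. \<bar>\<phi> x\<bar> \<le> B" "\<And>x. norm (grad \<phi> x) \<le> B"
    by (rule test_bounded[OF \<phi>]) blast
  note m = test_borel[OF \<phi>]
  have gc: "continuous_on UNIV g" using g(1) by (meson DERIV_continuous continuous_at_imp_continuous_on)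
  have mg: "(\<lambda>x. g (\<phi> x)) \<in> borel_measurable borel"
    "(\<lambda>x. g' (\<phi> x) *\<^sub>R grad \<phi> x) \<in> borel_measurable borel"
    using m borel_measurable_continuous_onI[OF gc] borel_measurable_continuous_onI[OF g(2)] by measurable
  have "\<exists>P p. (\<lambda>x. P (\<phi> x)) \<in> test_functions \<Omega> \<and> (\<forall>t. (P has_real_derivative p t) (at t)) \<and>
      (\<forall>t\<in>{-B..B}. \<bar>P t - g t\<bar> \<le> 1 / Suc n * B \<and> \<bar>p t - g' t\<bar> \<le> 1 / Suc n)" for n
  proof -
    obtain p where p: "real_polynomial_function p" "\<And>t. t \<in> {-B..B} \<Longrightarrow> \<bar>g' t - p t\<bar> < 1 / Suc n"
      using Stone_Weierstrass_real_polynomial_function[of "{-B..B}" g' "1 / Suc n"]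
        continuous_on_subset[OF g(2)] by auto
    then obtain a k where ak: "p = (\<lambda>t. \<Sum>i\<le>k. a i * t ^ i)"
      using real_polynomial_function_iff_sum by blast
    define P where "P t = (\<Sum>i\<le>k. a i / Suc i * t ^ Suc i)" for t :: real
    have dP: "(P has_real_derivative p t) (at t)" for t
      unfolding P_def[abs_def] ak
      by (rule DERIV_sum) (auto intro!: derivative_eq_intros simp del: of_nat_Suc power_Suc)
    have P0: "P 0 = 0" by (simp add: P_def)
    have close: "\<bar>P t - g t\<bar> \<le> 1 / Suc n * B" if t: "t \<in> {-B..B}" for t
    proof -
      have "norm ((P t - g t) - (P 0 - g 0)) \<le> 1 / Suc n * norm (t - 0)"
      proof (rule field_differentiable_bound[where S = "{-B..B}"])
        show "((\<lambda>t. P t - g t) has_field_derivative p s - g' s) (at s within {-B..B})" for s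
          by (intro DERIV_subset[OF DERIV_diff[OF dP g(1)]]) auto
        show "norm (p s - g' s) \<le> 1 / Suc n" if "s \<in> {-B..B}" for s using p(2)[OF that] by simp
      qed (use t B in auto)
      also have "\<dots> \<le> 1 / Suc n * B" using t by (intro mult_left_mono) auto
      finally show ?thesis using P0 g(3) by simp
    qed
    obtain K where K: "compact K" "K \<subseteq> \<Omega>" "\<forall>x. x \<notin> K \<longrightarrow> \<phi> x = 0 \<and> grad \<phi> x = 0"
      using test_compact_support[OF \<phi>] by blast
    have "smooth (\<lambda>x. P (\<phi> x))" unfolding P_def
      by (intro smooth_sum smooth_cmult smooth_power test_smooth[OF \<phi>])
    then have "(\<lambda>x. P (\<phi> x)) \<in> test_functions \<Omega>"
      by (rule test_functionsI[OF _ K(1,2)]) (use K(3) P0 in simp)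
    then show ?thesis using dP close p(2) by (intro exI[of _ P] exI[of _ p]) (auto simp: abs_minus_commute less_imp_le)
  qed
  then have "\<forall>n. \<exists>P p. (\<lambda>x. P (\<phi> x)) \<in> test_functions \<Omega> \<and> (\<forall>t. (P has_real_derivative p t) (at t)) \<and>
      (\<forall>t\<in>{-B..B}. \<bar>P t - g t\<bar> \<le> 1 / Suc n * B \<and> \<bar>p t - g' t\<bar> \<le> 1 / Suc n)" by blast
  from choice[OF this] obtain P where "\<forall>n. \<exists>p. (\<lambda>x. P n (\<phi> x)) \<in> test_functions \<Omega> \<and>
      (\<forall>t. (P n has_real_derivative p t) (at t)) \<and>
      (\<forall>t\<in>{-B..B}. \<bar>P n t - g t\<bar> \<le> 1 / Suc n * B \<and> \<bar>p t - g' t\<bar> \<le> 1 / Suc n)" by blast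
  from choice[OF this] obtain p where "\<forall>n. (\<lambda>x. P n (\<phi> x)) \<in> test_functions \<Omega> \<and>
      (\<forall>t. (P n has_real_derivative p n t) (at t)) \<and>
      (\<forall>t\<in>{-B..B}. \<bar>P n t - g t\<bar> \<le> 1 / Suc n * B \<and> \<bar>p n t - g' t\<bar> \<le> 1 / Suc n)" by blast
  then have P: "\<And>n. (\<lambda>x. P n (\<phi> x)) \<in> test_functions \<Omega>" "\<And>n t. (P n has_real_derivative p n t) (at t)"
    "\<And>n t. t \<in> {-B..B} \<Longrightarrow> \<bar>P n t - g t\<bar> \<le> 1 / Suc n * B" "\<And>n t. t \<in> {-B..B} \<Longrightarrow> \<bar>p n t - g' t\<bar> \<le> 1 / Suc n"
    by blast+
  have inB: "\<phi> x \<in> {-B..B}" for x using B(2)[of x] by auto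
  have gr: "grad (\<lambda>x. P n (\<phi> x)) x = p n (\<phi> x) *\<^sub>R grad \<phi> x" for n x
    by (rule grad_comp[OF test_smooth[OF \<phi>] P(2)])
  obtain C where C: "\<And>t. t \<in> {-B..B} \<Longrightarrow> \<bar>g t\<bar> \<le> C" "\<And>t. t \<in> {-B..B} \<Longrightarrow> \<bar>g' t\<bar> \<le> C"
  proof -
    have "bounded (g ` {-B..B})" "bounded (g' ` {-B..B})"
      by (intro compact_imp_bounded compact_continuous_image continuous_on_subset[OF gc] continuous_on_subset[OF g(2)]; simp)+
    then obtain c d where "\<forall>z\<in>g ` {-B..B}. norm z \<le> c" "\<forall>z\<in>g' ` {-B..B}. norm z \<le> d"
      unfolding bounded_iff by blast
    then show ?thesis by (intro that[of "max c d"]) (auto simp: le_max_iff_disj)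
  qed
  have s1: "1 / real (Suc n) \<le> 1" for n by simp
  have z: "(\<lambda>n. 1 / real (Suc n) * c) \<longlonglongrightarrow> 0" for c
    using tendsto_mult_left_zero[OF LIMSEQ_Suc[OF lim_1_over_n]] .
  have conv: "(\<lambda>n. P n (\<phi> x)) \<longlonglongrightarrow> g (\<phi> x)" "(\<lambda>n. p n (\<phi> x)) \<longlonglongrightarrow> g' (\<phi> x)" for x
  proof -
    show "(\<lambda>n. P n (\<phi> x)) \<longlonglongrightarrow> g (\<phi> x)"
      by (rule LIM_zero_cancel, rule Lim_null_comparison[OF _ z[of B]]) (use P(3)[OF inB] in auto)
    show "(\<lambda>n. p n (\<phi> x)) \<longlonglongrightarrow> g' (\<phi> x)"
      by (rule LIM_zero_cancel, rule Lim_null_comparison[OF _ z[of 1]]) (use P(4)[OF inB] in auto)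
  qed
  have bP: "\<bar>P n (\<phi> x)\<bar> \<le> C + B" "\<bar>p n (\<phi> x)\<bar> \<le> C + 1" for n x
  proof -
    have "1 / real (Suc n) * B \<le> 1 * B" using B(1) by (intro mult_right_mono) auto
    then show "\<bar>P n (\<phi> x)\<bar> \<le> C + B" using P(3)[OF inB, of n x] C(1)[OF inB, of x] by linarith
    show "\<bar>p n (\<phi> x)\<bar> \<le> C + 1" using P(4)[OF inB, of n x] C(2)[OF inB, of x] s1[of n] by linarith
  qed
  have ci: "integrable \<mu> (\<lambda>x. c)" for c :: real using fin by (simp add: finite_measure.integrable_const)
  have G1: "(\<lambda>x. g (\<phi> x)) \<in> L2_on \<mu>" "(\<lambda>n. nsq \<mu> (\<lambda>x. P n (\<phi> x) - g (\<phi> x))) \<longlonglongrightarrow> 0"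
  proof -
    have "AE x in \<mu>. (norm (P n (\<phi> x)))\<^sup>2 \<le> (C + B)\<^sup>2" for n
      using bP(1)[of n] by (intro AE_I2) (auto intro!: abs_le_square_iff[THEN iffD1] order_trans[OF _ abs_ge_self])
    note dc = L2_dominated_convergence[OF borel_measurable_mu[OF test_borel(1)[OF P(1)]] borel_measurable_mu[OF mg(1)]
       AE_I2[OF conv(1)] ci this]
    show "(\<lambda>x. g (\<phi> x)) \<in> L2_on \<mu>" "(\<lambda>n. nsq \<mu> (\<lambda>x. P n (\<phi> x) - g (\<phi> x))) \<longlonglongrightarrow> 0"
      by (rule dc)+
  qed
  have G2: "(\<lambda>x. g' (\<phi> x) *\<^sub>R grad \<phi> x) \<in> L2_on \<mu>"
    "(\<lambda>n. nsq \<mu> (\<lambda>x. grad (\<lambda>x. P n (\<phi> x)) x - g' (\<phi> x) *\<^sub>R grad \<phi> x)) \<longlonglongrightarrow> 0"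
  proof -
    have b: "AE x in \<mu>. (norm (grad (\<lambda>x. P n (\<phi> x)) x))\<^sup>2 \<le> ((C + 1) * B)\<^sup>2" for n
    proof (rule AE_I2)
      fix x
      have "norm (grad (\<lambda>x. P n (\<phi> x)) x) \<le> (C + 1) * B"
        unfolding gr norm_scaleR using bP(2)[of n x] B(3)[of x] by (intro mult_mono) auto
      then show "(norm (grad (\<lambda>x. P n (\<phi> x)) x))\<^sup>2 \<le> ((C + 1) * B)\<^sup>2" by (intro power_mono) auto
    qed
    have c: "AE x in \<mu>. (\<lambda>n. grad (\<lambda>x. P n (\<phi> x)) x) \<longlonglongrightarrow> g' (\<phi> x) *\<^sub>R grad \<phi> x"
      unfolding gr by (intro AE_I2 tendsto_intros conv)
    note dc = L2_dominated_convergence[OF borel_measurable_mu[OF test_borel(2)[OF P(1)]] borel_measurable_mu[OF mg(2)] c ci b]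
    show "(\<lambda>x. g' (\<phi> x) *\<^sub>R grad \<phi> x) \<in> L2_on \<mu>"
      "(\<lambda>n. nsq \<mu> (\<lambda>x. grad (\<lambda>x. P n (\<phi> x)) x - g' (\<phi> x) *\<^sub>R grad \<phi> x)) \<longlonglongrightarrow> 0"
      by (rule dc)+
  qed
  show ?thesis by (rule H0_closed[OF H0_test[OF P(1)] G1(1) G2(1) G1(2) G2(2)])
qed

lemma nsq_lipschitz_le:
  fixes y z :: "real^'n \<Rightarrow> real"
  assumes "y \<in> L2_on \<mu>" "z \<in> L2_on \<mu>" "\<And>s t. \<bar>g s - g t\<bar> \<le> L * \<bar>s - t\<bar>" "g \<in> borel_measurable borel"
  shows "nsq \<mu> (\<lambda>x. g (y x) - g (z x)) \<le> L\<^sup>2 * nsq \<mu> (\<lambda>x. y x - z x)"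
proof -
  have "nsq \<mu> (\<lambda>x. g (y x) - g (z x)) \<le> nsq \<mu> (\<lambda>x. L *\<^sub>R (y x - z x))"
  proof (rule nsq_mono)
    show "(\<lambda>x. g (y x) - g (z x)) \<in> borel_measurable \<mu>"
      using L2_onD(1)[OF assms(1)] L2_onD(1)[OF assms(2)] assms(4) by measurable
    show "AE x in \<mu>. norm (g (y x) - g (z x)) \<le> norm (L *\<^sub>R (y x - z x))"
      using assms(3) by (intro AE_I2) (auto simp: abs_mult intro: order_trans[OF _ mult_right_mono[OF abs_ge_self]])
  qed (intro L2_on_scaleR L2_on_diff assms)
  then show ?thesis by (simp only: nsq_scaleR)
qed

lemma L2_on_lipschitz:
  fixes y :: "real^'n \<Rightarrow> real"
  assumes "y \<in> L2_on \<mu>" "\<And>s t. \<bar>g s - g t\<bar> \<le> L * \<bar>s - t\<bar>" "g \<in> borel_measurable borel" "g 0 = 0"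
  shows "(\<lambda>x. g (y x)) \<in> L2_on \<mu>"
proof (rule L2_on_bound)
  show "(\<lambda>x. g (y x)) \<in> borel_measurable \<mu>" using L2_onD(1)[OF assms(1)] assms(3) by measurable
  show "integrable \<mu> (\<lambda>x. L\<^sup>2 * (norm (y x))\<^sup>2)" using L2_onD(2)[OF assms(1)] by simp
  show "AE x in \<mu>. (norm (g (y x)))\<^sup>2 \<le> L\<^sup>2 * (norm (y x))\<^sup>2"
  proof (rule AE_I2)
    fix x
    have "\<bar>g (y x)\<bar> \<le> L * \<bar>y x\<bar>" using assms(2)[of "y x" 0] assms(4) by simp
    then have "\<bar>g (y x)\<bar>\<^sup>2 \<le> (L * \<bar>y x\<bar>)\<^sup>2" by (rule power_mono) simp
    then show "(norm (g (y x)))\<^sup>2 \<le> L\<^sup>2 * (norm (y x))\<^sup>2" by (simp add: power_mult_distrib)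
  qed
qed

lemma lipschitz_of_derivative_bound:
  fixes g :: "real \<Rightarrow> real"
  assumes "\<And>t. (g has_real_derivative g' t) (at t)" "\<And>t. \<bar>g' t\<bar> \<le> L"
  shows "\<bar>g s - g t\<bar> \<le> L * \<bar>s - t\<bar>"
  using field_differentiable_bound[of UNIV g g' L s t] assms by simp

lemma H0_chain_C1:
  assumes H: "H0 \<Omega> y G"
    and g: "\<And>t. (g has_real_derivative g' t) (at t)" "continuous_on UNIV g'" "g 0 = 0" "\<And>t. \<bar>g' t\<bar> \<le> L"
  shows "H0 \<Omega> (\<lambda>x. g (y x)) (\<lambda>x. g' (y x) *\<^sub>R G x)"
proof -
  note yG = H0_L2[OF H]
  obtain \<phi>' where \<phi>': "\<And>k. \<phi>' k \<in> test_functions \<Omega>" "(\<lambda>k. nsq \<mu> (\<lambda>x. \<phi>' k x - y x)) \<longlonglongrightarrow> 0"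
    "(\<lambda>k. nsq \<mu> (\<lambda>x. grad (\<phi>' k) x - G x)) \<longlonglongrightarrow> 0" by (rule H0_approx[OF H]) blast
  obtain r where r: "strict_mono r" "AE x in \<mu>. (\<lambda>k. \<phi>' (r k) x) \<longlonglongrightarrow> y x"
    using L2_conv_AE_subseq[OF test_L2(1)[OF \<phi>'(1)] yG(1) \<phi>'(2)] by blast
  define \<phi> where "\<phi> k = \<phi>' (r k)" for k
  have \<phi>: "\<And>k. \<phi> k \<in> test_functions \<Omega>" "(\<lambda>k. nsq \<mu> (\<lambda>x. \<phi> k x - y x)) \<longlonglongrightarrow> 0"
    "(\<lambda>k. nsq \<mu> (\<lambda>x. grad (\<phi> k) x - G x)) \<longlonglongrightarrow> 0" "AE x in \<mu>. (\<lambda>k. \<phi> k x) \<longlonglongrightarrow> y x"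
    using \<phi>'(1) LIMSEQ_subseq_LIMSEQ[OF \<phi>'(2) r(1)] LIMSEQ_subseq_LIMSEQ[OF \<phi>'(3) r(1)] r(2)
    by (simp_all add: \<phi>_def o_def)
  have gc: "continuous_on UNIV g" using g(1) by (meson DERIV_continuous continuous_at_imp_continuous_on)
  note gm = borel_measurable_continuous_onI[OF gc] borel_measurable_continuous_onI[OF g(2)]
  note lip = lipschitz_of_derivative_bound[OF g(1,4)]
  have m1: "(\<lambda>x. g' (y x)) \<in> borel_measurable \<mu>" using L2_onD(1)[OF yG(1)] gm(2) by measurable
  have m2: "(\<lambda>x. g' (\<phi> k x)) \<in> borel_measurable \<mu>" for k
    using borel_measurable_mu[OF test_borel(1)[OF \<phi>(1)[of k]]] gm(2) by measurable
  note L1 = L2_on_bounded_scaleR[OF yG(2) m1 g(4)]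
  note L3 = L2_on_bounded_scaleR[OF yG(2) m2 g(4)]
  show ?thesis
  proof (rule H0_closed[OF H0_chain_test[OF \<phi>(1) g(1-3)] L2_on_lipschitz[OF yG(1) lip gm(1) g(3)] L1])
    show "(\<lambda>k. nsq \<mu> (\<lambda>x. g (\<phi> k x) - g (y x))) \<longlonglongrightarrow> 0"
      by (rule tendsto_sandwich[OF _ _ tendsto_const tendsto_mult_right_zero[OF \<phi>(2), of "L\<^sup>2"]])
        (use nsq_lipschitz_le[OF test_L2(1)[OF \<phi>(1)] yG(1) lip gm(1)] in auto)
    have d: "(\<lambda>k. nsq \<mu> (\<lambda>x. g' (\<phi> k x) *\<^sub>R G x - g' (y x) *\<^sub>R G x)) \<longlonglongrightarrow> 0"
    proof (rule L2_dominated_convergence(2)[OF L2_onD(1)[OF L3] L2_onD(1)[OF L1]])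
      show "AE x in \<mu>. (\<lambda>k. g' (\<phi> k x) *\<^sub>R G x) \<longlonglongrightarrow> g' (y x) *\<^sub>R G x"
        using \<phi>(4)
      proof eventually_elim
        case (elim x)
        have "isCont g' (y x)" using g(2) by (simp add: continuous_on_eq_continuous_at)
        from isCont_tendsto_compose[OF this elim] show ?case by (intro tendsto_intros)
      qed
      show "integrable \<mu> (\<lambda>x. L\<^sup>2 * (norm (G x))\<^sup>2)" using L2_onD(2)[OF yG(2)] by simp
      have "(g' t)\<^sup>2 \<le> L\<^sup>2" for t using g(4)[of t] by (metis abs_ge_zero power2_abs power_mono)
      then show "AE x in \<mu>. (norm (g' (\<phi> k x) *\<^sub>R G x))\<^sup>2 \<le> L\<^sup>2 * (norm (G x))\<^sup>2" for k
        by (intro AE_I2) (simp add: power_mult_distrib mult_right_mono)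
    qed
    have le: "nsq \<mu> (\<lambda>x. g' (\<phi> k x) *\<^sub>R grad (\<phi> k) x - g' (\<phi> k x) *\<^sub>R G x) \<le> L\<^sup>2 * nsq \<mu> (\<lambda>x. grad (\<phi> k) x - G x)" for k
    proof -
      have "nsq \<mu> (\<lambda>x. g' (\<phi> k x) *\<^sub>R (grad (\<phi> k) x - G x)) \<le> nsq \<mu> (\<lambda>x. L *\<^sub>R (grad (\<phi> k) x - G x))"
      proof (rule nsq_mono)
        have D: "(\<lambda>x. grad (\<phi> k) x - G x) \<in> L2_on \<mu>" by (rule L2_on_diff[OF test_L2(2)[OF \<phi>(1)] yG(2)])
        show "(\<lambda>x. L *\<^sub>R (grad (\<phi> k) x - G x)) \<in> L2_on \<mu>" by (rule L2_on_scaleR[OF D])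
        show "(\<lambda>x. g' (\<phi> k x) *\<^sub>R (grad (\<phi> k) x - G x)) \<in> borel_measurable \<mu>"
          by (rule L2_onD(1)[OF L2_on_bounded_scaleR[OF D m2 g(4)]])
        have "\<bar>g' t\<bar> \<le> \<bar>L\<bar>" for t using g(4)[of t] by linarith
        then show "AE x in \<mu>. norm (g' (\<phi> k x) *\<^sub>R (grad (\<phi> k) x - G x)) \<le> norm (L *\<^sub>R (grad (\<phi> k) x - G x))"
          by (intro AE_I2) (simp add: mult_right_mono)
      qed
      then show ?thesis unfolding nsq_scaleR by (simp only: scaleR_diff_right)
    qed
    show "(\<lambda>k. nsq \<mu> (\<lambda>x. g' (\<phi> k x) *\<^sub>R grad (\<phi> k) x - g' (y x) *\<^sub>R G x)) \<longlonglongrightarrow> 0"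
    proof (rule tendsto_sandwich[OF _ _ tendsto_const])
      show "\<forall>\<^sub>F k in sequentially. nsq \<mu> (\<lambda>x. g' (\<phi> k x) *\<^sub>R grad (\<phi> k) x - g' (y x) *\<^sub>R G x)
          \<le> 2 * (L\<^sup>2 * nsq \<mu> (\<lambda>x. grad (\<phi> k) x - G x)) + 2 * nsq \<mu> (\<lambda>x. g' (\<phi> k x) *\<^sub>R G x - g' (y x) *\<^sub>R G x)"
      proof (intro always_eventually allI)
        fix k
        note L2k = L2_on_bounded_scaleR[OF test_L2(2)[OF \<phi>(1)[of k]] m2[of k] g(4)]
        show "nsq \<mu> (\<lambda>x. g' (\<phi> k x) *\<^sub>R grad (\<phi> k) x - g' (y x) *\<^sub>R G x)
          \<le> 2 * (L\<^sup>2 * nsq \<mu> (\<lambda>x. grad (\<phi> k) x - G x)) + 2 * nsq \<mu> (\<lambda>x. g' (\<phi> k x) *\<^sub>R G x - g' (y x) *\<^sub>R G x)"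
          using nsq_diff_triangle[OF L2k L3[of k] L1] le[of k] by argo
      qed
      show "(\<lambda>k. 2 * (L\<^sup>2 * nsq \<mu> (\<lambda>x. grad (\<phi> k) x - G x)) + 2 * nsq \<mu> (\<lambda>x. g' (\<phi> k x) *\<^sub>R G x - g' (y x) *\<^sub>R G x)) \<longlonglongrightarrow> 0"
        using tendsto_add[OF tendsto_mult_right_zero[OF tendsto_mult_right_zero[OF \<phi>(3), of "L\<^sup>2"], of 2]
            tendsto_mult_right_zero[OF d, of 2]] by simp
    qed simp
  qed
qed

text \<open>
  The approximations are the averages of \<open>g\<close> over intervals of length \<open>1 / n\<close> to the right; their
  derivatives are the difference quotients of \<open>g\<close>.
\<close>

lemma lipschitz_C1_approx:
  fixes g :: "real \<Rightarrow> real"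
  assumes lip: "\<And>s t. \<bar>g s - g t\<bar> \<le> L * \<bar>s - t\<bar>" and g0: "g 0 = 0"
  obtains a where
    "\<And>n t. (a n has_real_derivative real (Suc n) * (g (t + 1 / real (Suc n)) - g t)) (at t)"
    "\<And>n. a n 0 = 0" "\<And>t. (\<lambda>n. a n t) \<longlonglongrightarrow> g t"
    "\<And>n t. \<bar>real (Suc n) * (g (t + 1 / real (Suc n)) - g t)\<bar> \<le> L"
    "continuous_on UNIV g"
proof -
  have gc: "continuous_on UNIV g"
  proof (rule lipschitz_on_continuous_on)
    show "L-lipschitz_on UNIV g"
    proof (rule lipschitz_onI)
      show "0 \<le> L" using order_trans[OF abs_ge_zero lip[of 1 0]] by simp
    qed (use lip in \<open>simp add: dist_real_def\<close>)
  qed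
  have "\<exists>F. \<forall>x. - \<infinity> < ereal x \<longrightarrow> ereal x < \<infinity> \<longrightarrow> (F has_vector_derivative g x) (at x)"
    by (rule einterval_antiderivative) (use gc in \<open>simp_all add: continuous_on_eq_continuous_at\<close>)
  then obtain F where "\<forall>x. (F has_vector_derivative g x) (at x)" by auto
  then have F: "(F has_real_derivative g t) (at t)" for t
    by (simp add: has_real_derivative_iff_has_vector_derivative)
  define a where "a n t = real (Suc n) * (F (t + 1 / real (Suc n)) - F t)
      - real (Suc n) * (F (0 + 1 / real (Suc n)) - F 0)" for n t
  show ?thesis
  proof (rule that[of a])
    fix n t
    show "(a n has_real_derivative real (Suc n) * (g (t + 1 / real (Suc n)) - g t)) (at t)"
    proof -
      have "((\<lambda>t. F (t + 1 / real (Suc n))) has_real_derivative g (t + 1 / real (Suc n))) (at t)"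
        using F[of "t + 1 / real (Suc n)"] by (simp only: DERIV_shift)
      from DERIV_diff[OF DERIV_cmult[OF DERIV_diff[OF this F[of t]], of "real (Suc n)"] DERIV_const]
      show ?thesis unfolding a_def[abs_def] by simp
    qed
    show "a n 0 = 0" by (simp add: a_def)
    have "\<bar>g (t + 1 / real (Suc n)) - g t\<bar> \<le> L * (1 / real (Suc n))" using lip[of "t + 1 / real (Suc n)" t] by simp
    then have "real (Suc n) * \<bar>g (t + 1 / real (Suc n)) - g t\<bar> \<le> real (Suc n) * (L * (1 / real (Suc n)))"
      by (rule mult_left_mono) simp
    then show "\<bar>real (Suc n) * (g (t + 1 / real (Suc n)) - g t)\<bar> \<le> L" by (simp add: abs_mult)
    have q: "(\<lambda>n. real (Suc n) * (F (s + 1 / real (Suc n)) - F s)) \<longlonglongrightarrow> g s" for s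
    proof -
      have "((\<lambda>h. (F (s + h) - F s) / h) \<longlongrightarrow> g s) (at 0)" using F[of s] by (simp add: DERIV_def)
      moreover have "filterlim (\<lambda>n. 1 / real (Suc n)) (at 0) sequentially"
        unfolding filterlim_at using LIMSEQ_Suc[OF lim_1_over_n[where 'a=real]] by auto
      ultimately have "(\<lambda>n. (F (s + 1 / real (Suc n)) - F s) / (1 / real (Suc n))) \<longlonglongrightarrow> g s"
        by (rule filterlim_compose)
      then show ?thesis by (simp add: mult.commute)
    qed
    show "(\<lambda>n. a n t) \<longlonglongrightarrow> g t" unfolding a_def using tendsto_diff[OF q[of t] q[of 0]] g0 by simp
  qed (rule gc)
qed

text \<open>
  Only a derivative from the right is available for piecewise linear \<open>g\<close>, and it suffices: the
  approximations of \<open>g\<close> have as derivatives the difference quotients to the right, which are bounded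
  and converge everywhere, so dominated convergence applies to the gradients.
\<close>

lemma H0_chain:
  assumes H: "H0 \<Omega> y G"
    and lip: "\<And>s t. \<bar>g s - g t\<bar> \<le> L * \<bar>s - t\<bar>" and g0: "g 0 = 0"
    and h: "\<And>t. (g has_real_derivative h t) (at_right t)"
  shows "H0 \<Omega> (\<lambda>x. g (y x)) (\<lambda>x. h (y x) *\<^sub>R G x)"
proof -
  note yG = H0_L2[OF H]
  obtain a where a: "\<And>n t. (a n has_real_derivative real (Suc n) * (g (t + 1 / real (Suc n)) - g t)) (at t)"
    "\<And>n. a n 0 = 0" "\<And>t. (\<lambda>n. a n t) \<longlonglongrightarrow> g t"
    "\<And>n t. \<bar>real (Suc n) * (g (t + 1 / real (Suc n)) - g t)\<bar> \<le> L"
    "continuous_on UNIV g" using lipschitz_C1_approx[of g L] lip g0 by blast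
  define d where "d n t = real (Suc n) * (g (t + 1 / real (Suc n)) - g t)" for n t
  have dc: "continuous_on UNIV (d n)" for n unfolding d_def[abs_def]
    by (intro continuous_intros continuous_on_compose2[OF a(5)]) auto
  have ad: "(a n has_real_derivative d n t) (at t)" "\<bar>d n t\<bar> \<le> L" for n t
    using a(1)[of n t] a(4)[of n t] by (simp_all add: d_def)
  have dh: "(\<lambda>n. d n t) \<longlonglongrightarrow> h t" for t
  proof -
    have "((\<lambda>s. (g s - g t) / (s - t)) \<longlongrightarrow> h t) (at_right t)" using h[of t] by (simp add: has_field_derivative_iff)
    moreover have "filterlim (\<lambda>n. t + 1 / real (Suc n)) (at_right t) sequentially"
      unfolding filterlim_at using tendsto_add[OF tendsto_const[of t] LIMSEQ_Suc[OF lim_1_over_n[where 'a=real]]] by auto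
    ultimately have "(\<lambda>n. (g (t + 1 / real (Suc n)) - g t) / (t + 1 / real (Suc n) - t)) \<longlonglongrightarrow> h t"
      by (rule filterlim_compose)
    then show ?thesis by (simp add: d_def mult.commute)
  qed
  note dm = borel_measurable_continuous_onI[OF dc]
  have hm: "h \<in> borel_measurable borel" by (rule borel_measurable_LIMSEQ_real[OF dh dm])
  have gm: "g \<in> borel_measurable borel" by (rule borel_measurable_continuous_onI[OF a(5)])
  have ym: "y \<in> borel_measurable \<mu>" "G \<in> borel_measurable \<mu>" using L2_onD(1)[OF yG(1)] L2_onD(1)[OF yG(2)] .
  have Hn: "H0 \<Omega> (\<lambda>x. a n (y x)) (\<lambda>x. d n (y x) *\<^sub>R G x)" for n
    by (rule H0_chain_C1[OF H ad(1) dc a(2) ad(2)])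
  have A: "(\<lambda>x. g (y x)) \<in> L2_on \<mu>" "(\<lambda>n. nsq \<mu> (\<lambda>x. a n (y x) - g (y x))) \<longlonglongrightarrow> 0"
  proof -
    have b: "AE x in \<mu>. (norm (a n (y x)))\<^sup>2 \<le> L\<^sup>2 * (norm (y x))\<^sup>2" for n
    proof (rule AE_I2)
      fix x
      have "\<bar>a n (y x)\<bar> \<le> L * \<bar>y x\<bar>" using lipschitz_of_derivative_bound[OF ad, of n "y x" 0] a(2) by simp
      then have "\<bar>a n (y x)\<bar>\<^sup>2 \<le> (L * \<bar>y x\<bar>)\<^sup>2" by (rule power_mono) simp
      then show "(norm (a n (y x)))\<^sup>2 \<le> L\<^sup>2 * (norm (y x))\<^sup>2" by (simp add: power_mult_distrib)
    qed
    have i: "integrable \<mu> (\<lambda>x. L\<^sup>2 * (norm (y x))\<^sup>2)" using L2_onD(2)[OF yG(1)] by simp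
    have gy: "(\<lambda>x. g (y x)) \<in> borel_measurable \<mu>" using ym gm by measurable
    note dc = L2_dominated_convergence[OF L2_onD(1)[OF H0_L2(1)[OF Hn]] gy AE_I2[OF a(3)] i b]
    show "(\<lambda>x. g (y x)) \<in> L2_on \<mu>" "(\<lambda>n. nsq \<mu> (\<lambda>x. a n (y x) - g (y x))) \<longlonglongrightarrow> 0" by (rule dc)+
  qed
  have Bc: "(\<lambda>x. h (y x) *\<^sub>R G x) \<in> L2_on \<mu>"
    "(\<lambda>n. nsq \<mu> (\<lambda>x. d n (y x) *\<^sub>R G x - h (y x) *\<^sub>R G x)) \<longlonglongrightarrow> 0"
  proof -
    have "(d n t)\<^sup>2 \<le> L\<^sup>2" for n t using ad(2)[of n t] by (metis abs_ge_zero power2_abs power_mono)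
    then have b: "AE x in \<mu>. (norm (d n (y x) *\<^sub>R G x))\<^sup>2 \<le> L\<^sup>2 * (norm (G x))\<^sup>2" for n
      by (intro AE_I2) (simp add: power_mult_distrib mult_right_mono)
    have i: "integrable \<mu> (\<lambda>x. L\<^sup>2 * (norm (G x))\<^sup>2)" using L2_onD(2)[OF yG(2)] by simp
    have gy: "(\<lambda>x. h (y x) *\<^sub>R G x) \<in> borel_measurable \<mu>" using ym hm by measurable
    have c: "AE x in \<mu>. (\<lambda>n. d n (y x) *\<^sub>R G x) \<longlonglongrightarrow> h (y x) *\<^sub>R G x" by (intro AE_I2 tendsto_intros dh)
    note dc = L2_dominated_convergence[OF L2_onD(1)[OF H0_L2(2)[OF Hn]] gy c i b]
    show "(\<lambda>x. h (y x) *\<^sub>R G x) \<in> L2_on \<mu>"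
      "(\<lambda>n. nsq \<mu> (\<lambda>x. d n (y x) *\<^sub>R G x - h (y x) *\<^sub>R G x)) \<longlonglongrightarrow> 0" by (rule dc)+
  qed
  show ?thesis by (rule H0_closed[OF Hn A(1) Bc(1) A(2) Bc(2)])
qed

text \<open>
  A Lipschitz function such as an infinite zigzag need not come with an explicit derivative; here the
  gradient is supplied by \<open>H0_weak_closure\<close>.
\<close>

lemma H0_lipschitz:
  assumes H: "H0 \<Omega> y G" and lip: "\<And>s t. \<bar>g s - g t\<bar> \<le> L * \<bar>s - t\<bar>" and g0: "g 0 = 0"
  obtains K where "H0 \<Omega> (\<lambda>x. g (y x)) K"
proof -
  note yG = H0_L2[OF H]
  obtain a where a: "\<And>n t. (a n has_real_derivative real (Suc n) * (g (t + 1 / real (Suc n)) - g t)) (at t)"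
    "\<And>n. a n 0 = 0" "\<And>t. (\<lambda>n. a n t) \<longlonglongrightarrow> g t"
    "\<And>n t. \<bar>real (Suc n) * (g (t + 1 / real (Suc n)) - g t)\<bar> \<le> L"
    "continuous_on UNIV g" using lipschitz_C1_approx[of g L] lip g0 by blast
  define d where "d n t = real (Suc n) * (g (t + 1 / real (Suc n)) - g t)" for n t
  have dc: "continuous_on UNIV (d n)" for n unfolding d_def[abs_def]
    by (intro continuous_intros continuous_on_compose2[OF a(5)]) auto
  have ad: "(a n has_real_derivative d n t) (at t)" "\<bar>d n t\<bar> \<le> L" for n t
    using a(1)[of n t] a(4)[of n t] by (simp_all add: d_def)
  have Hn: "H0 \<Omega> (\<lambda>x. a n (y x)) (\<lambda>x. d n (y x) *\<^sub>R G x)" for n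
    by (rule H0_chain_C1[OF H ad(1) dc a(2) ad(2)])
  have L0: "0 \<le> L" using ad(2)[of 0 0] by linarith
  have b1: "nsq \<mu> (\<lambda>x. a n (y x)) \<le> L\<^sup>2 * nsq \<mu> y" for n
  proof -
    have "nsq \<mu> (\<lambda>x. a n (y x)) \<le> nsq \<mu> (\<lambda>x. L *\<^sub>R y x)"
    proof (rule nsq_mono[OF L2_on_scaleR[OF yG(1)] L2_onD(1)[OF H0_L2(1)[OF Hn]]], rule AE_I2)
      fix x show "norm (a n (y x)) \<le> norm (L *\<^sub>R y x)"
        using lipschitz_of_derivative_bound[OF ad, of n "y x" 0] a(2) L0 by (simp add: abs_mult)
    qed
    then show ?thesis by (simp only: nsq_scaleR)
  qed
  have b2: "nsq \<mu> (\<lambda>x. d n (y x) *\<^sub>R G x) \<le> L\<^sup>2 * nsq \<mu> G" for n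
  proof -
    have "nsq \<mu> (\<lambda>x. d n (y x) *\<^sub>R G x) \<le> nsq \<mu> (\<lambda>x. L *\<^sub>R G x)"
    proof (rule nsq_mono[OF L2_on_scaleR[OF yG(2)] L2_onD(1)[OF H0_L2(2)[OF Hn]]], rule AE_I2)
      fix x show "norm (d n (y x) *\<^sub>R G x) \<le> norm (L *\<^sub>R G x)"
        using ad(2)[of n "y x"] L0 by (simp add: mult_right_mono)
    qed
    then show ?thesis by (simp only: nsq_scaleR)
  qed
  have gy: "(\<lambda>x. g (y x)) \<in> borel_measurable \<mu>"
    using L2_onD(1)[OF yG(1)] borel_measurable_continuous_onI[OF a(5)] by measurable
  obtain K where "H0 \<Omega> (\<lambda>x. g (y x)) K"
  proof (rule H0_weak_closure[OF Hn _ _ _ gy])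
    show "nsq \<mu> (\<lambda>x. a n (y x)) \<le> max (L\<^sup>2 * nsq \<mu> y) (L\<^sup>2 * nsq \<mu> G)" for n using b1[of n] by simp
    show "nsq \<mu> (\<lambda>x. d n (y x) *\<^sub>R G x) \<le> max (L\<^sup>2 * nsq \<mu> y) (L\<^sup>2 * nsq \<mu> G)" for n using b2[of n] by simp
    show "AE x in \<mu>. (\<lambda>j. a j (y x)) \<longlonglongrightarrow> g (y x)" by (rule AE_I2[OF a(3)])
  qed blast
  then show ?thesis by (rule that)
qed

end

section \<open>Translations and averages\<close>

lemma Cauchy_Schwarz_set_nn_integral:
  assumes [measurable]: "f \<in> borel_measurable M" "A \<in> sets M"
  shows "(\<integral>\<^sup>+x\<in>A. f x \<partial>M)\<^sup>2 \<le> (\<integral>\<^sup>+x\<in>A. (f x)\<^sup>2 \<partial>M) * emeasure M A"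
proof -
  have "(\<integral>\<^sup>+x. (f x * indicator A x) * indicator A x \<partial>M)\<^sup>2
      \<le> (\<integral>\<^sup>+x. (f x * indicator A x)\<^sup>2 \<partial>M) * (\<integral>\<^sup>+x. (indicator A x)\<^sup>2 \<partial>M)"
    by (rule Cauchy_Schwarz_nn_integral) measurable
  also have "(\<lambda>x. (f x * indicator A x) * indicator A x) = (\<lambda>x. f x * indicator A x)"
    by (auto simp: indicator_def)
  also have "(\<lambda>x. (f x * indicator A x)\<^sup>2) = (\<lambda>x. (f x)\<^sup>2 * indicator A x)"
    by (auto simp: indicator_def)
  also have "(\<lambda>x. (indicator A x)\<^sup>2 :: ennreal) = indicator A" by (auto simp: indicator_def)
  finally show ?thesis by simp
qed

lemma increment_le_nn_integral:
  fixes \<psi> :: "real \<Rightarrow> real"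
  assumes d: "\<And>t. (\<psi> has_real_derivative \<psi>' t) (at t)" and c: "continuous_on UNIV \<psi>'" and ab: "a \<le> b"
  shows "ennreal \<bar>\<psi> b - \<psi> a\<bar> \<le> (\<integral>\<^sup>+t\<in>{a..b}. ennreal \<bar>\<psi>' t\<bar> \<partial>lborel)"
proof -
  have h: "has_bochner_integral lborel (\<lambda>t. \<psi>' t * indicator {a..b} t) (\<psi> b - \<psi> a)"
    by (rule has_bochner_integral_FTC_Icc_real[OF ab d])
      (use c in \<open>simp add: continuous_on_eq_continuous_at\<close>)
  then have "ennreal (norm (\<psi> b - \<psi> a)) \<le> (\<integral>\<^sup>+t. ennreal (norm (\<psi>' t * indicator {a..b} t)) \<partial>lborel)"
    using has_bochner_integral_integral_eq[OF h] has_bochner_integral_iff[THEN iffD1, OF h]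
      integral_norm_bound_ennreal by fastforce
  also have "\<dots> = (\<integral>\<^sup>+t\<in>{a..b}. ennreal \<bar>\<psi>' t\<bar> \<partial>lborel)"
    by (intro nn_integral_cong) (auto simp: indicator_def)
  finally show ?thesis by simp
qed

lemma nn_integral_lborel_affine:
  fixes f :: "'a::euclidean_space \<Rightarrow> ennreal"
  assumes [measurable]: "f \<in> borel_measurable borel" and c: "0 < c"
  shows "(\<integral>\<^sup>+x. f (a + c *\<^sub>R x) \<partial>lborel) = ennreal (1 / c ^ DIM('a)) * (\<integral>\<^sup>+x. f x \<partial>lborel)"
proof -
  have "(\<integral>\<^sup>+x. f x \<partial>lborel) = (\<integral>\<^sup>+x. f x \<partial>density (distr lborel borel (\<lambda>x. a + c *\<^sub>R x)) (\<lambda>_. ennreal (\<bar>c\<bar> ^ DIM('a))))"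
    using lborel_affine[of c a] c by simp
  also have "\<dots> = ennreal (c ^ DIM('a)) * (\<integral>\<^sup>+x. f (a + c *\<^sub>R x) \<partial>lborel)"
    using c by (simp add: nn_integral_density nn_integral_distr nn_integral_cmult)
  finally have "ennreal (1 / c ^ DIM('a)) * (\<integral>\<^sup>+x. f x \<partial>lborel)
      = (ennreal (1 / c ^ DIM('a)) * ennreal (c ^ DIM('a))) * (\<integral>\<^sup>+x. f (a + c *\<^sub>R x) \<partial>lborel)"
    by (simp add: mult.assoc)
  also have "ennreal (1 / c ^ DIM('a)) * ennreal (c ^ DIM('a)) = 1"
    using c by (simp add: ennreal_mult[symmetric])
  finally show ?thesis by simp
qed

lemma nn_integral_lborel_translate:
  fixes f :: "'a::euclidean_space \<Rightarrow> ennreal"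
  assumes "f \<in> borel_measurable borel"
  shows "(\<integral>\<^sup>+x. f (x + a) \<partial>lborel) = (\<integral>\<^sup>+x. f x \<partial>lborel)"
  using nn_integral_lborel_affine[OF assms, of 1 a] by (simp add: add.commute)

text \<open>Averages are taken over a cube of volume one that stays away from the origin.\<close>

definition unit_cube :: "'a::euclidean_space set" where
  "unit_cube = cbox One (2 *\<^sub>R One)"

lemma emeasure_unit_cube: "emeasure lborel (unit_cube :: 'a::euclidean_space set) = 1"
  unfolding unit_cube_def by (subst emeasure_lborel_cbox) (auto simp: inner_diff_left)

lemma sets_unit_cube [measurable, simp]: "unit_cube \<in> sets borel"
  by (simp add: unit_cube_def)

lemma norm_unit_cube:
  assumes "h \<in> (unit_cube :: 'a::euclidean_space set)"
  shows "1 \<le> norm h" "norm h \<le> 2 * DIM('a)"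
proof -
  have h: "1 \<le> h \<bullet> b" "h \<bullet> b \<le> 2" if "b \<in> Basis" for b
    using assms that by (auto simp: unit_cube_def mem_box)
  obtain b :: 'a where b: "b \<in> Basis" using nonempty_Basis by blast
  show "1 \<le> norm h" using h(1)[OF b] Basis_le_norm[OF b, of h] by linarith
  have "norm h \<le> (\<Sum>b\<in>Basis. \<bar>h \<bullet> b\<bar>)" by (rule norm_le_l1)
  also have "\<dots> \<le> (\<Sum>b\<in>(Basis::'a set). 2)" by (rule sum_mono) (use h in fastforce)
  finally show "norm h \<le> 2 * DIM('a)" by simp
qed

definition avg :: "('a::euclidean_space \<Rightarrow> real) \<Rightarrow> real \<Rightarrow> 'a \<Rightarrow> real" where
  "avg \<phi> r x = (LINT h|lborel. indicator unit_cube h * \<phi> (x + r *\<^sub>R h))"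

context bounded_open
begin

lemma test_diff_along:
  assumes "\<phi> \<in> test_functions \<Omega>" "a \<le> b"
  shows "ennreal \<bar>\<phi> (x + b *\<^sub>R h) - \<phi> (x + a *\<^sub>R h)\<bar>
    \<le> (\<integral>\<^sup>+t\<in>{a..b}. ennreal (norm (grad \<phi> (x + t *\<^sub>R h)) * norm h) \<partial>lborel)"
proof -
  have "ennreal \<bar>\<phi> (x + b *\<^sub>R h) - \<phi> (x + a *\<^sub>R h)\<bar>
      \<le> (\<integral>\<^sup>+t\<in>{a..b}. ennreal \<bar>grad \<phi> (x + t *\<^sub>R h) \<bullet> h\<bar> \<partial>lborel)"
  proof (rule increment_le_nn_integral[OF _ _ assms(2)])
    fix t
    have "((\<lambda>t. x + t *\<^sub>R h) has_derivative (\<lambda>t. t *\<^sub>R h)) (at t)"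
      by (auto intro!: derivative_eq_intros)
    from has_derivative_compose[OF this smooth_has_grad[OF test_smooth[OF assms(1)]]]
    show "((\<lambda>t. \<phi> (x + t *\<^sub>R h)) has_real_derivative grad \<phi> (x + t *\<^sub>R h) \<bullet> h) (at t)"
      by (simp add: has_field_derivative_def mult.commute[of _ "grad \<phi> (x + t *\<^sub>R h) \<bullet> h"] inner_scaleR_right)
  next
    show "continuous_on UNIV (\<lambda>t. grad \<phi> (x + t *\<^sub>R h) \<bullet> h)"
      by (intro continuous_intros continuous_on_compose2[OF continuous_grad[OF test_smooth[OF assms(1)], of UNIV]]) auto
  qed
  also have "\<dots> \<le> (\<integral>\<^sup>+t\<in>{a..b}. ennreal (norm (grad \<phi> (x + t *\<^sub>R h)) * norm h) \<partial>lborel)"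
    by (intro nn_integral_mono mult_right_mono ennreal_leI Cauchy_Schwarz_ineq2) auto
  finally show ?thesis .
qed

lemma nn_integral_mu_eq_lborel:
  assumes "g \<in> borel_measurable borel" "\<And>x. x \<notin> \<Omega> \<Longrightarrow> g x = 0"
  shows "(\<integral>\<^sup>+x. g x \<partial>\<mu>) = (\<integral>\<^sup>+x. g x \<partial>lborel)"
proof -
  have "(\<integral>\<^sup>+x. g x \<partial>\<mu>) = (\<integral>\<^sup>+x. g x * indicator \<Omega> x \<partial>lebesgue)"
    by (rule nn_integral_restrict_space) simp
  also have "(\<lambda>x. g x * indicator \<Omega> x) = g" using assms(2) by (auto simp: indicator_def)
  also have "(\<integral>\<^sup>+x. g x \<partial>lebesgue) = (\<integral>\<^sup>+x. g x \<partial>lborel)"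
    by (rule nn_integral_completion)
  finally show ?thesis .
qed

lemma nn_integral_mu_le_lborel:
  assumes "g \<in> borel_measurable borel"
  shows "(\<integral>\<^sup>+x. g x \<partial>\<mu>) \<le> (\<integral>\<^sup>+x. g x \<partial>lborel)"
proof -
  have "(\<integral>\<^sup>+x. g x \<partial>\<mu>) = (\<integral>\<^sup>+x. g x * indicator \<Omega> x \<partial>lebesgue)"
    by (rule nn_integral_restrict_space) simp
  also have "\<dots> \<le> (\<integral>\<^sup>+x. g x \<partial>lebesgue)" by (intro nn_integral_mono) (auto simp: indicator_def)
  also have "(\<integral>\<^sup>+x. g x \<partial>lebesgue) = (\<integral>\<^sup>+x. g x \<partial>lborel)"
    by (rule nn_integral_completion)
  finally show ?thesis .
qed

lemma nn_integral_grad_sq: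
  assumes "\<phi> \<in> test_functions \<Omega>"
  shows "(\<integral>\<^sup>+x. (ennreal (norm (grad \<phi> x)))\<^sup>2 \<partial>lborel) = ennreal (nsq \<mu> (grad \<phi>))"
proof -
  note [measurable] = test_borel[OF assms]
  have "(\<integral>\<^sup>+x. (ennreal (norm (grad \<phi> x)))\<^sup>2 \<partial>\<mu>) = (\<integral>\<^sup>+x. (ennreal (norm (grad \<phi> x)))\<^sup>2 \<partial>lborel)"
    by (rule nn_integral_mu_eq_lborel) (use test_outside[OF assms] in auto)
  then show ?thesis using nn_integral_eq_nsq[OF test_L2(2)[OF assms]] by simp
qed

lemma nn_integral_test_sq:
  assumes "\<phi> \<in> test_functions \<Omega>"
  shows "(\<integral>\<^sup>+x. (ennreal \<bar>\<phi> x\<bar>)\<^sup>2 \<partial>lborel) = ennreal (nsq \<mu> \<phi>)"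
proof -
  note [measurable] = test_borel[OF assms]
  have "(\<integral>\<^sup>+x. (ennreal \<bar>\<phi> x\<bar>)\<^sup>2 \<partial>\<mu>) = (\<integral>\<^sup>+x. (ennreal \<bar>\<phi> x\<bar>)\<^sup>2 \<partial>lborel)"
    by (rule nn_integral_mu_eq_lborel) (use test_outside[OF assms] in auto)
  then show ?thesis using nn_integral_eq_nsq[OF test_L2(1)[OF assms]] by simp
qed

lemma translation_le:
  assumes \<phi>: "\<phi> \<in> test_functions \<Omega>"
  shows "(\<integral>\<^sup>+x. (ennreal \<bar>\<phi> (x + h) - \<phi> x\<bar>)\<^sup>2 \<partial>lborel) \<le> ennreal ((norm h)\<^sup>2 * nsq \<mu> (grad \<phi>))"
proof -
  note [measurable] = test_borel[OF \<phi>]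
  have pt: "(ennreal \<bar>\<phi> (x + h) - \<phi> x\<bar>)\<^sup>2
      \<le> (\<integral>\<^sup>+t\<in>{0..1}. (ennreal (norm (grad \<phi> (x + t *\<^sub>R h))))\<^sup>2 * ennreal ((norm h)\<^sup>2) \<partial>lborel)" for x
  proof -
    have "(ennreal \<bar>\<phi> (x + h) - \<phi> x\<bar>)\<^sup>2
        \<le> (\<integral>\<^sup>+t\<in>{0..1}. ennreal (norm (grad \<phi> (x + t *\<^sub>R h)) * norm h) \<partial>lborel)\<^sup>2"
      using test_diff_along[OF \<phi>, of 0 1 x h] by (intro power_mono) auto
    also have "\<dots> \<le> (\<integral>\<^sup>+t\<in>{0..1}. (ennreal (norm (grad \<phi> (x + t *\<^sub>R h)) * norm h))\<^sup>2 \<partial>lborel) * emeasure lborel {0..1::real}"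
      by (rule Cauchy_Schwarz_set_nn_integral) measurable
    finally show ?thesis by (simp add: ennreal_mult power_mult_distrib ennreal_power)
  qed
  have "(\<integral>\<^sup>+x. (ennreal \<bar>\<phi> (x + h) - \<phi> x\<bar>)\<^sup>2 \<partial>lborel)
      \<le> (\<integral>\<^sup>+x. (\<integral>\<^sup>+t\<in>{0..1}. (ennreal (norm (grad \<phi> (x + t *\<^sub>R h))))\<^sup>2 * ennreal ((norm h)\<^sup>2) \<partial>lborel) \<partial>lborel)"
    by (rule nn_integral_mono) (rule pt)
  also have "\<dots> = (\<integral>\<^sup>+t. (\<integral>\<^sup>+x. (ennreal (norm (grad \<phi> (x + t *\<^sub>R h))))\<^sup>2 * ennreal ((norm h)\<^sup>2) * indicator {0..1} t \<partial>lborel) \<partial>lborel)"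
    by (rule lborel_pair.Fubini') measurable
  also have "\<dots> = (\<integral>\<^sup>+t. ennreal (nsq \<mu> (grad \<phi>)) * ennreal ((norm h)\<^sup>2) * indicator {0..1::real} t \<partial>lborel)"
  proof (rule nn_integral_cong)
    fix t :: real
    have "(\<integral>\<^sup>+x. (ennreal (norm (grad \<phi> (x + t *\<^sub>R h))))\<^sup>2 \<partial>lborel) = (\<integral>\<^sup>+x. (ennreal (norm (grad \<phi> x)))\<^sup>2 \<partial>lborel)"
      by (rule nn_integral_lborel_translate) measurable
    then show "(\<integral>\<^sup>+x. (ennreal (norm (grad \<phi> (x + t *\<^sub>R h))))\<^sup>2 * ennreal ((norm h)\<^sup>2) * indicator {0..1} t \<partial>lborel)
        = ennreal (nsq \<mu> (grad \<phi>)) * ennreal ((norm h)\<^sup>2) * indicator {0..1} t"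
      by (simp add: nn_integral_multc nn_integral_grad_sq[OF \<phi>])
  qed
  also have "\<dots> = ennreal ((norm h)\<^sup>2 * nsq \<mu> (grad \<phi>))"
    by (subst nn_integral_cmult_indicator) (auto simp: ennreal_mult mult.commute)
  finally show ?thesis .
qed

text \<open>A translation by more than the diameter moves the domain off itself.\<close>

lemma Poincare_test: "\<exists>P>0. \<forall>\<phi>\<in>test_functions \<Omega>. nsq \<mu> \<phi> \<le> P * nsq \<mu> (grad \<phi>)"
proof -
  obtain R where R: "\<Omega> \<subseteq> ball 0 R" "R > 0" using bounded_subset_ballD[OF bounded_dom, of 0] by blast
  obtain e :: "real^'n" where e: "norm e = 2 * R" using vector_choose_size[of "2 * R"] R(2) by auto
  have "nsq \<mu> \<phi> \<le> (2 * R)\<^sup>2 * nsq \<mu> (grad \<phi>)" if \<phi>: "\<phi> \<in> test_functions \<Omega>" for \<phi>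
  proof -
    note [measurable] = test_borel[OF \<phi>]
    have "(\<integral>\<^sup>+x. (ennreal \<bar>\<phi> x\<bar>)\<^sup>2 \<partial>lborel) \<le> (\<integral>\<^sup>+x. (ennreal \<bar>\<phi> (x + e) - \<phi> x\<bar>)\<^sup>2 \<partial>lborel)"
    proof (rule nn_integral_mono)
      fix x
      show "(ennreal \<bar>\<phi> x\<bar>)\<^sup>2 \<le> (ennreal \<bar>\<phi> (x + e) - \<phi> x\<bar>)\<^sup>2"
      proof (cases "x \<in> \<Omega>")
        case True
        then have "norm x < R" using R(1) by auto
        then have "norm (x + e) \<ge> R" using norm_triangle_ineq4[of "x + e" x] e by simp
        then have "x + e \<notin> \<Omega>" using R(1) by auto
        then show ?thesis using test_outside[OF \<phi>] by simp
      qed (simp add: test_outside[OF \<phi>])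
    qed
    then have "ennreal (nsq \<mu> \<phi>) \<le> ennreal ((norm e)\<^sup>2 * nsq \<mu> (grad \<phi>))"
      unfolding nn_integral_test_sq[OF \<phi>] using translation_le[OF \<phi>, of e] by (rule order_trans)
    then show ?thesis by (simp add: e)
  qed
  moreover have "(2 * R)\<^sup>2 > 0" using R(2) by simp
  ultimately show ?thesis by blast
qed

lemma Poincare: "\<exists>P>0. \<forall>y G. H0 \<Omega> y G \<longrightarrow> nsq \<mu> y \<le> P * nsq \<mu> G"
proof -
  obtain P where P: "P > 0" "\<forall>\<phi>\<in>test_functions \<Omega>. nsq \<mu> \<phi> \<le> P * nsq \<mu> (grad \<phi>)"
    using Poincare_test by blast
  have "nsq \<mu> y \<le> P * nsq \<mu> G" if H: "H0 \<Omega> y G" for y G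
  proof -
    obtain \<phi> where \<phi>: "\<And>k. \<phi> k \<in> test_functions \<Omega>" "(\<lambda>k. nsq \<mu> (\<lambda>x. \<phi> k x - y x)) \<longlonglongrightarrow> 0"
      "(\<lambda>k. nsq \<mu> (\<lambda>x. grad (\<phi> k) x - G x)) \<longlonglongrightarrow> 0" by (rule H0_approx[OF H]) blast
    note t1 = tendsto_nsq[OF test_L2(1)[OF \<phi>(1)] H0_L2(1)[OF H] \<phi>(2)]
    note t2 = tendsto_nsq[OF test_L2(2)[OF \<phi>(1)] H0_L2(2)[OF H] \<phi>(3)]
    show ?thesis
      by (rule LIMSEQ_le[OF t1 tendsto_mult_left[OF t2, of P]]) (use P(2) \<phi>(1) in blast)
  qed
  then show ?thesis using P(1) by blast
qed

lemma avg_integrable: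
  assumes "\<phi> \<in> test_functions \<Omega>"
  shows "integrable lborel (\<lambda>h. indicator unit_cube h * \<phi> (x + r *\<^sub>R h))"
proof -
  obtain B where B: "B > 0" "\<And>x. \<bar>\<phi> x\<bar> \<le> B" "\<And>x. norm (grad \<phi> x) \<le> B"
    by (rule test_bounded[OF assms]) blast
  note [measurable] = test_borel[OF assms]
  show ?thesis
  proof (rule Bochner_Integration.integrable_bound[where f = "\<lambda>h. indicator unit_cube h * B"])
    show "integrable lborel (\<lambda>h. indicator (unit_cube :: (real^'n) set) h * B)"
      by (intro integrable_mult_left integrable_real_indicator) (auto simp: emeasure_unit_cube)
  qed (use B in \<open>auto simp: indicator_def\<close>)
qed

lemma integral_unit_cube_const: "(LINT h|lborel. indicator (unit_cube :: (real^'n) set) h * c) = (c::real)"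
  using emeasure_unit_cube[where 'a = "real^'n"] by (simp add: measure_def)

text \<open>
  Jensen's inequality.  The function \<open>\<psi>\<close> is another average, a constant value of \<open>\<phi>\<close>, or zero below.
\<close>

lemma avg_diff_sq_le:
  assumes \<phi>: "\<phi> \<in> test_functions \<Omega>" and int: "integrable lborel (\<lambda>h. indicator (unit_cube :: (real^'n) set) h * \<psi> h)"
    and [measurable]: "\<psi> \<in> borel_measurable borel"
  shows "(ennreal \<bar>avg \<phi> r x - (LINT h|lborel. indicator unit_cube h * \<psi> h)\<bar>)\<^sup>2
    \<le> (\<integral>\<^sup>+h\<in>unit_cube. (ennreal \<bar>\<phi> (x + r *\<^sub>R h) - \<psi> h\<bar>)\<^sup>2 \<partial>lborel)"
proof -
  note [measurable] = test_borel[OF \<phi>]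
  have "avg \<phi> r x - (LINT h|lborel. indicator unit_cube h * \<psi> h)
      = (LINT h|lborel. indicator unit_cube h * (\<phi> (x + r *\<^sub>R h) - \<psi> h))"
    using avg_integrable[OF \<phi>, of x r] int by (simp add: avg_def right_diff_distrib)
  moreover have i: "integrable lborel (\<lambda>h. indicator unit_cube h * (\<phi> (x + r *\<^sub>R h) - \<psi> h))"
    using Bochner_Integration.integrable_diff[OF avg_integrable[OF \<phi>, of x r] int] by (simp add: right_diff_distrib)
  ultimately have "ennreal \<bar>avg \<phi> r x - (LINT h|lborel. indicator unit_cube h * \<psi> h)\<bar>
      \<le> (\<integral>\<^sup>+h. ennreal (norm (indicator unit_cube h * (\<phi> (x + r *\<^sub>R h) - \<psi> h))) \<partial>lborel)"
    using integral_norm_bound_ennreal[OF i] by simp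
  also have "\<dots> = (\<integral>\<^sup>+h\<in>unit_cube. ennreal \<bar>\<phi> (x + r *\<^sub>R h) - \<psi> h\<bar> \<partial>lborel)"
    by (intro nn_integral_cong) (auto simp: indicator_def)
  finally have "(ennreal \<bar>avg \<phi> r x - (LINT h|lborel. indicator unit_cube h * \<psi> h)\<bar>)\<^sup>2
      \<le> (\<integral>\<^sup>+h\<in>unit_cube. ennreal \<bar>\<phi> (x + r *\<^sub>R h) - \<psi> h\<bar> \<partial>lborel)\<^sup>2" by (rule power_mono) simp
  also have "\<dots> \<le> (\<integral>\<^sup>+h\<in>unit_cube. (ennreal \<bar>\<phi> (x + r *\<^sub>R h) - \<psi> h\<bar>)\<^sup>2 \<partial>lborel) * emeasure lborel (unit_cube :: (real^'n) set)"
    by (rule Cauchy_Schwarz_set_nn_integral) measurable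
  finally show ?thesis by (simp add: emeasure_unit_cube)
qed

text \<open>
  By Jensen's inequality the difference of two averages is controlled by the \<open>L\<^sup>2\<close> norm of a
  translation, so averages at a fixed scale are Lipschitz with a constant that depends on the gradient
  only through its norm.
\<close>

lemma avg_shift:
  assumes \<phi>: "\<phi> \<in> test_functions \<Omega>" and r: "0 < r"
  shows "(avg \<phi> r x - avg \<phi> r z)\<^sup>2 \<le> 1 / r ^ CARD('n) * ((norm (x - z))\<^sup>2 * nsq \<mu> (grad \<phi>))"
proof -
  note [measurable] = test_borel[OF \<phi>]
  have "(ennreal \<bar>avg \<phi> r x - avg \<phi> r z\<bar>)\<^sup>2
      \<le> (\<integral>\<^sup>+h\<in>unit_cube. (ennreal \<bar>\<phi> (x + r *\<^sub>R h) - \<phi> (z + r *\<^sub>R h)\<bar>)\<^sup>2 \<partial>lborel)"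
    using avg_diff_sq_le[OF \<phi> avg_integrable[OF \<phi>, of z r], of r x] by (simp add: avg_def[of \<phi> r z])
  also have "\<dots> \<le> (\<integral>\<^sup>+h. (ennreal \<bar>\<phi> ((z + r *\<^sub>R h) + (x - z)) - \<phi> (z + r *\<^sub>R h)\<bar>)\<^sup>2 \<partial>lborel)"
  proof (rule nn_integral_mono)
    fix h
    have e: "(z + r *\<^sub>R h) + (x - z) = x + r *\<^sub>R h" by simp
    show "(ennreal \<bar>\<phi> (x + r *\<^sub>R h) - \<phi> (z + r *\<^sub>R h)\<bar>)\<^sup>2 * indicator unit_cube h
        \<le> (ennreal \<bar>\<phi> ((z + r *\<^sub>R h) + (x - z)) - \<phi> (z + r *\<^sub>R h)\<bar>)\<^sup>2"
      unfolding e by (auto simp: indicator_def)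
  qed
  also have "\<dots> = ennreal (1 / r ^ CARD('n)) * (\<integral>\<^sup>+y. (ennreal \<bar>\<phi> (y + (x - z)) - \<phi> y\<bar>)\<^sup>2 \<partial>lborel)"
    using nn_integral_lborel_affine[of "\<lambda>y. (ennreal \<bar>\<phi> (y + (x - z)) - \<phi> y\<bar>)\<^sup>2" r z] r by simp
  also have "\<dots> \<le> ennreal (1 / r ^ CARD('n)) * ennreal ((norm (x - z))\<^sup>2 * nsq \<mu> (grad \<phi>))"
    by (intro mult_left_mono translation_le[OF \<phi>]) simp
  also have "\<dots> = ennreal (1 / r ^ CARD('n) * ((norm (x - z))\<^sup>2 * nsq \<mu> (grad \<phi>)))"
    using r by (subst ennreal_mult) auto
  finally have "ennreal ((avg \<phi> r x - avg \<phi> r z)\<^sup>2) \<le> ennreal (1 / r ^ CARD('n) * ((norm (x - z))\<^sup>2 * nsq \<mu> (grad \<phi>)))"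
    by (simp add: ennreal_power)
  then show ?thesis using r by (subst (asm) ennreal_le_iff) auto
qed

lemma avg_sq_le:
  assumes \<phi>: "\<phi> \<in> test_functions \<Omega>" and r: "0 < r"
  shows "(avg \<phi> r x)\<^sup>2 \<le> 1 / r ^ CARD('n) * nsq \<mu> \<phi>"
proof -
  note [measurable] = test_borel[OF \<phi>]
  have "(ennreal \<bar>avg \<phi> r x\<bar>)\<^sup>2 \<le> (\<integral>\<^sup>+h\<in>unit_cube. (ennreal \<bar>\<phi> (x + r *\<^sub>R h)\<bar>)\<^sup>2 \<partial>lborel)"
    using avg_diff_sq_le[OF \<phi>, of "\<lambda>_. 0" r x] by simp
  also have "\<dots> \<le> (\<integral>\<^sup>+h. (ennreal \<bar>\<phi> (x + r *\<^sub>R h)\<bar>)\<^sup>2 \<partial>lborel)"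
    by (intro nn_integral_mono) (auto simp: indicator_def)
  also have "\<dots> = ennreal (1 / r ^ CARD('n)) * (\<integral>\<^sup>+y. (ennreal \<bar>\<phi> y\<bar>)\<^sup>2 \<partial>lborel)"
    using nn_integral_lborel_affine[of "\<lambda>y. (ennreal \<bar>\<phi> y\<bar>)\<^sup>2" r x] r by simp
  also have "(\<integral>\<^sup>+y. (ennreal \<bar>\<phi> y\<bar>)\<^sup>2 \<partial>lborel) = ennreal (nsq \<mu> \<phi>)" by (rule nn_integral_test_sq[OF \<phi>])
  also have "ennreal (1 / r ^ CARD('n)) * ennreal (nsq \<mu> \<phi>) = ennreal (1 / r ^ CARD('n) * nsq \<mu> \<phi>)"
    using r by (subst ennreal_mult) auto
  finally have "ennreal ((avg \<phi> r x)\<^sup>2) \<le> ennreal (1 / r ^ CARD('n) * nsq \<mu> \<phi>)"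
    by (simp add: ennreal_power)
  then show ?thesis using r by (subst (asm) ennreal_le_iff) auto
qed

lemma avg_continuous:
  assumes \<phi>: "\<phi> \<in> test_functions \<Omega>" and r: "0 < r"
  shows "continuous_on UNIV (avg \<phi> r)"
proof -
  define C where "C = sqrt (1 / r ^ CARD('n) * nsq \<mu> (grad \<phi>))"
  have "\<bar>avg \<phi> r x - avg \<phi> r z\<bar> \<le> C * norm (x - z)" for x z
  proof -
    have "\<bar>avg \<phi> r x - avg \<phi> r z\<bar> = sqrt ((avg \<phi> r x - avg \<phi> r z)\<^sup>2)" by simp
    also have "\<dots> \<le> sqrt (1 / r ^ CARD('n) * nsq \<mu> (grad \<phi>) * (norm (x - z))\<^sup>2)"
      using avg_shift[OF \<phi> r, of x z] by (intro real_sqrt_le_mono) (simp add: mult_ac)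
    also have "\<dots> = C * norm (x - z)" unfolding C_def real_sqrt_mult[of _ "(norm (x - z))\<^sup>2"] by simp
    finally show ?thesis .
  qed
  moreover have "0 \<le> C" using r by (simp add: C_def)
  ultimately have "C-lipschitz_on UNIV (avg \<phi> r)" by (intro lipschitz_onI) (auto simp: dist_real_def dist_norm)
  then show ?thesis by (rule lipschitz_on_continuous_on)
qed

lemma avg_L2:
  assumes \<phi>: "\<phi> \<in> test_functions \<Omega>" and r: "0 < r"
  shows "avg \<phi> r \<in> L2_on \<mu>"
proof (rule L2_on_bounded[OF fin])
  show "avg \<phi> r \<in> borel_measurable \<mu>"
    by (intro borel_measurable_mu borel_measurable_continuous_onI avg_continuous[OF assms])
  fix x
  have "\<bar>avg \<phi> r x\<bar> = sqrt ((avg \<phi> r x)\<^sup>2)" by simp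
  also have "\<dots> \<le> sqrt (1 / r ^ CARD('n) * nsq \<mu> \<phi>)" by (intro real_sqrt_le_mono avg_sq_le[OF assms])
  finally show "norm (avg \<phi> r x) \<le> sqrt (1 / r ^ CARD('n) * nsq \<mu> \<phi>)" by simp
qed

lemma avg_close:
  assumes \<phi>: "\<phi> \<in> test_functions \<Omega>" and r: "0 < r"
  shows "nsq \<mu> (\<lambda>x. avg \<phi> r x - \<phi> x) \<le> (2 * real CARD('n) * r)\<^sup>2 * nsq \<mu> (grad \<phi>)"
proof -
  note [measurable] = test_borel[OF \<phi>] borel_measurable_continuous_onI[OF avg_continuous[OF assms]]
  have pt: "(ennreal \<bar>avg \<phi> r x - \<phi> x\<bar>)\<^sup>2 \<le> (\<integral>\<^sup>+h\<in>unit_cube. (ennreal \<bar>\<phi> (x + r *\<^sub>R h) - \<phi> x\<bar>)\<^sup>2 \<partial>lborel)" for x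
  proof -
    have "integrable lborel (\<lambda>h. indicator (unit_cube :: (real^'n) set) h * \<phi> x)"
      by (intro integrable_mult_left integrable_real_indicator) (auto simp: emeasure_unit_cube)
    from avg_diff_sq_le[OF \<phi> this, of r x] show ?thesis unfolding integral_unit_cube_const by simp
  qed
  have "ennreal (nsq \<mu> (\<lambda>x. avg \<phi> r x - \<phi> x)) = (\<integral>\<^sup>+x. (ennreal \<bar>avg \<phi> r x - \<phi> x\<bar>)\<^sup>2 \<partial>\<mu>)"
    using nn_integral_eq_nsq[OF L2_on_diff[OF avg_L2[OF assms] test_L2(1)[OF \<phi>]]] by simp
  also have "\<dots> \<le> (\<integral>\<^sup>+x. (ennreal \<bar>avg \<phi> r x - \<phi> x\<bar>)\<^sup>2 \<partial>lborel)"
    by (rule nn_integral_mu_le_lborel) measurable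
  also have "\<dots> \<le> (\<integral>\<^sup>+x. (\<integral>\<^sup>+h\<in>unit_cube. (ennreal \<bar>\<phi> (x + r *\<^sub>R h) - \<phi> x\<bar>)\<^sup>2 \<partial>lborel) \<partial>lborel)"
    by (rule nn_integral_mono) (rule pt)
  also have "\<dots> = (\<integral>\<^sup>+h. (\<integral>\<^sup>+x. (ennreal \<bar>\<phi> (x + r *\<^sub>R h) - \<phi> x\<bar>)\<^sup>2 * indicator unit_cube h \<partial>lborel) \<partial>lborel)"
    by (rule lborel_pair.Fubini') measurable
  also have "\<dots> \<le> (\<integral>\<^sup>+h. ennreal ((2 * real CARD('n) * r)\<^sup>2 * nsq \<mu> (grad \<phi>)) * indicator (unit_cube :: (real^'n) set) h \<partial>lborel)"
  proof (rule nn_integral_mono)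
    fix h :: "real^'n"
    show "(\<integral>\<^sup>+x. (ennreal \<bar>\<phi> (x + r *\<^sub>R h) - \<phi> x\<bar>)\<^sup>2 * indicator unit_cube h \<partial>lborel)
        \<le> ennreal ((2 * real CARD('n) * r)\<^sup>2 * nsq \<mu> (grad \<phi>)) * indicator unit_cube h"
    proof (cases "h \<in> unit_cube")
      case True
      have "norm (r *\<^sub>R h) \<le> 2 * real CARD('n) * r"
        using norm_unit_cube(2)[OF True] r by (simp add: mult.commute)
      then have "(norm (r *\<^sub>R h))\<^sup>2 * nsq \<mu> (grad \<phi>) \<le> (2 * real CARD('n) * r)\<^sup>2 * nsq \<mu> (grad \<phi>)"
        by (intro mult_right_mono power_mono) auto
      then show ?thesis using translation_le[OF \<phi>, of "r *\<^sub>R h"] True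
        by (auto intro: order_trans ennreal_leI)
    qed simp
  qed
  also have "\<dots> = ennreal ((2 * real CARD('n) * r)\<^sup>2 * nsq \<mu> (grad \<phi>))"
    by (simp add: nn_integral_cmult emeasure_unit_cube)
  finally show ?thesis by (subst (asm) ennreal_le_iff) auto
qed

end

section \<open>Compactness\<close>

lemma diagonal_convergent_subseq:
  fixes a :: "nat \<Rightarrow> nat \<Rightarrow> real"
  assumes "\<And>i. bounded (range (a i))"
  obtains r where "strict_mono r" "\<And>i. convergent (\<lambda>j. a i (r j))"
proof -
  interpret subseqs "\<lambda>i s. convergent (\<lambda>j. a i (s j))"
  proof
    fix i and s :: "nat \<Rightarrow> nat" assume "strict_mono s"
    have "bounded (range (\<lambda>j. a i (s j)))" using assms[of i] by (rule bounded_subset) auto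
    from bounded_imp_convergent_subsequence[OF this] obtain l r where
      "strict_mono r" "((\<lambda>j. a i (s j)) \<circ> r) \<longlonglongrightarrow> l" by blast
    then show "\<exists>r'. strict_mono r' \<and> convergent (\<lambda>j. a i ((s \<circ> r') j))"
      by (auto simp: convergent_def o_def)
  qed
  have c: "convergent (\<lambda>j. a i (diagseq j))" for i
  proof -
    have "convergent (\<lambda>j. a i ((diagseq \<circ> (+) (Suc i)) j))"
    proof (rule diagseq_holds)
      fix r s :: "nat \<Rightarrow> nat" and n assume "strict_mono r" "convergent (\<lambda>j. a n (s j))"
      then show "convergent (\<lambda>j. a n ((s \<circ> r) j))"
        using convergent_subseq_convergent[of "\<lambda>j. a n (s j)" r] by (simp add: o_def)
    qed
    then have "convergent (\<lambda>j. a i (diagseq (j + Suc i)))" by (simp add: o_def add.commute)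
    then show ?thesis using convergent_ignore_initial_segment[of "\<lambda>j. a i (diagseq j)" "Suc i"] by blast
  qed
  show ?thesis by (rule that[OF subseq_diagseq c])
qed

context bounded_open
begin

text \<open>
  On the averages of a bounded sequence, which are uniformly Lipschitz, a diagonal argument over a
  countable dense set applies.  The averages differ from the functions by little, uniformly along
  the sequence.
\<close>

lemma Rellich_test:
  assumes \<phi>: "\<And>j. \<phi> j \<in> test_functions \<Omega>" and B: "\<And>j. nsq \<mu> (\<phi> j) \<le> B" "\<And>j. nsq \<mu> (grad (\<phi> j)) \<le> B"
  shows "\<exists>r :: nat \<Rightarrow> nat. strict_mono r \<and>
    (\<forall>e>0. \<exists>N. \<forall>i\<ge>N. \<forall>j\<ge>N. nsq \<mu> (\<lambda>x. \<phi> (r i) x - \<phi> (r j) x) < e)"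
proof -
  have B0: "0 \<le> B" using B(1)[of 0] nsq_nonneg[of \<mu> "\<phi> 0"] by linarith
  obtain D :: "(real^'n) set" where D: "countable D" "\<And>X. open X \<Longrightarrow> X \<noteq> {} \<Longrightarrow> \<exists>d\<in>D. d \<in> X"
    using countable_dense_setE by blast
  have Dne: "D \<noteq> {}" using D(2)[of UNIV] by auto
  define s where "s m = 1 / real (Suc m)" for m
  have s: "0 < s m" for m by (simp add: s_def)
  define a where "a i j = avg (\<phi> j) (s (fst (prod_decode i))) (from_nat_into D (snd (prod_decode i)))" for i j
  have avgb: "\<bar>avg (\<phi> j) (s m) x\<bar> \<le> sqrt (1 / s m ^ CARD('n) * B)" for j m x
  proof -
    have "(avg (\<phi> j) (s m) x)\<^sup>2 \<le> 1 / s m ^ CARD('n) * B"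
      by (rule order_trans[OF avg_sq_le[OF \<phi> s] mult_left_mono[OF B(1)]]) (use s[of m] in simp)
    then show ?thesis using real_le_rsqrt[of "\<bar>avg (\<phi> j) (s m) x\<bar>"] by simp
  qed
  have "bounded (range (a i))" for i
    unfolding bounded_iff a_def using avgb by (auto intro!: exI)
  from diagonal_convergent_subseq[of a, OF this] obtain r where r: "strict_mono r" "\<And>i. convergent (\<lambda>j. a i (r j))" by blast
  have cD: "convergent (\<lambda>j. avg (\<phi> (r j)) (s m) d)" if dD: "d \<in> D" for m d
  proof -
    obtain k where "from_nat_into D k = d" using from_nat_into_surj[OF D(1) dD] by blast
    then show ?thesis using r(2)[of "prod_encode (m, k)"] by (simp add: a_def)
  qed
  have cx: "convergent (\<lambda>j. avg (\<phi> (r j)) (s m) x)" for m x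
  proof -
    define C where "C = sqrt (1 / s m ^ CARD('n) * B) + 1"
    have C: "C > 0" using s[of m] B0 by (auto simp: C_def add_nonneg_pos)
    have lip: "\<bar>avg (\<phi> j) (s m) x - avg (\<phi> j) (s m) d\<bar> \<le> C * norm (x - d)" for j d
    proof -
      have "(avg (\<phi> j) (s m) x - avg (\<phi> j) (s m) d)\<^sup>2 \<le> 1 / s m ^ CARD('n) * ((norm (x - d))\<^sup>2 * B)"
        by (rule order_trans[OF avg_shift[OF \<phi> s] mult_left_mono[OF mult_left_mono[OF B(2)]]]) (use s[of m] in simp_all)
      then have "\<bar>avg (\<phi> j) (s m) x - avg (\<phi> j) (s m) d\<bar> \<le> sqrt (1 / s m ^ CARD('n) * ((norm (x - d))\<^sup>2 * B))"
        using real_le_rsqrt[of "\<bar>avg (\<phi> j) (s m) x - avg (\<phi> j) (s m) d\<bar>"] by simp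
      also have "\<dots> = sqrt (1 / s m ^ CARD('n) * B) * norm (x - d)"
        by (simp add: real_sqrt_mult real_sqrt_divide)
      also have "\<dots> \<le> C * norm (x - d)" by (intro mult_right_mono) (auto simp: C_def)
      finally show ?thesis .
    qed
    have "Cauchy (\<lambda>j. avg (\<phi> (r j)) (s m) x)"
    proof (rule CauchyI)
      fix e :: real assume e: "e > 0"
      have "ball x (e / (4 * C)) \<noteq> {}" using e C by (simp add: not_le)
      from D(2)[OF open_ball this] obtain d where d: "d \<in> D" "dist x d < e / (4 * C)" by auto
      have near: "\<bar>avg (\<phi> j) (s m) x - avg (\<phi> j) (s m) d\<bar> \<le> e / 4" for j
      proof -
        have "C * norm (x - d) \<le> C * (e / (4 * C))" using d(2) C by (intro mult_left_mono) (auto simp: dist_norm)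
        then show ?thesis using lip[of j d] C by simp
      qed
      have "Cauchy (\<lambda>j. avg (\<phi> (r j)) (s m) d)" using cD[OF d(1)] by (simp add: Cauchy_convergent_iff)
      from CauchyD[OF this, of "e / 4"] obtain N where
        N: "\<And>i j. i \<ge> N \<Longrightarrow> j \<ge> N \<Longrightarrow> \<bar>avg (\<phi> (r i)) (s m) d - avg (\<phi> (r j)) (s m) d\<bar> < e / 4"
        using e by auto
      have "\<bar>avg (\<phi> (r i)) (s m) x - avg (\<phi> (r j)) (s m) x\<bar> < e" if "i \<ge> N" "j \<ge> N" for i j
        using N[OF that] near[of "r i"] near[of "r j"] e by linarith
      then show "\<exists>N. \<forall>i\<ge>N. \<forall>j\<ge>N. norm (avg (\<phi> (r i)) (s m) x - avg (\<phi> (r j)) (s m) x) < e" by auto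
    qed
    then show ?thesis by (simp add: Cauchy_convergent_iff)
  qed
  have main: "\<exists>N. \<forall>i\<ge>N. \<forall>j\<ge>N. nsq \<mu> (\<lambda>x. \<phi> (r i) x - \<phi> (r j) x) < e" if e: "e > 0" for e
  proof -
    define K where "K = (2 * real CARD('n))\<^sup>2 * B + 1"
    have K: "K > 0" using B0 by (auto simp: K_def add_nonneg_pos)
    have eK: "0 < min 1 (e / (12 * K))" using e K by simp
    obtain m where m: "1 / real (Suc m) < min 1 (e / (12 * K))"
      using nat_approx_posE[OF eK] by blast
    then have sm: "s m < 1" "s m < e / (12 * K)" by (auto simp: s_def)
    have "(s m)\<^sup>2 \<le> s m" using sm(1) s[of m] by (simp add: power2_eq_square mult_left_le)
    have close: "nsq \<mu> (\<lambda>x. avg (\<phi> j) (s m) x - \<phi> j x) \<le> e / 12" for j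
    proof -
      have "nsq \<mu> (\<lambda>x. avg (\<phi> j) (s m) x - \<phi> j x) \<le> (2 * real CARD('n) * s m)\<^sup>2 * B"
        by (rule order_trans[OF avg_close[OF \<phi> s] mult_left_mono[OF B(2)]]) simp
      also have "\<dots> = (s m)\<^sup>2 * ((2 * real CARD('n))\<^sup>2 * B)" by (simp add: power_mult_distrib)
      also have "\<dots> \<le> s m * K" using \<open>(s m)\<^sup>2 \<le> s m\<close> B0 s[of m] by (intro mult_mono) (auto simp: K_def)
      also have "\<dots> \<le> e / (12 * K) * K" using sm(2) K by (intro mult_right_mono) auto
      finally show ?thesis using K by simp
    qed
    define g0 where "g0 x = lim (\<lambda>j. avg (\<phi> (r j)) (s m) x)" for x
    have lim: "(\<lambda>j. avg (\<phi> (r j)) (s m) x) \<longlonglongrightarrow> g0 x" for x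
      using cx[of m x] by (simp add: g0_def convergent_LIMSEQ_iff)
    have am: "avg (\<phi> j) (s m) \<in> borel_measurable \<mu>" for j by (rule L2_onD(1)[OF avg_L2[OF \<phi> s]])
    have gm: "g0 \<in> borel_measurable \<mu>" by (rule borel_measurable_LIMSEQ_real[OF lim am])
    have ci: "integrable \<mu> (\<lambda>x. 1 / s m ^ CARD('n) * B)" using fin by (simp add: finite_measure.integrable_const)
    have b: "AE x in \<mu>. (norm (avg (\<phi> (r j)) (s m) x))\<^sup>2 \<le> 1 / s m ^ CARD('n) * B" for j
    proof (rule AE_I2)
      fix x show "(norm (avg (\<phi> (r j)) (s m) x))\<^sup>2 \<le> 1 / s m ^ CARD('n) * B"
        unfolding real_norm_def power2_abs
        by (rule order_trans[OF avg_sq_le[OF \<phi> s] mult_left_mono[OF B(1)]]) (use s[of m] in simp)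
    qed
    note dc = L2_dominated_convergence[OF am gm AE_I2[OF lim] ci b]
    from order_tendstoD(2)[OF dc(2), of "e / 48"] e obtain N where
      N: "\<And>j. j \<ge> N \<Longrightarrow> nsq \<mu> (\<lambda>x. avg (\<phi> (r j)) (s m) x - g0 x) < e / 48"
      by (auto simp: eventually_sequentially)
    have "nsq \<mu> (\<lambda>x. \<phi> (r i) x - \<phi> (r j) x) < e" if "i \<ge> N" "j \<ge> N" for i j
    proof -
      let ?A = "\<lambda>j. avg (\<phi> (r j)) (s m)"
      note L = test_L2(1)[OF \<phi>[of "r i"]] test_L2(1)[OF \<phi>[of "r j"]] avg_L2[OF \<phi>[of "r i"] s[of m]] avg_L2[OF \<phi>[of "r j"] s[of m]]
      have "nsq \<mu> (\<lambda>x. ?A i x - ?A j x) \<le> 2 * nsq \<mu> (\<lambda>x. ?A i x - g0 x) + 2 * nsq \<mu> (\<lambda>x. g0 x - ?A j x)"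
        by (rule nsq_diff_triangle[OF L(3) dc(1) L(4)])
      then have 1: "nsq \<mu> (\<lambda>x. ?A i x - ?A j x) < e / 12"
        using N[OF that(1)] N[OF that(2)] nsq_minus_commute[of \<mu> g0 "?A j"] by linarith
      have 2: "nsq \<mu> (\<lambda>x. ?A i x - \<phi> (r j) x) \<le> 2 * nsq \<mu> (\<lambda>x. ?A i x - ?A j x) + 2 * nsq \<mu> (\<lambda>x. ?A j x - \<phi> (r j) x)"
        by (rule nsq_diff_triangle[OF L(3,4,2)])
      have "nsq \<mu> (\<lambda>x. \<phi> (r i) x - \<phi> (r j) x) \<le> 2 * nsq \<mu> (\<lambda>x. \<phi> (r i) x - ?A i x) + 2 * nsq \<mu> (\<lambda>x. ?A i x - \<phi> (r j) x)"
        by (rule nsq_diff_triangle[OF L(1,3,2)])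
      then show ?thesis
        using 1 2 close[of "r i"] close[of "r j"] nsq_minus_commute[of \<mu> "\<phi> (r i)" "?A i"] e by linarith
    qed
    then show ?thesis by blast
  qed
  show ?thesis using r(1) main by blast
qed

lemma Rellich:
  assumes H: "\<And>j. H0 \<Omega> (y j) (G j)" and B: "\<And>j. nsq \<mu> (y j) \<le> B" "\<And>j. nsq \<mu> (G j) \<le> B"
  shows "\<exists>(r :: nat \<Rightarrow> nat) y0. strict_mono r \<and> y0 \<in> L2_on \<mu> \<and> (AE x in \<mu>. (\<lambda>j. y (r j) x) \<longlonglongrightarrow> y0 x)"
proof -
  have "\<forall>j. \<exists>\<phi>. \<phi> \<in> test_functions \<Omega> \<and> nsq \<mu> (\<lambda>x. \<phi> x - y j x) < 1 / Suc j \<and> nsq \<mu> (\<lambda>x. grad \<phi> x - G j x) < 1 / Suc j"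
    by (intro allI H0_approx_within[OF H]) simp
  from choice[OF this] obtain \<phi> where \<phi>: "\<And>j. \<phi> j \<in> test_functions \<Omega>" "\<And>j. nsq \<mu> (\<lambda>x. \<phi> j x - y j x) < 1 / Suc j"
    "\<And>j. nsq \<mu> (\<lambda>x. grad (\<phi> j) x - G j x) < 1 / Suc j" by blast
  have s1: "1 / real (Suc j) \<le> 1" for j by simp
  have b1: "nsq \<mu> (\<phi> j) \<le> 2 + 2 * B" for j
  proof -
    have "nsq \<mu> (\<lambda>x. (\<phi> j x - y j x) + y j x) \<le> 2 * nsq \<mu> (\<lambda>x. \<phi> j x - y j x) + 2 * nsq \<mu> (y j)"
      by (rule nsq_add_le[OF L2_on_diff[OF test_L2(1)[OF \<phi>(1)] H0_L2(1)[OF H]] H0_L2(1)[OF H]])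
    then show ?thesis using less_le_trans[OF \<phi>(2) s1, of j] B(1)[of j] by simp
  qed
  have b2: "nsq \<mu> (grad (\<phi> j)) \<le> 2 + 2 * B" for j
  proof -
    have "nsq \<mu> (\<lambda>x. (grad (\<phi> j) x - G j x) + G j x) \<le> 2 * nsq \<mu> (\<lambda>x. grad (\<phi> j) x - G j x) + 2 * nsq \<mu> (G j)"
      by (rule nsq_add_le[OF L2_on_diff[OF test_L2(2)[OF \<phi>(1)] H0_L2(2)[OF H]] H0_L2(2)[OF H]])
    then show ?thesis using less_le_trans[OF \<phi>(3) s1, of j] B(2)[of j] by simp
  qed
  obtain r where r: "strict_mono (r :: nat \<Rightarrow> nat)"
    "\<forall>e>0. \<exists>N. \<forall>i\<ge>N. \<forall>j\<ge>N. nsq \<mu> (\<lambda>x. \<phi> (r i) x - \<phi> (r j) x) < e"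
    using Rellich_test[of \<phi> "2 + 2 * B", OF \<phi>(1) b1 b2] by blast
  obtain y0 where y0: "y0 \<in> L2_on \<mu>" "(\<lambda>k. nsq \<mu> (\<lambda>x. \<phi> (r k) x - y0 x)) \<longlonglongrightarrow> 0"
    by (rule L2_complete[OF fin test_L2(1)[OF \<phi>(1)] r(2)[rule_format]]) blast
  have c: "(\<lambda>k. nsq \<mu> (\<lambda>x. y (r k) x - y0 x)) \<longlonglongrightarrow> 0"
  proof (rule tendsto_sandwich[OF _ _ tendsto_const])
    show "\<forall>\<^sub>F k in sequentially. nsq \<mu> (\<lambda>x. y (r k) x - y0 x) \<le> 2 * (1 / real (Suc k)) + 2 * nsq \<mu> (\<lambda>x. \<phi> (r k) x - y0 x)"
    proof (intro always_eventually allI)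
      fix k
      have "1 / real (Suc (r k)) \<le> 1 / real (Suc k)" using seq_suble[OF r(1), of k] by (intro frac_le) auto
      then show "nsq \<mu> (\<lambda>x. y (r k) x - y0 x) \<le> 2 * (1 / real (Suc k)) + 2 * nsq \<mu> (\<lambda>x. \<phi> (r k) x - y0 x)"
        using nsq_diff_triangle[OF H0_L2(1)[OF H[of "r k"]] test_L2(1)[OF \<phi>(1)[of "r k"]] y0(1)]
          \<phi>(2)[of "r k"] nsq_minus_commute[of \<mu> "\<phi> (r k)" "y (r k)"] by argo
    qed
    show "(\<lambda>k. 2 * (1 / real (Suc k)) + 2 * nsq \<mu> (\<lambda>x. \<phi> (r k) x - y0 x)) \<longlonglongrightarrow> 0"
      using tendsto_add[OF tendsto_mult_right_zero[OF LIMSEQ_Suc[OF lim_1_over_n], of 2] tendsto_mult_right_zero[OF y0(2), of 2]]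
      by simp
  qed simp
  obtain r' where r': "strict_mono r'" "AE x in \<mu>. (\<lambda>k. y (r (r' k)) x) \<longlonglongrightarrow> y0 x"
    by (rule L2_conv_AE_subseq[OF H0_L2(1)[OF H] y0(1) c]) blast
  show ?thesis
    using strict_mono_o[OF r(1) r'(1)] y0(1) r'(2) by (intro exI[of _ "r \<circ> r'"] exI[of _ y0]) simp
qed

end

section \<open>The embedding into \<open>L\<^sup>4\<close> in dimension at most four\<close>

lemma Chebyshev_nsq:
  assumes g: "g \<in> L2_on M" and s: "0 < s" and fin: "finite_measure M"
  shows "s\<^sup>2 * measure M {x \<in> space M. s < norm (g x)} \<le> nsq M g"
proof -
  note [measurable] = L2_onD(1)[OF g]
  interpret finite_measure M by (rule fin)
  have "s\<^sup>2 * measure M {x \<in> space M. s < norm (g x)} = (LINT x|M. s\<^sup>2 * indicator {x \<in> space M. s < norm (g x)} x)"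
    by simp
  also have "\<dots> \<le> nsq M g" unfolding nsq_def
  proof (rule integral_mono)
    show "integrable M (\<lambda>x. s\<^sup>2 * indicator {x \<in> space M. s < norm (g x)} x)"
      by (intro integrable_mult_right integrable_real_indicator) (auto simp: emeasure_eq_measure)
    show "integrable M (\<lambda>x. (norm (g x))\<^sup>2)" by (rule L2_onD(2)[OF g])
    show "s\<^sup>2 * indicator {x \<in> space M. s < norm (g x)} x \<le> (norm (g x))\<^sup>2" for x
      using s by (auto simp: indicator_def intro!: power_mono)
  qed
  finally show ?thesis .
qed

lemma ennreal_le_sqrt: "a\<^sup>2 \<le> ennreal b \<Longrightarrow> 0 \<le> b \<Longrightarrow> a \<le> ennreal (sqrt b)"
proof (cases a)
  case (real r)
  assume "a\<^sup>2 \<le> ennreal b" "0 \<le> b"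
  then have "r\<^sup>2 \<le> b" using real by (simp add: ennreal_power)
  then show ?thesis using real by (simp add: ennreal_leI real_le_rsqrt)
next
  case top
  assume "a\<^sup>2 \<le> ennreal b"
  then show ?thesis using top by (simp add: power2_eq_square top_unique)
qed

context bounded_open
begin

text \<open>
  The averages over cubes at distance comparable to \<open>r\<close> vanish once \<open>r\<close> exceeds the diameter.
  Their decay is controlled by integrating the gradient along the rays from \<open>x\<close>, and the average of
  the gradient at scale \<open>s\<close> is at most \<open>s powr (- N / 2)\<close> times its \<open>L\<^sup>2\<close> norm, which for \<open>N \<le> 4\<close> is
  bounded by a multiple of \<open>1 / s\<^sup>2\<close>.
\<close>

lemma avg_sup:
  assumes N4: "CARD('n) \<le> 4"
  shows "\<exists>c>0. \<exists>D>0. \<forall>\<phi>\<in>test_functions \<Omega>. \<forall>x\<in>\<Omega>. \<forall>r. 0 < r \<longrightarrow> r \<le> D \<longrightarrow>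
    \<bar>avg \<phi> r x\<bar> \<le> c * sqrt (nsq \<mu> (grad \<phi>)) / r"
proof -
  obtain R where R: "\<Omega> \<subseteq> ball 0 R" "R > 0" using bounded_subset_ballD[OF bounded_dom, of 0] by blast
  define D where "D = 2 * R"
  define m where "m = max 1 D"
  define \<kappa> where "\<kappa> = 2 * real CARD('n)"
  have D: "D > 0" "1 \<le> m" "D \<le> m" "0 < \<kappa>" using R(2) by (auto simp: D_def m_def \<kappa>_def)
  have "\<bar>avg \<phi> r x\<bar> \<le> \<kappa> * m\<^sup>2 * sqrt (nsq \<mu> (grad \<phi>)) / r"
    if \<phi>: "\<phi> \<in> test_functions \<Omega>" and x: "x \<in> \<Omega>" and r: "0 < r" "r \<le> D" for \<phi> x r
  proof -
    note [measurable] = test_borel[OF \<phi>]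
    let ?E = "nsq \<mu> (grad \<phi>)"
    define K where "K = \<kappa> * m\<^sup>2 * sqrt ?E"
    have K: "0 \<le> K" using D by (simp add: K_def)
    have far: "\<phi> (x + D *\<^sub>R h) = 0" if "h \<in> unit_cube" for h
    proof -
      have "D \<le> norm (D *\<^sub>R h)" using norm_unit_cube(1)[OF that] D by simp
      moreover have "norm x < R" using x R(1) by auto
      ultimately have "norm (x + D *\<^sub>R h) \<ge> R"
        using norm_triangle_ineq4[of "x + D *\<^sub>R h" x] by (simp add: D_def)
      then have "x + D *\<^sub>R h \<notin> \<Omega>" using R(1) by auto
      then show ?thesis by (rule test_outside(1)[OF \<phi>])
    qed
    have ray: "ennreal \<bar>\<phi> (x + r *\<^sub>R h)\<bar> * indicator unit_cube h
        \<le> (\<integral>\<^sup>+s\<in>{r..D}. ennreal \<kappa> * ennreal (norm (grad \<phi> (x + s *\<^sub>R h))) * indicator unit_cube h \<partial>lborel)" for h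
    proof (cases "h \<in> unit_cube")
      case True
      have "ennreal \<bar>\<phi> (x + r *\<^sub>R h)\<bar> \<le> (\<integral>\<^sup>+s\<in>{r..D}. ennreal (norm (grad \<phi> (x + s *\<^sub>R h)) * norm h) \<partial>lborel)"
        using test_diff_along[OF \<phi> r(2), of x h] far[OF True] by simp
      also have "\<dots> \<le> (\<integral>\<^sup>+s\<in>{r..D}. ennreal \<kappa> * ennreal (norm (grad \<phi> (x + s *\<^sub>R h))) * indicator unit_cube h \<partial>lborel)"
      proof (intro nn_integral_mono mult_right_mono)
        fix s
        have "norm (grad \<phi> (x + s *\<^sub>R h)) * norm h \<le> \<kappa> * norm (grad \<phi> (x + s *\<^sub>R h))"
          using norm_unit_cube(2)[OF True] by (subst mult.commute) (intro mult_right_mono, auto simp: \<kappa>_def)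
        then have "ennreal (norm (grad \<phi> (x + s *\<^sub>R h)) * norm h) \<le> ennreal (\<kappa> * norm (grad \<phi> (x + s *\<^sub>R h)))"
          by (rule ennreal_leI)
        then show "ennreal (norm (grad \<phi> (x + s *\<^sub>R h)) * norm h)
          \<le> ennreal \<kappa> * ennreal (norm (grad \<phi> (x + s *\<^sub>R h))) * indicator unit_cube h"
          using True D by (simp add: ennreal_mult)
      qed simp
      finally show ?thesis using True by simp
    qed simp
    have at_scale: "(\<integral>\<^sup>+h\<in>unit_cube. ennreal (norm (grad \<phi> (x + s *\<^sub>R h))) \<partial>lborel) \<le> ennreal (m\<^sup>2 * sqrt ?E / s\<^sup>2)"
      if s: "s \<in> {r..D}" for s
    proof -
      have s0: "0 < s" "s \<le> m" using s r D by auto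
      have "(\<integral>\<^sup>+h\<in>unit_cube. ennreal (norm (grad \<phi> (x + s *\<^sub>R h))) \<partial>lborel)\<^sup>2
          \<le> (\<integral>\<^sup>+h\<in>unit_cube. (ennreal (norm (grad \<phi> (x + s *\<^sub>R h))))\<^sup>2 \<partial>lborel) * emeasure lborel (unit_cube :: (real^'n) set)"
        by (rule Cauchy_Schwarz_set_nn_integral) measurable
      also have "\<dots> = (\<integral>\<^sup>+h\<in>unit_cube. (ennreal (norm (grad \<phi> (x + s *\<^sub>R h))))\<^sup>2 \<partial>lborel)"
        by (simp add: emeasure_unit_cube)
      also have "\<dots> \<le> (\<integral>\<^sup>+h. (ennreal (norm (grad \<phi> (x + s *\<^sub>R h))))\<^sup>2 \<partial>lborel)"
        by (intro nn_integral_mono) (auto simp: indicator_def)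
      also have "\<dots> = ennreal (1 / s ^ CARD('n)) * (\<integral>\<^sup>+y. (ennreal (norm (grad \<phi> y)))\<^sup>2 \<partial>lborel)"
        using nn_integral_lborel_affine[of "\<lambda>y. (ennreal (norm (grad \<phi> y)))\<^sup>2" s x] s0 by simp
      also have "\<dots> = ennreal (1 / s ^ CARD('n) * ?E)"
        using s0 by (simp add: nn_integral_grad_sq[OF \<phi>] ennreal_mult[symmetric])
      finally have "(\<integral>\<^sup>+h\<in>unit_cube. ennreal (norm (grad \<phi> (x + s *\<^sub>R h))) \<partial>lborel) \<le> ennreal (sqrt (1 / s ^ CARD('n) * ?E))"
        by (rule ennreal_le_sqrt) (use s0 in auto)
      also have "sqrt (1 / s ^ CARD('n) * ?E) \<le> m\<^sup>2 * sqrt ?E / s\<^sup>2"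
      proof -
        have "s ^ 4 = s ^ CARD('n) * s ^ (4 - CARD('n))" using N4 by (simp add: power_add[symmetric])
        also have "s ^ (4 - CARD('n)) \<le> m ^ (4 - CARD('n))" using s0 by (intro power_mono) auto
        also have "m ^ (4 - CARD('n)) \<le> m ^ 4" using D by (intro power_increasing) auto
        finally have "s ^ 4 \<le> s ^ CARD('n) * m ^ 4" using s0 by simp
        then have "1 / s ^ CARD('n) \<le> m ^ 4 / s ^ 4" using s0 by (simp add: divide_simps mult.commute)
        then have "sqrt (1 / s ^ CARD('n) * ?E) \<le> sqrt ((m\<^sup>2 / s\<^sup>2)\<^sup>2 * ?E)"
          by (intro real_sqrt_le_mono mult_right_mono) (simp_all add: power_divide power_mult[symmetric])
        also have "\<dots> = m\<^sup>2 / s\<^sup>2 * sqrt ?E" by (simp add: real_sqrt_mult)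
        finally show ?thesis by simp
      qed
      finally show ?thesis by (auto simp: ennreal_leI)
    qed
    have "ennreal \<bar>avg \<phi> r x\<bar> \<le> (\<integral>\<^sup>+h. ennreal (norm (indicator unit_cube h * \<phi> (x + r *\<^sub>R h))) \<partial>lborel)"
      unfolding avg_def using integral_norm_bound_ennreal[OF avg_integrable[OF \<phi>, of x r]] by simp
    also have "\<dots> = (\<integral>\<^sup>+h. ennreal \<bar>\<phi> (x + r *\<^sub>R h)\<bar> * indicator unit_cube h \<partial>lborel)"
      by (intro nn_integral_cong) (auto simp: indicator_def)
    also have "\<dots> \<le> (\<integral>\<^sup>+h. (\<integral>\<^sup>+s\<in>{r..D}. ennreal \<kappa> * ennreal (norm (grad \<phi> (x + s *\<^sub>R h))) * indicator unit_cube h \<partial>lborel) \<partial>lborel)"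
      by (rule nn_integral_mono) (rule ray)
    also have "\<dots> = (\<integral>\<^sup>+s. (\<integral>\<^sup>+h. ennreal \<kappa> * ennreal (norm (grad \<phi> (x + s *\<^sub>R h))) * indicator unit_cube h * indicator {r..D} s \<partial>lborel) \<partial>lborel)"
      by (rule lborel_pair.Fubini') measurable
    also have "\<dots> \<le> (\<integral>\<^sup>+s. ennreal (K / s\<^sup>2) * indicator {r..D} s \<partial>lborel)"
    proof (rule nn_integral_mono)
      fix s
      have "(\<integral>\<^sup>+h. ennreal \<kappa> * ennreal (norm (grad \<phi> (x + s *\<^sub>R h))) * indicator unit_cube h * indicator {r..D} s \<partial>lborel)
          = ennreal \<kappa> * (\<integral>\<^sup>+h\<in>unit_cube. ennreal (norm (grad \<phi> (x + s *\<^sub>R h))) \<partial>lborel) * indicator {r..D} s"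
      proof -
        have "(\<integral>\<^sup>+h. ennreal \<kappa> * ennreal (norm (grad \<phi> (x + s *\<^sub>R h))) * indicator unit_cube h * indicator {r..D} s \<partial>lborel)
            = (\<integral>\<^sup>+h. ennreal \<kappa> * (ennreal (norm (grad \<phi> (x + s *\<^sub>R h))) * indicator unit_cube h) * indicator {r..D} s \<partial>lborel)"
          by (simp add: mult.assoc)
        then show ?thesis by (simp add: nn_integral_multc nn_integral_cmult)
      qed
      also have "\<dots> \<le> ennreal (K / s\<^sup>2) * indicator {r..D} s"
      proof (cases "s \<in> {r..D}")
        case True
        have "ennreal \<kappa> * (\<integral>\<^sup>+h\<in>unit_cube. ennreal (norm (grad \<phi> (x + s *\<^sub>R h))) \<partial>lborel)
            \<le> ennreal \<kappa> * ennreal (m\<^sup>2 * sqrt ?E / s\<^sup>2)" by (intro mult_left_mono at_scale[OF True]) simp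
        also have "\<dots> = ennreal (K / s\<^sup>2)" using D by (simp add: K_def ennreal_mult[symmetric] mult.assoc)
        finally show ?thesis using True by simp
      qed simp
      finally show "(\<integral>\<^sup>+h. ennreal \<kappa> * ennreal (norm (grad \<phi> (x + s *\<^sub>R h))) * indicator unit_cube h * indicator {r..D} s \<partial>lborel)
          \<le> ennreal (K / s\<^sup>2) * indicator {r..D} s" .
    qed
    also have "\<dots> = ennreal (- K / D - (- K / r))"
    proof (rule nn_integral_FTC_Icc)
      fix s assume "s \<in> {r..D}"
      then show "((\<lambda>s. - K / s) has_real_derivative K / s\<^sup>2) (at s)" "0 \<le> K / s\<^sup>2"
        using r K by (auto intro!: derivative_eq_intros simp: power2_eq_square)
    qed (use r in auto)
    also have "\<dots> \<le> ennreal (K / r)" using K D by (intro ennreal_leI) simp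
    finally show ?thesis using K r by (simp add: K_def)
  qed
  moreover have "\<kappa> * m\<^sup>2 > 0" using D by simp
  ultimately show ?thesis using D(1) by blast
qed

text \<open>
  Choose the scale \<open>r\<close> so that the averages are at most \<open>t / 2\<close>; where \<open>\<bar>\<phi>\<bar>\<close> exceeds \<open>t\<close>, the function
  then differs from its average by more than \<open>t / 2\<close>, and Chebyshev's inequality applies.  Scales
  beyond the diameter occur only for \<open>t\<close> bounded by a multiple of the norm of the gradient.
\<close>

lemma weak_type_test:
  assumes N4: "CARD('n) \<le> 4"
  shows "\<exists>C\<ge>0. \<forall>\<phi>\<in>test_functions \<Omega>. \<forall>t>0. t ^ 4 * measure \<mu> {x \<in> \<Omega>. t < \<bar>\<phi> x\<bar>} \<le> C * (nsq \<mu> (grad \<phi>))\<^sup>2"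
proof -
  obtain c D where cD: "c > 0" "D > 0" and
    sup: "\<And>\<phi> x r. \<phi> \<in> test_functions \<Omega> \<Longrightarrow> x \<in> \<Omega> \<Longrightarrow> 0 < r \<Longrightarrow> r \<le> D \<Longrightarrow> \<bar>avg \<phi> r x\<bar> \<le> c * sqrt (nsq \<mu> (grad \<phi>)) / r"
    using avg_sup[OF N4] by blast
  obtain P where P: "P > 0" "\<forall>\<phi>\<in>test_functions \<Omega>. nsq \<mu> \<phi> \<le> P * nsq \<mu> (grad \<phi>)" using Poincare_test by blast
  define \<kappa> where "\<kappa> = 2 * real CARD('n)"
  define V where "V = measure \<mu> \<Omega>"
  define C where "C = 16 * \<kappa>\<^sup>2 * c\<^sup>2 + V * (2 * c / D) ^ 4"
  have C0: "0 \<le> V" "0 \<le> 16 * \<kappa>\<^sup>2 * c\<^sup>2" "0 \<le> V * (2 * c / D) ^ 4" by (auto simp: V_def)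
  interpret finite_measure \<mu> by (rule fin)
  have "t ^ 4 * measure \<mu> {x \<in> \<Omega>. t < \<bar>\<phi> x\<bar>} \<le> C * (nsq \<mu> (grad \<phi>))\<^sup>2"
    if \<phi>: "\<phi> \<in> test_functions \<Omega>" and t: "0 < t" for \<phi> t
  proof -
    note [measurable] = L2_onD(1)[OF test_L2(1)[OF \<phi>]]
    define E where "E = nsq \<mu> (grad \<phi>)"
    have E0: "0 \<le> E" by (simp add: E_def)
    define a where "a = measure \<mu> {x \<in> \<Omega>. t < \<bar>\<phi> x\<bar>}"
    have a0: "0 \<le> a" by (simp add: a_def)
    have aV: "a \<le> V" unfolding a_def V_def by (intro finite_measure_mono) (auto intro: sets.top[of \<mu>, simplified])
    have "t ^ 4 * a \<le> C * E\<^sup>2"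
    proof (cases "E = 0")
      case True
      then have "nsq \<mu> \<phi> \<le> 0" using P(2) \<phi> by (metis E_def mult_zero_right)
      then have "t\<^sup>2 * a \<le> 0" using Chebyshev_nsq[OF test_L2(1)[OF \<phi>] t fin] by (simp add: a_def)
      then have "a = 0" using t a0 by (simp add: mult_le_0_iff)
      then show ?thesis using True by simp
    next
      case False
      then have E: "E > 0" using E0 by simp
      define r where "r = 2 * c * sqrt E / t"
      have r: "r > 0" using cD E t by (simp add: r_def)
      have rt: "r\<^sup>2 = 4 * c\<^sup>2 * E / t\<^sup>2" using E by (simp add: r_def power_mult_distrib power_divide)
      show ?thesis
      proof (cases "r \<le> D")
        case True
        have sub: "{x \<in> \<Omega>. t < \<bar>\<phi> x\<bar>} \<subseteq> {x \<in> \<Omega>. t / 2 < norm (avg \<phi> r x - \<phi> x)}"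
        proof clarify
          fix x assume x: "x \<in> \<Omega>" "t < \<bar>\<phi> x\<bar>"
          have "\<bar>avg \<phi> r x\<bar> \<le> c * sqrt E / r" using sup[OF \<phi> x(1) r True] by (simp add: E_def)
          also have "\<dots> = t / 2" using cD E t by (simp add: r_def)
          finally show "t / 2 < norm (avg \<phi> r x - \<phi> x)" using x(2) by (simp add: real_norm_def abs_if split: if_splits)
        qed
        have d: "(\<lambda>x. avg \<phi> r x - \<phi> x) \<in> L2_on \<mu>" by (rule L2_on_diff[OF avg_L2[OF \<phi> r] test_L2(1)[OF \<phi>]])
        have ms: "{x \<in> \<Omega>. t / 2 < norm (avg \<phi> r x - \<phi> x)} \<in> sets \<mu>"
        proof -
          note [measurable] = L2_onD(1)[OF d]
          have "{x \<in> space \<mu>. t / 2 < norm (avg \<phi> r x - \<phi> x)} \<in> sets \<mu>" by measurable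
          then show ?thesis by simp
        qed
        have "(t / 2)\<^sup>2 * a \<le> (t / 2)\<^sup>2 * measure \<mu> {x \<in> \<Omega>. t / 2 < norm (avg \<phi> r x - \<phi> x)}"
          unfolding a_def by (intro mult_left_mono finite_measure_mono sub ms) simp
        also have "\<dots> \<le> nsq \<mu> (\<lambda>x. avg \<phi> r x - \<phi> x)"
          using Chebyshev_nsq[OF d _ fin, of "t / 2"] t by simp
        also have "\<dots> \<le> (\<kappa> * r)\<^sup>2 * E" using avg_close[OF \<phi> r] by (simp add: \<kappa>_def E_def)
        also have "\<dots> = 4 * \<kappa>\<^sup>2 * c\<^sup>2 * E\<^sup>2 / t\<^sup>2" by (simp add: power_mult_distrib rt) (simp add: power2_eq_square)
        finally have "(t / 2)\<^sup>2 * a * (4 * t\<^sup>2) \<le> 4 * \<kappa>\<^sup>2 * c\<^sup>2 * E\<^sup>2 / t\<^sup>2 * (4 * t\<^sup>2)"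
          by (rule mult_right_mono) simp
        then have "t ^ 4 * a \<le> 16 * \<kappa>\<^sup>2 * c\<^sup>2 * E\<^sup>2"
          using t by (simp add: power2_eq_square power4_eq_xxxx field_simps)
        also have "\<dots> \<le> C * E\<^sup>2" using C0 by (intro mult_right_mono) (auto simp: C_def)
        finally show ?thesis .
      next
        case False
        then have "t \<le> 2 * c / D * sqrt E" using cD t by (simp add: r_def field_simps)
        then have "t ^ 4 \<le> (2 * c / D * sqrt E) ^ 4" using t by (intro power_mono) auto
        also have "\<dots> = (2 * c / D) ^ 4 * E\<^sup>2"
          using E by (simp add: power_mult_distrib power4_eq_xxxx power2_eq_square)
        finally have "t ^ 4 * a \<le> (2 * c / D) ^ 4 * E\<^sup>2 * V" using aV a0 by (intro mult_mono) auto
        also have "\<dots> = V * (2 * c / D) ^ 4 * E\<^sup>2" by simp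
        also have "\<dots> \<le> C * E\<^sup>2" using C0 by (intro mult_right_mono) (auto simp: C_def)
        finally show ?thesis .
      qed
    qed
    then show ?thesis by (simp add: a_def E_def)
  qed
  moreover have "0 \<le> C" using C0 by (simp add: C_def)
  ultimately show ?thesis by blast
qed

lemma weak_type:
  assumes N4: "CARD('n) \<le> 4"
  shows "\<exists>C\<ge>0. \<forall>y G t. H0 \<Omega> y G \<longrightarrow> 0 < t \<longrightarrow> t ^ 4 * measure \<mu> {x \<in> \<Omega>. t < \<bar>y x\<bar>} \<le> C * (nsq \<mu> G)\<^sup>2"
proof -
  obtain C where C: "C \<ge> 0" "\<And>\<phi> t. \<phi> \<in> test_functions \<Omega> \<Longrightarrow> 0 < t \<Longrightarrow> t ^ 4 * measure \<mu> {x \<in> \<Omega>. t < \<bar>\<phi> x\<bar>} \<le> C * (nsq \<mu> (grad \<phi>))\<^sup>2"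
    using weak_type_test[OF N4] by blast
  interpret finite_measure \<mu> by (rule fin)
  have "t ^ 4 * measure \<mu> {x \<in> \<Omega>. t < \<bar>y x\<bar>} \<le> 16 * C * (nsq \<mu> G)\<^sup>2" if H: "H0 \<Omega> y G" and t: "0 < t" for y G t
  proof -
    obtain \<phi> where \<phi>: "\<And>k. \<phi> k \<in> test_functions \<Omega>" "(\<lambda>k. nsq \<mu> (\<lambda>x. \<phi> k x - y x)) \<longlonglongrightarrow> 0"
      "(\<lambda>k. nsq \<mu> (\<lambda>x. grad (\<phi> k) x - G x)) \<longlonglongrightarrow> 0" by (rule H0_approx[OF H]) blast
    note tG = tendsto_nsq[OF test_L2(2)[OF \<phi>(1)] H0_L2(2)[OF H] \<phi>(3)]
    have "t ^ 4 * measure \<mu> {x \<in> \<Omega>. t < \<bar>y x\<bar>} \<le> 16 * C * (nsq \<mu> (grad (\<phi> k)))\<^sup>2 + 4 * t\<^sup>2 * nsq \<mu> (\<lambda>x. \<phi> k x - y x)" for k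
    proof -
      have d: "(\<lambda>x. \<phi> k x - y x) \<in> L2_on \<mu>" by (rule L2_on_diff[OF test_L2(1)[OF \<phi>(1)] H0_L2(1)[OF H]])
      note [measurable] = L2_onD(1)[OF d] L2_onD(1)[OF test_L2(1)[OF \<phi>(1)[of k]]]
      have m1: "{x \<in> space \<mu>. t / 2 < \<bar>\<phi> k x\<bar>} \<in> sets \<mu>" by measurable
      have m2: "{x \<in> space \<mu>. t / 2 < norm (\<phi> k x - y x)} \<in> sets \<mu>" by measurable
      let ?A = "{x \<in> \<Omega>. t / 2 < \<bar>\<phi> k x\<bar>}" and ?B = "{x \<in> \<Omega>. t / 2 < norm (\<phi> k x - y x)}"
      have "{x \<in> \<Omega>. t < \<bar>y x\<bar>} \<subseteq> ?A \<union> ?B"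
      proof
        fix x assume x: "x \<in> {x \<in> \<Omega>. t < \<bar>y x\<bar>}"
        have "\<bar>y x\<bar> \<le> \<bar>\<phi> k x\<bar> + \<bar>\<phi> k x - y x\<bar>" by linarith
        then have "t / 2 < \<bar>\<phi> k x\<bar> \<or> t / 2 < \<bar>\<phi> k x - y x\<bar>" using x by auto
        then show "x \<in> ?A \<union> ?B" using x by auto
      qed
      then have "measure \<mu> {x \<in> \<Omega>. t < \<bar>y x\<bar>} \<le> measure \<mu> (?A \<union> ?B)"
        using m1 m2 by (intro finite_measure_mono) auto
      also have "\<dots> \<le> measure \<mu> ?A + measure \<mu> ?B" using m1 m2 by (intro measure_Un_le) auto
      finally have "t ^ 4 * measure \<mu> {x \<in> \<Omega>. t < \<bar>y x\<bar>} \<le> t ^ 4 * (measure \<mu> ?A + measure \<mu> ?B)"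
        using t by (intro mult_left_mono) auto
      also have "\<dots> = 16 * ((t / 2) ^ 4 * measure \<mu> ?A) + 4 * t\<^sup>2 * ((t / 2)\<^sup>2 * measure \<mu> ?B)"
        by (simp add: power4_eq_xxxx power2_eq_square algebra_simps)
      also have "\<dots> \<le> 16 * (C * (nsq \<mu> (grad (\<phi> k)))\<^sup>2) + 4 * t\<^sup>2 * nsq \<mu> (\<lambda>x. \<phi> k x - y x)"
        using C(2)[OF \<phi>(1)[of k], of "t / 2"] Chebyshev_nsq[OF d _ fin, of "t / 2"] t
        by (intro add_mono mult_left_mono) auto
      finally show ?thesis by simp
    qed
    moreover have "(\<lambda>k. 16 * C * (nsq \<mu> (grad (\<phi> k)))\<^sup>2 + 4 * t\<^sup>2 * nsq \<mu> (\<lambda>x. \<phi> k x - y x)) \<longlonglongrightarrow> 16 * C * (nsq \<mu> G)\<^sup>2 + 4 * t\<^sup>2 * 0"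
      by (intro tendsto_intros tG \<phi>(2))
    ultimately have "t ^ 4 * measure \<mu> {x \<in> \<Omega>. t < \<bar>y x\<bar>} \<le> 16 * C * (nsq \<mu> G)\<^sup>2 + 4 * t\<^sup>2 * 0"
      by (intro LIMSEQ_le_const) auto
    then show ?thesis by simp
  qed
  then show ?thesis using C(1) by (intro exI[of _ "16 * C"]) auto
qed

end

lemma right_derivative_affine:
  assumes "\<And>s. t \<le> s \<Longrightarrow> s < u \<Longrightarrow> g s = a * s + b" "t < u"
  shows "(g has_real_derivative a) (at_right t)"
  unfolding has_field_derivative_iff
proof (rule tendsto_eventually, unfold eventually_at_right_field, intro exI conjI allI impI)
  fix s assume "t < s" "s < u"
  then have "g s - g t = a * (s - t)" using assms by (simp add: algebra_simps)
  then show "(g s - g t) / (s - t) = a" using \<open>t < s\<close> by simp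
qed (rule assms(2))

text \<open>The part of \<open>t\<close> between the levels \<open>2 ^ k\<close> and \<open>2 ^ Suc k\<close>, and its derivative from the right.\<close>

definition layer :: "nat \<Rightarrow> real \<Rightarrow> real" where
  "layer k t = min (max (\<bar>t\<bar> - 2 ^ k) 0) (2 ^ k)"

definition above :: "real \<Rightarrow> real \<Rightarrow> real" where
  "above a t = of_bool (if 0 \<le> t then a \<le> t else a < - t)"

definition layer' :: "nat \<Rightarrow> real \<Rightarrow> real" where
  "layer' k t = (if 0 \<le> t then 1 else - 1) * (above (2 ^ k) t - above (2 ^ Suc k) t)"

lemma layer_lipschitz: "\<bar>layer k s - layer k t\<bar> \<le> 1 * \<bar>s - t\<bar>"
proof -
  have 1: "\<bar>max (\<bar>s\<bar> - p) 0 - max (\<bar>t\<bar> - p) 0\<bar> \<le> \<bar>s - t\<bar>" for p by (simp add: max_def abs_if)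
  have 2: "\<bar>min a p - min b p\<bar> \<le> \<bar>a - b\<bar>" for a b p :: real by (simp add: min_def abs_if)
  show ?thesis unfolding layer_def mult_1 by (rule order_trans[OF 2 1])
qed

lemma layer_right_derivative: "(layer k has_real_derivative layer' k t) (at_right t)"
proof -
  have p: "(2::real) ^ k > 0" by simp
  consider "2 ^ Suc k \<le> t" | "2 ^ k \<le> t" "t < 2 ^ Suc k" | "- (2 ^ k) \<le> t" "t < 2 ^ k"
    | "- (2 ^ Suc k) \<le> t" "t < - (2 ^ k)" | "t < - (2 ^ Suc k)" by linarith
  then show ?thesis
  proof cases
    case 1
    then have "layer' k t = 0" using p by (simp add: layer'_def above_def)
    then show ?thesis
      using 1 p by (simp only:) (rule right_derivative_affine[where u = "t + 1" and b = "2 ^ k"], auto simp: layer_def)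
  next
    case 2
    then have "layer' k t = 1" using p by (simp add: layer'_def above_def)
    then show ?thesis
      using 2 p by (simp only:) (rule right_derivative_affine[where u = "2 ^ Suc k" and b = "- (2 ^ k)"], auto simp: layer_def)
  next
    case 3
    then have "layer' k t = 0" using p by (auto simp: layer'_def above_def)
    then show ?thesis
      using 3 p by (simp only:) (rule right_derivative_affine[where u = "2 ^ k" and b = 0], auto simp: layer_def)
  next
    case 4
    then have "layer' k t = - 1" using p by (auto simp: layer'_def above_def)
    then show ?thesis
      using 4 p by (simp only:) (rule right_derivative_affine[where u = "- (2 ^ k)" and b = "- (2 ^ k)"], auto simp: layer_def)
  next
    case 5
    then have "layer' k t = 0" using p by (auto simp: layer'_def above_def)
    then show ?thesis
      using 5 p by (simp only:) (rule right_derivative_affine[where u = "- (2 ^ Suc k)" and b = "2 ^ k"], auto simp: layer_def)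
  qed
qed

lemma sum_layer'_sq: "(\<Sum>k<n. (layer' k t)\<^sup>2) \<le> 1"
proof -
  have "(layer' k t)\<^sup>2 = above (2 ^ k) t - above (2 ^ Suc k) t" for k
  proof -
    have "(2::real) ^ k \<le> 2 ^ Suc k" by simp
    then show ?thesis by (auto simp: layer'_def above_def)
  qed
  then have "(\<Sum>k<n. (layer' k t)\<^sup>2) = above (2 ^ 0) t - above (2 ^ n) t"
    using sum_lessThan_telescope'[of "\<lambda>k. above (2 ^ k) t" n] by simp
  also have "\<dots> \<le> 1" by (auto simp: above_def)
  finally show ?thesis .
qed

context bounded_open
begin

text \<open>
  The weak bound is applied to the layers of \<open>y\<close>.  Their gradients live on disjoint sets, so the
  sum over the layers is bounded by the square of the sum of the energies of the layers.
\<close>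

lemma L4_embedding:
  assumes N4: "CARD('n) \<le> 4"
  shows "\<exists>C\<ge>0. \<forall>y G. H0 \<Omega> y G \<longrightarrow> (\<lambda>x. (y x)\<^sup>2) \<in> L2_on \<mu> \<and> nsq \<mu> (\<lambda>x. (y x)\<^sup>2) \<le> C * (1 + (nsq \<mu> G)\<^sup>2)"
proof -
  obtain C where C: "C \<ge> 0" "\<And>y G t. H0 \<Omega> y G \<Longrightarrow> 0 < t \<Longrightarrow> t ^ 4 * measure \<mu> {x \<in> \<Omega>. t < \<bar>y x\<bar>} \<le> C * (nsq \<mu> G)\<^sup>2"
    using weak_type[OF N4] by blast
  interpret finite_measure \<mu> by (rule fin)
  define V where "V = measure \<mu> \<Omega>"
  have V: "0 \<le> V" by (simp add: V_def)
  have main: "(\<integral>\<^sup>+x. ennreal ((y x) ^ 4) \<partial>\<mu>) \<le> ennreal (16 * V + 2 ^ 12 * C * (nsq \<mu> G)\<^sup>2)" if H: "H0 \<Omega> y G" for y G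
  proof -
    note yG = H0_L2[OF H]
    note [measurable] = L2_onD(1)[OF yG(1)]
    define e where "e k = nsq \<mu> (\<lambda>x. layer' k (y x) *\<^sub>R G x)" for k
    have Hk: "H0 \<Omega> (\<lambda>x. layer k (y x)) (\<lambda>x. layer' k (y x) *\<^sub>R G x)" for k
      by (rule H0_chain[OF H layer_lipschitz _ layer_right_derivative]) (simp add: layer_def)
    have es: "(\<Sum>k<n. e k) \<le> nsq \<mu> G" for n
    proof -
      have "(\<Sum>k<n. e k) = (LINT x|\<mu>. (\<Sum>k<n. (norm (layer' k (y x) *\<^sub>R G x))\<^sup>2))"
        unfolding e_def nsq_def using L2_onD(2)[OF H0_L2(2)[OF Hk]] by (subst Bochner_Integration.integral_sum) auto
      also have "\<dots> \<le> nsq \<mu> G" unfolding nsq_def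
      proof (rule integral_mono)
        show "integrable \<mu> (\<lambda>x. \<Sum>k<n. (norm (layer' k (y x) *\<^sub>R G x))\<^sup>2)"
          using L2_onD(2)[OF H0_L2(2)[OF Hk]] by (intro Bochner_Integration.integrable_sum) auto
        show "integrable \<mu> (\<lambda>x. (norm (G x))\<^sup>2)" by (rule L2_onD(2)[OF yG(2)])
        show "(\<Sum>k<n. (norm (layer' k (y x) *\<^sub>R G x))\<^sup>2) \<le> (norm (G x))\<^sup>2" for x
          using mult_right_mono[OF sum_layer'_sq[where n = n and t = "y x"], of "(norm (G x))\<^sup>2"]
          by (simp add: power_mult_distrib sum_distrib_right)
      qed
      finally show ?thesis .
    qed
    have e0: "0 \<le> e k" for k by (simp add: e_def)
    have es2: "(\<Sum>k<n. (e k)\<^sup>2) \<le> (nsq \<mu> G)\<^sup>2" for n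
    proof -
      have "(\<Sum>k<n. (e k)\<^sup>2) \<le> (\<Sum>k<n. e k * nsq \<mu> G)"
      proof (rule sum_mono)
        fix k assume "k \<in> {..<n}"
        then have "e k \<le> (\<Sum>k<n. e k)" using e0 by (intro member_le_sum) auto
        then show "(e k)\<^sup>2 \<le> e k * nsq \<mu> G"
          unfolding power2_eq_square using es[of n] e0[of k] by (intro mult_left_mono) auto
      qed
      also have "\<dots> \<le> nsq \<mu> G * nsq \<mu> G"
        unfolding sum_distrib_right[symmetric] by (intro mult_right_mono es) simp
      finally show ?thesis by (simp add: power2_eq_square)
    qed
    define a where "a k = measure \<mu> {x \<in> \<Omega>. 2 ^ Suc k \<le> \<bar>y x\<bar>}" for k
    have ak: "2 ^ (4 * k) * a k \<le> 16 * C * (e k)\<^sup>2" for k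
    proof -
      have "{x \<in> \<Omega>. 2 ^ Suc k \<le> \<bar>y x\<bar>} \<subseteq> {x \<in> \<Omega>. 2 ^ k / 2 < \<bar>layer k (y x)\<bar>}"
      proof clarify
        fix x assume "x \<in> \<Omega>" "2 ^ Suc k \<le> \<bar>y x\<bar>"
        then have "layer k (y x) = 2 ^ k" by (simp add: layer_def)
        then show "2 ^ k / 2 < \<bar>layer k (y x)\<bar>" by simp
      qed
      moreover have "{x \<in> \<Omega>. 2 ^ k / 2 < \<bar>layer k (y x)\<bar>} \<in> sets \<mu>"
      proof -
        note [measurable] = L2_onD(1)[OF H0_L2(1)[OF Hk[of k]]]
        have "{x \<in> space \<mu>. 2 ^ k / 2 < \<bar>layer k (y x)\<bar>} \<in> sets \<mu>" by measurable
        then show ?thesis by simp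
      qed
      ultimately have "a k \<le> measure \<mu> {x \<in> \<Omega>. 2 ^ k / 2 < \<bar>layer k (y x)\<bar>}"
        unfolding a_def by (intro finite_measure_mono)
      then have "(2 ^ k / 2) ^ 4 * a k \<le> (2 ^ k / 2) ^ 4 * measure \<mu> {x \<in> \<Omega>. 2 ^ k / 2 < \<bar>layer k (y x)\<bar>}"
        by (rule mult_left_mono) simp
      also have "\<dots> \<le> C * (e k)\<^sup>2" unfolding e_def by (rule C(2)[OF Hk]) simp
      finally have "(2 ^ k / 2) ^ 4 * a k \<le> C * (e k)\<^sup>2" .
      moreover have "(2 ^ k / 2 :: real) ^ 4 = 2 ^ (4 * k) / 16"
        by (simp add: power_divide power_mult[symmetric] mult.commute)
      ultimately show ?thesis by simp
    qed
    have pt: "ennreal ((y x) ^ 4) \<le> 16 + (\<Sum>k. ennreal (2 ^ (4 * k + 8)) * indicator {x \<in> \<Omega>. 2 ^ Suc k \<le> \<bar>y x\<bar>} x)"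
      if x: "x \<in> \<Omega>" for x
    proof (cases "\<bar>y x\<bar> < 2")
      case True
      have "\<bar>y x\<bar> ^ 4 \<le> 2 ^ 4" using True by (intro power_mono) auto
      then have "ennreal ((y x) ^ 4) \<le> ennreal 16" by (intro ennreal_leI) simp
      also have "ennreal 16 = 16" by simp
      finally show ?thesis by (rule order_trans) simp
    next
      case False
      obtain n0 where "\<bar>y x\<bar> < 2 ^ n0" using real_arch_pow[of "2::real" "\<bar>y x\<bar>"] by auto
      define n where "n = (LEAST n. \<bar>y x\<bar> < 2 ^ n)"
      have n: "\<bar>y x\<bar> < 2 ^ n" unfolding n_def by (rule LeastI) fact
      have "n \<ge> 2"
      proof (rule ccontr)
        assume "\<not> 2 \<le> n"
        then have "(2::real) ^ n \<le> 2 ^ 1" by (intro power_increasing) auto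
        then show False using n False by simp
      qed
      then obtain k where "n = 2 + k" using le_Suc_ex by blast
      then have k: "n = Suc (Suc k)" by simp
      have "\<not> \<bar>y x\<bar> < 2 ^ Suc k"
      proof
        assume "\<bar>y x\<bar> < 2 ^ Suc k"
        then have "n \<le> Suc k" unfolding n_def by (rule Least_le)
        then show False using k by simp
      qed
      then have in1: "x \<in> {x \<in> \<Omega>. 2 ^ Suc k \<le> \<bar>y x\<bar>}" using x by simp
      have "\<bar>y x\<bar> ^ 4 \<le> (2 ^ n) ^ 4" using n by (intro power_mono) auto
      also have "(2 ^ n) ^ 4 = (2 ^ (4 * k + 8) :: real)" by (simp add: k power_mult[symmetric] power_add)
      finally have "ennreal ((y x) ^ 4) \<le> ennreal (2 ^ (4 * k + 8))" by (intro ennreal_leI) simp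
      also have "\<dots> = ennreal (2 ^ (4 * k + 8)) * indicator {x \<in> \<Omega>. 2 ^ Suc k \<le> \<bar>y x\<bar>} x" using in1 by simp
      also have "\<dots> \<le> (\<Sum>i. ennreal (2 ^ (4 * i + 8)) * indicator {x \<in> \<Omega>. 2 ^ Suc i \<le> \<bar>y x\<bar>} x)"
      proof -
        have "f k \<le> (\<Sum>i. f i)" for f :: "nat \<Rightarrow> ennreal"
          using sum_le_suminf[of f "{k}"] by simp
        then show ?thesis .
      qed
      finally show ?thesis by (rule order_trans) simp
    qed
    have sk: "{x \<in> \<Omega>. 2 ^ Suc k \<le> \<bar>y x\<bar>} \<in> sets \<mu>" for k
    proof -
      have "{x \<in> space \<mu>. 2 ^ Suc k \<le> \<bar>y x\<bar>} \<in> sets \<mu>" by measurable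
      then show ?thesis by simp
    qed
    have "(\<integral>\<^sup>+x. ennreal ((y x) ^ 4) \<partial>\<mu>)
        \<le> (\<integral>\<^sup>+x. 16 + (\<Sum>k. ennreal (2 ^ (4 * k + 8)) * indicator {x \<in> \<Omega>. 2 ^ Suc k \<le> \<bar>y x\<bar>} x) \<partial>\<mu>)"
      by (rule nn_integral_mono) (use pt in simp)
    also have "\<dots> = 16 * emeasure \<mu> \<Omega> + (\<integral>\<^sup>+x. (\<Sum>k. ennreal (2 ^ (4 * k + 8)) * indicator {x \<in> \<Omega>. 2 ^ Suc k \<le> \<bar>y x\<bar>} x) \<partial>\<mu>)"
      using sk by (subst nn_integral_add) auto
    also have "(\<integral>\<^sup>+x. (\<Sum>k. ennreal (2 ^ (4 * k + 8)) * indicator {x \<in> \<Omega>. 2 ^ Suc k \<le> \<bar>y x\<bar>} x) \<partial>\<mu>)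
        = (\<Sum>k. \<integral>\<^sup>+x. ennreal (2 ^ (4 * k + 8)) * indicator {x \<in> \<Omega>. 2 ^ Suc k \<le> \<bar>y x\<bar>} x \<partial>\<mu>)"
      using sk by (intro nn_integral_suminf) auto
    also have "\<dots> = (\<Sum>k. ennreal (2 ^ (4 * k + 8) * a k))"
      using sk by (intro suminf_cong) (simp add: nn_integral_cmult_indicator emeasure_eq_measure a_def ennreal_mult)
    also have "\<dots> \<le> ennreal (2 ^ 12 * C * (nsq \<mu> G)\<^sup>2)"
    proof (rule suminf_le_const[OF summableI])
      fix n
      have "(\<Sum>k<n. 2 ^ (4 * k + 8) * a k) \<le> (\<Sum>k<n. 2 ^ 12 * C * (e k)\<^sup>2)"
      proof (rule sum_mono)
        fix k
        show "2 ^ (4 * k + 8) * a k \<le> 2 ^ 12 * C * (e k)\<^sup>2"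
          using mult_left_mono[OF ak[of k], of "2 ^ 8"] by (simp add: power_add)
      qed
      also have "\<dots> = 2 ^ 12 * C * (\<Sum>k<n. (e k)\<^sup>2)" by (simp add: sum_distrib_left)
      also have "\<dots> \<le> 2 ^ 12 * C * (nsq \<mu> G)\<^sup>2" using C(1) by (intro mult_left_mono es2) auto
      finally show "(\<Sum>k<n. ennreal (2 ^ (4 * k + 8) * a k)) \<le> ennreal (2 ^ 12 * C * (nsq \<mu> G)\<^sup>2)"
        by (subst sum_ennreal) (auto simp: a_def intro: ennreal_leI)
    qed
    also have "16 * emeasure \<mu> \<Omega> + ennreal (2 ^ 12 * C * (nsq \<mu> G)\<^sup>2) = ennreal (16 * V + 2 ^ 12 * C * (nsq \<mu> G)\<^sup>2)"
      using V C(1) by (simp add: V_def emeasure_eq_measure ennreal_plus ennreal_mult)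
    finally show ?thesis by (auto intro: add_left_mono)
  qed
  define C' where "C' = 16 * V + 2 ^ 12 * C"
  have "(\<lambda>x. (y x)\<^sup>2) \<in> L2_on \<mu> \<and> nsq \<mu> (\<lambda>x. (y x)\<^sup>2) \<le> C' * (1 + (nsq \<mu> G)\<^sup>2)" if H: "H0 \<Omega> y G" for y G
  proof -
    note [measurable] = L2_onD(1)[OF H0_L2(1)[OF H]]
    have p4: "(norm ((y x)\<^sup>2))\<^sup>2 = (y x) ^ 4" for x by (simp add: power_mult[symmetric])
    have fin4: "(\<integral>\<^sup>+x. ennreal ((y x) ^ 4) \<partial>\<mu>) < \<infinity>"
      using main[OF H] by (rule le_less_trans) simp
    have i: "integrable \<mu> (\<lambda>x. (y x) ^ 4)"
      by (rule integrableI_nonneg) (use fin4 in auto)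
    then have "(\<lambda>x. (y x)\<^sup>2) \<in> L2_on \<mu>" by (simp add: L2_on_def p4)
    moreover have "ennreal (nsq \<mu> (\<lambda>x. (y x)\<^sup>2)) \<le> ennreal (16 * V + 2 ^ 12 * C * (nsq \<mu> G)\<^sup>2)"
      using main[OF H] i unfolding nsq_def p4 by (subst nn_integral_eq_integral[symmetric]) auto
    then have "nsq \<mu> (\<lambda>x. (y x)\<^sup>2) \<le> 16 * V + 2 ^ 12 * C * (nsq \<mu> G)\<^sup>2"
      using V C(1) by (subst (asm) ennreal_le_iff) auto
    moreover have "16 * V + 2 ^ 12 * C * (nsq \<mu> G)\<^sup>2 \<le> C' * (1 + (nsq \<mu> G)\<^sup>2)"
      using V C(1) by (simp add: C'_def algebra_simps)
    ultimately show ?thesis by linarith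
  qed
  moreover have "0 \<le> C'" using V C(1) by (simp add: C'_def)
  ultimately show ?thesis by blast
qed

end

section \<open>Energies\<close>

text \<open>
  Countably many controls on disjoint sets become a single one.  The bounds \<open>(1 / 4) ^ j\<close> stand for
  norms at most \<open>(1 / 2) ^ j\<close>, small enough to be summed.
\<close>

lemma glue_L2:
  fixes v :: "nat \<Rightarrow> 'a \<Rightarrow> real"
  assumes B: "\<And>j. B j \<in> sets M" "disjoint_family B" and v: "\<And>j. v j \<in> L2_on M" "\<And>j. nsq M (v j) \<le> (1 / 4) ^ j"
  obtains u where "u \<in> L2_on M" "\<And>j x. x \<in> B j \<Longrightarrow> u x = v j x"
    "\<And>x. (\<And>j. x \<notin> B j) \<Longrightarrow> u x = 0"
proof -
  note [measurable] = B(1) L2_onD(1)[OF v(1)]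
  define u where "u x = (\<Sum>j. indicator (B j) x * v j x)" for x
  have uB: "u x = v j x" "(\<Sum>i. ennreal ((v i x)\<^sup>2) * indicator (B i) x) = ennreal ((u x)\<^sup>2)" if "x \<in> B j" for x j
  proof -
    have z: "indicator (B i) x = (if i = j then 1 else 0 :: 'b::zero_neq_one)" for i
      using B(2) that by (auto simp: disjoint_family_on_def indicator_def)
    show e: "u x = v j x" unfolding u_def z by (subst suminf_finite[of "{j}"]) auto
    show "(\<Sum>i. ennreal ((v i x)\<^sup>2) * indicator (B i) x) = ennreal ((u x)\<^sup>2)"
      unfolding z e by (subst suminf_finite[of "{j}"]) auto
  qed
  have u0: "u x = 0" if "\<And>j. x \<notin> B j" for x using that by (simp add: u_def)
  have um[measurable]: "u \<in> borel_measurable M" unfolding u_def[abs_def] by measurable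
  have "(\<integral>\<^sup>+x. ennreal ((u x)\<^sup>2) \<partial>M) = (\<integral>\<^sup>+x. (\<Sum>i. ennreal ((v i x)\<^sup>2) * indicator (B i) x) \<partial>M)"
  proof (rule nn_integral_cong)
    fix x
    show "ennreal ((u x)\<^sup>2) = (\<Sum>i. ennreal ((v i x)\<^sup>2) * indicator (B i) x)"
    proof (cases "\<exists>j. x \<in> B j")
      case True then show ?thesis using uB(2) by auto
    next
      case False then show ?thesis by (simp add: u0)
    qed
  qed
  also have "\<dots> = (\<Sum>i. \<integral>\<^sup>+x. ennreal ((v i x)\<^sup>2) * indicator (B i) x \<partial>M)"
    by (rule nn_integral_suminf) measurable
  also have "\<dots> \<le> (\<Sum>i. ennreal ((1 / 4) ^ i))"
  proof (rule suminf_le[OF _ summableI summableI])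
    fix i
    have "(\<integral>\<^sup>+x. ennreal ((v i x)\<^sup>2) * indicator (B i) x \<partial>M) \<le> (\<integral>\<^sup>+x. (ennreal (norm (v i x)))\<^sup>2 \<partial>M)"
      by (intro nn_integral_mono) (auto simp: indicator_def ennreal_power)
    also have "\<dots> \<le> ennreal ((1 / 4) ^ i)" unfolding nn_integral_eq_nsq[OF v(1)] by (intro ennreal_leI v(2))
    finally show "(\<integral>\<^sup>+x. ennreal ((v i x)\<^sup>2) * indicator (B i) x \<partial>M) \<le> ennreal ((1 / 4) ^ i)" .
  qed
  also have "\<dots> = ennreal (\<Sum>i. (1 / 4) ^ i)" by (rule suminf_ennreal2) (auto intro: summable_geometric)
  also have "\<dots> < \<infinity>" by simp
  finally have "integrable M (\<lambda>x. (u x)\<^sup>2)" by (intro integrableI_bounded) auto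
  then have "u \<in> L2_on M" by (simp add: L2_on_def)
  then show ?thesis using uB(1) u0 by (rule that)
qed

text \<open>
  If \<open>v\<close> is not square integrable then its \<open>L\<^sup>2\<close> norms over suitable disjoint layers grow
  geometrically, and \<open>u\<close> is built from the normalised restrictions of \<open>- v\<close>.
\<close>

lemma not_L2_witness:
  fixes v :: "'a \<Rightarrow> real"
  assumes fin: "finite_measure M" and v: "v \<in> borel_measurable M" "v \<notin> L2_on M"
  obtains u where "u \<in> L2_on M" "\<And>x. x \<in> space M \<Longrightarrow> v x * u x \<le> 0" "(\<integral>\<^sup>+x. ennreal (- (v x * u x)) \<partial>M) = \<infinity>"
proof -
  note [measurable] = v(1)
  define S where "S i k x = (v x)\<^sup>2 * indicator {x \<in> space M. real i \<le> \<bar>v x\<bar> \<and> \<bar>v x\<bar> < real k} x" for i k :: nat and x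
  have S_nonneg: "0 \<le> S i k x" for i k x by (simp add: S_def)
  have Sm[measurable]: "S i k \<in> borel_measurable M" for i k unfolding S_def[abs_def] by measurable
  have Sint: "integrable M (S i k)" for i k
  proof (rule Bochner_Integration.integrable_bound[where f = "\<lambda>x. (real k)\<^sup>2"])
    show "integrable M (\<lambda>x. (real k)\<^sup>2)" using fin by (simp add: finite_measure.integrable_const)
    have "(v x)\<^sup>2 \<le> (real k)\<^sup>2" if "\<bar>v x\<bar> < real k" for x
      using that power_mono[of "\<bar>v x\<bar>" "real k" 2] by simp
    then show "AE x in M. norm (S i k x) \<le> norm ((real k)\<^sup>2)" by (intro AE_I2) (auto simp: S_def indicator_def)
  qed simp
  have inf: "(\<integral>\<^sup>+x. ennreal ((v x)\<^sup>2) \<partial>M) = \<infinity>"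
  proof (rule ccontr)
    assume "(\<integral>\<^sup>+x. ennreal ((v x)\<^sup>2) \<partial>M) \<noteq> \<infinity>"
    then have "(\<integral>\<^sup>+x. ennreal ((v x)\<^sup>2) \<partial>M) < \<infinity>" by (simp add: top.not_eq_extremum)
    then have "integrable M (\<lambda>x. (v x)\<^sup>2)" by (intro integrableI_bounded) auto
    then show False using v by (simp add: L2_on_def)
  qed
  have ex: "\<exists>k>i. A \<le> (LINT x|M. S i k x)" for i A
  proof (rule ccontr)
    assume "\<not> (\<exists>k>i. A \<le> (LINT x|M. S i k x))"
    then have b: "(LINT x|M. S i k x) \<le> max A 0" if "i < k" for k using that by fastforce
    have "(\<integral>\<^sup>+x. ennreal ((v x)\<^sup>2) \<partial>M) \<le> (\<integral>\<^sup>+x. ennreal ((real i)\<^sup>2) + liminf (\<lambda>k. ennreal (S i k x)) \<partial>M)"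
    proof (rule nn_integral_mono)
      fix x assume x: "x \<in> space M"
      show "ennreal ((v x)\<^sup>2) \<le> ennreal ((real i)\<^sup>2) + liminf (\<lambda>k. ennreal (S i k x))"
      proof (cases "\<bar>v x\<bar> < real i")
        case True
        then have "(v x)\<^sup>2 \<le> (real i)\<^sup>2" using power_mono[of "\<bar>v x\<bar>" "real i" 2] by simp
        then have "ennreal ((v x)\<^sup>2) \<le> ennreal ((real i)\<^sup>2)" by (rule ennreal_leI)
        then show ?thesis by (rule order_trans) simp
      next
        case False
        obtain k0 where k0: "\<bar>v x\<bar> < real k0" using reals_Archimedean2 by blast
        have "\<forall>\<^sub>F k in sequentially. ennreal ((v x)\<^sup>2) \<le> ennreal (S i k x)"
          by (rule eventually_sequentiallyI[of k0]) (use k0 False x in \<open>auto simp: S_def\<close>)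
        then have "ennreal ((v x)\<^sup>2) \<le> liminf (\<lambda>k. ennreal (S i k x))" by (rule Liminf_bounded)
        then show ?thesis by (rule order_trans) simp
      qed
    qed
    also have "\<dots> = ennreal ((real i)\<^sup>2) * emeasure M (space M) + (\<integral>\<^sup>+x. liminf (\<lambda>k. ennreal (S i k x)) \<partial>M)"
      by (subst nn_integral_add) auto
    also have "(\<integral>\<^sup>+x. liminf (\<lambda>k. ennreal (S i k x)) \<partial>M) \<le> liminf (\<lambda>k. \<integral>\<^sup>+x. ennreal (S i k x) \<partial>M)"
      by (rule nn_integral_liminf) measurable
    also have "liminf (\<lambda>k. \<integral>\<^sup>+x. ennreal (S i k x) \<partial>M) \<le> liminf (\<lambda>k. ennreal (max A 0))"
    proof (rule Liminf_mono, rule eventually_sequentiallyI[of "Suc i"])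
      fix k assume "Suc i \<le> k"
      then show "(\<integral>\<^sup>+x. ennreal (S i k x) \<partial>M) \<le> ennreal (max A 0)"
        using b[of k] by (subst nn_integral_eq_integral[OF Sint]) (auto simp: S_nonneg intro: ennreal_leI)
    qed
    also have "liminf (\<lambda>k. ennreal (max A 0)) = ennreal (max A 0)" by (simp add: Liminf_const)
    finally have "(\<integral>\<^sup>+x. ennreal ((v x)\<^sup>2) \<partial>M) \<le> ennreal ((real i)\<^sup>2) * emeasure M (space M) + ennreal (max A 0)"
      by (auto intro: add_left_mono)
    also have "\<dots> < \<infinity>"
      by (simp add: finite_measure.emeasure_eq_measure[OF fin] ennreal_mult_less_top less_top[symmetric] ennreal_mult_eq_top_iff)
    finally show False using inf by simp
  qed
  have "\<forall>p. \<exists>k. snd p < k \<and> 16 ^ fst p \<le> (LINT x|M. S (snd p) k x)" using ex by auto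
  from choice[OF this] obtain nx where nx: "\<And>j i. i < nx (j, i)" "\<And>j i. 16 ^ j \<le> (LINT x|M. S i (nx (j, i)) x)"
    by auto
  define K where "K = rec_nat 0 (\<lambda>j i. nx (j, i))"
  have K: "K j < K (Suc j)" "16 ^ j \<le> (LINT x|M. S (K j) (K (Suc j)) x)" for j
    using nx by (simp_all add: K_def)
  have Kmono: "K i \<le> K j" if "i \<le> j" for i j
    using that by (rule lift_Suc_mono_le[of K, rotated]) (simp add: K(1) less_imp_le)
  define B where "B j = {x \<in> space M. real (K j) \<le> \<bar>v x\<bar> \<and> \<bar>v x\<bar> < real (K (Suc j))}" for j
  have Bs[measurable]: "B j \<in> sets M" for j unfolding B_def by measurable
  have "B i \<inter> B j = {}" if "i < j" for i j
  proof -
    have "real (K (Suc i)) \<le> real (K j)" using Kmono[of "Suc i" j] that by simp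
    then show ?thesis by (auto simp: B_def)
  qed
  then have Bd: "disjoint_family B"
    unfolding disjoint_family_on_def by (metis Int_commute linorder_neqE_nat)
  define N where "N j = sqrt (LINT x|M. S (K j) (K (Suc j)) x)" for j
  have N: "4 ^ j \<le> N j" "(N j)\<^sup>2 = (LINT x|M. S (K j) (K (Suc j)) x)" for j
  proof -
    have "((4::real) ^ j)\<^sup>2 = 16 ^ j" by (simp add: power2_eq_square power_mult_distrib[symmetric])
    then show "4 ^ j \<le> N j" unfolding N_def using K(2)[of j] by (intro real_le_rsqrt) simp
    have "0 \<le> (LINT x|M. S (K j) (K (Suc j)) x)" by (rule order_trans[OF _ K(2)]) simp
    then show "(N j)\<^sup>2 = (LINT x|M. S (K j) (K (Suc j)) x)" by (simp add: N_def)
  qed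
  have Np: "0 < N j" for j using N(1)[of j] by (rule less_le_trans[rotated]) simp
  define q where "q j x = - ((1 / 2) ^ j / N j) * (v x * indicator (B j) x)" for j x
  have vB: "(v x * indicator (B j) x)\<^sup>2 = S (K j) (K (Suc j)) x" for j x by (auto simp: S_def B_def indicator_def)
  have vBL: "(\<lambda>x. v x * indicator (B j) x) \<in> L2_on M" for j
    using Sint[of "K j" "K (Suc j)"] by (simp add: L2_on_def vB)
  have qL: "q j \<in> L2_on M" for j unfolding q_def[abs_def] by (rule L2_on_cmult[OF vBL])
  have "nsq M (q j) = ((1 / 2) ^ j / N j)\<^sup>2 * (N j)\<^sup>2" for j
  proof -
    have "nsq M (q j) = (- ((1 / 2) ^ j / N j))\<^sup>2 * nsq M (\<lambda>x. v x * indicator (B j) x)"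
      using nsq_scaleR[of M "- ((1 / 2) ^ j / N j)" "\<lambda>x. v x * indicator (B j) x"] by (simp add: q_def[abs_def])
    also have "nsq M (\<lambda>x. v x * indicator (B j) x) = (N j)\<^sup>2"
      unfolding nsq_def real_norm_def power2_abs vB N(2) ..
    finally show ?thesis by simp
  qed
  moreover have "((1 / 2) ^ j / N j)\<^sup>2 * (N j)\<^sup>2 = (1 / 4) ^ j" for j
  proof -
    have "((1 / 2) ^ j / N j)\<^sup>2 * (N j)\<^sup>2 = (1 / 2) ^ j * (1 / 2) ^ j" using Np[of j] by (simp add: power2_eq_square)
    also have "\<dots> = (1 / 4 :: real) ^ j" unfolding power_mult_distrib[symmetric] by simp
    finally show ?thesis .
  qed
  ultimately have qn: "nsq M (q j) \<le> (1 / 4) ^ j" for j by simp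
  obtain u where u: "u \<in> L2_on M" "\<And>j x. x \<in> B j \<Longrightarrow> u x = q j x" "\<And>x. (\<And>j. x \<notin> B j) \<Longrightarrow> u x = 0"
    by (rule glue_L2[of B M q, OF Bs Bd qL qn]) blast
  have sgn: "v x * u x \<le> 0" for x
  proof (cases "\<exists>j. x \<in> B j")
    case True
    then obtain j where "x \<in> B j" by blast
    then have "v x * u x = - ((1 / 2) ^ j / N j) * (v x)\<^sup>2" using u(2) by (simp add: q_def power2_eq_square)
    also have "\<dots> \<le> 0" using Np[of j] by simp
    finally show ?thesis .
  qed (use u(3) in simp)
  have big: "ennreal (2 ^ j) \<le> (\<integral>\<^sup>+x. ennreal (- (v x * u x)) \<partial>M)" for j
  proof -
    have i: "integrable M (\<lambda>x. (1 / 2) ^ j / N j * S (K j) (K (Suc j)) x)" using Sint by simp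
    have "2 ^ j \<le> (1 / 2) ^ j / N j * (N j)\<^sup>2"
    proof -
      have "(2::real) ^ j = (1 / 2) ^ j * 4 ^ j" by (simp add: power_mult_distrib[symmetric])
      also have "\<dots> \<le> (1 / 2) ^ j * N j" by (intro mult_left_mono N) simp
      also have "\<dots> = (1 / 2) ^ j / N j * (N j)\<^sup>2" using Np[of j] by (simp add: power2_eq_square)
      finally show ?thesis .
    qed
    also have "\<dots> = (LINT x|M. (1 / 2) ^ j / N j * S (K j) (K (Suc j)) x)" by (simp add: N(2))
    finally have "ennreal (2 ^ j) \<le> ennreal (LINT x|M. (1 / 2) ^ j / N j * S (K j) (K (Suc j)) x)" by (rule ennreal_leI)
    also have "\<dots> = (\<integral>\<^sup>+x. ennreal ((1 / 2) ^ j / N j * S (K j) (K (Suc j)) x) \<partial>M)"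
      by (rule nn_integral_eq_integral[OF i, symmetric]) (use Np[of j] in \<open>auto simp: S_def intro!: AE_I2\<close>)
    also have "\<dots> \<le> (\<integral>\<^sup>+x. ennreal (- (v x * u x)) \<partial>M)"
    proof (intro nn_integral_mono ennreal_leI)
      fix x
      show "(1 / 2) ^ j / N j * S (K j) (K (Suc j)) x \<le> - (v x * u x)"
      proof (cases "x \<in> B j")
        case True
        then have "- (v x * u x) = (1 / 2) ^ j / N j * (v x * indicator (B j) x)\<^sup>2" using u(2) by (simp add: q_def power2_eq_square)
        then show ?thesis by (simp add: vB)
      next
        case False
        then have "S (K j) (K (Suc j)) x = 0" unfolding vB[symmetric] by simp
        then show ?thesis using sgn[of x] by simp
      qed
    qed
    finally show ?thesis .
  qed
  have "(\<integral>\<^sup>+x. ennreal (- (v x * u x)) \<partial>M) = \<infinity>"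
  proof (rule ccontr)
    assume "(\<integral>\<^sup>+x. ennreal (- (v x * u x)) \<partial>M) \<noteq> \<infinity>"
    then obtain r where r: "(\<integral>\<^sup>+x. ennreal (- (v x * u x)) \<partial>M) = ennreal r" "0 \<le> r"
      by (cases "\<integral>\<^sup>+x. ennreal (- (v x * u x)) \<partial>M") auto
    obtain j where "r < 2 ^ j" using real_arch_pow[of "2::real" r] by auto
    then show False using big[of j] r by simp
  qed
  then show ?thesis using u(1) sgn by (intro that)
qed

locale state_problem = bounded_open \<Omega> for \<Omega> :: "(real^'n) set" +
  fixes f :: "real^'n \<Rightarrow> real" and W :: "real^'n \<Rightarrow> real" and w :: "real \<Rightarrow> real" and c C :: real
  assumes f_L2: "f \<in> L2_on \<mu>" and W_convex: "convex_on UNIV W" and c_pos: "0 < c" and c_less_C: "c < C"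
    and W_lower: "\<And>p. c * ((norm p)\<^sup>2 - 1) \<le> W p" and W_upper: "\<And>p. W p \<le> C * ((norm p)\<^sup>2 + 1)"
    and w_continuous: "continuous_on UNIV w"
    and states_nonempty: "\<And>u. u \<in> L2_on \<mu> \<Longrightarrow> states \<Omega> W w f u \<noteq> {}"
begin

lemma C_pos: "0 < C"
  using c_pos c_less_C by simp

lemma W_continuous: "continuous_on UNIV W"
  by (rule convex_on_continuous[OF open_UNIV W_convex])

lemma w_borel [measurable]: "w \<in> borel_measurable borel"
  by (rule borel_measurable_continuous_onI[OF w_continuous])

lemma W_borel [measurable]: "W \<in> borel_measurable borel"
  by (rule borel_measurable_continuous_onI[OF W_continuous])

lemma W_abs_le: "\<bar>W p\<bar> \<le> C * ((norm p)\<^sup>2 + 1)"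
proof -
  have "- W p \<le> c * (1 - (norm p)\<^sup>2)" using W_lower[of p] by (simp add: algebra_simps)
  also have "\<dots> \<le> c * (1 + (norm p)\<^sup>2)" using c_pos by (intro mult_left_mono) auto
  also have "\<dots> \<le> C * ((norm p)\<^sup>2 + 1)" using c_less_C by (subst add.commute) (intro mult_right_mono, auto)
  finally show ?thesis using W_upper[of p] by (simp add: abs_le_iff)
qed

lemma integrable_const: "integrable \<mu> (\<lambda>x. r :: real)"
  using fin by (simp add: finite_measure.integrable_const)

lemma W_integrable:
  assumes "G \<in> L2_on \<mu>"
  shows "integrable \<mu> (\<lambda>x. W (G x))"
proof (rule Bochner_Integration.integrable_bound)
  note [measurable] = L2_onD(1)[OF assms]
  show "integrable \<mu> (\<lambda>x. C * ((norm (G x))\<^sup>2 + 1))"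
    using L2_onD(2)[OF assms] integrable_const by simp
  show "(\<lambda>x. W (G x)) \<in> borel_measurable \<mu>" by measurable
  show "AE x in \<mu>. norm (W (G x)) \<le> norm (C * ((norm (G x))\<^sup>2 + 1))"
    using W_abs_le by (intro AE_I2) (auto intro: order_trans[OF _ abs_ge_self])
qed

text \<open>
  Otherwise some control makes the energy of \<open>y\<close> equal to \<open>- \<infinity>\<close>, and has no state.
\<close>

lemma w_L2:
  assumes H: "H0 \<Omega> y G"
  shows "(\<lambda>x. w (y x)) \<in> L2_on \<mu>"
proof (rule ccontr)
  assume n: "(\<lambda>x. w (y x)) \<notin> L2_on \<mu>"
  note L = H0_L2[OF H]
  have m[measurable]: "(\<lambda>x. w (y x)) \<in> borel_measurable \<mu>" using L2_onD(1)[OF L(1)] by measurable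
  obtain u where u: "u \<in> L2_on \<mu>" "\<And>x. x \<in> space \<mu> \<Longrightarrow> w (y x) * u x \<le> 0"
    "(\<integral>\<^sup>+x. ennreal (- (w (y x) * u x)) \<partial>\<mu>) = \<infinity>"
    by (rule not_L2_witness[OF fin m n]) blast
  note y10 = H10_if_H0[OF H]
  have wgL: "weak_grad \<Omega> y \<in> L2_on \<mu>" by (rule H0_L2(2)[OF H0_if_H10[OF y10(1)]])
  define q where "q x = W (weak_grad \<Omega> y x) + f x * y x" for x
  have q: "integrable \<mu> q"
    unfolding q_def[abs_def] using W_integrable[OF wgL] L2_on_mult_integrable[OF f_L2 L(1)] by simp
  note [measurable] = borel_measurable_integrable[OF q] L2_onD(1)[OF u(1)]
  let ?g = "\<lambda>x. W (weak_grad \<Omega> y x) + w (y x) * u x + f x * y x"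
  have g: "?g x = q x + w (y x) * u x" for x by (simp add: q_def)
  have qf: "(\<integral>\<^sup>+x. ennreal \<bar>q x\<bar> \<partial>\<mu>) < \<infinity>" using q by (simp add: integrable_iff_bounded)
  have pos: "(\<integral>\<^sup>+x. ennreal (?g x) \<partial>\<mu>) < \<infinity>"
  proof -
    have "(\<integral>\<^sup>+x. ennreal (?g x) \<partial>\<mu>) \<le> (\<integral>\<^sup>+x. ennreal \<bar>q x\<bar> \<partial>\<mu>)"
    proof (intro nn_integral_mono ennreal_leI)
      fix x assume "x \<in> space \<mu>"
      from u(2)[OF this] show "?g x \<le> \<bar>q x\<bar>" unfolding g by linarith
    qed
    then show ?thesis using qf by (rule le_less_trans)
  qed
  have neg: "(\<integral>\<^sup>+x. ennreal (- ?g x) \<partial>\<mu>) = \<infinity>"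
  proof -
    have "\<infinity> = (\<integral>\<^sup>+x. ennreal (- (w (y x) * u x)) \<partial>\<mu>)" using u(3) by simp
    also have "\<dots> \<le> (\<integral>\<^sup>+x. ennreal (- ?g x) + ennreal \<bar>q x\<bar> \<partial>\<mu>)"
    proof (rule nn_integral_mono)
      fix x
      have "ennreal (- (w (y x) * u x)) \<le> ennreal (max 0 (- ?g x) + \<bar>q x\<bar>)"
        unfolding g by (intro ennreal_leI) linarith
      also have "\<dots> = ennreal (- ?g x) + ennreal \<bar>q x\<bar>"
        by (subst ennreal_plus) (auto simp: max_def ennreal_neg)
      finally show "ennreal (- (w (y x) * u x)) \<le> ennreal (- ?g x) + ennreal \<bar>q x\<bar>" .
    qed
    also have "\<dots> = (\<integral>\<^sup>+x. ennreal (- ?g x) \<partial>\<mu>) + (\<integral>\<^sup>+x. ennreal \<bar>q x\<bar> \<partial>\<mu>)"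
      unfolding g by (rule nn_integral_add) auto
    finally show ?thesis using qf by (auto simp: top_unique)
  qed
  have "state_energy \<Omega> W w f y u = - \<infinity>"
    unfolding state_energy_def ext_integral_def neg using pos
    by (cases "\<integral>\<^sup>+x. ennreal (?g x) \<partial>\<mu>") auto
  moreover obtain z where "z \<in> states \<Omega> W w f u" using states_nonempty[OF u(1)] by blast
  ultimately show False using y10(1) by (auto simp: states_def)
qed

definition J :: "(real^'n \<Rightarrow> real) \<Rightarrow> (real^'n \<Rightarrow> real) \<Rightarrow> (real^'n \<Rightarrow> real^'n) \<Rightarrow> real" where
  "J u y G = (LINT x|\<mu>. W (G x)) + (LINT x|\<mu>. w (y x) * u x) + (LINT x|\<mu>. f x * y x)"

lemma state_energy_eq_J:
  assumes H: "H0 \<Omega> y G" and u: "u \<in> L2_on \<mu>"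
  shows "state_energy \<Omega> W w f y u = ereal (J u y G)"
proof -
  note y10 = H10_if_H0[OF H]
  have wg: "weak_grad \<Omega> y \<in> L2_on \<mu>" by (rule H0_L2(2)[OF H0_if_H10[OF y10(1)]])
  note i = W_integrable[OF wg] L2_on_mult_integrable[OF w_L2[OF H] u] L2_on_mult_integrable[OF f_L2 H0_L2(1)[OF H]]
  have "(LINT x|\<mu>. W (weak_grad \<Omega> y x)) = (LINT x|\<mu>. W (G x))"
    by (rule integral_cong_AE[OF borel_measurable_integrable[OF W_integrable[OF wg]]
          borel_measurable_integrable[OF W_integrable[OF H0_L2(2)[OF H]]]])
      (use y10(2) in eventually_elim, simp)
  then show ?thesis
    unfolding state_energy_def using i by (subst ext_integral_eq_integral) (auto simp: J_def)
qed

lemma states_iff: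
  assumes H: "H0 \<Omega> y G" and u: "u \<in> L2_on \<mu>"
  shows "y \<in> states \<Omega> W w f u \<longleftrightarrow> (\<forall>z K. H0 \<Omega> z K \<longrightarrow> J u y G \<le> J u z K)"
proof
  assume "y \<in> states \<Omega> W w f u"
  then show "\<forall>z K. H0 \<Omega> z K \<longrightarrow> J u y G \<le> J u z K"
    using state_energy_eq_J[OF H u] state_energy_eq_J[OF _ u] H10_if_H0(1) by (fastforce simp: states_def)
next
  assume m: "\<forall>z K. H0 \<Omega> z K \<longrightarrow> J u y G \<le> J u z K"
  have "state_energy \<Omega> W w f y u \<le> state_energy \<Omega> W w f z u" if "z \<in> H10 \<Omega>" for z
    using m H0_if_H10[OF that] unfolding state_energy_eq_J[OF H u] state_energy_eq_J[OF H0_if_H10[OF that] u] by simp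
  then show "y \<in> states \<Omega> W w f u"
    using H10_if_H0(1)[OF H] by (simp add: states_def state_energy_eq_J[OF H u])
qed

lemma state_H0: "y \<in> states \<Omega> W w f u \<Longrightarrow> H0 \<Omega> y (weak_grad \<Omega> y)"
  by (intro H0_if_H10) (simp add: states_def)

text \<open>
  This is where a state, which attains the minimum, is worth more than an infimum.
\<close>

lemma J_bounded_below:
  assumes u: "u \<in> L2_on \<mu>"
  obtains m where "\<And>y G. H0 \<Omega> y G \<Longrightarrow> m \<le> J u y G"
proof -
  obtain y where "y \<in> states \<Omega> W w f u" using states_nonempty[OF u] by blast
  then have "\<forall>z K. H0 \<Omega> z K \<longrightarrow> J u y (weak_grad \<Omega> y) \<le> J u z K"
    using states_iff[OF state_H0 u] by blast
  then show ?thesis using that by blast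
qed

lemma J_upper:
  "\<exists>A\<ge>0. \<forall>u y G. u \<in> L2_on \<mu> \<longrightarrow> H0 \<Omega> y G \<longrightarrow> J u y G \<le> A * (1 + nsq \<mu> G) + (LINT x|\<mu>. w (y x) * u x)"
proof -
  obtain P where P: "P > 0" "\<forall>y G. H0 \<Omega> y G \<longrightarrow> nsq \<mu> y \<le> P * nsq \<mu> G" using Poincare by blast
  define V where "V = measure \<mu> \<Omega>"
  define A where "A = C * (1 + V) + nsq \<mu> f + P"
  have V: "0 \<le> V" by (simp add: V_def)
  have A0: "0 \<le> A" using C_pos V P(1) by (simp add: A_def)
  have "J u y G \<le> A * (1 + nsq \<mu> G) + (LINT x|\<mu>. w (y x) * u x)" if H: "H0 \<Omega> y G" for u y G
  proof -
    note L = H0_L2[OF H]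
    have "(LINT x|\<mu>. W (G x)) \<le> (LINT x|\<mu>. C * ((norm (G x))\<^sup>2 + 1))"
      by (rule integral_mono[OF W_integrable[OF L(2)]]) (use L2_onD(2)[OF L(2)] integrable_const W_upper in simp_all)
    also have "\<dots> = C * (nsq \<mu> G + V)" using L2_onD(2)[OF L(2)] integrable_const by (simp add: nsq_def V_def)
    finally have 1: "(LINT x|\<mu>. W (G x)) \<le> C * (nsq \<mu> G + V)" .
    have "(LINT x|\<mu>. f x * y x) \<le> sqrt (nsq \<mu> f) * sqrt (nsq \<mu> y)" using nsq_Cauchy_Schwarz[OF f_L2 L(1)] by simp
    also have "\<dots> \<le> nsq \<mu> f + nsq \<mu> y"
    proof -
      have "0 \<le> sqrt (nsq \<mu> f) * sqrt (nsq \<mu> y)" by simp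
      moreover have "2 * (sqrt (nsq \<mu> f) * sqrt (nsq \<mu> y)) \<le> nsq \<mu> f + nsq \<mu> y"
        using sum_squares_bound[of "sqrt (nsq \<mu> f)" "sqrt (nsq \<mu> y)"] by (simp add: mult.assoc)
      ultimately show ?thesis by argo
    qed
    also have "nsq \<mu> y \<le> P * nsq \<mu> G" using P(2) H by blast
    finally have 2: "(LINT x|\<mu>. f x * y x) \<le> nsq \<mu> f + P * nsq \<mu> G" by simp
    have "C * (nsq \<mu> G + V) + (nsq \<mu> f + P * nsq \<mu> G) \<le> A * (1 + nsq \<mu> G)"
    proof -
      have "A * (1 + nsq \<mu> G) - (C * (nsq \<mu> G + V) + (nsq \<mu> f + P * nsq \<mu> G))
          = C + C * V * nsq \<mu> G + nsq \<mu> f * nsq \<mu> G + P" by (simp add: A_def algebra_simps)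
      also have "\<dots> \<ge> 0" using C_pos V P(1) by simp
      finally show ?thesis by simp
    qed
    then show ?thesis using 1 2 by (simp add: J_def)
  qed
  then show ?thesis using A0 by blast
qed

section \<open>Coercivity in dimension at most four\<close>

text \<open>
  A bump truncated at half of its height at an interior point, and rescaled.
\<close>

lemma plateau:
  obtains \<zeta> K B where "H0 \<Omega> \<zeta> K" "B \<in> sets \<mu>" "0 < measure \<mu> B" "\<And>x. x \<in> B \<Longrightarrow> \<zeta> x = 1"
proof -
  obtain p where p: "p \<in> \<Omega>" using nonempty_dom by blast
  then obtain a b where ab: "p \<in> box a b" "cbox a b \<subseteq> \<Omega>"
    using open_contains_cbox[of \<Omega>] open_dom by (metis (no_types, lifting))
  define \<beta> where "\<beta> = box_bump a b 1"
  have \<beta>: "\<beta> \<in> test_functions \<Omega>" unfolding \<beta>_def by (rule box_bump_test[OF ab(2)])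
  define \<eta> where "\<eta> = \<beta> p / 2"
  have \<eta>: "0 < \<eta>" "\<eta> < \<beta> p" using box_bump_pos[of 1 p a b] ab(1) by (auto simp: \<eta>_def \<beta>_def)
  define B where "B = {x. \<eta> < \<beta> x}"
  have oB: "open B" unfolding B_def
    by (intro open_Collect_less continuous_on_const smooth_continuous[OF test_smooth[OF \<beta>]])
  have sub: "B \<subseteq> \<Omega>" using test_outside(1)[OF \<beta>] \<eta> by (force simp: B_def)
  define g where "g s = min (max s 0) \<eta> / \<eta>" for s
  have lip: "\<bar>g s - g t\<bar> \<le> 1 / \<eta> * \<bar>s - t\<bar>" for s t
  proof -
    have "\<bar>min (max s 0) \<eta> - min (max t 0) \<eta>\<bar> \<le> \<bar>s - t\<bar>" by (simp add: min_def max_def abs_if)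
    then have "\<bar>min (max s 0) \<eta> - min (max t 0) \<eta>\<bar> / \<eta> \<le> \<bar>s - t\<bar> / \<eta>" using \<eta> by (intro divide_right_mono) auto
    then show ?thesis using \<eta>(1) by (simp add: g_def diff_divide_distrib[symmetric])
  qed
  have "g 0 = 0" using \<eta> by (simp add: g_def)
  then obtain K where K: "H0 \<Omega> (\<lambda>x. g (\<beta> x)) K" using H0_lipschitz[OF H0_test[OF \<beta>] lip] by blast
  have "\<not> negligible B" using oB \<eta>(2) by (intro open_not_negligible) (auto simp: B_def)
  then have "emeasure lebesgue B \<noteq> 0" using oB by (auto simp: negligible_iff_null_sets null_sets_def)
  then have "emeasure \<mu> B \<noteq> 0" using sub by (simp add: emeasure_restrict_space)
  then have "0 < measure \<mu> B" using finite_measure.emeasure_eq_measure[OF fin, of B] by (simp add: zero_less_measure_iff)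
  moreover have "B \<in> sets \<mu>" using sub oB by (auto simp: sets_restrict_space_iff)
  moreover have "g (\<beta> x) = 1" if "x \<in> B" for x using that \<eta> by (simp add: g_def B_def)
  ultimately show ?thesis using K by (intro that)
qed

text \<open>
  On multiples \<open>t * \<zeta> x\<close> of a plateau function the controls \<open>\<plusminus> l\<close> on the plateau contribute
  \<open>\<plusminus> l * w t\<close> times its measure, while the other terms grow at most quadratically in \<open>t\<close>.  Both energies
  are bounded below, and \<open>l\<close> can be taken arbitrarily large.
\<close>

lemma w_subquadratic:
  assumes d: "0 < d"
  obtains K where "0 \<le> K" "\<And>t. \<bar>w t\<bar> \<le> d * t\<^sup>2 + K"
proof -
  obtain \<zeta> D B where \<zeta>: "H0 \<Omega> \<zeta> D" "B \<in> sets \<mu>" "0 < measure \<mu> B" "\<And>x. x \<in> B \<Longrightarrow> \<zeta> x = 1" by (rule plateau) blast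
  obtain A where A: "A \<ge> 0" "\<And>u y G. u \<in> L2_on \<mu> \<Longrightarrow> H0 \<Omega> y G \<Longrightarrow> J u y G \<le> A * (1 + nsq \<mu> G) + (LINT x|\<mu>. w (y x) * u x)"
    using J_upper by blast
  define b where "b = measure \<mu> B"
  define E where "E = nsq \<mu> D"
  have b: "0 < b" and E: "0 \<le> E" using \<zeta>(3) by (auto simp: b_def E_def)
  \<comment> \<open>large enough that the quadratic term, divided by the gain \<open>l * b\<close>, has coefficient at most \<open>d\<close>\<close>
  define l where "l = A * E / (d * b) + 1"
  have l: "0 < l" using A(1) E d b by (simp add: l_def add_nonneg_pos)
  have uL: "(\<lambda>x. s * indicator B x) \<in> L2_on \<mu>" for s :: real
    by (rule L2_on_bounded[OF fin, where B = "\<bar>s\<bar>"]) (use \<zeta>(2) in \<open>auto simp: indicator_def\<close>)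
  obtain m1 where m1: "\<And>y G. H0 \<Omega> y G \<Longrightarrow> m1 \<le> J (\<lambda>x. l * indicator B x) y G"
    by (rule J_bounded_below[OF uL]) blast
  obtain m2 where m2: "\<And>y G. H0 \<Omega> y G \<Longrightarrow> m2 \<le> J (\<lambda>x. - l * indicator B x) y G"
    by (rule J_bounded_below[OF uL]) blast
  have key: "m \<le> A * (1 + t\<^sup>2 * E) + w t * s * b"
    if "\<And>y G. H0 \<Omega> y G \<Longrightarrow> m \<le> J (\<lambda>x. s * indicator B x) y G" for m s t
  proof -
    have H: "H0 \<Omega> (\<lambda>x. t * \<zeta> x) (\<lambda>x. t *\<^sub>R D x)" by (rule H0_scaleR[OF \<zeta>(1)])
    have "(LINT x|\<mu>. w (t * \<zeta> x) * (s * indicator B x)) = (LINT x|\<mu>. (w t * s) * indicator B x)"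
      by (rule Bochner_Integration.integral_cong) (auto simp: indicator_def \<zeta>(4))
    also have "\<dots> = w t * s * b"
      using \<zeta>(2) sets.sets_into_space[OF \<zeta>(2)] by (simp add: b_def Int_absorb2)
    finally have e: "(LINT x|\<mu>. w (t * \<zeta> x) * (s * indicator B x)) = w t * s * b" .
    show ?thesis
      using order_trans[OF that[OF H] A(2)[OF uL[of s] H]] unfolding e nsq_scaleR E_def by simp
  qed
  define K where "K = (A + \<bar>m1\<bar> + \<bar>m2\<bar>) / (l * b)"
  show ?thesis
  proof (rule that[of K])
    show "0 \<le> K" using A(1) l b by (simp add: K_def)
    fix t
    have "l * b * \<bar>w t\<bar> \<le> A * (1 + t\<^sup>2 * E) + \<bar>m1\<bar> + \<bar>m2\<bar>"
    proof (cases "0 \<le> w t")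
      case True
      then show ?thesis using key[of m2 "- l" t] m2 by (simp add: mult_ac)
    next
      case False
      then show ?thesis using key[of m1 l t] m1 by (simp add: mult_ac)
    qed
    then have "\<bar>w t\<bar> \<le> (A * (1 + t\<^sup>2 * E) + \<bar>m1\<bar> + \<bar>m2\<bar>) / (l * b)"
      using l b by (simp add: pos_le_divide_eq mult.commute)
    also have "\<dots> = (A * E / (l * b)) * t\<^sup>2 + K"
      by (simp add: K_def add_divide_distrib distrib_left mult_ac)
    also have "A * E / (l * b) \<le> d"
    proof -
      have "A * E \<le> d * (l * b)" using d b by (simp add: l_def field_simps)
      then show ?thesis using l b by (simp add: pos_divide_le_eq)
    qed
    finally show "\<bar>w t\<bar> \<le> d * t\<^sup>2 + K" by (simp add: mult_right_mono)
  qed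
qed

text \<open>
  Here \<open>w\<close> grows less than any multiple of the square, and the norm of \<open>y\<^sup>2\<close> is controlled by the
  energy.
\<close>

lemma coercive_low_dimension:
  assumes N4: "CARD('n) \<le> 4" and d: "0 < d"
  shows "\<exists>K\<ge>0. \<forall>y G. H0 \<Omega> y G \<longrightarrow> sqrt (nsq \<mu> (\<lambda>x. w (y x))) \<le> d * nsq \<mu> G + K"
proof -
  obtain C4 where C4: "C4 \<ge> 0" "\<And>y G. H0 \<Omega> y G \<Longrightarrow> (\<lambda>x. (y x)\<^sup>2) \<in> L2_on \<mu> \<and> nsq \<mu> (\<lambda>x. (y x)\<^sup>2) \<le> C4 * (1 + (nsq \<mu> G)\<^sup>2)"
    using L4_embedding[OF N4] by blast
  define e where "e = d / (sqrt C4 + 1)"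
  have e: "0 < e" using d C4(1) by (simp add: e_def add_nonneg_pos)
  obtain K where K: "0 \<le> K" "\<And>t. \<bar>w t\<bar> \<le> e * t\<^sup>2 + K" by (rule w_subquadratic[OF e]) blast
  define K' where "K' = d + K * sqrt (measure \<mu> \<Omega>)"
  have "sqrt (nsq \<mu> (\<lambda>x. w (y x))) \<le> d * nsq \<mu> G + K'" if H: "H0 \<Omega> y G" for y G
  proof -
    have y2: "(\<lambda>x. (y x)\<^sup>2) \<in> L2_on \<mu>" "nsq \<mu> (\<lambda>x. (y x)\<^sup>2) \<le> C4 * (1 + (nsq \<mu> G)\<^sup>2)" using C4(2)[OF H] by auto
    have kL: "(\<lambda>x. K) \<in> L2_on \<mu>" by (rule L2_on_const[OF fin])
    have eL: "(\<lambda>x. e * (y x)\<^sup>2) \<in> L2_on \<mu>" by (rule L2_on_cmult[OF y2(1)])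
    have "sqrt (nsq \<mu> (\<lambda>x. w (y x))) \<le> sqrt (nsq \<mu> (\<lambda>x. e * (y x)\<^sup>2 + K))"
      by (intro real_sqrt_le_mono nsq_mono L2_on_add eL kL L2_onD(1)[OF w_L2[OF H]] AE_I2)
        (use K(2) in \<open>auto intro: order_trans[OF _ abs_ge_self]\<close>)
    also have "\<dots> \<le> sqrt (nsq \<mu> (\<lambda>x. e * (y x)\<^sup>2)) + sqrt (nsq \<mu> (\<lambda>x. K))" by (rule sqrt_nsq_triangle[OF eL kL])
    also have "sqrt (nsq \<mu> (\<lambda>x. K)) = K * sqrt (measure \<mu> \<Omega>)"
      using K(1) by (simp add: nsq_def real_sqrt_mult mult.commute)
    also have "sqrt (nsq \<mu> (\<lambda>x. e * (y x)\<^sup>2)) = e * sqrt (nsq \<mu> (\<lambda>x. (y x)\<^sup>2))"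
      using nsq_scaleR[of \<mu> e "\<lambda>x. (y x)\<^sup>2"] e by (simp add: real_sqrt_mult)
    also have "\<dots> \<le> e * (sqrt C4 * (1 + nsq \<mu> G))"
    proof (rule mult_left_mono)
      have "1 + (nsq \<mu> G)\<^sup>2 \<le> (1 + nsq \<mu> G)\<^sup>2" by (simp add: power2_sum)
      then have "sqrt (C4 * (1 + (nsq \<mu> G)\<^sup>2)) \<le> sqrt (C4 * (1 + nsq \<mu> G)\<^sup>2)"
        using C4(1) by (intro real_sqrt_le_mono mult_left_mono)
      also have "\<dots> = sqrt C4 * (1 + nsq \<mu> G)" by (simp add: real_sqrt_mult)
      finally show "sqrt (nsq \<mu> (\<lambda>x. (y x)\<^sup>2)) \<le> sqrt C4 * (1 + nsq \<mu> G)"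
        using real_sqrt_le_mono[OF y2(2)] by linarith
    qed (use e in simp)
    also have "\<dots> = (e * sqrt C4) * (1 + nsq \<mu> G)" by simp
    also have "\<dots> \<le> d * (1 + nsq \<mu> G)"
    proof (rule mult_right_mono)
      have "d * sqrt C4 \<le> d * (sqrt C4 + 1)" using d by simp
      then show "e * sqrt C4 \<le> d" using C4(1) by (simp add: e_def pos_divide_le_eq add_nonneg_pos)
    qed simp
    finally show ?thesis by (simp add: K'_def algebra_simps)
  qed
  moreover have "0 \<le> K'" using d K(1) by (simp add: K'_def)
  ultimately show ?thesis by blast
qed

end

section \<open>Coercivity in dimension at least five\<close>

context bounded_open
begin

text \<open>
  A copy of \<open>g\<close> on the domain scaled down by the factor \<open>e\<close> and moved to \<open>p\<close>, extended by zero.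
\<close>

definition dilate :: "real \<Rightarrow> real^'n \<Rightarrow> (real^'n \<Rightarrow> 'b::zero) \<Rightarrow> real^'n \<Rightarrow> 'b" where
  "dilate e p g x = (if (1 / e) *\<^sub>R (x - p) \<in> \<Omega> then g ((1 / e) *\<^sub>R (x - p)) else 0)"

definition copy :: "real \<Rightarrow> real^'n \<Rightarrow> (real^'n) set" where
  "copy e p = {x. (1 / e) *\<^sub>R (x - p) \<in> \<Omega>}"

lemma copy_open: "open (copy e p)"
  unfolding copy_def using open_vimage[OF open_dom, of "\<lambda>x. (1 / e) *\<^sub>R (x - p)"]
  by (simp add: vimage_def continuous_intros)

lemma copy_subset_ball:
  assumes "\<Omega> \<subseteq> ball 0 R" "0 < e" "e * R \<le> r"
  shows "copy e p \<subseteq> ball p r"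
proof
  fix x assume "x \<in> copy e p"
  then have "norm ((1 / e) *\<^sub>R (x - p)) < R" using assms(1) by (auto simp: copy_def)
  then have "norm (x - p) < e * R" using assms(2) by (simp add: pos_divide_less_eq mult.commute)
  then show "x \<in> ball p r" using assms(3) by (simp add: dist_norm norm_minus_commute)
qed

lemma dilate_L2:
  assumes e: "0 < e" and sub: "copy e p \<subseteq> \<Omega>" and g: "g \<in> L2_on \<mu>"
  shows "dilate e p g \<in> L2_on \<mu>" "nsq \<mu> (dilate e p g) = e ^ CARD('n) * nsq \<mu> g"
proof -
  let ?T = "\<lambda>x::real^'n. (- (1 / e) *\<^sub>R p) + (\<Sum>j\<in>Basis. ((1 / e) * (x \<bullet> j)) *\<^sub>R j)"
  have T: "?T x = (1 / e) *\<^sub>R (x - p)" for x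
    by (simp only: scaleR_scaleR[symmetric] scaleR_sum_right[symmetric] euclidean_representation)
      (simp add: scaleR_diff_right)
  define g0 where "g0 x = indicator \<Omega> x *\<^sub>R g x" for x
  have dg: "dilate e p g x = g0 (?T x)" for x unfolding T g0_def dilate_def by simp
  have g0m: "g0 \<in> borel_measurable lebesgue"
    unfolding g0_def[abs_def] using borel_measurable_restrict_space_iff[of \<Omega> lebesgue g] L2_onD(1)[OF g] by simp
  have Tm: "?T \<in> lebesgue \<rightarrow>\<^sub>M lebesgue" by (rule lebesgue_affine_measurable) (use e in simp)
  have leb: "lebesgue = density (distr lebesgue lebesgue ?T) (\<lambda>_. (\<Prod>j\<in>(Basis::(real^'n) set). \<bar>1 / e\<bar>))"
    by (rule lebesgue_affine_euclidean) (use e in simp)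
  have "dilate e p g \<in> borel_measurable lebesgue"
    unfolding dg[abs_def] by (rule measurable_compose[OF Tm g0m])
  then have m: "dilate e p g \<in> borel_measurable \<mu>" by (rule measurable_restrict_space1)
  have "(\<integral>\<^sup>+x. ennreal ((norm (dilate e p g x))\<^sup>2) \<partial>\<mu>) = (\<integral>\<^sup>+x. ennreal ((norm (g0 (?T x)))\<^sup>2) \<partial>lebesgue)"
  proof -
    have "(\<integral>\<^sup>+x. ennreal ((norm (dilate e p g x))\<^sup>2) \<partial>\<mu>) = (\<integral>\<^sup>+x. ennreal ((norm (dilate e p g x))\<^sup>2) * indicator \<Omega> x \<partial>lebesgue)"
      by (rule nn_integral_restrict_space) simp
    also have "\<dots> = (\<integral>\<^sup>+x. ennreal ((norm (g0 (?T x)))\<^sup>2) \<partial>lebesgue)"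
      unfolding dg[symmetric] using sub by (intro nn_integral_cong) (auto simp: indicator_def dilate_def copy_def)
    finally show ?thesis .
  qed
  also have "\<dots> = ennreal (e ^ CARD('n)) * (\<integral>\<^sup>+x. ennreal ((norm (g0 x))\<^sup>2) \<partial>lebesgue)"
  proof -
    have "(\<integral>\<^sup>+x. ennreal ((norm (g0 x))\<^sup>2) \<partial>lebesgue)
        = (\<integral>\<^sup>+x. ennreal ((norm (g0 x))\<^sup>2) \<partial>density (distr lebesgue lebesgue ?T) (\<lambda>_. (\<Prod>j\<in>(Basis::(real^'n) set). \<bar>1 / e\<bar>)))"
      using leb by (rule arg_cong[where f = "\<lambda>M. \<integral>\<^sup>+x. ennreal ((norm (g0 x))\<^sup>2) \<partial>M"])
    also have "\<dots> = ennreal ((1 / e) ^ CARD('n)) * (\<integral>\<^sup>+x. ennreal ((norm (g0 (?T x)))\<^sup>2) \<partial>lebesgue)"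
    proof -
      have h: "(\<lambda>x. ennreal ((norm (g0 x))\<^sup>2)) \<in> borel_measurable lebesgue" using g0m by measurable
      have "(\<integral>\<^sup>+x. ennreal ((norm (g0 x))\<^sup>2) \<partial>density (distr lebesgue lebesgue ?T) (\<lambda>_. (\<Prod>j\<in>(Basis::(real^'n) set). \<bar>1 / e\<bar>)))
          = (\<integral>\<^sup>+x. ennreal ((1 / e) ^ CARD('n)) * ennreal ((norm (g0 x))\<^sup>2) \<partial>distr lebesgue lebesgue ?T)"
        using e by (subst nn_integral_density) (use h in auto)
      also have "\<dots> = ennreal ((1 / e) ^ CARD('n)) * (\<integral>\<^sup>+x. ennreal ((norm (g0 x))\<^sup>2) \<partial>distr lebesgue lebesgue ?T)"
        by (rule nn_integral_cmult) (use h in simp)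
      also have "(\<integral>\<^sup>+x. ennreal ((norm (g0 x))\<^sup>2) \<partial>distr lebesgue lebesgue ?T) = (\<integral>\<^sup>+x. ennreal ((norm (g0 (?T x)))\<^sup>2) \<partial>lebesgue)"
        by (rule nn_integral_distr[OF Tm]) (use h in simp)
      finally show ?thesis .
    qed
    finally have "ennreal (e ^ CARD('n)) * (\<integral>\<^sup>+x. ennreal ((norm (g0 x))\<^sup>2) \<partial>lebesgue)
        = (ennreal (e ^ CARD('n)) * ennreal ((1 / e) ^ CARD('n))) * (\<integral>\<^sup>+x. ennreal ((norm (g0 (?T x)))\<^sup>2) \<partial>lebesgue)"
      by (simp add: mult.assoc)
    also have "ennreal (e ^ CARD('n)) * ennreal ((1 / e) ^ CARD('n)) = 1"
      using e by (simp add: ennreal_mult[symmetric] power_mult_distrib[symmetric])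
    finally show ?thesis by simp
  qed
  also have "(\<integral>\<^sup>+x. ennreal ((norm (g0 x))\<^sup>2) \<partial>lebesgue) = (\<integral>\<^sup>+x. (ennreal (norm (g x)))\<^sup>2 \<partial>\<mu>)"
  proof -
    have "(\<integral>\<^sup>+x. (ennreal (norm (g x)))\<^sup>2 \<partial>\<mu>) = (\<integral>\<^sup>+x. (ennreal (norm (g x)))\<^sup>2 * indicator \<Omega> x \<partial>lebesgue)"
      by (rule nn_integral_restrict_space) simp
    also have "\<dots> = (\<integral>\<^sup>+x. ennreal ((norm (g0 x))\<^sup>2) \<partial>lebesgue)"
      by (intro nn_integral_cong) (auto simp: indicator_def g0_def ennreal_power)
    finally show ?thesis by simp
  qed
  finally have e1: "(\<integral>\<^sup>+x. ennreal ((norm (dilate e p g x))\<^sup>2) \<partial>\<mu>) = ennreal (e ^ CARD('n) * nsq \<mu> g)"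
    using e by (simp add: nn_integral_eq_nsq[OF g] ennreal_mult)
  then have "integrable \<mu> (\<lambda>x. (norm (dilate e p g x))\<^sup>2)"
    using m by (intro integrableI_bounded) (auto simp: measurable_compose)
  then show L: "dilate e p g \<in> L2_on \<mu>" using m by (simp add: L2_on_def)
  have "ennreal (nsq \<mu> (dilate e p g)) = ennreal (e ^ CARD('n) * nsq \<mu> g)"
    using nn_integral_eq_nsq[OF L] e1 by (simp add: ennreal_power)
  then show "nsq \<mu> (dilate e p g) = e ^ CARD('n) * nsq \<mu> g" using e by (subst (asm) ennreal_inj) auto
qed

lemma dilate_test:
  assumes e: "0 < e" and sub: "copy e p \<subseteq> \<Omega>" and \<phi>: "\<phi> \<in> test_functions \<Omega>"
  shows "dilate e p \<phi> \<in> test_functions \<Omega>" "grad (dilate e p \<phi>) = (\<lambda>x. (1 / e) *\<^sub>R dilate e p (grad \<phi>) x)"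
proof -
  have eq: "dilate e p \<phi> = (\<lambda>x. \<phi> ((1 / e) *\<^sub>R x + (- (1 / e) *\<^sub>R p)))"
  proof
    fix x
    show "dilate e p \<phi> x = \<phi> ((1 / e) *\<^sub>R x + (- (1 / e) *\<^sub>R p))"
      using test_outside(1)[OF \<phi>, of "(1 / e) *\<^sub>R (x - p)"] by (simp add: dilate_def scaleR_diff_right)
  qed
  obtain K where K: "compact K" "K \<subseteq> \<Omega>" "\<forall>x. x \<notin> K \<longrightarrow> \<phi> x = 0 \<and> grad \<phi> x = 0"
    using test_compact_support[OF \<phi>] by blast
  let ?K = "(\<lambda>x. p + e *\<^sub>R x) ` K"
  have inK: "(1 / e) *\<^sub>R (x - p) \<in> K \<Longrightarrow> x \<in> ?K" for x
    by (rule image_eqI[where x = "(1 / e) *\<^sub>R (x - p)"]) (use e in auto)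
  show "dilate e p \<phi> \<in> test_functions \<Omega>"
  proof (rule test_functionsI[of _ ?K])
    show "smooth (dilate e p \<phi>)" unfolding eq by (rule smooth_affine[OF test_smooth[OF \<phi>]])
    show "compact ?K" by (intro compact_continuous_image continuous_intros K(1))
    show "?K \<subseteq> \<Omega>"
    proof clarify
      fix x assume "x \<in> K"
      then have "p + e *\<^sub>R x \<in> copy e p" using K(2) e by (auto simp: copy_def)
      then show "p + e *\<^sub>R x \<in> \<Omega>" using sub by blast
    qed
    show "dilate e p \<phi> x = 0" if "x \<notin> ?K" for x
    proof -
      have "(1 / e) *\<^sub>R (x - p) \<notin> K" using that inK[of x] by blast
      then show ?thesis using K(3) by (simp add: dilate_def)
    qed
  qed
  show "grad (dilate e p \<phi>) = (\<lambda>x. (1 / e) *\<^sub>R dilate e p (grad \<phi>) x)"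
  proof
    fix x
    have "grad (dilate e p \<phi>) x = (1 / e) *\<^sub>R grad \<phi> ((1 / e) *\<^sub>R x + (- (1 / e) *\<^sub>R p))"
      unfolding eq by (rule grad_affine[OF test_smooth[OF \<phi>]])
    also have "grad \<phi> ((1 / e) *\<^sub>R x + (- (1 / e) *\<^sub>R p)) = dilate e p (grad \<phi>) x"
      using test_outside(2)[OF \<phi>, of "(1 / e) *\<^sub>R (x - p)"] by (simp add: dilate_def scaleR_diff_right)
    finally show "grad (dilate e p \<phi>) x = (1 / e) *\<^sub>R dilate e p (grad \<phi>) x" .
  qed
qed

lemma dilate_diff: "dilate e p g x - dilate e p h x = dilate e p (\<lambda>x. g x - h x) x"
  for g h :: "real^'n \<Rightarrow> 'b::real_normed_vector"
  by (simp add: dilate_def)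

lemma H0_dilate:
  assumes e: "0 < e" and sub: "copy e p \<subseteq> \<Omega>" and H: "H0 \<Omega> y G"
  shows "H0 \<Omega> (dilate e p y) (\<lambda>x. (1 / e) *\<^sub>R dilate e p G x)"
proof -
  note L = H0_L2[OF H]
  obtain \<phi> where \<phi>: "\<And>k. \<phi> k \<in> test_functions \<Omega>" "(\<lambda>k. nsq \<mu> (\<lambda>x. \<phi> k x - y x)) \<longlonglongrightarrow> 0"
    "(\<lambda>k. nsq \<mu> (\<lambda>x. grad (\<phi> k) x - G x)) \<longlonglongrightarrow> 0" by (rule H0_approx[OF H]) blast
  have n1: "nsq \<mu> (\<lambda>x. dilate e p (\<phi> k) x - dilate e p y x) = e ^ CARD('n) * nsq \<mu> (\<lambda>x. \<phi> k x - y x)" for k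
    unfolding dilate_diff by (rule dilate_L2(2)[OF e sub L2_on_diff[OF test_L2(1)[OF \<phi>(1)] L(1)]])
  have n2: "nsq \<mu> (\<lambda>x. (1 / e) *\<^sub>R dilate e p (grad (\<phi> k)) x - (1 / e) *\<^sub>R dilate e p G x)
      = (1 / e)\<^sup>2 * (e ^ CARD('n) * nsq \<mu> (\<lambda>x. grad (\<phi> k) x - G x))" for k
    unfolding scaleR_diff_right[symmetric] nsq_scaleR dilate_diff
    by (subst dilate_L2(2)[OF e sub L2_on_diff[OF test_L2(2)[OF \<phi>(1)] L(2)]]) simp
  have "H0 \<Omega> (dilate e p (\<phi> k)) (\<lambda>x. (1 / e) *\<^sub>R dilate e p (grad (\<phi> k)) x)" for k
    using H0_test[OF dilate_test(1)[OF e sub \<phi>(1)]] unfolding dilate_test(2)[OF e sub \<phi>(1)] .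
  then show ?thesis
  proof (rule H0_closed[OF _ dilate_L2(1)[OF e sub L(1)] L2_on_scaleR[OF dilate_L2(1)[OF e sub L(2)]]])
    show "(\<lambda>k. nsq \<mu> (\<lambda>x. dilate e p (\<phi> k) x - dilate e p y x)) \<longlonglongrightarrow> 0"
      unfolding n1 by (rule tendsto_mult_right_zero[OF \<phi>(2)])
    show "(\<lambda>k. nsq \<mu> (\<lambda>x. (1 / e) *\<^sub>R dilate e p (grad (\<phi> k)) x - (1 / e) *\<^sub>R dilate e p G x)) \<longlonglongrightarrow> 0"
      unfolding n2 by (intro tendsto_mult_right_zero \<phi>(3))
  qed
qed

text \<open>
  The centres approach a point of a ball along a segment, at distances halved in every step.
\<close>

lemma disjoint_balls:
  "\<exists>(p :: nat \<Rightarrow> real^'n) r. \<forall>k. 0 < r k \<and> ball (p k) (r k) \<subseteq> \<Omega> \<and>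
    (\<forall>j. k \<noteq> j \<longrightarrow> ball (p k) (r k) \<inter> ball (p j) (r j) = {})"
proof -
  obtain q R where q: "0 < R" "ball q R \<subseteq> \<Omega>" using nonempty_dom open_dom openE by blast
  obtain e :: "real^'n" where e: "norm e = 1" using vector_choose_size[of 1] by auto
  define p where "p k = q + (R * (1 / 2) ^ Suc k) *\<^sub>R e" for k
  define r where "r k = R * ((1 / 2) ^ k / 8)" for k
  have dp: "dist (p i) (p j) = R * \<bar>(1 / 2) ^ Suc i - (1 / 2) ^ Suc j\<bar>" for i j
  proof -
    have "p i - p j = (R * ((1 / 2) ^ Suc i - (1 / 2) ^ Suc j)) *\<^sub>R e" by (simp add: p_def algebra_simps)
    then show ?thesis using e q(1) by (simp add: dist_norm abs_mult)
  qed
  have disj: "ball (p i) (r i) \<inter> ball (p j) (r j) = {}" if ij: "i < j" for i j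
  proof (rule disjoint_ballI)
    have le: "(1 / 2 :: real) ^ j \<le> (1 / 2) ^ Suc i" using ij by (intro power_decreasing) auto
    have "r i + r j = R * ((1 / 2) ^ i / 8 + (1 / 2) ^ j / 8)" by (simp add: r_def algebra_simps)
    also have "\<dots> \<le> R * ((1 / 2) ^ Suc i - (1 / 2) ^ Suc j)"
    proof (rule mult_left_mono)
      have "(0::real) \<le> (1 / 2) ^ i" by simp
      then show "(1 / 2) ^ i / 8 + (1 / 2) ^ j / 8 \<le> (1 / 2 :: real) ^ Suc i - (1 / 2) ^ Suc j"
        using le unfolding power_Suc by linarith
    qed (use q in simp)
    also have "\<dots> \<le> R * \<bar>(1 / 2) ^ Suc i - (1 / 2) ^ Suc j\<bar>" using q by (intro mult_left_mono) auto
    finally show "r i + r j \<le> dist (p i) (p j)" by (simp add: dp)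
  qed
  show ?thesis
  proof (intro exI[of _ p] exI[of _ r] allI conjI impI)
    show "0 < r k" for k using q by (simp add: r_def)
    show "ball (p k) (r k) \<subseteq> \<Omega>" for k
    proof -
      have "ball (p k) (r k) \<subseteq> ball q R"
      proof
        fix x assume "x \<in> ball (p k) (r k)"
        then have "dist (p k) x < r k" by simp
        moreover have "dist q (p k) = R * (1 / 2) ^ Suc k" using e q(1) by (simp add: p_def dist_norm)
        moreover have "dist q x \<le> dist q (p k) + dist (p k) x" by (rule dist_triangle)
        ultimately have "dist q x < R * ((1 / 2) ^ Suc k + (1 / 2) ^ k / 8)" by (simp add: r_def distrib_left)
        also have "\<dots> \<le> R * 1"
        proof (rule mult_left_mono)
          have "(1 / 2 :: real) ^ k \<le> 1" by (rule power_le_one) auto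
          then show "(1 / 2 :: real) ^ Suc k + (1 / 2) ^ k / 8 \<le> 1" by simp
        qed (use q in simp)
        finally show "x \<in> ball q R" by simp
      qed
      then show ?thesis using q(2) by blast
    qed
    show "ball (p i) (r i) \<inter> ball (p j) (r j) = {}" if "i \<noteq> j" for i j
      using that disj[of i j] disj[of j i] by (cases "i < j") (auto simp: Int_commute)
  qed
qed

end

context state_problem
begin

text \<open>
  If coercivity fails there are functions \<open>y\<close> whose norms \<open>\<parallel>w(y)\<parallel>\<close> are large compared with their
  energies.  Scaled copies of them are placed into disjoint balls.  A copy of size \<open>e\<close> has energy of
  order \<open>e ^ (N - 2)\<close>, whereas a control of norm \<open>(1 / 2) ^ k\<close> supported there gains
  \<open>(1 / 2) ^ k * e powr (N / 2)\<close>.  As \<open>N / 2 < N - 2\<close> for \<open>N \<ge> 5\<close>, the gain wins for small \<open>e\<close>, and a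
  single control gains on all copies without bound.
\<close>

lemma coercive_high_dimension:
  assumes N5: "5 \<le> CARD('n)" and d: "0 < d"
  shows "\<exists>K\<ge>0. \<forall>y G. H0 \<Omega> y G \<longrightarrow> sqrt (nsq \<mu> (\<lambda>x. w (y x))) \<le> d * nsq \<mu> G + K"
proof (rule ccontr)
  assume neg: "\<not> ?thesis"
  have bad: "\<exists>y G. H0 \<Omega> y G \<and> d * nsq \<mu> G + K < sqrt (nsq \<mu> (\<lambda>x. w (y x)))" if "0 \<le> K" for K
    using neg that by (meson not_le)
  obtain A where A: "A \<ge> 0" "\<And>u y G. u \<in> L2_on \<mu> \<Longrightarrow> H0 \<Omega> y G \<Longrightarrow> J u y G \<le> A * (1 + nsq \<mu> G) + (LINT x|\<mu>. w (y x) * u x)"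
    using J_upper by blast
  obtain R where R: "\<Omega> \<subseteq> ball 0 R" "R > 0" using bounded_subset_ballD[OF bounded_dom, of 0] by blast
  obtain p :: "nat \<Rightarrow> real^'n" where "\<exists>r. \<forall>k. 0 < r k \<and> ball (p k) (r k) \<subseteq> \<Omega> \<and> (\<forall>j. k \<noteq> j \<longrightarrow> ball (p k) (r k) \<inter> ball (p j) (r j) = {})"
    using disjoint_balls ..
  then obtain r where balls: "\<forall>k. 0 < r k \<and> ball (p k) (r k) \<subseteq> \<Omega> \<and> (\<forall>j. k \<noteq> j \<longrightarrow> ball (p k) (r k) \<inter> ball (p j) (r j) = {})"
    ..
  have pr: "0 < r k" "ball (p k) (r k) \<subseteq> \<Omega>" for k using balls by auto
  have pr3: "ball (p i) (r i) \<inter> ball (p j) (r j) = {}" if "i \<noteq> j" for i j using balls that by simp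
  define l where "l k = (1 / 2 :: real) ^ k" for k
  have l: "0 < l k" for k by (simp add: l_def)
  \<comment> \<open>the first two bounds make the copy fit into its ball, the third makes the gain exceed the energy\<close>
  define e where "e k = min (min 1 (r k / R)) ((l k * d / (A + 1))\<^sup>2)" for k
  have e: "0 < e k" "e k \<le> 1" "e k * R \<le> r k" "e k \<le> (l k * d / (A + 1))\<^sup>2" for k
  proof -
    have "0 < l k * d / (A + 1)" using l[of k] d A(1) by simp
    from zero_less_power[OF this, of 2] show "0 < e k" using pr(1)[of k] R(2) by (simp add: e_def)
    have "e k \<le> r k / R" by (simp add: e_def)
    then show "e k * R \<le> r k" using R(2) by (simp add: pos_le_divide_eq)
  qed (simp_all add: e_def)
  define N where "N = CARD('n)"
  have N: "5 \<le> N" using N5 by (simp add: N_def)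
  define q where "q k = sqrt (e k ^ N)" for k
  have q: "0 < q k" "(q k)\<^sup>2 = e k ^ N" for k using e(1)[of k] by (auto simp: q_def)
  have gain: "A * e k ^ (N - 2) \<le> l k * d * q k" for k
  proof -
    have "e k ^ (N - 4) \<le> e k ^ 1" using N e(1,2)[of k] by (intro power_decreasing) auto
    then have "(A + 1)\<^sup>2 * e k ^ (N - 4) \<le> (A + 1)\<^sup>2 * e k" by (intro mult_left_mono) auto
    also have "\<dots> \<le> (A + 1)\<^sup>2 * (l k * d / (A + 1))\<^sup>2" by (intro mult_left_mono e(4)) simp
    also have "\<dots> = (l k * d)\<^sup>2" using A(1) by (simp add: power_divide)
    finally have "((A + 1)\<^sup>2 * e k ^ (N - 4)) * e k ^ N \<le> (l k * d)\<^sup>2 * e k ^ N"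
      using e(1)[of k] by (intro mult_right_mono) auto
    moreover have "e k ^ (N - 4) * e k ^ N = (e k ^ (N - 2))\<^sup>2"
    proof -
      have "N - 4 + N = (N - 2) * 2" using N by linarith
      then show ?thesis by (simp only: power_add[symmetric] power_mult[symmetric])
    qed
    ultimately have "((A + 1) * e k ^ (N - 2))\<^sup>2 \<le> (l k * d * q k)\<^sup>2"
      by (simp add: power_mult_distrib q(2) mult.assoc)
    moreover have "0 \<le> l k * d * q k" using l[of k] d q(1)[of k] by simp
    ultimately have "(A + 1) * e k ^ (N - 2) \<le> l k * d * q k" by (rule power2_le_imp_le)
    moreover have "A * e k ^ (N - 2) \<le> (A + 1) * e k ^ (N - 2)" using e(1)[of k] by (intro mult_right_mono) auto
    ultimately show ?thesis by linarith
  qed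
  have "\<forall>k. \<exists>yG. H0 \<Omega> (fst yG) (snd yG) \<and> d * nsq \<mu> (snd yG) + real k / (l k * q k) < sqrt (nsq \<mu> (\<lambda>x. w (fst yG x)))"
  proof
    fix k
    have "0 \<le> real k / (l k * q k)" using l[of k] q(1)[of k] by simp
    from bad[OF this] show "\<exists>yG. H0 \<Omega> (fst yG) (snd yG) \<and> d * nsq \<mu> (snd yG) + real k / (l k * q k) < sqrt (nsq \<mu> (\<lambda>x. w (fst yG x)))"
      by auto
  qed
  from choice[OF this] obtain yG where
    yG: "\<And>k. H0 \<Omega> (fst (yG k)) (snd (yG k)) \<and> d * nsq \<mu> (snd (yG k)) + real k / (l k * q k) < sqrt (nsq \<mu> (\<lambda>x. w (fst (yG k) x)))"
    by blast
  define y where "y k = fst (yG k)" for k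
  define G where "G k = snd (yG k)" for k
  define s where "s k = sqrt (nsq \<mu> (\<lambda>x. w (y k x)))" for k
  have H: "H0 \<Omega> (y k) (G k)" and big: "d * nsq \<mu> (G k) + real k / (l k * q k) < s k" for k
    using yG[of k] by (auto simp: y_def G_def s_def)
  have sp: "0 < s k" for k
  proof -
    have "0 \<le> d * nsq \<mu> (G k) + real k / (l k * q k)" using d l[of k] q(1)[of k] by simp
    then show ?thesis using big[of k] by linarith
  qed
  have ss: "(s k)\<^sup>2 = nsq \<mu> (\<lambda>x. w (y k x))" for k by (simp add: s_def)
  define B where "B k = copy (e k) (p k)" for k
  have Bball: "B k \<subseteq> ball (p k) (r k)" for k unfolding B_def by (rule copy_subset_ball[OF R(1) e(1,3)])
  have Bsub: "B k \<subseteq> \<Omega>" for k using Bball pr(2) by blast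
  note cs = Bsub[unfolded B_def]
  have Bs: "B k \<in> sets \<mu>" for k
    using Bsub[of k] copy_open[of "e k" "p k"] by (auto simp: sets_restrict_space_iff B_def)
  have Bd: "disjoint_family B"
    unfolding disjoint_family_on_def
  proof (intro ballI impI)
    fix i j :: nat assume "i \<noteq> j"
    from pr3[OF this] show "B i \<inter> B j = {}" using Bball[of i] Bball[of j] by blast
  qed
  have wL: "(\<lambda>x. w (y k x)) \<in> L2_on \<mu>" for k by (rule w_L2[OF H])
  define v where "v k x = - (l k / (q k * s k)) * dilate (e k) (p k) (\<lambda>x. w (y k x)) x" for k x
  have vL: "v k \<in> L2_on \<mu>" for k
    unfolding v_def[abs_def] by (rule L2_on_cmult[OF dilate_L2(1)[OF e(1) cs wL]])
  have "nsq \<mu> (v k) = (1 / 4) ^ k" for k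
  proof -
    have "nsq \<mu> (v k) = (l k / (q k * s k))\<^sup>2 * (e k ^ N * (s k)\<^sup>2)"
      using nsq_scaleR[of \<mu> "- (l k / (q k * s k))" "dilate (e k) (p k) (\<lambda>x. w (y k x))"]
        dilate_L2(2)[OF e(1) cs wL, of k k] by (simp add: v_def[abs_def] ss N_def)
    also have "\<dots> = (l k)\<^sup>2" using q(1)[of k] sp[of k] unfolding q(2)[symmetric] by (simp add: power_divide power_mult_distrib)
    also have "\<dots> = (1 / 4) ^ k" by (simp add: l_def power2_eq_square power_mult_distrib[symmetric])
    finally show ?thesis .
  qed
  then have vn: "nsq \<mu> (v k) \<le> (1 / 4) ^ k" for k by simp
  obtain u where u: "u \<in> L2_on \<mu>" "\<And>j x. x \<in> B j \<Longrightarrow> u x = v j x" "\<And>x. (\<And>j. x \<notin> B j) \<Longrightarrow> u x = 0"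
    by (rule glue_L2[of B \<mu> v, OF Bs Bd vL vn]) blast
  have ui: "integrable \<mu> u" by (rule L2_on_integrable[OF fin u(1)])
  define U where "U = (LINT x|\<mu>. \<bar>u x\<bar>)"
  obtain m where m: "\<And>y G. H0 \<Omega> y G \<Longrightarrow> m \<le> J u y G" by (rule J_bounded_below[OF u(1)]) blast
  have "m \<le> A + \<bar>w 0\<bar> * U - real k" for k
  proof -
    let ?Y = "dilate (e k) (p k) (y k)" and ?K = "\<lambda>x. (1 / e k) *\<^sub>R dilate (e k) (p k) (G k) x"
    have HY: "H0 \<Omega> ?Y ?K" by (rule H0_dilate[OF e(1) cs H])
    have nK: "nsq \<mu> ?K = e k ^ (N - 2) * nsq \<mu> (G k)"
    proof -
      have "nsq \<mu> ?K = (1 / e k)\<^sup>2 * (e k ^ N * nsq \<mu> (G k))"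
        unfolding nsq_scaleR by (simp add: dilate_L2(2)[OF e(1) cs H0_L2(2)[OF H]] N_def)
      moreover have "e k ^ N = e k ^ (N - 2) * (e k)\<^sup>2"
      proof -
        have "N - 2 + 2 = N" using N by linarith
        then show ?thesis by (simp only: power_add[symmetric])
      qed
      ultimately show ?thesis using e(1)[of k] by (simp add: power_divide)
    qed
    let ?D = "dilate (e k) (p k) (\<lambda>x. w (y k x))"
    have DL: "?D \<in> L2_on \<mu>" by (rule dilate_L2(1)[OF e(1) cs wL])
    have pt: "w (?Y x) * u x \<le> \<bar>w 0\<bar> * \<bar>u x\<bar> - l k / (q k * s k) * (norm (?D x))\<^sup>2" for x
    proof (cases "x \<in> B k")
      case True
      then have "w (?Y x) * u x = - (l k / (q k * s k)) * (norm (?D x))\<^sup>2"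
        using u(2)[OF True] by (simp add: v_def B_def copy_def dilate_def power2_eq_square)
      then show ?thesis by simp
    next
      case False
      then have eq: "w (?Y x) = w 0" "?D x = 0" by (auto simp: B_def copy_def dilate_def)
      show ?thesis unfolding eq by (simp add: abs_mult[symmetric])
    qed
    have "(LINT x|\<mu>. w (?Y x) * u x) \<le> (LINT x|\<mu>. \<bar>w 0\<bar> * \<bar>u x\<bar> - l k / (q k * s k) * (norm (?D x))\<^sup>2)"
      by (rule integral_mono[OF L2_on_mult_integrable[OF w_L2[OF HY] u(1)] _ pt])
        (use ui L2_onD(2)[OF DL] in simp)
    also have "\<dots> = \<bar>w 0\<bar> * U - l k / (q k * s k) * nsq \<mu> ?D"
      using ui L2_onD(2)[OF DL] by (simp add: U_def nsq_def)
    also have "nsq \<mu> ?D = (q k)\<^sup>2 * (s k)\<^sup>2"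
      by (simp add: dilate_L2(2)[OF e(1) cs wL] q(2) ss N_def)
    also have "l k / (q k * s k) * ((q k)\<^sup>2 * (s k)\<^sup>2) = l k * q k * s k"
      using q(1)[of k] sp[of k] by (simp add: power2_eq_square)
    finally have "(LINT x|\<mu>. w (?Y x) * u x) \<le> \<bar>w 0\<bar> * U - l k * q k * s k" .
    moreover have "m \<le> A * (1 + e k ^ (N - 2) * nsq \<mu> (G k)) + (LINT x|\<mu>. w (?Y x) * u x)"
      using order_trans[OF m[OF HY] A(2)[OF u(1) HY]] by (simp add: nK)
    moreover have "l k * q k * (d * nsq \<mu> (G k) + real k / (l k * q k)) \<le> l k * q k * s k"
      using big[of k] l[of k] q(1)[of k] by (intro mult_left_mono) auto
    moreover have "l k * q k * (d * nsq \<mu> (G k) + real k / (l k * q k)) = l k * d * q k * nsq \<mu> (G k) + real k"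
      using l[of k] q(1)[of k] by (simp add: field_simps)
    moreover have "A * e k ^ (N - 2) * nsq \<mu> (G k) \<le> l k * d * q k * nsq \<mu> (G k)"
      by (intro mult_right_mono gain) simp
    moreover have "A * (1 + e k ^ (N - 2) * nsq \<mu> (G k)) = A + A * e k ^ (N - 2) * nsq \<mu> (G k)" by (simp add: algebra_simps)
    ultimately show ?thesis by linarith
  qed
  moreover obtain k where "A + \<bar>w 0\<bar> * U - m < real k" using reals_Archimedean2 by blast
  ultimately show False by (smt (verit))
qed

text \<open>
  The coefficient \<open>d\<close> is arbitrarily small: the pairing of \<open>w (y x)\<close> with controls from any bounded set
  can therefore be absorbed by the growth of \<open>W\<close>.
\<close>

lemma coercive:
  assumes d: "0 < d"
  shows "\<exists>K\<ge>0. \<forall>y G. H0 \<Omega> y G \<longrightarrow> sqrt (nsq \<mu> (\<lambda>x. w (y x))) \<le> d * nsq \<mu> G + K"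
proof (cases "CARD('n) \<le> 4")
  case True
  then show ?thesis by (rule coercive_low_dimension[OF _ d])
next
  case False
  then have "5 \<le> CARD('n)" by simp
  then show ?thesis by (rule coercive_high_dimension[OF _ d])
qed

text \<open>
  A state has at most the energy of the zero function, which is bounded in terms of the norm of the
  control.  On the other side half of the gradient term survives after \<open>coercive\<close> and Poincare's
  inequality have absorbed the two lower order terms, each into a quarter.
\<close>

lemma states_bounded:
  assumes R: "0 \<le> R"
  shows "\<exists>B. \<forall>u y. u \<in> L2_on \<mu> \<longrightarrow> nsq \<mu> u \<le> R \<longrightarrow> y \<in> states \<Omega> W w f u \<longrightarrow>
    nsq \<mu> y \<le> B \<and> nsq \<mu> (weak_grad \<Omega> y) \<le> B"
proof -
  obtain P where P: "P > 0" "\<forall>y G. H0 \<Omega> y G \<longrightarrow> nsq \<mu> y \<le> P * nsq \<mu> G" using Poincare by blast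
  define V where "V = measure \<mu> \<Omega>"
  define b where "b = sqrt R"
  have b: "0 \<le> b" using R by (simp add: b_def)
  \<comment> \<open>then \<open>d * b \<le> c / 4\<close>\<close>
  define d where "d = c / (4 * (b + 1))"
  have d: "0 < d" using c_pos b by (simp add: d_def)
  obtain K where K: "0 \<le> K" "\<forall>y G. H0 \<Omega> y G \<longrightarrow> sqrt (nsq \<mu> (\<lambda>x. w (y x))) \<le> d * nsq \<mu> G + K"
    using coercive[OF d] by blast
  define Q where "Q = \<bar>W 0\<bar> * V + \<bar>w 0\<bar> * (b * sqrt V) + c * V + b * K + nsq \<mu> f * P / c"
  define B where "B = 2 * Q / c"
  have "nsq \<mu> y \<le> max B (P * B) \<and> nsq \<mu> (weak_grad \<Omega> y) \<le> max B (P * B)"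
    if u: "u \<in> L2_on \<mu>" "nsq \<mu> u \<le> R" and y: "y \<in> states \<Omega> W w f u" for u y
  proof -
    define G where "G = weak_grad \<Omega> y"
    have H: "H0 \<Omega> y G" unfolding G_def by (rule state_H0[OF y])
    note L = H0_L2[OF H]
    define E where "E = nsq \<mu> G"
    have E: "0 \<le> E" by (simp add: E_def)
    have ub: "sqrt (nsq \<mu> u) \<le> b" using u(2) by (simp add: b_def)
    have "J u y G \<le> J u (\<lambda>x. 0) (\<lambda>x. 0)" using y states_iff[OF H u(1)] H0_zero by blast
    also have "\<dots> = W 0 * V + (LINT x|\<mu>. w 0 * u x)" by (simp add: J_def V_def mult.commute)
    also have "(LINT x|\<mu>. w 0 * u x) \<le> \<bar>w 0\<bar> * (b * sqrt V)"
    proof -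
      have "(LINT x|\<mu>. w 0 * u x) \<le> sqrt (nsq \<mu> (\<lambda>x. w 0)) * sqrt (nsq \<mu> u)"
        using nsq_Cauchy_Schwarz[OF L2_on_const[OF fin, of "w 0"] u(1)] by simp
      also have "sqrt (nsq \<mu> (\<lambda>x. w 0)) = \<bar>w 0\<bar> * sqrt V"
        by (simp add: nsq_def V_def real_sqrt_mult mult.commute)
      also have "\<bar>w 0\<bar> * sqrt V * sqrt (nsq \<mu> u) \<le> \<bar>w 0\<bar> * sqrt V * b"
        using ub by (intro mult_left_mono) (auto simp: V_def)
      finally show ?thesis by (simp add: mult_ac)
    qed
    also have "W 0 * V \<le> \<bar>W 0\<bar> * V" by (intro mult_right_mono) (auto simp: V_def)
    finally have up: "J u y G \<le> \<bar>W 0\<bar> * V + \<bar>w 0\<bar> * (b * sqrt V)" by simp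
    have "c * (E - V) = (LINT x|\<mu>. c * ((norm (G x))\<^sup>2 - 1))"
      using L2_onD(2)[OF L(2)] integrable_const by (simp add: E_def V_def nsq_def)
    also have "\<dots> \<le> (LINT x|\<mu>. W (G x))"
      by (rule integral_mono[OF _ W_integrable[OF L(2)]]) (use L2_onD(2)[OF L(2)] integrable_const W_lower in simp_all)
    finally have lo1: "c * (E - V) \<le> (LINT x|\<mu>. W (G x))" .
    have "- (LINT x|\<mu>. w (y x) * u x) \<le> sqrt (nsq \<mu> (\<lambda>x. w (y x))) * sqrt (nsq \<mu> u)"
      using nsq_Cauchy_Schwarz[OF w_L2[OF H] u(1)] by simp
    also have "\<dots> \<le> (d * E + K) * b"
      using K(2) H ub K(1) d E by (intro mult_mono) (auto simp: E_def)
    also have "\<dots> \<le> c / 4 * E + b * K"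
    proof -
      have "d * b \<le> c / 4" using b c_pos by (simp add: d_def pos_divide_le_eq field_simps)
      then have "d * b * E \<le> c / 4 * E" using E by (intro mult_right_mono)
      then show ?thesis by (simp add: algebra_simps)
    qed
    finally have lo2: "- (LINT x|\<mu>. w (y x) * u x) \<le> c / 4 * E + b * K" .
    have yP: "nsq \<mu> y \<le> P * E" using P(2) H by (simp add: E_def)
    have "- (LINT x|\<mu>. f x * y x) \<le> sqrt (nsq \<mu> f) * sqrt (nsq \<mu> y)" using nsq_Cauchy_Schwarz[OF f_L2 L(1)] by simp
    also have "\<dots> \<le> sqrt (nsq \<mu> f) * sqrt (P * E)" using yP by (intro mult_left_mono) auto
    also have "\<dots> = sqrt ((nsq \<mu> f * P / c) * (c * E))" using c_pos by (simp add: real_sqrt_mult[symmetric])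
    also have "\<dots> \<le> nsq \<mu> f * P / c + c / 4 * E"
    proof (rule real_le_lsqrt)
      have sq: "a * (4 * t) \<le> (a + t)\<^sup>2" for a t :: real
        using zero_le_power2[of "a - t"] by (simp add: power2_eq_square algebra_simps)
      show "nsq \<mu> f * P / c * (c * E) \<le> (nsq \<mu> f * P / c + c / 4 * E)\<^sup>2"
        using sq[of "nsq \<mu> f * P / c" "c / 4 * E"] by simp
      show "0 \<le> nsq \<mu> f * P / c + c / 4 * E" using P(1) c_pos E by simp
    qed
    finally have lo3: "- (LINT x|\<mu>. f x * y x) \<le> nsq \<mu> f * P / c + c / 4 * E" .
    have "c / 2 * E \<le> Q"
      using up lo1 lo2 lo3 unfolding J_def Q_def by (simp add: algebra_simps)
    then have EB: "E \<le> B" using c_pos by (simp add: B_def field_simps)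
    moreover have "nsq \<mu> y \<le> P * B" using yP EB P(1) by (meson mult_left_mono less_imp_le order_trans)
    ultimately show ?thesis by (simp add: E_def G_def le_max_iff_disj)
  qed
  then show ?thesis by blast
qed

end

section \<open>Cut-off functions\<close>

definition odd_ext :: "(real \<Rightarrow> real) \<Rightarrow> real \<Rightarrow> real" where
  "odd_ext r t = (if 0 \<le> t then r t else - r (- t))"

lemma odd_ext_lipschitz:
  assumes r: "\<And>a b. 0 \<le> a \<Longrightarrow> 0 \<le> b \<Longrightarrow> \<bar>r a - r b\<bar> \<le> L * \<bar>a - b\<bar>" "r 0 = 0"
  shows "\<bar>odd_ext r s - odd_ext r t\<bar> \<le> L * \<bar>s - t\<bar>"
proof -
  have r0: "\<bar>r a\<bar> \<le> L * a" if "0 \<le> a" for a using r(1)[of a 0] r(2) that by simp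
  consider "0 \<le> s" "0 \<le> t" | "s < 0" "t < 0" | "0 \<le> s" "t < 0" | "s < 0" "0 \<le> t" by linarith
  then show ?thesis
  proof cases
    case 1 then show ?thesis using r(1)[of s t] by (simp add: odd_ext_def)
  next
    case 2
    then show ?thesis using r(1)[of "- s" "- t"] by (simp add: odd_ext_def abs_minus_commute)
  next
    case 3
    then have "\<bar>r s + r (- t)\<bar> \<le> L * s + L * (- t)" using r0[of s] r0[of "- t"] by linarith
    then show ?thesis using 3 by (simp add: odd_ext_def right_diff_distrib)
  next
    case 4
    then have "\<bar>- r (- s) - r t\<bar> \<le> L * (- s) + L * t" using r0[of "- s"] r0[of t] by linarith
    moreover have "\<bar>s - t\<bar> = - s + t" using 4 by simp
    ultimately show ?thesis using 4 by (simp only: odd_ext_def distrib_left) simp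
  qed
qed

text \<open>
  Used to pass from a function \<open>z\<close> to \<open>y\<close> where \<open>y - z\<close> is large: it vanishes up to modulus \<open>M\<close> and
  is the identity from modulus \<open>M * s / (s - 1)\<close> on.  In between its slope is \<open>s\<close>, as close to one as
  desired; the price is a long transition interval.
\<close>

definition far_part :: "real \<Rightarrow> real \<Rightarrow> real \<Rightarrow> real" where
  "far_part s M = odd_ext (\<lambda>a. min a (s * max (a - M) 0))"

lemma far_part_lipschitz:
  assumes s: "1 < s" and M: "0 \<le> M"
  shows "\<bar>far_part s M x - far_part s M y\<bar> \<le> s * \<bar>x - y\<bar>"
  unfolding far_part_def
proof (rule odd_ext_lipschitz)
  fix a b :: real
  have m: "\<bar>min p q - min p' q'\<bar> \<le> l" if "\<bar>p - p'\<bar> \<le> l" "\<bar>q - q'\<bar> \<le> l" for p q p' q' l :: real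
    using that by (simp add: min_def abs_le_iff)
  show "\<bar>min a (s * max (a - M) 0) - min b (s * max (b - M) 0)\<bar> \<le> s * \<bar>a - b\<bar>"
  proof (rule m)
    show "\<bar>a - b\<bar> \<le> s * \<bar>a - b\<bar>" using s by (simp add: mult_le_cancel_right1)
    have "\<bar>max (a - M) 0 - max (b - M) 0\<bar> \<le> \<bar>a - b\<bar>" by (simp add: max_def abs_if)
    then have "s * \<bar>max (a - M) 0 - max (b - M) 0\<bar> \<le> s * \<bar>a - b\<bar>" using s by (intro mult_left_mono) auto
    then show "\<bar>s * max (a - M) 0 - s * max (b - M) 0\<bar> \<le> s * \<bar>a - b\<bar>"
      using s by (simp add: right_diff_distrib[symmetric] abs_mult)
  qed
qed (use M in simp)

lemma far_part_values:
  assumes s: "1 < s" and M: "0 < M"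
  shows "\<bar>t\<bar> \<le> M \<Longrightarrow> far_part s M t = 0"
    and "M * s / (s - 1) \<le> \<bar>t\<bar> \<Longrightarrow> far_part s M t = t"
    and "M \<le> \<bar>t\<bar> \<Longrightarrow> \<bar>t\<bar> \<le> M * s / (s - 1) \<Longrightarrow> far_part s M t = (if 0 \<le> t then s * (\<bar>t\<bar> - M) else - (s * (\<bar>t\<bar> - M)))"
    and "\<bar>far_part s M t\<bar> \<le> \<bar>t\<bar>" and "\<bar>t - far_part s M t\<bar> \<le> \<bar>t\<bar>"
proof -
  have B: "M * s / (s - 1) \<le> a \<longleftrightarrow> a \<le> s * (a - M)" "a \<le> M * s / (s - 1) \<longleftrightarrow> s * (a - M) \<le> a" for a
    using s by (auto simp: divide_le_eq le_divide_eq algebra_simps)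
  have MB: "M < M * s / (s - 1)" using s M by (simp add: less_divide_eq algebra_simps)
  have nn: "0 \<le> s * max (a - M) 0" for a using s by simp
  show "far_part s M t = 0" if "\<bar>t\<bar> \<le> M" using that by (auto simp: far_part_def odd_ext_def max_def min_def)
  show "far_part s M t = t" if "M * s / (s - 1) \<le> \<bar>t\<bar>"
    using that MB B(1)[of "\<bar>t\<bar>"] by (auto simp: far_part_def odd_ext_def max_def min_def abs_if split: if_splits)
  show "far_part s M t = (if 0 \<le> t then s * (\<bar>t\<bar> - M) else - (s * (\<bar>t\<bar> - M)))" if "M \<le> \<bar>t\<bar>" "\<bar>t\<bar> \<le> M * s / (s - 1)"
    using that B(2)[of "\<bar>t\<bar>"] by (auto simp: far_part_def odd_ext_def max_def min_def abs_if split: if_splits)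
  show "\<bar>far_part s M t\<bar> \<le> \<bar>t\<bar>" "\<bar>t - far_part s M t\<bar> \<le> \<bar>t\<bar>"
    using nn[of t] nn[of "- t"] by (auto simp: far_part_def odd_ext_def min_def)
qed

lemma far_part_right_derivative:
  assumes s: "1 < s" and M: "0 < M"
  obtains h where "\<And>t. (far_part s M has_real_derivative h t) (at_right t)"
    "\<And>t. h t = 0 \<or> h t = 1 \<or> h t = s" "\<And>t. \<bar>t\<bar> < M \<Longrightarrow> h t = 0"
proof -
  define B where "B = M * s / (s - 1)"
  have MB: "M < B" using s M by (simp add: B_def less_divide_eq algebra_simps)
  note v = far_part_values[OF s M, folded B_def]
  have "\<exists>d. (far_part s M has_real_derivative d) (at_right t) \<and> (d = 0 \<or> d = 1 \<or> d = s) \<and> (\<bar>t\<bar> < M \<longrightarrow> d = 0)" for t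
  proof -
    consider "B \<le> t" | "M \<le> t" "t < B" | "- M \<le> t" "t < M" | "- B \<le> t" "t < - M" | "t < - B" by linarith
    then show ?thesis
    proof cases
      case 1
      have "(far_part s M has_real_derivative 1) (at_right t)"
        by (rule right_derivative_affine[where u = "t + 1" and b = 0]) (use 1 MB M v(2) in auto)
      then show ?thesis using 1 MB by auto
    next
      case 2
      have "(far_part s M has_real_derivative s) (at_right t)"
        by (rule right_derivative_affine[where u = B and b = "- s * M"]) (use 2 MB M v(3) in \<open>auto simp: right_diff_distrib\<close>)
      then show ?thesis using 2 M by auto
    next
      case 3
      have "(far_part s M has_real_derivative 0) (at_right t)"
        by (rule right_derivative_affine[where u = M and b = 0]) (use 3 v(1) in auto)
      then show ?thesis by auto
    next
      case 4
      have "(far_part s M has_real_derivative s) (at_right t)"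
        by (rule right_derivative_affine[where u = "- M" and b = "s * M"]) (use 4 MB M v(3) in \<open>auto simp: right_diff_distrib\<close>)
      then show ?thesis using 4 M by auto
    next
      case 5
      have "(far_part s M has_real_derivative 1) (at_right t)"
        by (rule right_derivative_affine[where u = "- B" and b = 0]) (use 5 MB M v(2) in auto)
      then show ?thesis using 5 MB by auto
    qed
  qed
  then have "\<forall>t. \<exists>d. (far_part s M has_real_derivative d) (at_right t) \<and> (d = 0 \<or> d = 1 \<or> d = s) \<and> (\<bar>t\<bar> < M \<longrightarrow> d = 0)" by blast
  from choice[OF this] obtain h where
    "\<forall>t. (far_part s M has_real_derivative h t) (at_right t) \<and> (h t = 0 \<or> h t = 1 \<or> h t = s) \<and> (\<bar>t\<bar> < M \<longrightarrow> h t = 0)" ..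
  then show ?thesis by (intro that[of h]) auto
qed

text \<open>
  A bounded replacement for the identity.  It returns to zero instead of staying constant beyond \<open>K\<close>,
  so that the cut-offs at different levels differ from zero and from the identity on disjoint sets.
\<close>

definition near_part :: "real \<Rightarrow> real \<Rightarrow> real" where
  "near_part K = odd_ext (\<lambda>a. max 0 (min a (2 * K - a)))"

lemma near_part_lipschitz:
  assumes "0 \<le> K"
  shows "\<bar>near_part K x - near_part K y\<bar> \<le> 1 * \<bar>x - y\<bar>"
  unfolding near_part_def
  by (rule odd_ext_lipschitz) (use assms in \<open>auto simp: max_def min_def abs_if\<close>)

lemma near_part_values:
  assumes K: "0 < K"
  shows "\<bar>t\<bar> \<le> K \<Longrightarrow> near_part K t = t"
    and "K \<le> \<bar>t\<bar> \<Longrightarrow> \<bar>t\<bar> \<le> 2 * K \<Longrightarrow> near_part K t = (if 0 \<le> t then 2 * K - \<bar>t\<bar> else - (2 * K - \<bar>t\<bar>))"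
    and "2 * K \<le> \<bar>t\<bar> \<Longrightarrow> near_part K t = 0"
    and "\<bar>near_part K t\<bar> \<le> \<bar>t\<bar>" and "\<bar>near_part K t\<bar> \<le> K"
  using K by (auto simp: near_part_def odd_ext_def max_def min_def abs_if split: if_splits)

lemma near_part_right_derivative:
  assumes K: "0 < K"
  obtains h where "\<And>t. (near_part K has_real_derivative h t) (at_right t)"
    "\<And>t. \<bar>h t\<bar> \<le> 1" "\<And>t. \<bar>t\<bar> < K \<Longrightarrow> h t = 1"
proof -
  note v = near_part_values[OF K]
  have "\<exists>d. (near_part K has_real_derivative d) (at_right t) \<and> \<bar>d\<bar> \<le> 1 \<and> (\<bar>t\<bar> < K \<longrightarrow> d = 1)" for t
  proof -
    consider "2 * K \<le> t" | "K \<le> t" "t < 2 * K" | "- K \<le> t" "t < K" | "- (2 * K) \<le> t" "t < - K" | "t < - (2 * K)" by linarith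
    then show ?thesis
    proof cases
      case 1
      have "(near_part K has_real_derivative 0) (at_right t)"
        by (rule right_derivative_affine[where u = "t + 1" and b = 0]) (use 1 K v(3) in auto)
      then show ?thesis using 1 K by auto
    next
      case 2
      have "(near_part K has_real_derivative -1) (at_right t)"
        by (rule right_derivative_affine[where u = "2 * K" and b = "2 * K"]) (use 2 K v(2) in auto)
      then show ?thesis using 2 K by (intro exI[of _ "-1"]) auto
    next
      case 3
      have "(near_part K has_real_derivative 1) (at_right t)"
        by (rule right_derivative_affine[where u = K and b = 0]) (use 3 v(1) in auto)
      then show ?thesis by auto
    next
      case 4
      have "(near_part K has_real_derivative -1) (at_right t)"
        by (rule right_derivative_affine[where u = "- K" and b = "- (2 * K)"]) (use 4 K v(2) in auto)
      then show ?thesis using 4 K by (intro exI[of _ "-1"]) auto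
    next
      case 5
      have "(near_part K has_real_derivative 0) (at_right t)"
        by (rule right_derivative_affine[where u = "- (2 * K)" and b = 0]) (use 5 K v(3) in auto)
      then show ?thesis using 5 K by auto
    qed
  qed
  then have "\<forall>t. \<exists>d. (near_part K has_real_derivative d) (at_right t) \<and> \<bar>d\<bar> \<le> 1 \<and> (\<bar>t\<bar> < K \<longrightarrow> d = 1)" by blast
  from choice[OF this] obtain h where "\<forall>t. (near_part K has_real_derivative h t) (at_right t) \<and> \<bar>h t\<bar> \<le> 1 \<and> (\<bar>t\<bar> < K \<longrightarrow> h t = 1)" ..
  then show ?thesis by (intro that[of h]) auto
qed

text \<open>
  A single Lipschitz function that agrees with infinitely many of the cut-offs on the intervals where
  these are neither zero nor the identity.  It is the distance to the points \<open>0\<close> and \<open>q ^ i\<close>,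
  \<open>q = 2 * s / (s - 1)\<close>, except that distances to points on the left are multiplied by \<open>s\<close>.
  Composition with it yields a square integrable bound for the nonlinearity \<open>w\<close> along all these
  cut-offs at once.
\<close>

definition ratio :: "real \<Rightarrow> real" where
  "ratio s = 2 * s / (s - 1)"

definition nodes :: "real \<Rightarrow> real set" where
  "nodes s = insert 0 (range (\<lambda>i. ratio s ^ i))"

definition zigzag :: "real \<Rightarrow> real \<Rightarrow> real" where
  "zigzag s = odd_ext (\<lambda>a. INF d\<in>nodes s. max (s * (a - d)) (d - a))"

lemma ratio_gt_2: "1 < s \<Longrightarrow> 2 < ratio s"
  by (simp add: ratio_def less_divide_eq)

lemma zigzag_aux:
  assumes s: "1 < s"
  shows "bdd_below ((\<lambda>d. max (s * (a - d)) (d - a)) ` nodes s)" "nodes s \<noteq> {}"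
    "0 \<le> max (s * (a - d)) (d - a)"
proof -
  show nn: "0 \<le> max (s * (a - d)) (d - a)" for d
    using s by (cases "d \<le> a") (auto simp: le_max_iff_disj)
  then show "bdd_below ((\<lambda>d. max (s * (a - d)) (d - a)) ` nodes s)" by (intro bdd_belowI[of _ 0]) auto
qed (simp add: nodes_def)

lemma zigzag_lipschitz:
  assumes s: "1 < s"
  shows "\<bar>zigzag s x - zigzag s y\<bar> \<le> s * \<bar>x - y\<bar>"
  unfolding zigzag_def
proof (rule odd_ext_lipschitz)
  let ?h = "\<lambda>d a. max (s * (a - d)) (d - a)"
  note bdd = zigzag_aux(1)[OF s]
  have h: "?h d a \<le> ?h d b + s * \<bar>a - b\<bar>" for d a b
  proof -
    have "s * (a - d) = s * (b - d) + s * (a - b)" by (simp add: algebra_simps)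
    also have "\<dots> \<le> s * (b - d) + s * \<bar>a - b\<bar>" using s by (intro add_left_mono mult_left_mono) auto
    finally have "s * (a - d) \<le> ?h d b + s * \<bar>a - b\<bar>" by (simp add: max_def split: if_splits)
    moreover have "\<bar>a - b\<bar> \<le> s * \<bar>a - b\<bar>" using mult_right_mono[of 1 s "\<bar>a - b\<bar>"] s by simp
    moreover have "b - a \<le> \<bar>a - b\<bar>" by simp
    ultimately have "s * (a - d) \<le> ?h d b + s * \<bar>a - b\<bar>" "d - a \<le> (d - b) + s * \<bar>a - b\<bar>" by argo+
    moreover from this(2) have "d - a \<le> ?h d b + s * \<bar>a - b\<bar>" by (simp add: max_def split: if_splits)
    ultimately show ?thesis by simp
  qed
  have one: "(INF d\<in>nodes s. ?h d a) \<le> (INF d\<in>nodes s. ?h d b) + s * \<bar>a - b\<bar>" for a b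
  proof -
    have "(INF d\<in>nodes s. ?h d a) - s * \<bar>a - b\<bar> \<le> (INF d\<in>nodes s. ?h d b)"
    proof (rule cINF_greatest[OF zigzag_aux(2)[OF s]])
      fix d assume "d \<in> nodes s"
      then have "(INF d\<in>nodes s. ?h d a) \<le> ?h d a" by (rule cINF_lower[OF bdd])
      then show "(INF d\<in>nodes s. ?h d a) - s * \<bar>a - b\<bar> \<le> ?h d b" using h[of a d b] by linarith
    qed
    then show ?thesis by simp
  qed
  show "\<bar>(INF d\<in>nodes s. ?h d a) - (INF d\<in>nodes s. ?h d b)\<bar> \<le> s * \<bar>a - b\<bar>" for a b
    using one[of a b] one[of b a] by (simp add: abs_le_iff abs_minus_commute)
  show "(INF d\<in>nodes s. ?h d 0) = 0"
  proof (rule antisym)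
    show "(INF d\<in>nodes s. ?h d 0) \<le> 0" using cINF_lower[OF bdd, of 0 0] by (simp add: nodes_def)
    show "0 \<le> (INF d\<in>nodes s. ?h d 0)" by (rule cINF_greatest[OF zigzag_aux(2)[OF s] zigzag_aux(3)[OF s]])
  qed
qed

lemma zigzag_0 [simp]:
  assumes s: "1 < s" shows "zigzag s 0 = 0"
proof -
  have "(INF d\<in>nodes s. max (s * (0 - d)) (d - 0)) = 0"
  proof (rule antisym)
    show "(INF d\<in>nodes s. max (s * (0 - d)) (d - 0)) \<le> 0" using cINF_lower[OF zigzag_aux(1)[OF s], of 0 0] by (simp add: nodes_def)
    show "0 \<le> (INF d\<in>nodes s. max (s * (0 - d)) (d - 0))" by (rule cINF_greatest[OF zigzag_aux(2)[OF s] zigzag_aux(3)[OF s]])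
  qed
  then show ?thesis by (simp add: zigzag_def odd_ext_def)
qed

lemma zigzag_value:
  assumes s: "1 < s" and a: "ratio s ^ i \<le> \<bar>t\<bar>" "\<bar>t\<bar> \<le> ratio s ^ Suc i"
  shows "zigzag s t = (if 0 \<le> t then 1 else -1) * min (s * (\<bar>t\<bar> - ratio s ^ i)) (ratio s ^ Suc i - \<bar>t\<bar>)"
proof -
  let ?q = "ratio s" and ?a = "\<bar>t\<bar>"
  have q: "1 < ?q" using ratio_gt_2[OF s] by simp
  let ?h = "\<lambda>d. max (s * (?a - d)) (d - ?a)"
  have "(INF d\<in>nodes s. ?h d) = min (s * (?a - ?q ^ i)) (?q ^ Suc i - ?a)"
  proof (rule antisym)
    have n: "?q ^ i \<in> nodes s" "?q ^ Suc i \<in> nodes s" unfolding nodes_def by blast+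
    have 0: "0 \<le> s * (?a - ?q ^ i)" using s a(1) by simp
    have 1: "s * (?a - ?q ^ Suc i) \<le> 0" using s a(2) by (intro mult_nonneg_nonpos) auto
    have "(INF d\<in>nodes s. ?h d) \<le> ?h (?q ^ i)" by (rule cINF_lower[OF zigzag_aux(1)[OF s] n(1)])
    also have "\<dots> = s * (?a - ?q ^ i)" using 0 a(1) by (intro max_absorb1) linarith
    finally have A: "(INF d\<in>nodes s. ?h d) \<le> s * (?a - ?q ^ i)" .
    have "(INF d\<in>nodes s. ?h d) \<le> ?h (?q ^ Suc i)" by (rule cINF_lower[OF zigzag_aux(1)[OF s] n(2)])
    also have "\<dots> = ?q ^ Suc i - ?a" using 1 a(2) by (intro max_absorb2) linarith
    finally show "(INF d\<in>nodes s. ?h d) \<le> min (s * (?a - ?q ^ i)) (?q ^ Suc i - ?a)" using A by simp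
    show "min (s * (?a - ?q ^ i)) (?q ^ Suc i - ?a) \<le> (INF d\<in>nodes s. ?h d)"
    proof (rule cINF_greatest[OF zigzag_aux(2)[OF s]])
      fix d assume "d \<in> nodes s"
      then have "d \<le> ?q ^ i \<or> ?q ^ Suc i \<le> d"
      proof (unfold nodes_def, elim insertE rangeE)
        fix j assume "d = ?q ^ j"
        moreover have "?q ^ j \<le> ?q ^ i \<or> ?q ^ Suc i \<le> ?q ^ j"
          using q by (cases "j \<le> i") (simp_all add: power_increasing del: power_Suc)
        ultimately show ?thesis by simp
      qed (use q in simp)
      then show "min (s * (?a - ?q ^ i)) (?q ^ Suc i - ?a) \<le> ?h d"
      proof
        assume "d \<le> ?q ^ i"
        then have "s * (?a - ?q ^ i) \<le> s * (?a - d)" using s by (intro mult_left_mono) auto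
        then show ?thesis by (meson max.coboundedI1 min.coboundedI1)
      next
        assume "?q ^ Suc i \<le> d"
        then have "?q ^ Suc i - ?a \<le> d - ?a" by simp
        then show ?thesis by (meson max.coboundedI2 min.coboundedI2)
      qed
    qed
  qed
  then show ?thesis by (auto simp: zigzag_def odd_ext_def)
qed

text \<open>
  The first alternatives cover moduli up to \<open>ratio s ^ i\<close> and beyond half of \<open>ratio s ^ Suc i\<close>; in
  between, where the cut-off has slope \<open>s\<close>, it follows the ascending branch of the zigzag.
\<close>

lemma far_part_cases:
  assumes s: "1 < s"
  shows "far_part s (ratio s ^ i) t = 0 \<or> far_part s (ratio s ^ i) t = t \<or> far_part s (ratio s ^ i) t = zigzag s t"
proof -
  let ?M = "ratio s ^ i"
  have M: "0 < ?M" using ratio_gt_2[OF s] by simp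
  define B where "B = ?M * s / (s - 1)"
  have q: "ratio s ^ Suc i = 2 * B" by (simp add: B_def ratio_def)
  have B: "0 < B" using M s by (simp add: B_def)
  note v = far_part_values[OF s M, folded B_def]
  consider "\<bar>t\<bar> \<le> ?M" | "B \<le> \<bar>t\<bar>" | "?M \<le> \<bar>t\<bar>" "\<bar>t\<bar> \<le> B" by linarith
  then show ?thesis
  proof cases
    case 3
    have "(s - 1) * \<bar>t\<bar> \<le> (s - 1) * B" using 3(2) s by (intro mult_left_mono) auto
    also have "(s - 1) * B = s * ?M" using s by (simp add: B_def)
    finally have "s * (\<bar>t\<bar> - ?M) \<le> \<bar>t\<bar>" by (simp add: algebra_simps)
    then have "s * (\<bar>t\<bar> - ?M) \<le> 2 * B - \<bar>t\<bar>" using 3(2) by linarith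
    then have "zigzag s t = (if 0 \<le> t then 1 else -1) * (s * (\<bar>t\<bar> - ?M))"
      using zigzag_value[OF s 3(1)] 3(2) B unfolding q by (simp add: min_absorb1)
    then show ?thesis using v(3)[OF 3] by auto
  qed (use v in auto)
qed

text \<open>
  For \<open>s = 2\<close> the nodes are the powers of \<open>4\<close>, and the descending branch of the zigzag runs between
  \<open>2 * 4 ^ i\<close> and \<open>4 * 4 ^ i\<close>.
\<close>

lemma near_part_cases: "near_part (2 * 4 ^ i) t = 0 \<or> near_part (2 * 4 ^ i) t = t \<or> near_part (2 * 4 ^ i) t = zigzag 2 t"
proof -
  let ?K = "2 * 4 ^ i :: real"
  have K: "0 < ?K" by simp
  have q: "ratio 2 = 4" by (simp add: ratio_def)
  note v = near_part_values[OF K]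
  consider "\<bar>t\<bar> \<le> ?K" | "2 * ?K \<le> \<bar>t\<bar>" | "?K \<le> \<bar>t\<bar>" "\<bar>t\<bar> \<le> 2 * ?K" by linarith
  then show ?thesis
  proof cases
    case 3
    have "zigzag 2 t = (if 0 \<le> t then 1 else -1) * min (2 * (\<bar>t\<bar> - ratio 2 ^ i)) (ratio 2 ^ Suc i - \<bar>t\<bar>)"
      by (rule zigzag_value) (use 3 in \<open>auto simp: q\<close>)
    also have "min (2 * (\<bar>t\<bar> - ratio 2 ^ i)) (ratio 2 ^ Suc i - \<bar>t\<bar>) = 2 * ?K - \<bar>t\<bar>"
      using 3 by (simp add: q min_def)
    finally show ?thesis using v(2)[OF 3] by auto
  qed (use v in auto)
qed

section \<open>Passage to the limit in the state problem\<close>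

text \<open>Fatou's lemma for a lower bound of the limit that holds up to arbitrarily small errors.\<close>

lemma Fatou_bound:
  fixes \<phi> :: "nat \<Rightarrow> 'a \<Rightarrow> real"
  assumes \<phi>: "\<And>k. integrable M (\<phi> k)" "\<And>k x. 0 \<le> \<phi> k x"
    and g: "g \<in> borel_measurable M" "\<And>x. 0 \<le> g x"
    and low: "AE x in M. \<forall>e>0. \<forall>\<^sub>F k in sequentially. g x - e \<le> \<phi> k x"
    and t: "\<And>k. (LINT x|M. \<phi> k x) \<le> t k" "t \<longlonglongrightarrow> T"
  shows "integrable M g" "(LINT x|M. g x) \<le> T"
proof -
  have T: "0 \<le> T"
  proof (rule LIMSEQ_le_const[OF t(2)], intro exI allI impI)
    fix k
    have "0 \<le> (LINT x|M. \<phi> k x)" using \<phi>(2) by (intro integral_nonneg_AE) auto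
    then show "0 \<le> t k" using t(1)[of k] by linarith
  qed
  have "(\<integral>\<^sup>+x. ennreal (g x) \<partial>M) \<le> (\<integral>\<^sup>+x. liminf (\<lambda>k. ennreal (\<phi> k x)) \<partial>M)"
  proof (rule nn_integral_mono_AE, use low in eventually_elim)
    fix x assume l: "\<forall>e>0. \<forall>\<^sub>F k in sequentially. g x - e \<le> \<phi> k x"
    show "ennreal (g x) \<le> liminf (\<lambda>k. ennreal (\<phi> k x))"
    proof (rule ennreal_le_epsilon)
      fix e :: real assume e: "0 < e"
      have "\<forall>\<^sub>F k in sequentially. ennreal (g x - e) \<le> ennreal (\<phi> k x)"
        using l e by (auto elim!: eventually_mono intro: ennreal_leI)
      then have "ennreal (g x - e) \<le> liminf (\<lambda>k. ennreal (\<phi> k x))" by (rule Liminf_bounded)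
      then have "ennreal (g x - e) + ennreal e \<le> liminf (\<lambda>k. ennreal (\<phi> k x)) + ennreal e" by (rule add_right_mono)
      moreover have "ennreal (g x) \<le> ennreal (g x - e) + ennreal e"
      proof (cases "e \<le> g x")
        case True then show ?thesis using e by (simp add: ennreal_plus[symmetric] del: ennreal_plus)
      next
        case False
        then have "ennreal (g x) \<le> ennreal e" by (intro ennreal_leI) simp
        then show ?thesis by (simp add: add_increasing)
      qed
      ultimately show "ennreal (g x) \<le> liminf (\<lambda>k. ennreal (\<phi> k x)) + ennreal e" using order_trans by blast
    qed
  qed
  also have "\<dots> \<le> liminf (\<lambda>k. \<integral>\<^sup>+x. ennreal (\<phi> k x) \<partial>M)"
    using \<phi>(1) by (intro nn_integral_liminf) (auto dest: borel_measurable_integrable)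
  also have "\<dots> \<le> liminf (\<lambda>k. ennreal (t k))"
  proof (rule Liminf_mono, rule always_eventually, rule allI)
    fix k
    have "(\<integral>\<^sup>+x. ennreal (\<phi> k x) \<partial>M) = ennreal (LINT x|M. \<phi> k x)"
      using \<phi> by (intro nn_integral_eq_integral) auto
    then show "(\<integral>\<^sup>+x. ennreal (\<phi> k x) \<partial>M) \<le> ennreal (t k)" using t(1)[of k] by (simp add: ennreal_leI)
  qed
  also have "\<dots> = ennreal T" by (intro lim_imp_Liminf tendsto_ennrealI t(2)) simp
  finally have le: "(\<integral>\<^sup>+x. ennreal (g x) \<partial>M) \<le> ennreal T" .
  then have "(\<integral>\<^sup>+x. ennreal (norm (g x)) \<partial>M) < \<infinity>" using g(2) by (simp add: le_less_trans[OF _ ennreal_less_top])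
  then show i: "integrable M g" using g(1) by (intro integrableI_bounded) auto
  have "ennreal (LINT x|M. g x) \<le> ennreal T"
    using nn_integral_eq_integral[OF i] g(2) le by simp
  then show "(LINT x|M. g x) \<le> T" using T by (simp add: ennreal_le_iff)
qed

lemma lipschitz_continuous:
  fixes g :: "real \<Rightarrow> real"
  assumes "\<And>s t. \<bar>g s - g t\<bar> \<le> L * \<bar>s - t\<bar>"
  shows "continuous_on UNIV g"
proof -
  have "0 \<le> L" using assms[of 1 0] abs_ge_zero[of "g 1 - g 0"] by simp
  then have "L-lipschitz_on UNIV g" using assms by (intro lipschitz_onI) (auto simp: dist_real_def)
  then show ?thesis by (rule lipschitz_on_continuous_on)
qed

lemma tendsto_continuous_UNIV:
  fixes g :: "real \<Rightarrow> real"
  assumes "continuous_on UNIV g" "(a \<longlongrightarrow> l) F"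
  shows "((\<lambda>k. g (a k)) \<longlongrightarrow> g l) F"
  by (rule continuous_on_tendsto_compose[OF assms]) auto

context state_problem
begin

text \<open>
  The gradient of a competitor is \<open>K + h *\<^sub>R (G - K)\<close> where \<open>h\<close> is the slope of a cut-off.  The
  slope \<open>s\<close>, greater than one, extrapolates beyond \<open>G\<close>; by convexity and quadratic growth this
  costs only a multiple of \<open>s - 1\<close>.
\<close>

lemma slope_estimate:
  assumes s: "1 < s" "s \<le> 2" and h: "h = 0 \<or> h = 1 \<or> h = s"
  shows "W (K + h *\<^sub>R (G - K)) + c
    \<le> (W K + c) + (if h = 0 then 0 else W G + c) + 9 * C * (s - 1) * (1 + (norm G)\<^sup>2 + (norm K)\<^sup>2)"
proof -
  have E: "0 \<le> 9 * C * (s - 1) * (1 + (norm G)\<^sup>2 + (norm K)\<^sup>2)" using s C_pos by simp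
  have WK: "0 \<le> W p + c" for p
  proof -
    have "0 \<le> c * (norm p)\<^sup>2" using c_pos by simp
    then show ?thesis using W_lower[of p] by (simp add: right_diff_distrib)
  qed
  consider "h = 0" | "h = 1" | "h = s" using h by blast
  then show ?thesis
  proof cases
    case 1 then show ?thesis using E by simp
  next
    case 2 then show ?thesis using E WK[of K] by simp
  next
    case 3
    have eq: "K + s *\<^sub>R (G - K) = (1 - (s - 1)) *\<^sub>R G + (s - 1) *\<^sub>R (2 *\<^sub>R G - K)"
      by (simp add: scaleR_diff_left scaleR_diff_right scaleR_2 scaleR_add_left scaleR_add_right)
    have "W (K + s *\<^sub>R (G - K)) \<le> (1 - (s - 1)) * W G + (s - 1) * W (2 *\<^sub>R G - K)"
      unfolding eq using s by (intro convex_onD[OF W_convex]) auto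
    also have "\<dots> = W G + (s - 1) * (W (2 *\<^sub>R G - K) - W G)" by (simp add: algebra_simps)
    also have "(s - 1) * (W (2 *\<^sub>R G - K) - W G) \<le> (s - 1) * (9 * C * (1 + (norm G)\<^sup>2 + (norm K)\<^sup>2))"
    proof (rule mult_left_mono)
      have "(norm (2 *\<^sub>R G - K))\<^sup>2 \<le> 8 * (norm G)\<^sup>2 + 2 * (norm K)\<^sup>2"
        using norm_add_sq_le[of "2 *\<^sub>R G" "- K"] by (simp add: power_mult_distrib)
      then have "C * ((norm (2 *\<^sub>R G - K))\<^sup>2 + 1) \<le> C * (8 * (norm G)\<^sup>2 + 2 * (norm K)\<^sup>2 + 1)"
        using C_pos by (intro mult_left_mono) auto
      then have "W (2 *\<^sub>R G - K) - W G \<le> C * (8 * (norm G)\<^sup>2 + 2 * (norm K)\<^sup>2 + 1) + C * ((norm G)\<^sup>2 + 1)"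
        using W_upper[of "2 *\<^sub>R G - K"] W_abs_le[of G] by linarith
      also have "\<dots> = 9 * C * (norm G)\<^sup>2 + 2 * C * (norm K)\<^sup>2 + 2 * C" by (simp add: algebra_simps)
      also have "\<dots> \<le> 9 * C * (norm G)\<^sup>2 + 9 * C * (norm K)\<^sup>2 + 9 * C"
        using C_pos by (intro add_mono mult_right_mono) auto
      finally show "W (2 *\<^sub>R G - K) - W G \<le> 9 * C * (1 + (norm G)\<^sup>2 + (norm K)\<^sup>2)" by (simp add: algebra_simps)
    qed (use s in simp)
    finally have "W (K + s *\<^sub>R (G - K)) \<le> W G + (s - 1) * (9 * C * (1 + (norm G)\<^sup>2 + (norm K)\<^sup>2))" by simp
    also have "(s - 1) * (9 * C * (1 + (norm G)\<^sup>2 + (norm K)\<^sup>2)) = 9 * C * (s - 1) * (1 + (norm G)\<^sup>2 + (norm K)\<^sup>2)"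
      by (simp only: mult_ac)
    finally have "W (K + s *\<^sub>R (G - K)) \<le> W G + 9 * C * (s - 1) * (1 + (norm G)\<^sup>2 + (norm K)\<^sup>2)" .
    moreover have "h \<noteq> 0" using 3 s by simp
    ultimately show ?thesis unfolding 3 using WK[of K] s by simp
  qed
qed

end

lemma eventually_less_power:
  fixes q :: real
  assumes "1 < q"
  shows "\<forall>\<^sub>F i in sequentially. a < q ^ i"
proof -
  obtain n where n: "a < q ^ n" using real_arch_pow[OF assms] by blast
  have "a < q ^ i" if "n \<le> i" for i
    using n power_increasing[OF that, of q] assms by linarith
  then show ?thesis unfolding eventually_sequentially by blast
qed

lemma (in state_problem) w_cutoff_L2:
  assumes "H0 \<Omega> z K" "H0 \<Omega> v V" and g: "\<And>s t. \<bar>g s - g t\<bar> \<le> L * \<bar>s - t\<bar>" "g 0 = 0"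
  shows "(\<lambda>x. w (z x + g (v x))) \<in> L2_on \<mu>"
proof -
  obtain V' where "H0 \<Omega> (\<lambda>x. g (v x)) V'" by (rule H0_lipschitz[OF assms(2) g])
  from w_L2[OF H0_add[OF assms(1) this]] show ?thesis .
qed

text \<open>
  Controls \<open>u j\<close> with minimizers \<open>y j\<close>.  Neither the controls nor the gradients converge; only
  convex combinations of them do, with weights \<open>b\<close> that move to infinity.
\<close>

locale converging_states = state_problem \<Omega> f W w c C
  for \<Omega> :: "(real^'n) set" and f W w c C +
  fixes u :: "nat \<Rightarrow> real^'n \<Rightarrow> real" and y :: "nat \<Rightarrow> real^'n \<Rightarrow> real" and G :: "nat \<Rightarrow> real^'n \<Rightarrow> real^'n"
    and u0 y0 :: "real^'n \<Rightarrow> real" and G0 :: "real^'n \<Rightarrow> real^'n"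
    and b :: "nat \<Rightarrow> nat \<Rightarrow> real" and m :: "nat \<Rightarrow> nat" and R :: real
  assumes u_L2: "\<And>j. u j \<in> L2_on \<mu>" "u0 \<in> L2_on \<mu>" and u_bounded: "\<And>j. nsq \<mu> (u j) \<le> R"
    and y_H0: "\<And>j. H0 \<Omega> (y j) (G j)" "H0 \<Omega> y0 G0" and G_bounded: "\<And>j. nsq \<mu> (G j) \<le> R"
    and minimal: "\<And>j z K. H0 \<Omega> z K \<Longrightarrow> J (u j) (y j) (G j) \<le> J (u j) z K"
    and y_conv: "AE x in \<mu>. (\<lambda>j. y j x) \<longlonglongrightarrow> y0 x"
    and weights: "tail_weights b m"
    and u_conv: "(\<lambda>k. nsq \<mu> (\<lambda>x. (\<Sum>j=k..m k. b k j * u j x) - u0 x)) \<longlonglongrightarrow> 0"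
    and G_conv: "AE x in \<mu>. (\<lambda>k. \<Sum>j=k..m k. b k j *\<^sub>R G j x) \<longlonglongrightarrow> G0 x"
begin

lemma weights_nonneg: "0 \<le> b k j" and weights_sum: "(\<Sum>j=k..m k. b k j) = 1"
  using weights by (auto simp: tail_weights_def)

lemmas weights_tendsto = tail_weights_tendsto[where 'b = real, OF weights, unfolded real_scaleR_def]

text \<open>
  The strong convergence of \<open>a\<close> leaves only the limit \<open>a0\<close> to be paired with the combinations of the
  controls, which converge strongly themselves.
\<close>

lemma pairing_converges:
  assumes a: "\<And>j. a j \<in> L2_on \<mu>" "a0 \<in> L2_on \<mu>" "(\<lambda>j. nsq \<mu> (\<lambda>x. a j x - a0 x)) \<longlonglongrightarrow> 0"
  shows "(\<lambda>k. \<Sum>j=k..m k. b k j * (LINT x|\<mu>. a j x * u j x)) \<longlonglongrightarrow> (LINT x|\<mu>. a0 x * u0 x)"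
proof -
  have d0: "(\<lambda>j. LINT x|\<mu>. (a j x - a0 x) * u j x) \<longlonglongrightarrow> 0"
  proof (rule Lim_null_comparison[OF always_eventually[OF allI]])
    fix j
    have "\<bar>LINT x|\<mu>. (a j x - a0 x) * u j x\<bar> \<le> sqrt (nsq \<mu> (\<lambda>x. a j x - a0 x)) * sqrt (nsq \<mu> (u j))"
      by (rule nsq_Cauchy_Schwarz[OF L2_on_diff[OF a(1,2)] u_L2(1)])
    also have "\<dots> \<le> sqrt (nsq \<mu> (\<lambda>x. a j x - a0 x)) * sqrt R"
      using u_bounded[of j] by (intro mult_left_mono) auto
    finally show "norm (LINT x|\<mu>. (a j x - a0 x) * u j x) \<le> sqrt (nsq \<mu> (\<lambda>x. a j x - a0 x)) * sqrt R" by simp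
  next
    show "(\<lambda>j. sqrt (nsq \<mu> (\<lambda>x. a j x - a0 x)) * sqrt R) \<longlonglongrightarrow> 0"
      using tendsto_mult_left_zero[OF tendsto_real_sqrt[OF a(3), simplified], of "sqrt R"] .
  qed
  have uL: "(\<lambda>x. \<Sum>j=k..m k. b k j * u j x) \<in> L2_on \<mu>" for k by (intro L2_on_sum L2_on_cmult u_L2(1))
  have "(\<Sum>j=k..m k. b k j * (LINT x|\<mu>. a j x * u j x))
      = (LINT x|\<mu>. (\<Sum>j=k..m k. b k j * u j x) * a0 x) + (\<Sum>j=k..m k. b k j * (LINT x|\<mu>. (a j x - a0 x) * u j x))" for k
  proof -
    have i: "integrable \<mu> (\<lambda>x. a0 x * u j x)" "integrable \<mu> (\<lambda>x. a j x * u j x)" for j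
      by (intro L2_on_mult_integrable a u_L2)+
    have "(LINT x|\<mu>. (\<Sum>j=k..m k. b k j * u j x) * a0 x) = (LINT x|\<mu>. (\<Sum>j=k..m k. b k j * (a0 x * u j x)))"
      by (simp add: sum_distrib_left mult_ac)
    also have "\<dots> = (\<Sum>j=k..m k. b k j * (LINT x|\<mu>. a0 x * u j x))"
      using i by (subst Bochner_Integration.integral_sum) auto
    finally show ?thesis using i by (simp add: left_diff_distrib sum.distrib[symmetric] algebra_simps)
  qed
  moreover have "(\<lambda>k. (LINT x|\<mu>. (\<Sum>j=k..m k. b k j * u j x) * a0 x)
      + (\<Sum>j=k..m k. b k j * (LINT x|\<mu>. (a j x - a0 x) * u j x))) \<longlonglongrightarrow> (LINT x|\<mu>. u0 x * a0 x) + 0"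
    by (intro tendsto_add tendsto_L2_mult_integral[OF uL u_L2(2) u_conv a(2)] weights_tendsto[OF d0])
  ultimately show ?thesis by (simp add: mult.commute)
qed

text \<open>
  The competitor is \<open>z\<close> where \<open>y j\<close> is close to \<open>z\<close> and \<open>y j\<close> where it is far from it.  Where
  \<open>y j\<close> is far from \<open>z\<close>, the energies of \<open>y j\<close> on both sides of the comparison cancel.  What
  remains of the nonlinearity \<open>w\<close> is bounded, so it converges strongly and can be paired with the
  combinations of the controls.
\<close>

lemma truncated_comparison:
  assumes z: "H0 \<Omega> z K" "\<And>x. \<bar>z x\<bar> \<le> Z" and s: "1 < s" "s \<le> 2" and M: "0 < M"
  shows "(LINT x|\<mu>. (if \<bar>y0 x - z x\<bar> < M then W (G0 x) + c else 0))
      + (LINT x|\<mu>. (w (y0 x) - w (z x + far_part s M (y0 x - z x))) * u0 x)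
      + (LINT x|\<mu>. f x * (y0 x - z x - far_part s M (y0 x - z x)))
    \<le> (LINT x|\<mu>. W (K x) + c) + 9 * C * (s - 1) * (measure \<mu> \<Omega> + R + nsq \<mu> K)"
proof -
  let ?r = "far_part s M"
  define D where "D = M * s / (s - 1)"
  have D: "0 < D" using s M by (simp add: D_def)
  note v = far_part_values[OF s(1) M, folded D_def]
  have r0: "?r 0 = 0" using v(1)[of 0] M by simp
  note lip = far_part_lipschitz[OF s(1) less_imp_le[OF M]]
  note rc = lipschitz_continuous[OF lip]
  obtain h where h: "\<And>t. (?r has_real_derivative h t) (at_right t)"
    "\<And>t. h t = 0 \<or> h t = 1 \<or> h t = s" "\<And>t. \<bar>t\<bar> < M \<Longrightarrow> h t = 0"
    by (rule far_part_right_derivative[OF s(1) M]) blast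
  have comp: "H0 \<Omega> (\<lambda>x. z x + ?r (v x - z x)) (\<lambda>x. K x + h (v x - z x) *\<^sub>R (V x - K x))" if "H0 \<Omega> v V" for v V
    by (rule H0_add[OF z(1) H0_chain[OF H0_diff[OF that z(1)] lip r0 h(1)]])
  obtain A where A: "\<And>t. \<bar>t\<bar> \<le> Z + D \<Longrightarrow> \<bar>w t\<bar> \<le> A"
  proof -
    have "compact (w ` {- (Z + D)..Z + D})"
      by (intro compact_continuous_image continuous_on_subset[OF w_continuous]) auto
    then obtain A where "\<forall>q\<in>w ` {- (Z + D)..Z + D}. norm q \<le> A"
      using compact_imp_bounded bounded_iff by metis
    then show ?thesis by (intro that[of A]) (simp add: abs_le_iff)
  qed
  define a where "a v x = w (v x) - w (z x + ?r (v x - z x))" for v x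
  define e where "e v x = v x - z x - ?r (v x - z x)" for v x
  have aL: "a v \<in> L2_on \<mu>" if "H0 \<Omega> v V" for v V
    unfolding a_def[abs_def] by (intro L2_on_diff w_L2[OF that] w_L2[OF comp[OF that]])
  have eL: "e v \<in> L2_on \<mu>" if "H0 \<Omega> v V" for v V
  proof -
    have "e v = (\<lambda>x. v x - (z x + ?r (v x - z x)))" by (simp add: e_def fun_eq_iff)
    then show ?thesis using L2_on_diff[OF H0_L2(1)[OF that] H0_L2(1)[OF comp[OF that]]] by simp
  qed
  have ae: "\<bar>a v x\<bar> \<le> 2 * A \<and> \<bar>e v x\<bar> \<le> D" for v x
  proof (cases "D \<le> \<bar>v x - z x\<bar>")
    case True
    then have "?r (v x - z x) = v x - z x" by (rule v(2))
    moreover have "0 \<le> A" using A[of 0] z(2)[of x] D by force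
    ultimately show ?thesis using D by (simp add: a_def e_def)
  next
    case False
    have 1: "\<bar>v x\<bar> \<le> Z + D" using z(2)[of x] False by linarith
    have 2: "\<bar>z x + ?r (v x - z x)\<bar> \<le> Z + D" using z(2)[of x] False v(4)[of "v x - z x"] by linarith
    show ?thesis using A[OF 1] A[OF 2] v(5)[of "v x - z x"] False unfolding a_def e_def by linarith
  qed
  have rconv: "AE x in \<mu>. (\<lambda>j. ?r (y j x - z x)) \<longlonglongrightarrow> ?r (y0 x - z x)"
    using y_conv by eventually_elim (intro tendsto_continuous_UNIV[OF rc] tendsto_intros)
  have sq: "(norm q)\<^sup>2 \<le> B\<^sup>2" if "\<bar>q\<bar> \<le> B" for q B :: real using that by (simp add: power2_le_iff_abs_le)
  have aconv: "(\<lambda>j. nsq \<mu> (\<lambda>x. a (y j) x - a y0 x)) \<longlonglongrightarrow> 0"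
  proof (rule L2_dominated_convergence(2)[OF _ _ _ integrable_const[of "(2 * A)\<^sup>2"]])
    show "AE x in \<mu>. (\<lambda>j. a (y j) x) \<longlonglongrightarrow> a y0 x"
      using y_conv rconv unfolding a_def
      by eventually_elim (intro tendsto_diff tendsto_continuous_UNIV[OF w_continuous] tendsto_add tendsto_const)
    show "AE x in \<mu>. (norm (a (y j) x))\<^sup>2 \<le> (2 * A)\<^sup>2" for j using ae[of "y j"] sq by blast
  qed (use L2_onD(1)[OF aL[OF y_H0(1)]] L2_onD(1)[OF aL[OF y_H0(2)]] in auto)
  have econv: "(\<lambda>j. nsq \<mu> (\<lambda>x. e (y j) x - e y0 x)) \<longlonglongrightarrow> 0"
  proof (rule L2_dominated_convergence(2)[OF _ _ _ integrable_const[of "D\<^sup>2"]])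
    show "AE x in \<mu>. (\<lambda>j. e (y j) x) \<longlonglongrightarrow> e y0 x"
      using y_conv rconv unfolding e_def by eventually_elim (intro tendsto_diff tendsto_const)
    show "AE x in \<mu>. (norm (e (y j) x))\<^sup>2 \<le> D\<^sup>2" for j using ae[of "y j"] sq by blast
  qed (use L2_onD(1)[OF eL[OF y_H0(1)]] L2_onD(1)[OF eL[OF y_H0(2)]] in auto)
  define \<phi> where "\<phi> v V x = (if \<bar>v x - z x\<bar> < M then W (V x) + c else 0)" for v V x
  have Wc: "0 \<le> W p + c" for p
  proof -
    have "0 \<le> c * (norm p)\<^sup>2" using c_pos by simp
    then show ?thesis using W_lower[of p] by (simp add: right_diff_distrib)
  qed
  have \<phi>0: "0 \<le> \<phi> v V x" for v V x using Wc by (simp add: \<phi>_def)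
  have \<phi>i: "integrable \<mu> (\<phi> v V)" if "H0 \<Omega> v V" for v V
  proof (rule Bochner_Integration.integrable_bound)
    show "integrable \<mu> (\<lambda>x. W (V x) + c)"
      by (intro Bochner_Integration.integrable_add W_integrable[OF H0_L2(2)[OF that]] integrable_const)
    note [measurable] = L2_onD(1)[OF H0_L2(1)[OF that]] L2_onD(1)[OF H0_L2(2)[OF that]] L2_onD(1)[OF H0_L2(1)[OF z(1)]]
    show "\<phi> v V \<in> borel_measurable \<mu>" unfolding \<phi>_def[abs_def] by measurable
    show "AE x in \<mu>. norm (\<phi> v V x) \<le> norm (W (V x) + c)" using Wc by (simp add: \<phi>_def)
  qed
  define T where "T = (LINT x|\<mu>. W (K x) + c) + 9 * C * (s - 1) * (measure \<mu> \<Omega> + R + nsq \<mu> K)"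
  have each: "(LINT x|\<mu>. \<phi> (y j) (G j) x) + (LINT x|\<mu>. a (y j) x * u j x) + (LINT x|\<mu>. f x * e (y j) x) \<le> T" for j
  proof -
    note H = y_H0(1)[of j] and cH = comp[OF y_H0(1)[of j]]
    let ?z = "\<lambda>x. z x + ?r (y j x - z x)" and ?K = "\<lambda>x. K x + h (y j x - z x) *\<^sub>R (G j x - K x)"
    have iw: "integrable \<mu> (\<lambda>x. w (y j x) * u j x)" "integrable \<mu> (\<lambda>x. w (?z x) * u j x)"
      by (intro L2_on_mult_integrable w_L2[OF H] w_L2[OF cH] u_L2)+
    have ifs: "integrable \<mu> (\<lambda>x. f x * y j x)" "integrable \<mu> (\<lambda>x. f x * ?z x)"
      by (intro L2_on_mult_integrable f_L2 H0_L2(1)[OF H] H0_L2(1)[OF cH])+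
    have E1: "(LINT x|\<mu>. a (y j) x * u j x) = (LINT x|\<mu>. w (y j x) * u j x) - (LINT x|\<mu>. w (?z x) * u j x)"
      unfolding a_def left_diff_distrib by (rule Bochner_Integration.integral_diff[OF iw])
    have "(LINT x|\<mu>. f x * e (y j) x) = (LINT x|\<mu>. f x * y j x - f x * ?z x)"
      by (rule Bochner_Integration.integral_cong) (auto simp: e_def algebra_simps)
    then have E2: "(LINT x|\<mu>. f x * e (y j) x) = (LINT x|\<mu>. f x * y j x) - (LINT x|\<mu>. f x * ?z x)"
      by (simp only: Bochner_Integration.integral_diff[OF ifs])
    have iW: "integrable \<mu> (\<lambda>x. W (K x) + c)" "integrable \<mu> (\<lambda>x. W (G j x))" "integrable \<mu> (\<lambda>x. W (?K x))"
      by (intro Bochner_Integration.integrable_add W_integrable integrable_const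
        H0_L2(2)[OF H] H0_L2(2)[OF cH] H0_L2(2)[OF z(1)])+
    have iN: "integrable \<mu> (\<lambda>x. 1 + (norm (G j x))\<^sup>2 + (norm (K x))\<^sup>2)"
      by (intro Bochner_Integration.integrable_add integrable_const L2_onD(2) H0_L2(2)[OF H] H0_L2(2)[OF z(1)])
    have "(LINT x|\<mu>. W (?K x)) \<le> (LINT x|\<mu>. ((W (K x) + c) + W (G j x) - \<phi> (y j) (G j) x)
        + 9 * C * (s - 1) * (1 + (norm (G j x))\<^sup>2 + (norm (K x))\<^sup>2))"
    proof (rule integral_mono[OF iW(3)])
      show "W (?K x) \<le> ((W (K x) + c) + W (G j x) - \<phi> (y j) (G j) x)
        + 9 * C * (s - 1) * (1 + (norm (G j x))\<^sup>2 + (norm (K x))\<^sup>2)" for x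
        using slope_estimate[OF s h(2)[of "y j x - z x"], of "K x" "G j x"] h(3)[of "y j x - z x"] Wc[of "G j x"]
        unfolding \<phi>_def by (cases "h (y j x - z x) = 0"; cases "\<bar>y j x - z x\<bar> < M") auto
    qed (intro Bochner_Integration.integrable_add Bochner_Integration.integrable_diff iW \<phi>i[OF H] integrable_mult_right iN)
    also have "\<dots> = (LINT x|\<mu>. W (K x) + c) + (LINT x|\<mu>. W (G j x)) - (LINT x|\<mu>. \<phi> (y j) (G j) x)
        + 9 * C * (s - 1) * (LINT x|\<mu>. 1 + (norm (G j x))\<^sup>2 + (norm (K x))\<^sup>2)"
      using iW \<phi>i[OF H] iN
      by (subst Bochner_Integration.integral_add, (intro Bochner_Integration.integrable_add Bochner_Integration.integrable_diff iW \<phi>i[OF H] integrable_mult_right iN)+,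
        subst Bochner_Integration.integral_diff, (intro Bochner_Integration.integrable_add iW \<phi>i[OF H])+,
        subst Bochner_Integration.integral_add, (intro iW)+, subst Bochner_Integration.integral_mult_right_zero) simp
    also have "(LINT x|\<mu>. 1 + (norm (G j x))\<^sup>2 + (norm (K x))\<^sup>2) = measure \<mu> \<Omega> + nsq \<mu> (G j) + nsq \<mu> K"
      using L2_onD(2)[OF H0_L2(2)[OF H]] L2_onD(2)[OF H0_L2(2)[OF z(1)]] integrable_const
      by (simp add: nsq_def)
    finally have "(LINT x|\<mu>. W (?K x)) \<le> (LINT x|\<mu>. W (K x) + c) + (LINT x|\<mu>. W (G j x)) - (LINT x|\<mu>. \<phi> (y j) (G j) x)
        + 9 * C * (s - 1) * (measure \<mu> \<Omega> + nsq \<mu> (G j) + nsq \<mu> K)" .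
    moreover have "9 * C * (s - 1) * (measure \<mu> \<Omega> + nsq \<mu> (G j) + nsq \<mu> K) \<le> 9 * C * (s - 1) * (measure \<mu> \<Omega> + R + nsq \<mu> K)"
      using s C_pos G_bounded[of j] by (intro mult_left_mono) auto
    ultimately show ?thesis using minimal[OF cH, of j] unfolding J_def E1 E2 T_def by linarith
  qed
  define t where "t k = T - (\<Sum>j=k..m k. b k j * (LINT x|\<mu>. a (y j) x * u j x)) - (\<Sum>j=k..m k. b k j * (LINT x|\<mu>. f x * e (y j) x))" for k
  have fe: "(\<lambda>j. LINT x|\<mu>. f x * e (y j) x) \<longlonglongrightarrow> (LINT x|\<mu>. f x * e y0 x)"
    using tendsto_L2_mult_integral[OF eL[OF y_H0(1)] eL[OF y_H0(2)] econv f_L2] by (simp add: mult.commute)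
  have tT: "t \<longlonglongrightarrow> T - (LINT x|\<mu>. a y0 x * u0 x) - (LINT x|\<mu>. f x * e y0 x)"
    unfolding t_def[abs_def]
    by (intro tendsto_diff tendsto_const weights_tendsto[OF fe] pairing_converges[OF aL[OF y_H0(1)] aL[OF y_H0(2)] aconv])
  have "(LINT x|\<mu>. \<phi> y0 G0 x) \<le> T - (LINT x|\<mu>. a y0 x * u0 x) - (LINT x|\<mu>. f x * e y0 x)"
  proof (rule Fatou_bound(2)[where \<phi> = "\<lambda>k x. \<Sum>j=k..m k. b k j * \<phi> (y j) (G j) x", OF _ _ _ \<phi>0 _ _ tT])
    show "integrable \<mu> (\<lambda>x. \<Sum>j=k..m k. b k j * \<phi> (y j) (G j) x)" for k
      by (intro Bochner_Integration.integrable_sum integrable_mult_right \<phi>i[OF y_H0(1)])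
    show "0 \<le> (\<Sum>j=k..m k. b k j * \<phi> (y j) (G j) x)" for k x
      by (intro sum_nonneg mult_nonneg_nonneg weights_nonneg \<phi>0)
    show "\<phi> y0 G0 \<in> borel_measurable \<mu>" using \<phi>i[OF y_H0(2)] by (rule borel_measurable_integrable)
    show "(LINT x|\<mu>. (\<Sum>j=k..m k. b k j * \<phi> (y j) (G j) x)) \<le> t k" for k
    proof -
      have "(\<Sum>j=k..m k. b k j * ((LINT x|\<mu>. \<phi> (y j) (G j) x) + (LINT x|\<mu>. a (y j) x * u j x) + (LINT x|\<mu>. f x * e (y j) x)))
          \<le> (\<Sum>j=k..m k. b k j * T)"
        by (intro sum_mono mult_left_mono each weights_nonneg)
      also have "\<dots> = T" by (simp add: sum_distrib_right[symmetric] weights_sum)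
      moreover have "(LINT x|\<mu>. (\<Sum>j=k..m k. b k j * \<phi> (y j) (G j) x)) = (\<Sum>j=k..m k. b k j * (LINT x|\<mu>. \<phi> (y j) (G j) x))"
        using \<phi>i[OF y_H0(1)] by (subst Bochner_Integration.integral_sum) auto
      ultimately show ?thesis by (simp add: t_def distrib_left sum.distrib)
    qed
    show "AE x in \<mu>. \<forall>d>0. \<forall>\<^sub>F k in sequentially. \<phi> y0 G0 x - d \<le> (\<Sum>j=k..m k. b k j * \<phi> (y j) (G j) x)"
      using y_conv G_conv
    proof eventually_elim
      fix x assume yc: "(\<lambda>j. y j x) \<longlonglongrightarrow> y0 x" and Gc: "(\<lambda>k. \<Sum>j=k..m k. b k j *\<^sub>R G j x) \<longlonglongrightarrow> G0 x"
      show "\<forall>d>0. \<forall>\<^sub>F k in sequentially. \<phi> y0 G0 x - d \<le> (\<Sum>j=k..m k. b k j * \<phi> (y j) (G j) x)"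
      proof (cases "\<bar>y0 x - z x\<bar> < M")
        case False
        have "0 \<le> (\<Sum>j=k..m k. b k j * \<phi> (y j) (G j) x)" for k
          by (intro sum_nonneg mult_nonneg_nonneg weights_nonneg \<phi>0)
        then show ?thesis using False by (intro allI impI always_eventually) (smt (verit) \<phi>_def)
      next
        case True
        have "(\<lambda>j. \<bar>y j x - z x\<bar>) \<longlonglongrightarrow> \<bar>y0 x - z x\<bar>" by (intro tendsto_intros yc)
        from order_tendstoD(2)[OF this True] obtain n where n: "\<And>j. n \<le> j \<Longrightarrow> \<bar>y j x - z x\<bar> < M"
          unfolding eventually_sequentially by blast
        have Wl: "(\<lambda>k. W (\<Sum>j=k..m k. b k j *\<^sub>R G j x) + c) \<longlonglongrightarrow> W (G0 x) + c"
          by (intro tendsto_add tendsto_const continuous_on_tendsto_compose[OF W_continuous Gc]) auto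
        have jensen: "W (\<Sum>j=k..m k. b k j *\<^sub>R G j x) + c \<le> (\<Sum>j=k..m k. b k j * \<phi> (y j) (G j) x)" if "n \<le> k" for k
        proof -
          have "{k..m k} \<noteq> {}" using weights_sum[of k] by force
          then have "W (\<Sum>j=k..m k. b k j *\<^sub>R G j x) \<le> (\<Sum>j=k..m k. b k j * W (G j x))"
            by (intro convex_on_sum[OF _ _ W_convex weights_sum weights_nonneg]) auto
          also have "\<dots> = (\<Sum>j=k..m k. b k j * (W (G j x) + c)) - c"
            by (simp add: distrib_left sum.distrib sum_distrib_right[symmetric] weights_sum)
          also have "(\<Sum>j=k..m k. b k j * (W (G j x) + c)) = (\<Sum>j=k..m k. b k j * \<phi> (y j) (G j) x)"
            using n that by (intro sum.cong) (auto simp: \<phi>_def)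
          finally show ?thesis by simp
        qed
        show ?thesis
        proof (intro allI impI)
          fix d :: real assume "0 < d"
          then have "\<forall>\<^sub>F k in sequentially. W (G0 x) + c - d < W (\<Sum>j=k..m k. b k j *\<^sub>R G j x) + c"
            by (intro order_tendstoD(1)[OF Wl]) simp
          then show "\<forall>\<^sub>F k in sequentially. \<phi> y0 G0 x - d \<le> (\<Sum>j=k..m k. b k j * \<phi> (y j) (G j) x)"
            using eventually_ge_at_top[of n]
          proof eventually_elim
            case (elim k)
            then show ?case using jensen[of k] True by (simp add: \<phi>_def)
          qed
        qed
      qed
    qed
  qed
  then show ?thesis unfolding T_def \<phi>_def a_def e_def by (simp only: diff_le_eq add.assoc add.commute le_diff_eq add.left_commute)
qed

text \<open>
  The levels \<open>ratio s ^ i\<close> tend to infinity, where the cut-off disappears.  Along them the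
  nonlinearity takes its values at \<open>z\<close>, at \<open>y0\<close>, or at \<open>z\<close> plus the zigzag of \<open>y0 - z\<close>, and all three are
  square integrable.
\<close>

lemma limit_comparison:
  assumes z: "H0 \<Omega> z K" "\<And>x. \<bar>z x\<bar> \<le> Z" and s: "1 < s" "s \<le> 2"
  shows "J u0 y0 G0 \<le> J u0 z K + 9 * C * (s - 1) * (measure \<mu> \<Omega> + R + nsq \<mu> K)"
proof -
  define r where "r i = far_part s (ratio s ^ i)" for i
  have q: "1 < ratio s" using ratio_gt_2[OF s(1)] by simp
  have q0: "0 < ratio s ^ i" for i using q by simp
  note v = far_part_values[OF s(1) q0, folded r_def]
  have r0: "r i 0 = 0" for i using v(1)[of 0 i] q0[of i] by simp
  note lip = far_part_lipschitz[OF s(1) less_imp_le[OF q0], folded r_def]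
  note D = H0_diff[OF y_H0(2) z(1)]
  have wr: "(\<lambda>x. w (z x + r i (y0 x - z x))) \<in> L2_on \<mu>" for i by (rule w_cutoff_L2[OF z(1) D lip r0])
  have wz: "(\<lambda>x. w (z x + zigzag s (y0 x - z x))) \<in> L2_on \<mu>"
    by (rule w_cutoff_L2[OF z(1) D zigzag_lipschitz[OF s(1)] zigzag_0[OF s(1)]])
  have ev: "\<forall>\<^sub>F i in sequentially. \<bar>y0 x - z x\<bar> < ratio s ^ i" for x by (rule eventually_less_power[OF q])
  note [measurable] = L2_onD(1)[OF H0_L2(1)[OF y_H0(2)]] L2_onD(1)[OF H0_L2(2)[OF y_H0(2)]] L2_onD(1)[OF H0_L2(1)[OF z(1)]]
  have lim1: "(\<lambda>i. LINT x|\<mu>. (if \<bar>y0 x - z x\<bar> < ratio s ^ i then W (G0 x) + c else 0)) \<longlonglongrightarrow> (LINT x|\<mu>. W (G0 x) + c)"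
  proof (rule integral_dominated_convergence[where w = "\<lambda>x. \<bar>W (G0 x) + c\<bar>"])
    show "integrable \<mu> (\<lambda>x. \<bar>W (G0 x) + c\<bar>)"
      by (intro integrable_abs Bochner_Integration.integrable_add W_integrable[OF H0_L2(2)[OF y_H0(2)]] integrable_const)
    show "AE x in \<mu>. (\<lambda>i. if \<bar>y0 x - z x\<bar> < ratio s ^ i then W (G0 x) + c else 0) \<longlonglongrightarrow> W (G0 x) + c"
    proof (rule AE_I2, rule tendsto_eventually)
      fix x show "\<forall>\<^sub>F i in sequentially. (if \<bar>y0 x - z x\<bar> < ratio s ^ i then W (G0 x) + c else 0) = W (G0 x) + c"
        using ev[of x] by eventually_elim simp
    qed
  qed (auto simp: abs_if)
  have lim2: "(\<lambda>i. LINT x|\<mu>. (w (y0 x) - w (z x + r i (y0 x - z x))) * u0 x) \<longlonglongrightarrow> (LINT x|\<mu>. (w (y0 x) - w (z x)) * u0 x)"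
  proof (rule integral_dominated_convergence[where
        w = "\<lambda>x. (2 * \<bar>w (y0 x)\<bar> + \<bar>w (z x)\<bar> + \<bar>w (z x + zigzag s (y0 x - z x))\<bar>) * \<bar>u0 x\<bar>"])
    have "(\<lambda>x. 2 * norm (w (y0 x)) + norm (w (z x)) + norm (w (z x + zigzag s (y0 x - z x)))) \<in> L2_on \<mu>"
      by (intro L2_on_add L2_on_cmult L2_on_norm w_L2[OF y_H0(2)] w_L2[OF z(1)] wz)
    from L2_on_mult_integrable[OF this L2_on_norm[OF u_L2(2)]]
    show "integrable \<mu> (\<lambda>x. (2 * \<bar>w (y0 x)\<bar> + \<bar>w (z x)\<bar> + \<bar>w (z x + zigzag s (y0 x - z x))\<bar>) * \<bar>u0 x\<bar>)" by simp
    show "(\<lambda>x. (w (y0 x) - w (z x)) * u0 x) \<in> borel_measurable \<mu>"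
      by (intro borel_measurable_integrable L2_on_mult_integrable L2_on_diff w_L2[OF y_H0(2)] w_L2[OF z(1)] u_L2)
    show "(\<lambda>x. (w (y0 x) - w (z x + r i (y0 x - z x))) * u0 x) \<in> borel_measurable \<mu>" for i
      by (intro borel_measurable_integrable L2_on_mult_integrable L2_on_diff w_L2[OF y_H0(2)] wr u_L2)
    show "AE x in \<mu>. (\<lambda>i. (w (y0 x) - w (z x + r i (y0 x - z x))) * u0 x) \<longlonglongrightarrow> (w (y0 x) - w (z x)) * u0 x"
    proof (rule AE_I2, rule tendsto_eventually)
      fix x show "\<forall>\<^sub>F i in sequentially. (w (y0 x) - w (z x + r i (y0 x - z x))) * u0 x = (w (y0 x) - w (z x)) * u0 x"
        using ev[of x] by eventually_elim (simp add: v(1))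
    qed
    show "AE x in \<mu>. norm ((w (y0 x) - w (z x + r i (y0 x - z x))) * u0 x)
      \<le> (2 * \<bar>w (y0 x)\<bar> + \<bar>w (z x)\<bar> + \<bar>w (z x + zigzag s (y0 x - z x))\<bar>) * \<bar>u0 x\<bar>" for i
    proof (rule AE_I2)
      fix x
      have "\<bar>w (y0 x) - w (z x + r i (y0 x - z x))\<bar> \<le> 2 * \<bar>w (y0 x)\<bar> + \<bar>w (z x)\<bar> + \<bar>w (z x + zigzag s (y0 x - z x))\<bar>"
        using far_part_cases[OF s(1), of i "y0 x - z x", folded r_def] by auto
      then show "norm ((w (y0 x) - w (z x + r i (y0 x - z x))) * u0 x)
        \<le> (2 * \<bar>w (y0 x)\<bar> + \<bar>w (z x)\<bar> + \<bar>w (z x + zigzag s (y0 x - z x))\<bar>) * \<bar>u0 x\<bar>"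
        by (simp add: abs_mult mult_right_mono)
    qed
  qed
  have lim3: "(\<lambda>i. LINT x|\<mu>. f x * (y0 x - z x - r i (y0 x - z x))) \<longlonglongrightarrow> (LINT x|\<mu>. f x * (y0 x - z x))"
  proof (rule integral_dominated_convergence[where w = "\<lambda>x. norm (f x) * norm (y0 x - z x)"])
    show "integrable \<mu> (\<lambda>x. norm (f x) * norm (y0 x - z x))"
      by (rule L2_on_inner_integrable(1)[OF f_L2 H0_L2(1)[OF D]])
    show "(\<lambda>x. f x * (y0 x - z x)) \<in> borel_measurable \<mu>"
      by (intro borel_measurable_integrable L2_on_mult_integrable f_L2 H0_L2(1)[OF D])
    show "(\<lambda>x. f x * (y0 x - z x - r i (y0 x - z x))) \<in> borel_measurable \<mu>" for i
      by (intro borel_measurable_integrable L2_on_mult_integrable[OF f_L2] L2_on_diff[OF H0_L2(1)[OF D]]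
        L2_on_lipschitz[OF H0_L2(1)[OF D] lip borel_measurable_continuous_onI[OF lipschitz_continuous[OF lip]] r0])
    show "AE x in \<mu>. (\<lambda>i. f x * (y0 x - z x - r i (y0 x - z x))) \<longlonglongrightarrow> f x * (y0 x - z x)"
    proof (rule AE_I2, rule tendsto_eventually)
      fix x show "\<forall>\<^sub>F i in sequentially. f x * (y0 x - z x - r i (y0 x - z x)) = f x * (y0 x - z x)"
        using ev[of x] by eventually_elim (simp add: v(1))
    qed
    show "AE x in \<mu>. norm (f x * (y0 x - z x - r i (y0 x - z x))) \<le> norm (f x) * norm (y0 x - z x)" for i
      by (intro AE_I2) (auto simp: abs_mult v(5) intro!: mult_left_mono)
  qed
  have "(LINT x|\<mu>. W (G0 x) + c) + (LINT x|\<mu>. (w (y0 x) - w (z x)) * u0 x) + (LINT x|\<mu>. f x * (y0 x - z x))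
      \<le> (LINT x|\<mu>. W (K x) + c) + 9 * C * (s - 1) * (measure \<mu> \<Omega> + R + nsq \<mu> K)"
    by (rule LIMSEQ_le_const2[OF tendsto_add[OF tendsto_add[OF lim1 lim2] lim3]])
      (use truncated_comparison[OF z s q0, folded r_def] in blast)
  moreover have "(LINT x|\<mu>. W (V x) + c) = (LINT x|\<mu>. W (V x)) + measure \<mu> \<Omega> * c" if "V \<in> L2_on \<mu>" for V
    using W_integrable[OF that] integrable_const by simp
  note this[OF H0_L2(2)[OF y_H0(2)]] this[OF H0_L2(2)[OF z(1)]]
  moreover have "(LINT x|\<mu>. (w (y0 x) - w (z x)) * u0 x) = (LINT x|\<mu>. w (y0 x) * u0 x) - (LINT x|\<mu>. w (z x) * u0 x)"
    unfolding left_diff_distrib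
    by (intro Bochner_Integration.integral_diff L2_on_mult_integrable w_L2[OF y_H0(2)] w_L2[OF z(1)] u_L2)
  moreover have "(LINT x|\<mu>. f x * (y0 x - z x)) = (LINT x|\<mu>. f x * y0 x) - (LINT x|\<mu>. f x * z x)"
    unfolding right_diff_distrib
    by (intro Bochner_Integration.integral_diff L2_on_mult_integrable f_L2 H0_L2(1)[OF y_H0(2)] H0_L2(1)[OF z(1)])
  ultimately show ?thesis unfolding J_def by linarith
qed

lemma limit_minimal_bounded:
  assumes z: "H0 \<Omega> z K" "\<And>x. \<bar>z x\<bar> \<le> Z"
  shows "J u0 y0 G0 \<le> J u0 z K"
proof (rule LIMSEQ_le_const)
  have "(\<lambda>n. J u0 z K + 9 * C * inverse (real (Suc n)) * (measure \<mu> \<Omega> + R + nsq \<mu> K))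
      \<longlonglongrightarrow> J u0 z K + 9 * C * 0 * (measure \<mu> \<Omega> + R + nsq \<mu> K)"
    by (intro tendsto_intros LIMSEQ_inverse_real_of_nat)
  then show "(\<lambda>n. J u0 z K + 9 * C * inverse (real (Suc n)) * (measure \<mu> \<Omega> + R + nsq \<mu> K)) \<longlonglongrightarrow> J u0 z K" by simp
  show "\<exists>N. \<forall>n\<ge>N. J u0 y0 G0 \<le> J u0 z K + 9 * C * inverse (real (Suc n)) * (measure \<mu> \<Omega> + R + nsq \<mu> K)"
  proof (intro exI allI impI)
    fix n
    have "0 < inverse (real (Suc n))" "inverse (real (Suc n)) \<le> 1" by (auto simp: inverse_eq_divide)
    then show "J u0 y0 G0 \<le> J u0 z K + 9 * C * inverse (real (Suc n)) * (measure \<mu> \<Omega> + R + nsq \<mu> K)"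
      using limit_comparison[OF z, of "1 + inverse (real (Suc n))"] by simp
  qed
qed

text \<open>
  Bounded competitors suffice, because an arbitrary one is the limit of its near parts at the levels
  \<open>2 * 4 ^ i\<close>, along which the nonlinearity is dominated through a single Lipschitz function.
\<close>

lemma limit_minimal:
  assumes z: "H0 \<Omega> z K"
  shows "J u0 y0 G0 \<le> J u0 z K"
proof -
  define r where "r i = near_part (2 * 4 ^ i)" for i :: nat
  have q0: "0 < (2 * 4 ^ i :: real)" for i :: nat by simp
  note v = near_part_values[OF q0, folded r_def]
  note lip = near_part_lipschitz[OF less_imp_le[OF q0], folded r_def]
  have r0: "r i 0 = 0" for i using v(1)[of 0 i] by simp
  have "\<forall>i. \<exists>h. (\<forall>t. (r i has_real_derivative h t) (at_right t)) \<and> (\<forall>t. \<bar>h t\<bar> \<le> 1) \<and> (\<forall>t. \<bar>t\<bar> < 2 * 4 ^ i \<longrightarrow> h t = 1)"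
  proof
    fix i
    obtain h where "\<And>t. (r i has_real_derivative h t) (at_right t)" "\<And>t. \<bar>h t\<bar> \<le> 1" "\<And>t. \<bar>t\<bar> < 2 * 4 ^ i \<Longrightarrow> h t = 1"
      by (rule near_part_right_derivative[OF q0[of i], folded r_def]) blast
    then show "\<exists>h. (\<forall>t. (r i has_real_derivative h t) (at_right t)) \<and> (\<forall>t. \<bar>h t\<bar> \<le> 1) \<and> (\<forall>t. \<bar>t\<bar> < 2 * 4 ^ i \<longrightarrow> h t = 1)"
      by (intro exI[of _ h]) auto
  qed
  from choice[OF this] obtain h where
    hh: "\<forall>i. (\<forall>t. (r i has_real_derivative h i t) (at_right t)) \<and> (\<forall>t. \<bar>h i t\<bar> \<le> 1) \<and> (\<forall>t. \<bar>t\<bar> < 2 * 4 ^ i \<longrightarrow> h i t = 1)" ..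
  have h: "(r i has_real_derivative h i t) (at_right t)" "\<bar>h i t\<bar> \<le> 1" "\<bar>t\<bar> < 2 * 4 ^ i \<Longrightarrow> h i t = 1" for i t
    using hh by auto
  have H: "H0 \<Omega> (\<lambda>x. r i (z x)) (\<lambda>x. h i (z x) *\<^sub>R K x)" for i by (rule H0_chain[OF z lip r0 h(1)])
  have ev: "\<forall>\<^sub>F i in sequentially. \<bar>z x\<bar> < 2 * 4 ^ i" for x
    using eventually_less_power[of 4 "\<bar>z x\<bar>"] by (simp, elim eventually_mono) (simp add: less_le_trans)
  note zL = H0_L2(1)[OF z] and KL = H0_L2(2)[OF z]
  have wz: "(\<lambda>x. w (zigzag 2 (z x))) \<in> L2_on \<mu>"
    using w_cutoff_L2[OF H0_zero z zigzag_lipschitz zigzag_0, of 2] by simp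
  have lim1: "(\<lambda>i. LINT x|\<mu>. W (h i (z x) *\<^sub>R K x)) \<longlonglongrightarrow> (LINT x|\<mu>. W (K x))"
  proof (rule integral_dominated_convergence[where w = "\<lambda>x. C * ((norm (K x))\<^sup>2 + 1)"])
    show "(\<lambda>x. W (K x)) \<in> borel_measurable \<mu>" by (intro borel_measurable_integrable W_integrable KL)
    show "(\<lambda>x. W (h i (z x) *\<^sub>R K x)) \<in> borel_measurable \<mu>" for i
      by (intro borel_measurable_integrable W_integrable H0_L2(2)[OF H])
    show "integrable \<mu> (\<lambda>x. C * ((norm (K x))\<^sup>2 + 1))"
      by (intro integrable_mult_right Bochner_Integration.integrable_add L2_onD(2)[OF KL] integrable_const)
    show "AE x in \<mu>. (\<lambda>i. W (h i (z x) *\<^sub>R K x)) \<longlonglongrightarrow> W (K x)"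
    proof (rule AE_I2, rule tendsto_eventually)
      fix x show "\<forall>\<^sub>F i in sequentially. W (h i (z x) *\<^sub>R K x) = W (K x)"
        using ev[of x] by eventually_elim (simp add: h(3))
    qed
    show "AE x in \<mu>. norm (W (h i (z x) *\<^sub>R K x)) \<le> C * ((norm (K x))\<^sup>2 + 1)" for i
    proof (rule AE_I2)
      fix x
      have "norm (h i (z x) *\<^sub>R K x) \<le> norm (K x)" using h(2)[of i "z x"] by (simp add: mult_left_le_one_le)
      then have "C * ((norm (h i (z x) *\<^sub>R K x))\<^sup>2 + 1) \<le> C * ((norm (K x))\<^sup>2 + 1)"
        using C_pos by (intro mult_left_mono add_right_mono power_mono) auto
      then show "norm (W (h i (z x) *\<^sub>R K x)) \<le> C * ((norm (K x))\<^sup>2 + 1)"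
        using W_abs_le[of "h i (z x) *\<^sub>R K x"] by simp
    qed
  qed
  have lim2: "(\<lambda>i. LINT x|\<mu>. w (r i (z x)) * u0 x) \<longlonglongrightarrow> (LINT x|\<mu>. w (z x) * u0 x)"
  proof (rule integral_dominated_convergence[where w = "\<lambda>x. (\<bar>w 0\<bar> + \<bar>w (z x)\<bar> + \<bar>w (zigzag 2 (z x))\<bar>) * \<bar>u0 x\<bar>"])
    have "(\<lambda>x. \<bar>w 0\<bar> + norm (w (z x)) + norm (w (zigzag 2 (z x)))) \<in> L2_on \<mu>"
      by (intro L2_on_add L2_on_const[OF fin] L2_on_norm w_L2[OF z] wz)
    from L2_on_mult_integrable[OF this L2_on_norm[OF u_L2(2)]]
    show "integrable \<mu> (\<lambda>x. (\<bar>w 0\<bar> + \<bar>w (z x)\<bar> + \<bar>w (zigzag 2 (z x))\<bar>) * \<bar>u0 x\<bar>)" by simp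
    show "(\<lambda>x. w (z x) * u0 x) \<in> borel_measurable \<mu>"
      by (intro borel_measurable_integrable L2_on_mult_integrable w_L2[OF z] u_L2)
    show "(\<lambda>x. w (r i (z x)) * u0 x) \<in> borel_measurable \<mu>" for i
      by (intro borel_measurable_integrable L2_on_mult_integrable w_L2[OF H] u_L2)
    show "AE x in \<mu>. (\<lambda>i. w (r i (z x)) * u0 x) \<longlonglongrightarrow> w (z x) * u0 x"
    proof (rule AE_I2, rule tendsto_eventually)
      fix x show "\<forall>\<^sub>F i in sequentially. w (r i (z x)) * u0 x = w (z x) * u0 x"
        using ev[of x] by eventually_elim (simp add: v(1))
    qed
    show "AE x in \<mu>. norm (w (r i (z x)) * u0 x) \<le> (\<bar>w 0\<bar> + \<bar>w (z x)\<bar> + \<bar>w (zigzag 2 (z x))\<bar>) * \<bar>u0 x\<bar>" for i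
    proof (rule AE_I2)
      fix x
      have "\<bar>w (r i (z x))\<bar> \<le> \<bar>w 0\<bar> + \<bar>w (z x)\<bar> + \<bar>w (zigzag 2 (z x))\<bar>"
        using near_part_cases[of i "z x", folded r_def] by auto
      then show "norm (w (r i (z x)) * u0 x) \<le> (\<bar>w 0\<bar> + \<bar>w (z x)\<bar> + \<bar>w (zigzag 2 (z x))\<bar>) * \<bar>u0 x\<bar>"
        by (simp add: abs_mult mult_right_mono)
    qed
  qed
  have lim3: "(\<lambda>i. LINT x|\<mu>. f x * r i (z x)) \<longlonglongrightarrow> (LINT x|\<mu>. f x * z x)"
  proof (rule integral_dominated_convergence[where w = "\<lambda>x. norm (f x) * norm (z x)"])
    show "integrable \<mu> (\<lambda>x. norm (f x) * norm (z x))" by (rule L2_on_inner_integrable(1)[OF f_L2 zL])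
    show "(\<lambda>x. f x * z x) \<in> borel_measurable \<mu>"
      by (intro borel_measurable_integrable L2_on_mult_integrable f_L2 zL)
    show "(\<lambda>x. f x * r i (z x)) \<in> borel_measurable \<mu>" for i
      by (intro borel_measurable_integrable L2_on_mult_integrable f_L2 H0_L2(1)[OF H])
    show "AE x in \<mu>. (\<lambda>i. f x * r i (z x)) \<longlonglongrightarrow> f x * z x"
    proof (rule AE_I2, rule tendsto_eventually)
      fix x show "\<forall>\<^sub>F i in sequentially. f x * r i (z x) = f x * z x"
        using ev[of x] by eventually_elim (simp add: v(1))
    qed
    show "AE x in \<mu>. norm (f x * r i (z x)) \<le> norm (f x) * norm (z x)" for i
      by (intro AE_I2) (auto simp: abs_mult v(4) intro!: mult_left_mono)
  qed
  have "(\<lambda>i. J u0 (\<lambda>x. r i (z x)) (\<lambda>x. h i (z x) *\<^sub>R K x)) \<longlonglongrightarrow> J u0 z K"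
    unfolding J_def by (intro tendsto_add lim1 lim2 lim3)
  then show ?thesis
    by (rule LIMSEQ_le_const) (use limit_minimal_bounded[OF H v(5)] in blast)
qed

end

section \<open>Lower semicontinuity of the cost and existence of optimal controls\<close>

lemma supporting_line:
  fixes g :: "real \<Rightarrow> real"
  assumes "convex_on UNIV g"
  obtains a where "\<And>v. g v0 + a * (v - v0) \<le> g v"
proof -
  have "g v0 + Inf ((\<lambda>t. (g v0 - g t) / (v0 - t)) ` ({v0<..} \<inter> UNIV)) * (v - v0) \<le> g v" for v
    by (rule convex_le_Inf_differential[OF assms]) auto
  then show ?thesis by (rule that)
qed

text \<open>
  A supporting line at \<open>u0\<close> remains a lower bound up to a small error if \<open>y\<close> is moved a little:
  for bounded controls by uniform continuity, and for large ones because \<open>F\<close> grows quadratically,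
  uniformly in \<open>y\<close>.
\<close>

lemma perturbed_supporting_line:
  fixes F :: "real \<Rightarrow> real \<Rightarrow> real"
  assumes F: "continuous_on UNIV (\<lambda>(y, u). F y u)" "\<And>y. convex_on UNIV (F y)"
    and C: "0 < C" "\<And>y u. C * (\<bar>u\<bar>\<^sup>2 - 1) \<le> F y u"
  obtains a where "\<And>e. 0 < e \<Longrightarrow> \<exists>d>0. \<forall>y v. \<bar>y - y0\<bar> < d \<longrightarrow> F y0 u0 + a * (v - u0) - e \<le> F y v"
proof -
  obtain a where a: "\<And>v. F y0 u0 + a * (v - u0) \<le> F y0 v" by (rule supporting_line[OF F(2)[of y0]]) blast
  define k where "k = F y0 u0 - a * u0 + C"
  \<comment> \<open>beyond \<open>M\<close> the parabola \<open>C * (\<bar>v\<bar>\<^sup>2 - 1)\<close> lies above the supporting line\<close>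
  define M where "M = (\<bar>a\<bar> + \<bar>k\<bar>) / C + 1"
  have large: "F y0 u0 + a * (v - u0) \<le> F y v" if v: "M < \<bar>v\<bar>" for y v
  proof -
    have M1: "1 \<le> M" using C(1) by (simp add: M_def)
    have "C * M = \<bar>a\<bar> + \<bar>k\<bar> + C" using C(1) by (simp add: M_def field_simps)
    moreover have "C * M \<le> C * \<bar>v\<bar>" using C(1) v by (intro mult_left_mono) auto
    ultimately have "\<bar>k\<bar> \<le> C * \<bar>v\<bar> - \<bar>a\<bar>" using C(1) by linarith
    moreover have "1 * \<bar>k\<bar> \<le> \<bar>v\<bar> * \<bar>k\<bar>" using v M1 by (intro mult_right_mono) auto
    ultimately have "\<bar>k\<bar> \<le> \<bar>v\<bar> * (C * \<bar>v\<bar> - \<bar>a\<bar>)" using mult_left_mono[of "\<bar>k\<bar>" "C * \<bar>v\<bar> - \<bar>a\<bar>" "\<bar>v\<bar>"] by linarith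
    also have "\<dots> = C * \<bar>v\<bar>\<^sup>2 - \<bar>a * v\<bar>" by (simp add: right_diff_distrib power2_eq_square abs_mult)
    finally have "k + a * v \<le> C * \<bar>v\<bar>\<^sup>2" by linarith
    then show ?thesis using C(2)[of v y] by (simp add: k_def algebra_simps)
  qed
  show ?thesis
  proof (rule that)
    fix e :: real assume e: "0 < e"
    have "compact (cball y0 1 \<times> {- M..M})" by (intro compact_Times) auto
    then have "uniformly_continuous_on (cball y0 1 \<times> {- M..M}) (\<lambda>(y, u). F y u)"
      by (intro compact_uniformly_continuous continuous_on_subset[OF F(1)]) auto
    then obtain d where d: "0 < d" "\<forall>p\<in>cball y0 1 \<times> {- M..M}. \<forall>q\<in>cball y0 1 \<times> {- M..M}. dist q p < d \<longrightarrow>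
        dist ((\<lambda>(y, u). F y u) q) ((\<lambda>(y, u). F y u) p) < e"
      unfolding uniformly_continuous_on_def using e by meson
    show "\<exists>d>0. \<forall>y v. \<bar>y - y0\<bar> < d \<longrightarrow> F y0 u0 + a * (v - u0) - e \<le> F y v"
    proof (intro exI[of _ "min d 1"] conjI allI impI)
      fix y v assume y: "\<bar>y - y0\<bar> < min d 1"
      show "F y0 u0 + a * (v - u0) - e \<le> F y v"
      proof (cases "M < \<bar>v\<bar>")
        case True then show ?thesis using large[OF True, of y] e by simp
      next
        case False
        then have v: "v \<in> {- M..M}" by auto
        have "dist (F y v) (F y0 v) < e"
          using d(2)[rule_format, of "(y0, v)" "(y, v)"] v y by (simp add: dist_Pair_Pair dist_real_def abs_minus_commute)
        then show ?thesis using a[of v] unfolding dist_real_def by linarith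
      qed
    qed (use d in simp)
  qed
qed

text \<open>
  Averaging the perturbed supporting lines leaves only an affine function of the combinations of
  the controls.
\<close>

lemma integrand_lower_semicontinuous:
  fixes F :: "real \<Rightarrow> real \<Rightarrow> real"
  assumes F: "continuous_on UNIV (\<lambda>(y, u). F y u)" "\<And>y. convex_on UNIV (F y)"
    and C: "0 < C" "\<And>y u. C * (\<bar>u\<bar>\<^sup>2 - 1) \<le> F y u"
    and b: "tail_weights b m" and y: "y \<longlonglongrightarrow> y0" and u: "(\<lambda>k. \<Sum>j=k..m k. b k j * u j) \<longlonglongrightarrow> u0"
    and e: "0 < e"
  shows "\<forall>\<^sub>F k in sequentially. F y0 u0 - e \<le> (\<Sum>j=k..m k. b k j * F (y j) (u j))"
proof -
  obtain a where a: "\<And>e. 0 < e \<Longrightarrow> \<exists>d>0. \<forall>y v. \<bar>y - y0\<bar> < d \<longrightarrow> F y0 u0 + a * (v - u0) - e \<le> F y v"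
    by (rule perturbed_supporting_line[OF F C, where ?y0.0 = y0 and ?u0.0 = u0]) blast
  have nn: "0 \<le> b k j" and sm: "(\<Sum>j=k..m k. b k j) = 1" for k j using b by (auto simp: tail_weights_def)
  obtain d where d: "0 < d" "\<And>y v. \<bar>y - y0\<bar> < d \<Longrightarrow> F y0 u0 + a * (v - u0) - e / 2 \<le> F y v"
    using a[of "e / 2"] e by auto
  have "\<forall>\<^sub>F j in sequentially. \<bar>y j - y0\<bar> < d" using tendstoD[OF y d(1)] by (simp add: dist_real_def)
  then obtain n where n: "\<And>j. n \<le> j \<Longrightarrow> \<bar>y j - y0\<bar> < d" unfolding eventually_sequentially by blast
  have "(\<lambda>k. a * ((\<Sum>j=k..m k. b k j * u j) - u0)) \<longlonglongrightarrow> a * (u0 - u0)" by (intro tendsto_intros u)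
  then have "\<forall>\<^sub>F k in sequentially. - (e / 2) < a * ((\<Sum>j=k..m k. b k j * u j) - u0)"
    using e by (intro order_tendstoD(1)) auto
  then show ?thesis using eventually_ge_at_top[of n]
  proof eventually_elim
    case (elim k)
    have "(\<Sum>j=k..m k. b k j * (F y0 u0 + a * (u j - u0) - e / 2)) \<le> (\<Sum>j=k..m k. b k j * F (y j) (u j))"
      using elim(2) by (intro sum_mono mult_left_mono d(2) n nn) auto
    moreover have "(\<Sum>j=k..m k. b k j * (F y0 u0 + a * (u j - u0) - e / 2))
        = (\<Sum>j=k..m k. b k j) * (F y0 u0 - a * u0 - e / 2) + a * (\<Sum>j=k..m k. b k j * u j)"
      by (simp add: sum_distrib_right sum_distrib_left sum.distrib[symmetric] algebra_simps)
    ultimately show ?case using elim(1) by (simp add: sm algebra_simps)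
  qed
qed

text \<open>
  The negative part has a finite integral, so no cancellation of infinities can occur.
\<close>

lemma ext_integral_bounded_below:
  assumes fin: "finite_measure M" and g: "g \<in> borel_measurable M" "\<And>x. - r \<le> g x" and ninf: "ext_integral M g \<noteq> \<infinity>"
  shows "integrable M g"
proof -
  have "(\<integral>\<^sup>+x. ennreal (- g x) \<partial>M) \<le> (\<integral>\<^sup>+x. ennreal r \<partial>M)"
    using g(2) by (intro nn_integral_mono ennreal_leI) (simp add: minus_le_iff)
  also have "\<dots> < \<infinity>" using finite_measure.emeasure_finite[OF fin, of "space M"]
    by (simp add: ennreal_mult_less_top top.not_eq_extremum)
  finally have neg: "(\<integral>\<^sup>+x. ennreal (- g x) \<partial>M) < \<infinity>" .
  have "(\<integral>\<^sup>+x. ennreal (g x) \<partial>M) \<noteq> \<infinity>"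
  proof
    assume "(\<integral>\<^sup>+x. ennreal (g x) \<partial>M) = \<infinity>"
    then show False using neg ninf unfolding ext_integral_def by (cases "\<integral>\<^sup>+x. ennreal (- g x) \<partial>M") auto
  qed
  then show ?thesis using neg g(1) by (simp add: real_integrable_def)
qed

context state_problem
begin

text \<open>
  The direct method.  Almost everywhere limits of convex combinations of a minimizing sequence take
  the place of weak limits: the states converge along a subsequence, while controls and gradients
  have strongly convergent convex combinations with common weights.
\<close>

theorem optimal_control_exists:
  fixes F :: "real \<Rightarrow> real \<Rightarrow> real"
  assumes F: "continuous_on UNIV (\<lambda>(y, u). F y u)" "\<And>y. convex_on UNIV (F y)"
    and D: "0 < D" "\<And>y u. D * (\<bar>u\<bar>\<^sup>2 - 1) \<le> F y u"
  shows "\<exists>u0\<in>L2_on \<mu>. \<exists>y0\<in>states \<Omega> W w f u0. \<forall>u\<in>L2_on \<mu>. \<forall>y\<in>states \<Omega> W w f u.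
    cost \<Omega> F y0 u0 \<le> cost \<Omega> F y u"
proof -
  define V where "V = measure \<mu> \<Omega>"
  have Fm: "(\<lambda>x. F (y x) (u x)) \<in> borel_measurable \<mu>" if "y \<in> borel_measurable \<mu>" "u \<in> borel_measurable \<mu>" for y u
  proof -
    have "(\<lambda>(y, u). F y u) \<in> borel_measurable borel" by (rule borel_measurable_continuous_onI[OF F(1)])
    from measurable_compose[OF borel_measurable_Pair[OF that] this] show ?thesis by simp
  qed
  have low: "- D \<le> F y u" for y u
  proof -
    have "0 \<le> D * \<bar>u\<bar>\<^sup>2" using D(1) by simp
    then show ?thesis using D(2)[of u y] by (simp add: right_diff_distrib)
  qed
  have fincost: "integrable \<mu> (\<lambda>x. F (y x) (u x))"
    if "u \<in> L2_on \<mu>" "y \<in> states \<Omega> W w f u" "cost \<Omega> F y u \<noteq> \<infinity>" for u y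
  proof (rule ext_integral_bounded_below[OF fin _ low])
    show "(\<lambda>x. F (y x) (u x)) \<in> borel_measurable \<mu>"
      by (intro Fm L2_onD(1)[OF that(1)] L2_onD(1)[OF H0_L2(1)[OF state_H0[OF that(2)]]])
  qed (use that(3) in \<open>simp add: cost_def\<close>)
  have cost_eq: "cost \<Omega> F y u = ereal (LINT x|\<mu>. F (y x) (u x))" if "integrable \<mu> (\<lambda>x. F (y x) (u x))" for y u
    unfolding cost_def by (rule ext_integral_eq_integral[OF that])
  define S where "S = {LINT x|\<mu>. F (y x) (u x) |u y. u \<in> L2_on \<mu> \<and> y \<in> states \<Omega> W w f u \<and> cost \<Omega> F y u \<noteq> \<infinity>}"
  show ?thesis
  proof (cases "S = {}")
    \<comment> \<open>all costs are infinite, and every control is optimal\<close>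
    case True
    then have inf: "cost \<Omega> F y u = \<infinity>" if "u \<in> L2_on \<mu>" "y \<in> states \<Omega> W w f u" for u y
      using that unfolding S_def by blast
    obtain y where "y \<in> states \<Omega> W w f (\<lambda>x. 0)" using states_nonempty[OF L2_on_zero] by blast
    then show ?thesis
      by (intro bexI[of _ "\<lambda>x. 0"] bexI[of _ y]) (auto simp: inf[OF _ _])
  next
    case False
    have below: "D * (nsq \<mu> u - V) \<le> (LINT x|\<mu>. F (y x) (u x))" if "u \<in> L2_on \<mu>" "integrable \<mu> (\<lambda>x. F (y x) (u x))" for u y
    proof -
      have "(LINT x|\<mu>. D * ((norm (u x))\<^sup>2 - 1)) \<le> (LINT x|\<mu>. F (y x) (u x))"
        by (intro integral_mono that(2) integrable_mult_right Bochner_Integration.integrable_diff L2_onD(2)[OF that(1)] integrable_const)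
          (use D(2) in simp)
      then show ?thesis using L2_onD(2)[OF that(1)] integrable_const by (simp add: nsq_def V_def)
    qed
    have bdd: "bdd_below S"
    proof (rule bdd_belowI)
      fix s assume "s \<in> S"
      then obtain u y where uy: "u \<in> L2_on \<mu>" "y \<in> states \<Omega> W w f u" "cost \<Omega> F y u \<noteq> \<infinity>" "s = (LINT x|\<mu>. F (y x) (u x))"
        unfolding S_def by blast
      have "D * (- V) \<le> D * (nsq \<mu> u - V)" using D(1) by (intro mult_left_mono) auto
      then show "D * (- V) \<le> s" using below[OF uy(1) fincost[OF uy(1-3)]] uy(4) by linarith
    qed
    define I where "I = Inf S"
    have "\<forall>j. \<exists>p. fst p \<in> L2_on \<mu> \<and> snd p \<in> states \<Omega> W w f (fst p) \<and> cost \<Omega> F (snd p) (fst p) \<noteq> \<infinity> \<and>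
        (LINT x|\<mu>. F (snd p x) (fst p x)) < I + inverse (real (Suc j))"
    proof
      fix j
      have "Inf S < I + inverse (real (Suc j))" by (simp add: I_def)
      from cInf_lessD[OF False this] obtain u y where "u \<in> L2_on \<mu>" "y \<in> states \<Omega> W w f u" "cost \<Omega> F y u \<noteq> \<infinity>"
        "(LINT x|\<mu>. F (y x) (u x)) < I + inverse (real (Suc j))" unfolding S_def by blast
      then show "\<exists>p. fst p \<in> L2_on \<mu> \<and> snd p \<in> states \<Omega> W w f (fst p) \<and> cost \<Omega> F (snd p) (fst p) \<noteq> \<infinity> \<and>
        (LINT x|\<mu>. F (snd p x) (fst p x)) < I + inverse (real (Suc j))"
        by (intro exI[of _ "(u, y)"]) simp
    qed
    from choice[OF this] obtain p where p: "\<forall>j. fst (p j) \<in> L2_on \<mu> \<and> snd (p j) \<in> states \<Omega> W w f (fst (p j)) \<and>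
        cost \<Omega> F (snd (p j)) (fst (p j)) \<noteq> \<infinity> \<and> (LINT x|\<mu>. F (snd (p j) x) (fst (p j) x)) < I + inverse (real (Suc j))" ..
    define R where "R = (I + 1) / D + V"
    have p1: "fst (p j) \<in> L2_on \<mu>" and p2: "snd (p j) \<in> states \<Omega> W w f (fst (p j))"
      and p3: "integrable \<mu> (\<lambda>x. F (snd (p j) x) (fst (p j) x))"
      and p4: "(LINT x|\<mu>. F (snd (p j) x) (fst (p j) x)) < I + inverse (real (Suc j))"
      and p5: "nsq \<mu> (fst (p j)) \<le> R" for j
    proof -
      show 1: "fst (p j) \<in> L2_on \<mu>" and 2: "snd (p j) \<in> states \<Omega> W w f (fst (p j))"
        and 4: "(LINT x|\<mu>. F (snd (p j) x) (fst (p j) x)) < I + inverse (real (Suc j))" using p by auto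
      show 3: "integrable \<mu> (\<lambda>x. F (snd (p j) x) (fst (p j) x))" using p fincost[OF 1 2] by auto
      have "inverse (real (Suc j)) \<le> 1" by (simp add: inverse_eq_divide)
      then have "D * (nsq \<mu> (fst (p j)) - V) \<le> I + 1" using below[OF 1 3] 4 by linarith
      then have "nsq \<mu> (fst (p j)) - V \<le> (I + 1) / D" using D(1) by (simp add: le_divide_eq mult.commute)
      then show "nsq \<mu> (fst (p j)) \<le> R" by (simp add: R_def)
    qed
    have "0 \<le> R" using p5[of 0] nsq_nonneg[of \<mu> "fst (p 0)"] by linarith
    from states_bounded[OF this] obtain B where B: "\<forall>u y. u \<in> L2_on \<mu> \<longrightarrow> nsq \<mu> u \<le> R \<longrightarrow> y \<in> states \<Omega> W w f u \<longrightarrow>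
      nsq \<mu> y \<le> B \<and> nsq \<mu> (weak_grad \<Omega> y) \<le> B" ..
    have yB: "nsq \<mu> (snd (p j)) \<le> B" "nsq \<mu> (weak_grad \<Omega> (snd (p j))) \<le> B" for j
      using B p1[of j] p2[of j] p5[of j] by auto
    note pH = state_H0[OF p2]
    from Rellich[of "\<lambda>j. snd (p j)" "\<lambda>j. weak_grad \<Omega> (snd (p j))" B, OF pH yB]
    obtain r :: "nat \<Rightarrow> nat" where "\<exists>y1. strict_mono r \<and> y1 \<in> L2_on \<mu> \<and> (AE x in \<mu>. (\<lambda>j. snd (p (r j)) x) \<longlonglongrightarrow> y1 x)" ..
    then obtain y1 where r: "strict_mono r" and y1: "AE x in \<mu>. (\<lambda>j. snd (p (r j)) x) \<longlonglongrightarrow> y1 x" by blast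
    define u where "u j = fst (p (r j))" for j
    define y where "y j = snd (p (r j))" for j
    define G where "G j = weak_grad \<Omega> (y j)" for j
    have uL: "u j \<in> L2_on \<mu>" for j unfolding u_def by (rule p1)
    have H: "H0 \<Omega> (y j) (G j)" for j unfolding y_def G_def by (rule pH)
    note HL = H0_L2[OF H]
    note vL = L2_on_Pair[OF uL L2_on_Pair[OF HL]]
    have "nsq \<mu> (\<lambda>x. (u j x, y j x, G j x)) \<le> R + B + B" for j
      using nsq_Pair[OF uL[of j] L2_on_Pair[OF HL(1)[of j] HL(2)[of j]]] nsq_Pair[OF HL(1)[of j] HL(2)[of j]] p5[of "r j"] yB[of "r j"]
      by (simp add: u_def y_def G_def)
    then obtain b m v0 where b: "tail_weights b m" and v0: "v0 \<in> L2_on \<mu>"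
      and vc: "(\<lambda>k. nsq \<mu> (\<lambda>x. (\<Sum>j=k..m k. b k j *\<^sub>R (u j x, y j x, G j x)) - v0 x)) \<longlonglongrightarrow> 0"
      and va: "AE x in \<mu>. (\<lambda>k. \<Sum>j=k..m k. b k j *\<^sub>R (u j x, y j x, G j x)) \<longlonglongrightarrow> v0 x"
      by (rule convex_combs_converge[where v = "\<lambda>j x. (u j x, y j x, G j x)", OF fin vL]) blast
    define u0 where "u0 x = fst (v0 x)" for x
    define y0 where "y0 x = fst (snd (v0 x))" for x
    define G0 where "G0 x = snd (snd (v0 x))" for x
    have L0: "u0 \<in> L2_on \<mu>" "y0 \<in> L2_on \<mu>" "G0 \<in> L2_on \<mu>"
      unfolding u0_def[abs_def] y0_def[abs_def] G0_def[abs_def] by (intro L2_on_fst L2_on_snd v0)+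
    have comb: "(\<Sum>j=k..m k. b k j *\<^sub>R (u j x, y j x, G j x))
        = ((\<Sum>j=k..m k. b k j * u j x), (\<Sum>j=k..m k. b k j * y j x), (\<Sum>j=k..m k. b k j *\<^sub>R G j x))" for k x
      by (simp add: sum_prod)
    have split: "v0 x = (u0 x, y0 x, G0 x)" for x by (simp add: u0_def y0_def G0_def)
    define U where "U k x = (\<Sum>j=k..m k. b k j * u j x) - u0 x" for k x
    define Y where "Y k x = (\<Sum>j=k..m k. b k j * y j x) - y0 x" for k x
    define P where "P k x = (\<Sum>j=k..m k. b k j *\<^sub>R G j x) - G0 x" for k x
    have UL: "U k \<in> L2_on \<mu>" and YL: "Y k \<in> L2_on \<mu>" and PL: "P k \<in> L2_on \<mu>" for k
      unfolding U_def[abs_def] Y_def[abs_def] P_def[abs_def]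
      by (intro L2_on_diff L2_on_sum L2_on_cmult L2_on_scaleR uL HL L0)+
    have "nsq \<mu> (U k) + (nsq \<mu> (Y k) + nsq \<mu> (P k)) = nsq \<mu> (\<lambda>x. (\<Sum>j=k..m k. b k j *\<^sub>R (u j x, y j x, G j x)) - v0 x)" for k
      unfolding comb split using nsq_Pair[OF UL[of k] L2_on_Pair[OF YL[of k] PL[of k]]] nsq_Pair[OF YL[of k] PL[of k]]
      by (simp add: U_def[abs_def] Y_def[abs_def] P_def[abs_def])
    then have sq: "(\<lambda>k. nsq \<mu> (U k) + (nsq \<mu> (Y k) + nsq \<mu> (P k))) \<longlonglongrightarrow> 0" using vc by simp
    have c0: "(\<lambda>k. nsq \<mu> (U k)) \<longlonglongrightarrow> 0" "(\<lambda>k. nsq \<mu> (Y k)) \<longlonglongrightarrow> 0" "(\<lambda>k. nsq \<mu> (P k)) \<longlonglongrightarrow> 0"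
      by (rule tendsto_sandwich[OF _ _ tendsto_const sq]; simp)+
    have ua: "AE x in \<mu>. (\<lambda>k. \<Sum>j=k..m k. b k j * u j x) \<longlonglongrightarrow> u0 x"
      using va unfolding comb by eventually_elim (drule tendsto_fst, simp add: u0_def)
    have Ga: "AE x in \<mu>. (\<lambda>k. \<Sum>j=k..m k. b k j *\<^sub>R G j x) \<longlonglongrightarrow> G0 x"
      using va unfolding comb by eventually_elim (drule tendsto_snd, drule tendsto_snd, simp add: G0_def)
    have ya: "AE x in \<mu>. (\<lambda>j. y j x) \<longlonglongrightarrow> y0 x"
      using va y1
    proof eventually_elim
      fix x assume 1: "(\<lambda>k. \<Sum>j=k..m k. b k j *\<^sub>R (u j x, y j x, G j x)) \<longlonglongrightarrow> v0 x" and 2: "(\<lambda>j. snd (p (r j)) x) \<longlonglongrightarrow> y1 x"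
      have 3: "(\<lambda>j. y j x) \<longlonglongrightarrow> y1 x" using 2 by (simp add: y_def)
      have "(\<lambda>k. \<Sum>j=k..m k. b k j * y j x) \<longlonglongrightarrow> y1 x" using tail_weights_tendsto[OF b 3] by simp
      moreover have "(\<lambda>k. \<Sum>j=k..m k. b k j * y j x) \<longlonglongrightarrow> y0 x"
        using tendsto_fst[OF tendsto_snd[OF 1]] unfolding comb y0_def by simp
      ultimately have "y1 x = y0 x" by (rule LIMSEQ_unique)
      then show "(\<lambda>j. y j x) \<longlonglongrightarrow> y0 x" using 3 by simp
    qed
    have H0': "H0 \<Omega> y0 G0"
      by (rule H0_closed[OF H0_sum[OF H] L0(2,3)]) (use c0 in \<open>simp_all add: Y_def[abs_def] P_def[abs_def]\<close>)
    interpret converging_states \<Omega> f W w c C u y G u0 y0 G0 b m "max R B"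
    proof
      show "nsq \<mu> (u j) \<le> max R B" "nsq \<mu> (G j) \<le> max R B" for j
        using p5[of "r j"] yB(2)[of "r j"] by (auto simp: u_def G_def y_def le_max_iff_disj)
      show "J (u j) (y j) (G j) \<le> J (u j) z K" if "H0 \<Omega> z K" for j z K
        using states_iff[OF H uL, of j j] p2[of "r j"] that by (simp add: u_def y_def)
      show "(\<lambda>k. nsq \<mu> (\<lambda>x. (\<Sum>j=k..m k. b k j * u j x) - u0 x)) \<longlonglongrightarrow> 0"
        using c0(1) by (simp add: U_def[abs_def])
    qed (use uL L0 H H0' ya b Ga in simp_all)
    have y0s: "y0 \<in> states \<Omega> W w f u0" using states_iff[OF H0' L0(1)] limit_minimal by blast
    have Fi: "integrable \<mu> (\<lambda>x. F (y j x) (u j x) + D)" for j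
      unfolding y_def u_def by (intro Bochner_Integration.integrable_add p3 integrable_const)
    have pos: "0 \<le> F a v + D" for a v using low[of a v] by simp
    define t where "t j = I + inverse (real (Suc (r j))) + V * D" for j
    have "t \<longlonglongrightarrow> I + 0 + V * D" unfolding t_def[abs_def]
      using LIMSEQ_subseq_LIMSEQ[OF LIMSEQ_inverse_real_of_nat r] by (intro tendsto_intros) (simp add: o_def)
    from tail_weights_tendsto[OF b this]
    have tT: "(\<lambda>k. \<Sum>j=k..m k. b k j * t j) \<longlonglongrightarrow> I + V * D" by simp
    have bound: "(LINT x|\<mu>. (\<Sum>j=k..m k. b k j * (F (y j x) (u j x) + D))) \<le> (\<Sum>j=k..m k. b k j * t j)" for k
    proof -
      have "(LINT x|\<mu>. (\<Sum>j=k..m k. b k j * (F (y j x) (u j x) + D))) = (\<Sum>j=k..m k. b k j * (LINT x|\<mu>. F (y j x) (u j x) + D))"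
        using Fi by (subst Bochner_Integration.integral_sum) auto
      also have "\<dots> \<le> (\<Sum>j=k..m k. b k j * t j)"
      proof (intro sum_mono mult_left_mono weights_nonneg)
        fix j
        have "(LINT x|\<mu>. F (y j x) (u j x) + D) = (LINT x|\<mu>. F (y j x) (u j x)) + V * D"
          using p3[of "r j"] integrable_const by (simp add: y_def u_def V_def)
        then show "(LINT x|\<mu>. F (y j x) (u j x) + D) \<le> t j" using p4[of "r j"] by (simp add: t_def y_def u_def)
      qed
      finally show ?thesis .
    qed
    have lsc: "AE x in \<mu>. \<forall>e>0. \<forall>\<^sub>F k in sequentially.
        F (y0 x) (u0 x) + D - e \<le> (\<Sum>j=k..m k. b k j * (F (y j x) (u j x) + D))"
      using ya ua
    proof eventually_elim
      case (elim x)
      have eq: "(\<Sum>j=k..m k. b k j * (F (y j x) (u j x) + D)) = (\<Sum>j=k..m k. b k j * F (y j x) (u j x)) + D" for k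
        by (simp add: distrib_left sum.distrib sum_distrib_right[symmetric] weights_sum)
      show ?case
      proof (intro allI impI)
        fix e :: real assume "0 < e"
        from integrand_lower_semicontinuous[OF F D b elim this]
        show "\<forall>\<^sub>F k in sequentially. F (y0 x) (u0 x) + D - e \<le> (\<Sum>j=k..m k. b k j * (F (y j x) (u j x) + D))"
          unfolding eq by eventually_elim simp
      qed
    qed
    have i: "integrable \<mu> (\<lambda>x. \<Sum>j=k..m k. b k j * (F (y j x) (u j x) + D))" for k
      by (intro Bochner_Integration.integrable_sum integrable_mult_right Fi)
    have n: "0 \<le> (\<Sum>j=k..m k. b k j * (F (y j x) (u j x) + D))" for k x
      by (intro sum_nonneg mult_nonneg_nonneg weights_nonneg pos)
    have gm: "(\<lambda>x. F (y0 x) (u0 x) + D) \<in> borel_measurable \<mu>"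
      by (intro borel_measurable_add Fm L2_onD(1)[OF L0(1)] L2_onD(1)[OF L0(2)]) simp
    note fat = Fatou_bound[OF i n gm pos lsc bound tT]
    have "integrable \<mu> (\<lambda>x. (F (y0 x) (u0 x) + D) - D)"
      by (rule Bochner_Integration.integrable_diff[OF fat(1) integrable_const])
    then have i0: "integrable \<mu> (\<lambda>x. F (y0 x) (u0 x))" by simp
    have "(LINT x|\<mu>. F (y0 x) (u0 x)) \<le> I" using fat(2) i0 integrable_const by (simp add: V_def)
    then have le: "cost \<Omega> F y0 u0 \<le> ereal I" by (simp add: cost_eq[OF i0])
    have "cost \<Omega> F y0 u0 \<le> cost \<Omega> F z v" if v: "v \<in> L2_on \<mu>" "z \<in> states \<Omega> W w f v" for v z
    proof (cases "cost \<Omega> F z v = \<infinity>")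
      case False
      have "(LINT x|\<mu>. F (z x) (v x)) \<in> S" unfolding S_def using v False by blast
      then have "I \<le> (LINT x|\<mu>. F (z x) (v x))" unfolding I_def by (rule cInf_lower[OF _ bdd])
      then show ?thesis using le by (simp add: cost_eq[OF fincost[OF v False]] order_trans[OF le])
    qed simp
    then show ?thesis using L0(1) y0s by blast
  qed
qed

end

theorem corollary2p2:
  fixes \<Omega> :: "(real^'n) set"
    and f :: "real^'n \<Rightarrow> real"
    and F :: "real \<Rightarrow> real \<Rightarrow> real"
    and W :: "real^'n \<Rightarrow> real"
    and w :: "real \<Rightarrow> real"
  assumes "regular_bounded_domain \<Omega>"
    and "f \<in> L2 \<Omega>"
    and "continuous_on UNIV (\<lambda>(y, u). F y u)"
    and "\<And>y. convex_on UNIV (F y)"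
    and "\<exists>C>0. \<forall>y u. C * (\<bar>u\<bar>\<^sup>2 - 1) \<le> F y u"
    and "strictly_convex W"
    and "\<exists>c C. 0 < c \<and> c < C \<and>
           (\<forall>p. c * ((norm p)\<^sup>2 - 1) \<le> W p \<and> W p \<le> C * ((norm p)\<^sup>2 + 1))"
    and "continuous_on UNIV w"
    and each_control_has_a_state: "\<And>u. u \<in> L2 \<Omega> \<Longrightarrow> states \<Omega> W w f u \<noteq> {}"
  shows "\<exists>u\<^sub>0\<in>L2 \<Omega>. \<exists>y\<^sub>0\<in>states \<Omega> W w f u\<^sub>0.
           \<forall>u\<in>L2 \<Omega>. \<forall>y\<in>states \<Omega> W w f u. cost \<Omega> F y\<^sub>0 u\<^sub>0 \<le> cost \<Omega> F y u"
proof -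
  obtain c C where cC: "0 < c" "c < C" "\<And>p. c * ((norm p)\<^sup>2 - 1) \<le> W p" "\<And>p. W p \<le> C * ((norm p)\<^sup>2 + 1)"
    using assms(7) by blast
  have convex: "convex_on UNIV W"
  proof (rule convex_onI)
    fix t :: real and p q assume "0 < t" "t < 1"
    then show "W ((1 - t) *\<^sub>R p + t *\<^sub>R q) \<le> (1 - t) * W p + t * W q"
      using assms(6) unfolding strictly_convex_def
      by (cases "p = q") (simp_all add: scaleR_add_left[symmetric] distrib_right[symmetric] less_imp_le)
  qed simp
  interpret state_problem \<Omega> f W w c C
    by unfold_locales
      (use assms(1,2,8,9) cC convex in \<open>simp_all add: regular_bounded_domain_def L2_eq_L2_on\<close>)
  obtain D where "0 < D" "\<And>y u. D * (\<bar>u\<bar>\<^sup>2 - 1) \<le> F y u" using assms(5) by blast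
  from optimal_control_exists[OF assms(3,4) this] show ?thesis by (simp add: L2_eq_L2_on)
qed

end
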